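(* Let $X$ be a determinantal point process on $(\mathbb{R}^d,\mu)$ with kernel $K$, and define $\omega(r)=\sup_{\|y-x\|\ge r}|K(x,y)|$. If $K$ is bounded and $\omega(r)\to0$ as $r\to+\infty$, then $X$ is $\beta$-mixing; more precisely, for all $p,q,r>0$, $$\beta_{p,q}(r)\le 4pq\,(1+2p\|K\|_\infty)(1+2q\|K\|_\infty)\,e^{2\|K\|_\infty(p+q)}\,\omega(r)^2.$$ Furthermore, if there exists $N\in\mathbb{N}$ such that $\mathrm{rank}(\mathcal{K})\le N$, then $$\beta_{p,q}(r)\le 4pq\,N^2\,9^N\,\omega(r)^2.$$
   Context: $\mu$ is a locally finite measure on $\mathbb{R}^d$, $\|\cdot\|$ the Euclidean norm, $\mathrm{dist}(A,B)=\inf\{\|y-x\|:x\in A,y\in B\}$. A determinantal point process (DPP) with kernel $K:(\mathbb{R}^d)^2\to\mathbb{R}$ is a simple point process whose $n$-th order intensity functions (with respect to $\mu$) are $\rho_n(x_1,\dots,x_n)=\det\big(K(x_i,x_j)\big)_{1\le i,j\le n}$ for all $n$; here $K$ is a locally square integrable hermitian measurable function whose associated integral operator $\mathcal{K}$ (w.r.t. $\mu$) is locally of trace class with eigenvalues in $[0,1]$. The intensity $\rho_n$ is defined by $\mathbb{E}\big[\sum^{\neq}_{x_1,\dots,x_n\in X} h(x_1,\dots,x_n)\big]=\int h\rho_n\,\mathrm{d}\mu^n$. For sub-$\sigma$-algebras, $\beta(\mathscr{A},\mathscr{B})=\frac12\sup\sum_{i,j}|\mathbb{P}(A_i\cap B_j)-\mathbb{P}(A_i)\mathbb{P}(B_j)|$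 over finite partitions $(A_i)\subset\mathscr{A}$, $(B_j)\subset\mathscr{B}$. $\mathcal{E}(A)$ is the $\sigma$-algebra generated by $X\cap A$, and $\beta_{p,q}(r)=\sup\{\beta(\mathcal{E}(A),\mathcal{E}(B)):\mu(A)\le p,\ \mu(B)\le q,\ \mathrm{dist}(A,B)>r\}$. $X$ is called $\beta$-mixing if $\beta_{p,q}(r)\to0$ as $r\to+\infty$ for all $p,q>0$. *)

theory Defs
  imports "HOL-Analysis.Analysis" "HOL-Probability.Probability"
begin

definition ldet :: "nat \<Rightarrow> (nat \<Rightarrow> nat \<Rightarrow> real) \<Rightarrow> real" where
  "ldet n A = (\<Sum>p | p permutes {..<n}. of_int (sign p) * (\<Prod>i<n. A i (p i)))"

definition sq_int :: "'a measure \<Rightarrow> ('a \<Rightarrow> real) \<Rightarrow> bool" where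
  "sq_int \<mu> f \<longleftrightarrow> f \<in> borel_measurable \<mu> \<and> integrable \<mu> (\<lambda>x. (f x)\<^sup>2)"

definition vanishes_outside :: "'a set \<Rightarrow> ('a \<Rightarrow> real) \<Rightarrow> bool" where
  "vanishes_outside C f \<longleftrightarrow> (\<forall>x. x \<notin> C \<longrightarrow> f x = 0)"

definition qform :: "'a measure \<Rightarrow> ('a \<Rightarrow> 'a \<Rightarrow> real) \<Rightarrow> ('a \<Rightarrow> real) \<Rightarrow> real" where
  "qform \<mu> K f = (\<integral>x. (\<integral>y. f x * K x y * f y \<partial>\<mu>) \<partial>\<mu>)"

text \<open>Standing assumptions on a DPP kernel: measurable, hermitian (symmetric, as K is real),
  locally square integrable, the operator has spectrum in [0,1] (0 <= K <= I as quadratic forms on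
  L^2 functions of bounded support), and it is locally of trace class (for each compact C the
  traces of the compression to L^2(C) over finite orthonormal families are bounded).\<close>
definition valid_kernel :: "'a::euclidean_space measure \<Rightarrow> ('a \<Rightarrow> 'a \<Rightarrow> real) \<Rightarrow> bool" where
  "valid_kernel \<mu> K \<longleftrightarrow>
     case_prod K \<in> borel_measurable (\<mu> \<Otimes>\<^sub>M \<mu>) \<and>
     (\<forall>x y. K x y = K y x) \<and>
     (\<forall>C. compact C \<longrightarrow>
        (\<integral>\<^sup>+ z. indicator (C \<times> C) z * ennreal ((case_prod K z)\<^sup>2) \<partial>(\<mu> \<Otimes>\<^sub>M \<mu>)) < \<infinity>) \<and>
     (\<forall>C f. compact C \<longrightarrow> sq_int \<mu> f \<longrightarrow> vanishes_outside C f \<longrightarrow>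
        0 \<le> qform \<mu> K f \<and> qform \<mu> K f \<le> (\<integral>x. (f x)\<^sup>2 \<partial>\<mu>)) \<and>
     (\<forall>C. compact C \<longrightarrow> (\<exists>B::real. \<forall>(m::nat) (e::nat \<Rightarrow> 'a \<Rightarrow> real).
        (\<forall>i<m. sq_int \<mu> (e i) \<and> vanishes_outside C (e i)) \<longrightarrow>
        (\<forall>i<m. \<forall>j<m. (\<integral>x. e i x * e j x \<partial>\<mu>) = (if i = j then 1 else 0)) \<longrightarrow>
        (\<Sum>i<m. qform \<mu> K (e i)) \<le> B))"

text \<open>rank of the integral operator is at most N: its range (on the dense set of L^2 functions
  of bounded support) lies, up to mu-null sets, in the span of N fixed functions.\<close>
definition kernel_rank_le :: "'a::euclidean_space measure \<Rightarrow> ('a \<Rightarrow> 'a \<Rightarrow> real) \<Rightarrow> nat \<Rightarrow> bool" where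
  "kernel_rank_le \<mu> K N \<longleftrightarrow>
     (\<exists>\<phi>::nat \<Rightarrow> 'a \<Rightarrow> real. \<forall>C f. compact C \<longrightarrow> sq_int \<mu> f \<longrightarrow> vanishes_outside C f \<longrightarrow>
        (\<exists>c::nat \<Rightarrow> real. AE x in \<mu>. (\<integral>y. K x y * f y \<partial>\<mu>) = (\<Sum>k<N. c k * \<phi> k x)))"

definition dtuples :: "nat \<Rightarrow> 'a set \<Rightarrow> (nat \<Rightarrow> 'a) set" where
  "dtuples n S = {x \<in> {..<n} \<rightarrow>\<^sub>E UNIV. inj_on x {..<n} \<and> x ` {..<n} \<subseteq> S}"

definition locally_finite_measure :: "'a::euclidean_space measure \<Rightarrow> bool" where
  "locally_finite_measure \<mu> \<longleftrightarrow> sets \<mu> = sets borel \<and>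
     (\<forall>B. B \<in> sets borel \<longrightarrow> bounded B \<longrightarrow> emeasure \<mu> B < \<infinity>)"

text \<open>X : the random configuration (a locally finite subset of R^d) defined on the probability
  space P; its n-th intensities w.r.t. mu are det(K(x_i,x_j)).\<close>
definition is_DPP :: "'w measure \<Rightarrow> 'a::euclidean_space measure \<Rightarrow> ('w \<Rightarrow> 'a set)
                      \<Rightarrow> ('a \<Rightarrow> 'a \<Rightarrow> real) \<Rightarrow> bool" where
  "is_DPP P \<mu> X K \<longleftrightarrow>
     prob_space P \<and> locally_finite_measure \<mu> \<and> valid_kernel \<mu> K \<and>
     (\<forall>\<omega>\<in>space P. \<forall>B. bounded B \<longrightarrow> finite (X \<omega> \<inter> B)) \<and>
     (\<forall>B. B \<in> sets borel \<longrightarrow> bounded B \<longrightarrow>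
        (\<lambda>\<omega>. card (X \<omega> \<inter> B)) \<in> measurable P (count_space UNIV)) \<and>
     (\<forall>(n::nat) (h::(nat \<Rightarrow> 'a) \<Rightarrow> ennreal).
        h \<in> borel_measurable (PiM {..<n} (\<lambda>_. \<mu>)) \<longrightarrow>
        (\<integral>\<^sup>+ \<omega>. (\<integral>\<^sup>+ x. h x \<partial>count_space (dtuples n (X \<omega>))) \<partial>P)
        = (\<integral>\<^sup>+ x. h x * ennreal (ldet n (\<lambda>i j. K (x i) (x j))) \<partial>PiM {..<n} (\<lambda>_. \<mu>)))"

definition cfg_events :: "'w measure \<Rightarrow> ('w \<Rightarrow> 'a::euclidean_space set) \<Rightarrow> 'a set \<Rightarrow> 'w set set" where
  "cfg_events P X A = sigma_sets (space P)
     {(\<lambda>\<omega>. card (X \<omega> \<inter> A \<inter> B)) -` {k} \<inter> space P | B k. B \<in> sets borel \<and> bounded B}"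

definition finite_partition :: "'w measure \<Rightarrow> 'w set set \<Rightarrow> nat set \<Rightarrow> (nat \<Rightarrow> 'w set) \<Rightarrow> bool" where
  "finite_partition P \<A> I F \<longleftrightarrow> finite I \<and> F ` I \<subseteq> \<A> \<and> disjoint_family_on F I \<and>
     (\<Union>i\<in>I. F i) = space P"

definition beta_coef :: "'w measure \<Rightarrow> 'w set set \<Rightarrow> 'w set set \<Rightarrow> real" where
  "beta_coef P \<A> \<B> = 1/2 * Sup {\<Sum>i\<in>I. \<Sum>j\<in>J. \<bar>measure P (F i \<inter> G j) - measure P (F i) * measure P (G j)\<bar>
      | I J F G. finite_partition P \<A> I F \<and> finite_partition P \<B> J G}"

text \<open>dist(A,B) = inf of distances, with inf of the empty set = +infinity.\<close>
definition set_dist :: "'a::euclidean_space set \<Rightarrow> 'a set \<Rightarrow> ereal" where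
  "set_dist A B = (INF x\<in>A. INF y\<in>B. ereal (norm (y - x)))"

definition beta_pq :: "'w measure \<Rightarrow> 'a::euclidean_space measure \<Rightarrow> ('w \<Rightarrow> 'a set)
                       \<Rightarrow> real \<Rightarrow> real \<Rightarrow> real \<Rightarrow> real" where
  "beta_pq P \<mu> X p q r = Sup {beta_coef P (cfg_events P X A) (cfg_events P X B) | A B.
      A \<in> sets \<mu> \<and> B \<in> sets \<mu> \<and> emeasure \<mu> A \<le> ennreal p \<and> emeasure \<mu> B \<le> ennreal q \<and>
      set_dist A B > ereal r}"

definition beta_mixing :: "'w measure \<Rightarrow> 'a::euclidean_space measure \<Rightarrow> ('w \<Rightarrow> 'a set) \<Rightarrow> bool" where
  "beta_mixing P \<mu> X \<longleftrightarrow> (\<forall>p q. p > 0 \<longrightarrow> q > 0 \<longrightarrow> ((\<lambda>r. beta_pq P \<mu> X p q r) \<longlongrightarrow> 0) at_top)"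

definition kernel_omega :: "('a::euclidean_space \<Rightarrow> 'a \<Rightarrow> real) \<Rightarrow> real \<Rightarrow> real" where
  "kernel_omega K r = Sup {\<bar>K x y\<bar> | x y. norm (y - x) \<ge> r}"

definition kernel_sup :: "('a \<Rightarrow> 'a \<Rightarrow> real) \<Rightarrow> real" where
  "kernel_sup K = Sup {\<bar>K x y\<bar> | x y. True}"

end

theory Submission
  imports Defs "Jordan_Normal_Form.Determinant"
begin

text \<open>Restrict the process to a compact window and average the kernel over the cells of finer and finer
  finite Borel partitions. The averages, weighted by the cell masses, form finite positive contractions, so
  determinant inequalities for positive semidefinite matrices apply; in particular, for disjoint index sets
  $U$ and $V$, $|\det M_{U \cup V} - \det M_U \det M_V|$ is controlled by the squares of the entries of $M$
  between $U$ and $V$. In the limit the averages recover $K$ off the diagonal, together with a canonical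
  diagonal $d$. The operator does not see the diagonal values $K(x,x)$, which do enter the intensities,
  but $K(x,x) \ge d(x)$ almost everywhere: otherwise some factorial moment of the number of points in a set
  would vanish while the next one does not.

  Events that depend on the numbers of points in finitely many sets become, for small cells,
  multi-affine functions of the cell counts, whose covariances are combinations of
  $\det M_{U \cup V} - \det M_U \det M_V$. The diagonal excess $K(x,x) - d(x)$ acts like an
  independent Poisson component: shifting the expansion by its cell masses, which are at most 1 for
  small cells, leaves coefficients that sum to at most $2^{|U|}$. Approximating arbitrary events
  by such count events gives the bound on the mixing coefficient.\<close>

section \<open>Principal minors of positive semidefinite matrices\<close>

definition fdet :: "'i set \<Rightarrow> ('i \<Rightarrow> 'i \<Rightarrow> real) \<Rightarrow> real" where
  "fdet S A = (\<Sum>p | p permutes S. of_int (sign p) * (\<Prod>i\<in>S. A i (p i)))"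

lemma ldet_eq_fdet: "ldet n A = fdet {..<n} A"
  by (simp add: ldet_def fdet_def)

lemma fdet_cong:
  assumes "\<And>i j. i \<in> S \<Longrightarrow> j \<in> S \<Longrightarrow> A i j = B i j"
  shows "fdet S A = fdet S B"
  unfolding fdet_def
  by (intro sum.cong refl arg_cong2[where f="(*)"] prod.cong) (auto simp: assms permutes_in_image)

lemma fdet_empty [simp]: "fdet {} A = 1"
proof -
  have "{p. p permutes ({}::'a set)} = {id}" by auto
  then show ?thesis by (simp add: fdet_def sign_id)
qed

text \<open>Relabelling conjugates the permutations and preserves their signs. An index set without
  order lets a principal minor be written \<open>fdet U A\<close> with the same \<open>A\<close>,
  and lets inductions add one index without renumbering; this lemma imports facts about ordered
  matrices.\<close>

lemma fdet_reindex:
  assumes e: "bij_betw e T S" and fin: "finite T"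
  shows "fdet S A = fdet T (\<lambda>i j. A (e i) (e j))"
proof -
  have inj: "inj_on e T" and im: "e ` T = S" using e by (auto simp: bij_betw_def)
  let ?g = "map_permutation T e"
  have bij: "bij_betw ?g {p. p permutes T} {p. p permutes S}"
  proof (rule bij_betw_byWitness[where f' = "map_permutation S (inv_into T e)"])
    show "\<forall>a\<in>{p. p permutes T}. map_permutation S (inv_into T e) (?g a) = a"
      using map_permutation_compose_inv[OF e, of _ "inv_into T e"] inj by auto
    have e': "bij_betw (inv_into T e) S T" using e by (rule bij_betw_inv_into)
    show "\<forall>a'\<in>{p. p permutes S}. ?g (map_permutation S (inv_into T e) a') = a'"
      using map_permutation_compose_inv[OF e', of _ e] im by (auto simp: f_inv_into_f)
    show "?g ` {p. p permutes T} \<subseteq> {p. p permutes S}"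
      using map_permutation_permutes[OF e] by auto
    show "map_permutation S (inv_into T e) ` {p. p permutes S} \<subseteq> {p. p permutes T}"
      using map_permutation_permutes[OF e'] by auto
  qed
  have "fdet S A = (\<Sum>p | p permutes T. of_int (sign (?g p)) * (\<Prod>i\<in>S. A i (?g p i)))"
    unfolding fdet_def by (rule sum.reindex_bij_betw[OF bij, symmetric])
  also have "\<dots> = fdet T (\<lambda>i j. A (e i) (e j))"
    unfolding fdet_def
  proof (intro sum.cong refl arg_cong2[where f="(*)"])
    fix p assume p: "p \<in> {p. p permutes T}"
    show "real_of_int (sign (?g p)) = of_int (sign p)"
      using p by (simp add: sign_map_permutation inj fin)
    have "(\<Prod>i\<in>S. A i (?g p i)) = (\<Prod>i\<in>T. A (e i) (?g p (e i)))"
      by (rule prod.reindex_bij_betw[OF e, symmetric])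
    also have "\<dots> = (\<Prod>i\<in>T. A (e i) (e (p i)))"
      by (intro prod.cong refl) (simp add: map_permutation_apply inj)
    finally show "(\<Prod>i\<in>S. A i (?g p i)) = (\<Prod>i\<in>T. A (e i) (e (p i)))" .
  qed
  finally show ?thesis .
qed

lemma fdet_eq_det: "fdet {..<n} A = Determinant.det (mat n n (\<lambda>(i, j). A i j))"
proof -
  have "Determinant.det (mat n n (\<lambda>(i, j). A i j))
      = (\<Sum>p\<in>{p. p permutes {0..<n}}. signof p * (\<Prod>i = 0..<n. mat n n (\<lambda>(i, j). A i j) $$ (i, p i)))"
    by (rule det_def') auto
  also have "\<dots> = fdet {..<n} A"
    unfolding fdet_def lessThan_atLeast0
  proof (intro sum.cong refl arg_cong2[where f="(*)"] prod.cong)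
    fix p x assume "p \<in> {p. p permutes {0..<n}}" "x \<in> {0..<n}"
    then show "mat n n (\<lambda>(i, j). A i j) $$ (x, p x) = A x (p x)"
      using permutes_in_image[of p "{0..<n}" x] by simp
  qed
  finally show ?thesis ..
qed

lemma fdet_mult:
  assumes "finite S"
  shows "fdet S (\<lambda>i j. \<Sum>k\<in>S. A i k * B k j) = fdet S A * fdet S B"
proof -
  obtain e where e: "bij_betw e {..<card S} S"
    using ex_bij_betw_nat_finite[OF assms] by (auto simp: lessThan_atLeast0)
  let ?n = "card S"
  let ?A = "mat ?n ?n (\<lambda>(i, j). A (e i) (e j))" and ?B = "mat ?n ?n (\<lambda>(i, j). B (e i) (e j))"
  have "fdet S (\<lambda>i j. \<Sum>k\<in>S. A i k * B k j)
      = Determinant.det (mat ?n ?n (\<lambda>(i, j). \<Sum>k\<in>S. A (e i) k * B k (e j)))"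
    by (simp add: fdet_reindex[OF e] fdet_eq_det)
  also have "mat ?n ?n (\<lambda>(i, j). \<Sum>k\<in>S. A (e i) k * B k (e j)) = ?A * ?B"
    by (rule eq_matI)
       (auto simp: scalar_prod_def sum.reindex_bij_betw[OF e, symmetric] lessThan_atLeast0 intro!: sum.cong)
  also have "Determinant.det \<dots> = fdet S A * fdet S B"
    by (subst det_mult[of _ ?n]) (auto simp: fdet_reindex[OF e] fdet_eq_det)
  finally show ?thesis .
qed

lemma fdet_transpose:
  assumes "finite S"
  shows "fdet S (\<lambda>i j. A j i) = fdet S A"
proof -
  obtain e where e: "bij_betw e {..<card S} S"
    using ex_bij_betw_nat_finite[OF assms] by (auto simp: lessThan_atLeast0)
  let ?n = "card S"
  let ?A = "mat ?n ?n (\<lambda>(i, j). A (e i) (e j))"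
  have "mat ?n ?n (\<lambda>(i, j). A (e j) (e i)) = transpose_mat ?A"
    by (rule eq_matI) auto
  moreover have "Determinant.det (transpose_mat ?A) = Determinant.det ?A"
    by (rule det_transpose[of _ ?n]) auto
  ultimately show ?thesis
    by (simp add: fdet_reindex[OF e] fdet_eq_det)
qed

lemma fdet_kernel:
  assumes S: "finite S" and v: "\<And>i. i \<in> S \<Longrightarrow> (\<Sum>j\<in>S. A i j * v j) = 0" and nz: "k \<in> S" "v k \<noteq> 0"
  shows "fdet S A = 0"
proof -
  obtain e where e: "bij_betw e {..<card S} S"
    using ex_bij_betw_nat_finite[OF S] by (auto simp: lessThan_atLeast0)
  let ?n = "card S"
  let ?A = "mat ?n ?n (\<lambda>(i, j). A (e i) (e j))"
  let ?v = "Matrix.vec ?n (\<lambda>i. v (e i))"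
  have "?A *\<^sub>v ?v = 0\<^sub>v ?n"
  proof (rule eq_vecI)
    fix i assume i: "i < dim_vec (0\<^sub>v ?n :: real Matrix.vec)"
    have ei: "e i \<in> S" using i e by (auto simp: bij_betw_def)
    have "(\<Sum>j<?n. A (e i) (e j) * v (e j)) = (\<Sum>j\<in>S. A (e i) j * v j)"
      by (rule sum.reindex_bij_betw[OF e])
    then show "vec_index (?A *\<^sub>v ?v) i = vec_index (0\<^sub>v ?n) i"
      using i v[OF ei] by (simp add: scalar_prod_def lessThan_atLeast0)
  qed simp
  moreover obtain m where m: "m < ?n" "e m = k" using e nz(1) by (metis bij_betw_def imageE lessThan_iff)
  have "?v \<noteq> 0\<^sub>v ?n"
  proof
    assume "?v = 0\<^sub>v ?n"
    then have "vec_index ?v m = vec_index (0\<^sub>v ?n) m" by simp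
    with m nz show False by simp
  qed
  ultimately have "Determinant.det ?A = 0"
    by (subst det_0_iff_vec_prod_zero[of _ ?n]) (auto intro!: exI[of _ ?v])
  then show ?thesis by (simp add: fdet_reindex[OF e] fdet_eq_det)
qed

lemma fdet_zero_row:
  assumes "finite S" "i \<in> S" "\<And>j. j \<in> S \<Longrightarrow> A i j = 0"
  shows "fdet S A = 0"
  unfolding fdet_def
proof (rule sum.neutral, safe)
  fix p assume p: "p permutes S"
  have "A i (p i) = 0" using assms p by (simp add: permutes_in_image)
  then have "(\<Prod>i\<in>S. A i (p i)) = 0" using assms by (intro prod_zero) auto
  then show "real_of_int (sign p) * (\<Prod>i\<in>S. A i (p i)) = 0" by simp
qed

text \<open>Fewer equations than unknowns: padding the coefficient matrix with zero rows makes it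
  square and singular, so it has a kernel vector.\<close>

lemma fdet_dependent_columns:
  fixes w :: "'i \<Rightarrow> nat \<Rightarrow> real"
  assumes S: "finite S" and N: "N < card S"
  shows "\<exists>v. (\<exists>k\<in>S. v k \<noteq> 0) \<and> (\<forall>l<N. (\<Sum>j\<in>S. v j * w j l) = 0)"
proof -
  obtain e where e: "bij_betw e {..<card S} S"
    using ex_bij_betw_nat_finite[OF S] by (auto simp: lessThan_atLeast0)
  let ?n = "card S"
  let ?A = "mat ?n ?n (\<lambda>(l, j). if l < N then w (e j) l else 0)"
  have "fdet {..<?n} (\<lambda>l j. if l < N then w (e j) l else 0) = 0"
    using N by (intro fdet_zero_row[of _ N]) auto
  then have "Determinant.det ?A = 0" by (simp add: fdet_eq_det)
  then obtain v where v: "v \<in> carrier_vec ?n" "v \<noteq> 0\<^sub>v ?n" "?A *\<^sub>v v = 0\<^sub>v ?n"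
    by (subst (asm) det_0_iff_vec_prod_zero[of _ ?n]) auto
  obtain m where m: "m < ?n" "vec_index v m \<noteq> 0"
    using v(1,2) by (metis carrier_vecD eq_vecI index_zero_vec(1) index_zero_vec(2))
  let ?g = "inv_into {..<?n} e"
  have g: "?g (e j) = j" if "j < ?n" for j
    using e that by (auto simp: bij_betw_def)
  show ?thesis
  proof (intro exI conjI allI impI)
    show "\<exists>k\<in>S. vec_index v (?g k) \<noteq> 0"
      using m g e by (intro bexI[of _ "e m"]) (auto simp: bij_betw_def)
    fix l assume l: "l < N"
    have "(\<Sum>j\<in>S. vec_index v (?g j) * w j l) = (\<Sum>j<?n. vec_index v (?g (e j)) * w (e j) l)"
      by (rule sum.reindex_bij_betw[OF e, symmetric])
    also have "\<dots> = (\<Sum>j<?n. w (e j) l * vec_index v j)"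
      by (intro sum.cong) (auto simp: g)
    also have "\<dots> = vec_index (?A *\<^sub>v v) l"
      using l N v(1) by (simp add: scalar_prod_def lessThan_atLeast0)
    also have "\<dots> = 0" using v(3) l N by simp
    finally show "(\<Sum>j\<in>S. vec_index v (?g j) * w j l) = 0" .
  qed
qed

lemma fdet_insert_unit_row:
  assumes "finite S" "i \<notin> S" "\<And>j. j \<in> S \<Longrightarrow> A i j = 0"
  shows "fdet (insert i S) A = A i i * fdet S A"
proof -
  let ?P = "{p. p permutes insert i S}" and ?Q = "{p. p permutes S}"
  have sub: "?Q \<subseteq> ?P" by (auto intro: permutes_subset)
  have fin: "finite ?P" using assms by (simp add: finite_permutations)
  have 1: "(\<Prod>k\<in>insert i S. A k (p k)) = 0" if p: "p \<in> ?P - ?Q" for p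
  proof -
    have "p i \<noteq> i"
    proof
      assume "p i = i"
      then have "p permutes S"
        using p permutes_superset[of p "insert i S" S] by auto
      then show False using p by simp
    qed
    then have "p i \<in> S" using p permutes_in_image[of p "insert i S" i] by auto
    then show ?thesis using assms by (intro prod_zero) auto
  qed
  have "fdet (insert i S) A = (\<Sum>p\<in>?Q. of_int (sign p) * (\<Prod>k\<in>insert i S. A k (p k)))"
    unfolding fdet_def by (rule sum.mono_neutral_right[OF fin sub]) (use 1 in auto)
  also have "\<dots> = (\<Sum>p\<in>?Q. A i i * (of_int (sign p) * (\<Prod>k\<in>S. A k (p k))))"
  proof (intro sum.cong refl)
    fix p assume "p \<in> ?Q"
    then have "p i = i" using assms(2) by (simp add: permutes_not_in)
    then show "of_int (sign p) * (\<Prod>k\<in>insert i S. A k (p k)) = A i i * (of_int (sign p) * (\<Prod>k\<in>S. A k (p k)))"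
      using assms by simp
  qed
  finally show ?thesis by (simp add: fdet_def sum_distrib_left)
qed

text \<open>Only the permutations fixing \<open>i\<close> use the entry at (\<open>i\<close>,
  \<open>i\<close>), and these are the permutations of \<open>S\<close>.\<close>

lemma fdet_insert_add_diag:
  assumes "finite S" "i \<notin> S" and eq: "\<And>a b. (a, b) \<noteq> (i, i) \<Longrightarrow> B a b = A a b" and "B i i = A i i + c"
  shows "fdet (insert i S) B = fdet (insert i S) A + c * fdet S A"
proof -
  let ?P = "{p. p permutes insert i S}" and ?Q = "{p. p permutes S}"
  have sub: "?Q \<subseteq> ?P" by (auto intro: permutes_subset)
  have fin: "finite ?P" using assms by (simp add: finite_permutations)
  let ?f = "\<lambda>A p. of_int (sign p) * (\<Prod>k\<in>insert i S. A k (p k)) :: real"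
  have S: "(\<Prod>k\<in>S. B k (p k)) = (\<Prod>k\<in>S. A k (p k))" for p
    using assms(2) by (intro prod.cong refl eq) auto
  have "?f B p - ?f A p = 0" if p: "p \<in> ?P - ?Q" for p
  proof -
    have "p i \<noteq> i"
    proof
      assume "p i = i"
      then have "p permutes S"
        using p permutes_superset[of p "insert i S" S] by auto
      then show False using p by simp
    qed
    then have "B i (p i) = A i (p i)" by (simp add: eq)
    then show ?thesis using assms S by simp
  qed
  then have "(\<Sum>p\<in>?P. ?f B p - ?f A p) = (\<Sum>p\<in>?Q. ?f B p - ?f A p)"
    by (intro sum.mono_neutral_right[OF fin sub]) auto
  also have "\<dots> = (\<Sum>p\<in>?Q. c * (of_int (sign p) * (\<Prod>k\<in>S. A k (p k))))"
  proof (intro sum.cong refl)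
    fix p assume "p \<in> ?Q"
    then have "p i = i" using assms(2) by (simp add: permutes_not_in)
    then show "?f B p - ?f A p = c * (of_int (sign p) * (\<Prod>k\<in>S. A k (p k)))"
      using assms S by (simp add: algebra_simps)
  qed
  finally show ?thesis
    by (simp add: fdet_def sum_distrib_left sum_subtractf)
qed

lemma fdet_add_diag:
  assumes "finite S"
  shows "fdet S (\<lambda>i j. A i j + (if i = j then c i else 0)) = (\<Sum>U\<in>Pow S. fdet U A * (\<Prod>i\<in>S - U. c i))"
proof -
  \<comment> \<open>The induction needs a set \<open>R\<close> of indices that stay in the matrix
    but are no longer perturbed: treating \<open>i\<close> splits the determinant into one where
    \<open>i\<close> moves to \<open>R\<close> and one where it disappears.\<close>
  have "fdet (S \<union> R) (\<lambda>i j. A i j + (if i = j \<and> i \<in> S then c i else 0))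
      = (\<Sum>U\<in>Pow S. fdet (U \<union> R) A * (\<Prod>i\<in>S - U. c i))" if "finite R" "S \<inter> R = {}" for R
    using assms that
  proof (induction S arbitrary: R rule: finite_induct)
    case (insert i S)
    let ?B = "\<lambda>S i j. A i j + (if i = j \<and> i \<in> S then c i else 0)"
    have "fdet (insert i (S \<union> R)) (?B (insert i S)) = fdet (insert i (S \<union> R)) (?B S) + c i * fdet (S \<union> R) (?B S)"
      by (rule fdet_insert_add_diag) (use insert in auto)
    also have "fdet (insert i (S \<union> R)) (?B S) = (\<Sum>U\<in>Pow S. fdet (U \<union> insert i R) A * (\<Prod>i\<in>S - U. c i))"
      using insert.IH[of "insert i R"] insert.hyps insert.prems by auto
    also have "\<dots> = (\<Sum>U\<in>Pow S. fdet (insert i U \<union> R) A * (\<Prod>j\<in>insert i S - insert i U. c j))"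
      using insert.hyps by (intro sum.cong refl arg_cong2[where f="(*)"] prod.cong) auto
    also have "c i * fdet (S \<union> R) (?B S) = (\<Sum>U\<in>Pow S. fdet (U \<union> R) A * (\<Prod>j\<in>insert i S - U. c j))"
    proof -
      have "(\<Prod>j\<in>insert i S - U. c j) = c i * (\<Prod>j\<in>S - U. c j)" if "U \<in> Pow S" for U
      proof -
        have "insert i S - U = insert i (S - U)" using that insert.hyps by auto
        then show ?thesis using insert.hyps by simp
      qed
      then show ?thesis
        using insert.IH[of R] insert.prems by (simp add: sum_distrib_left mult_ac)
    qed
    also have "(\<Sum>U\<in>Pow S. fdet (insert i U \<union> R) A * (\<Prod>j\<in>insert i S - insert i U. c j))
             + (\<Sum>U\<in>Pow S. fdet (U \<union> R) A * (\<Prod>j\<in>insert i S - U. c j))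
             = (\<Sum>U\<in>Pow (insert i S). fdet (U \<union> R) A * (\<Prod>j\<in>insert i S - U. c j))"
    proof -
      have "inj_on (insert i) (Pow S)" using insert.hyps by (auto simp: inj_on_def)
      then show ?thesis
        unfolding Pow_insert using insert.hyps
        by (subst sum.union_disjoint) (auto simp: sum.reindex)
    qed
    finally show ?case by simp
  qed simp
  from this[of "{}"] have "fdet S (\<lambda>i j. A i j + (if i = j \<and> i \<in> S then c i else 0))
      = (\<Sum>U\<in>Pow S. fdet U A * (\<Prod>i\<in>S - U. c i))" by simp
  moreover have "fdet S (\<lambda>i j. A i j + (if i = j \<and> i \<in> S then c i else 0))
      = fdet S (\<lambda>i j. A i j + (if i = j then c i else 0))"
    by (rule fdet_cong) auto
  ultimately show ?thesis by simp
qed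

section \<open>Quadratic forms and Schur complements\<close>

definition bil :: "'i set \<Rightarrow> ('i \<Rightarrow> 'i \<Rightarrow> real) \<Rightarrow> ('i \<Rightarrow> real) \<Rightarrow> ('i \<Rightarrow> real) \<Rightarrow> real" where
  "bil S A x y = (\<Sum>a\<in>S. \<Sum>b\<in>S. x a * A a b * y b)"

text \<open>The number \<open>e\<close> is a lower bound for the spectrum: \<open>pd 0\<close> means
  positive semidefinite, and \<open>pd e\<close> with \<open>e > 0\<close> gives the invertibility
  needed for orthonormalisation.\<close>

definition pd :: "real \<Rightarrow> 'i set \<Rightarrow> ('i \<Rightarrow> 'i \<Rightarrow> real) \<Rightarrow> bool" where
  "pd e S A \<longleftrightarrow> (\<forall>i\<in>S. \<forall>j\<in>S. A i j = A j i) \<and> (\<forall>x. e * (\<Sum>a\<in>S. (x a)\<^sup>2) \<le> bil S A x x)"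

text \<open>Schur complement of the single pivot \<open>A i i\<close>. It is defined on all indices,
  so the same function can be restricted to \<open>S\<close> without \<open>i\<close> or kept on a
  set containing \<open>i\<close>, where its row \<open>i\<close> vanishes if the pivot is
  nonzero.\<close>

definition schur :: "'i \<Rightarrow> ('i \<Rightarrow> 'i \<Rightarrow> real) \<Rightarrow> 'i \<Rightarrow> 'i \<Rightarrow> real" where
  "schur i A = (\<lambda>a b. A a b - A a i * A i b / A i i)"

abbreviation idm :: "'i \<Rightarrow> 'i \<Rightarrow> real" where
  "idm \<equiv> \<lambda>i j. if i = j then 1 else 0"

lemma pdI:
  assumes "\<And>i j. i \<in> S \<Longrightarrow> j \<in> S \<Longrightarrow> A i j = A j i" "\<And>x. e * (\<Sum>a\<in>S. (x a)\<^sup>2) \<le> bil S A x x"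
  shows "pd e S A"
  using assms by (auto simp: pd_def)

lemma pd_sym: "pd e S A \<Longrightarrow> i \<in> S \<Longrightarrow> j \<in> S \<Longrightarrow> A i j = A j i"
  and pd_bil: "pd e S A \<Longrightarrow> e * (\<Sum>a\<in>S. (x a)\<^sup>2) \<le> bil S A x x"
  and psd_bil: "pd 0 S A \<Longrightarrow> 0 \<le> bil S A x x"
  by (auto simp: pd_def)

lemma pd_mono: "pd e S A \<Longrightarrow> d \<le> e \<Longrightarrow> pd d S A"
  unfolding pd_def by (meson mult_right_mono order_trans sum_nonneg zero_le_power2)

lemma bil_cong: "(\<And>a b. a \<in> S \<Longrightarrow> b \<in> S \<Longrightarrow> A a b = B a b) \<Longrightarrow> bil S A x y = bil S B x y"
  unfolding bil_def by (intro sum.cong) auto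

lemma bil_add_mat: "bil S (\<lambda>a b. A a b + B a b) x y = bil S A x y + bil S B x y"
  and bil_diff_mat: "bil S (\<lambda>a b. A a b - B a b) x y = bil S A x y - bil S B x y"
  by (simp_all add: bil_def algebra_simps sum.distrib sum_subtractf)

lemma bil_diag:
  assumes "finite S"
  shows "bil S (\<lambda>a b. if a = b then c a else 0) x x = (\<Sum>a\<in>S. c a * (x a)\<^sup>2)"
proof -
  have "(\<Sum>b\<in>S. x a * (if a = b then c a else 0) * x b) = c a * (x a)\<^sup>2" if "a \<in> S" for a
  proof -
    have "(\<Sum>b\<in>S. x a * (if a = b then c a else 0) * x b) = (\<Sum>b\<in>S. if a = b then x a * c a * x b else 0)"
      by (intro sum.cong) auto
    then show ?thesis using assms that by (simp add: power2_eq_square)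
  qed
  then show ?thesis by (simp add: bil_def)
qed

lemma pd_add_diag:
  assumes "finite S" "pd e S A" "\<And>i. i \<in> S \<Longrightarrow> d \<le> c i"
  shows "pd (e + d) S (\<lambda>i j. A i j + (if i = j then c i else 0))"
proof (rule pdI)
  fix x
  have "d * (\<Sum>a\<in>S. (x a)\<^sup>2) \<le> (\<Sum>a\<in>S. c a * (x a)\<^sup>2)"
    unfolding sum_distrib_left by (intro sum_mono mult_right_mono assms) auto
  then show "(e + d) * (\<Sum>a\<in>S. (x a)\<^sup>2) \<le> bil S (\<lambda>i j. A i j + (if i = j then c i else 0)) x x"
    using pd_bil[OF assms(2), of x] by (simp add: bil_add_mat bil_diag[OF assms(1)] distrib_right)
qed (use pd_sym[OF assms(2)] in auto)

lemma pd_subset: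
  assumes "finite S" "pd e S A" "T \<subseteq> S"
  shows "pd e T A"
proof (rule pdI)
  fix x :: "'a \<Rightarrow> real"
  let ?x = "\<lambda>a. if a \<in> T then x a else 0"
  have "(\<Sum>a\<in>S. (?x a)\<^sup>2) = (\<Sum>a\<in>T. (x a)\<^sup>2)"
    by (rule sum.mono_neutral_cong_right) (use assms in auto)
  moreover have "bil S A ?x ?x = bil T A x x"
  proof -
    have "bil S A ?x ?x = (\<Sum>a\<in>T. \<Sum>b\<in>S. x a * A a b * ?x b)"
      unfolding bil_def by (rule sum.mono_neutral_cong_right) (use assms in auto)
    also have "\<dots> = bil T A x x"
      unfolding bil_def by (intro sum.cong sum.mono_neutral_cong_right) (use assms in auto)
    finally show ?thesis .
  qed
  ultimately show "e * (\<Sum>a\<in>T. (x a)\<^sup>2) \<le> bil T A x x"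
    using pd_bil[OF assms(2), of ?x] by simp
qed (use assms in \<open>auto simp: pd_def\<close>)

text \<open>The map \<open>f\<close> may repeat values: the test vector is pushed forward by adding
  its entries over each fibre. This covers several points lying in the same cell.\<close>

lemma psd_pullback:
  assumes "finite S" "finite T" "pd 0 S A" "f ` T \<subseteq> S"
  shows "pd 0 T (\<lambda>a b. A (f a) (f b))"
proof (rule pdI)
  fix x :: "'b \<Rightarrow> real"
  let ?x = "\<lambda>s. \<Sum>a | a \<in> T \<and> f a = s. x a"
  have "bil T (\<lambda>a b. A (f a) (f b)) x x = (\<Sum>a\<in>T. x a * (\<Sum>b\<in>T. A (f a) (f b) * x b))"
    by (simp add: bil_def sum_distrib_left mult_ac)
  also have "\<dots> = (\<Sum>a\<in>T. x a * (\<Sum>s\<in>S. \<Sum>b | b \<in> T \<and> f b = s. A (f a) (f b) * x b))"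
    by (intro sum.cong refl arg_cong2[where f="(*)"] sum.group[OF assms(2,1,4), symmetric])
  also have "\<dots> = (\<Sum>a\<in>T. x a * (\<Sum>s\<in>S. A (f a) s * ?x s))"
    by (intro sum.cong refl arg_cong2[where f="(*)"]) (simp add: sum_distrib_left)
  also have "\<dots> = (\<Sum>t\<in>S. \<Sum>a | a \<in> T \<and> f a = t. x a * (\<Sum>s\<in>S. A (f a) s * ?x s))"
    by (rule sum.group[OF assms(2,1,4), symmetric])
  also have "\<dots> = (\<Sum>t\<in>S. \<Sum>a | a \<in> T \<and> f a = t. x a * (\<Sum>s\<in>S. A t s * ?x s))"
    by (intro sum.cong refl) auto
  also have "\<dots> = bil S A ?x ?x"
    by (simp add: bil_def flip: sum_distrib_right) (simp add: sum_distrib_left mult.assoc)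
  finally show "0 * (\<Sum>a\<in>T. (x a)\<^sup>2) \<le> bil T (\<lambda>a b. A (f a) (f b)) x x"
    using psd_bil[OF assms(3), of ?x] by simp
next
  fix i j assume "i \<in> T" "j \<in> T"
  then show "A (f i) (f j) = A (f j) (f i)" using assms(4) by (intro pd_sym[OF assms(3)]) auto
qed

lemma bil_shift:
  assumes "finite S" "i \<in> S" and sym: "\<And>a. a \<in> S \<Longrightarrow> A a i = A i a"
  shows "bil S A (\<lambda>a. x a + (if a = i then t else 0)) (\<lambda>a. x a + (if a = i then t else 0))
       = bil S A x x + 2 * t * (\<Sum>b\<in>S. A i b * x b) + t\<^sup>2 * A i i"
proof -
  let ?d = "\<lambda>a. if a = i then t else 0"
  have d: "(\<Sum>b\<in>S. u b * ?d b) = u i * t" for u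
    using assms(1,2) by (simp add: if_distrib[of "\<lambda>z. _ * z"] cong: if_cong)
  have "bil S A (\<lambda>a. x a + ?d a) (\<lambda>a. x a + ?d a)
     = bil S A x x + (\<Sum>a\<in>S. x a * (\<Sum>b\<in>S. A a b * ?d b)) + (\<Sum>a\<in>S. (\<Sum>b\<in>S. A a b * x b) * ?d a)
       + (\<Sum>a\<in>S. (\<Sum>b\<in>S. A a b * ?d b) * ?d a)"
    by (simp add: bil_def sum_distrib_left sum_distrib_right flip: sum.distrib) (simp add: algebra_simps)
  also have "\<dots> = bil S A x x + (\<Sum>a\<in>S. x a * (A a i * t)) + (\<Sum>b\<in>S. A i b * x b) * t + A i i * t * t"
    by (simp only: d)
  also have "(\<Sum>a\<in>S. x a * (A a i * t)) = t * (\<Sum>a\<in>S. A i a * x a)"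
    unfolding sum_distrib_left by (intro sum.cong) (auto simp: sym)
  finally show ?thesis by (simp add: power2_eq_square algebra_simps)
qed

lemma bil_schur:
  assumes "finite S" and sym: "\<And>a. a \<in> S \<Longrightarrow> A a i = A i a"
  shows "bil S (schur i A) x x = bil S A x x - (\<Sum>b\<in>S. A i b * x b)\<^sup>2 / A i i"
proof -
  have "bil S (schur i A) x x = bil S A x x - (\<Sum>a\<in>S. \<Sum>b\<in>S. x a * (A a i * A i b / A i i) * x b)"
    unfolding schur_def bil_diff_mat by (simp add: bil_def)
  also have "(\<Sum>a\<in>S. \<Sum>b\<in>S. x a * (A a i * A i b / A i i) * x b) = (\<Sum>b\<in>S. A i b * x b)\<^sup>2 / A i i"
    unfolding power2_eq_square sum_product sum_divide_distrib
    by (intro sum.cong refl) (auto simp: sym)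
  finally show ?thesis .
qed

lemma pd_diag:
  assumes "finite S" "pd e S A" "i \<in> S"
  shows "e \<le> A i i"
proof -
  let ?x = "\<lambda>a. 0 + (if a = i then 1 else 0 :: real)"
  have "(\<Sum>a\<in>S. (?x a)\<^sup>2) = (\<Sum>a\<in>S. if a = i then 1 else 0)"
    by (intro sum.cong) auto
  then have "(\<Sum>a\<in>S. (?x a)\<^sup>2) = 1"
    using assms by simp
  moreover have "bil S A ?x ?x = A i i"
    by (subst bil_shift[OF assms(1,3)]) (use pd_sym[OF assms(2)] assms(3) in \<open>auto simp: bil_def\<close>)
  ultimately show ?thesis using pd_bil[OF assms(2), of ?x] by simp
qed

lemma psd_schur_full:
  assumes "finite S" "pd 0 S A" "i \<in> S" "A i i > 0"
  shows "pd 0 S (schur i A)"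
proof (rule pdI)
  fix x
  have sym: "A a i = A i a" if "a \<in> S" for a using pd_sym[OF assms(2) that assms(3)] .
  \<comment> \<open>The minimiser of the quadratic form along the line through \<open>x\<close> in
    direction \<open>i\<close>; its minimum is the Schur complement form.\<close>
  let ?t = "- (\<Sum>b\<in>S. A i b * x b) / A i i"
  have "0 \<le> bil S A (\<lambda>a. x a + (if a = i then ?t else 0)) (\<lambda>a. x a + (if a = i then ?t else 0))"
    by (rule psd_bil[OF assms(2)])
  also have "\<dots> = bil S (schur i A) x x"
    using assms(4) by (simp add: bil_shift[of S i A, OF assms(1,3) sym] bil_schur[of S A i, OF assms(1) sym] power2_eq_square field_simps)
  finally show "0 * (\<Sum>a\<in>S. (x a)\<^sup>2) \<le> bil S (schur i A) x x" by simp
qed (use pd_sym[OF assms(2)] assms(3) in \<open>auto simp: schur_def\<close>)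

lemma pd_schur:
  assumes "finite S" "i \<notin> S" "pd e (insert i S) A" "A i i > 0" "e \<ge> 0"
  shows "pd e S (schur i A)"
proof (rule pdI)
  fix x :: "'a \<Rightarrow> real"
  let ?S = "insert i S"
  let ?y = "\<lambda>a. if a = i then 0 else x a"
  have sym: "A a i = A i a" if "a \<in> ?S" for a using pd_sym[OF assms(3) that] by simp
  define L where "L = (\<Sum>b\<in>?S. A i b * ?y b)"
  \<comment> \<open>The vector on \<open>S\<close> is extended by the optimal value at
    \<open>i\<close>. This does not lower its norm, which is why the bound \<open>e\<close> is
    inherited.\<close>
  let ?t = "- L / A i i"
  let ?z = "\<lambda>a. ?y a + (if a = i then ?t else 0)"
  have y: "(\<Sum>b\<in>?S. A i b * ?y b) = (\<Sum>b\<in>S. A i b * x b)"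
    using assms(1,2) by (auto intro!: sum.cong)
  have "(\<Sum>a\<in>S. (x a)\<^sup>2) = (\<Sum>a\<in>S. (?z a)\<^sup>2)"
    using assms(2) by (intro sum.cong) auto
  also have "\<dots> \<le> (\<Sum>a\<in>?S. (?z a)\<^sup>2)"
    using assms(1) by (intro sum_mono2) auto
  finally have "e * (\<Sum>a\<in>S. (x a)\<^sup>2) \<le> e * (\<Sum>a\<in>?S. (?z a)\<^sup>2)"
    using assms(5) by (rule mult_left_mono)
  also have "\<dots> \<le> bil ?S A ?z ?z" by (rule pd_bil[OF assms(3)])
  also have "\<dots> = bil ?S A ?y ?y + 2 * ?t * L + ?t\<^sup>2 * A i i"
    unfolding L_def by (rule bil_shift) (use assms(1) sym in auto)
  also have "\<dots> = bil ?S A ?y ?y - L\<^sup>2 / A i i"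
    using assms(4) by (simp add: power2_eq_square)
  also have "bil ?S A ?y ?y = bil S A x x"
  proof -
    have S: "(\<Sum>b\<in>?S. u b * ?y b) = (\<Sum>b\<in>S. u b * x b)" for u :: "'a \<Rightarrow> real"
      using assms(1,2) by (auto intro!: sum.cong)
    have "bil ?S A ?y ?y = (\<Sum>a\<in>?S. (\<Sum>b\<in>?S. A a b * ?y b) * ?y a)"
      by (simp only: bil_def sum_distrib_right) (simp only: mult_ac)
    also have "\<dots> = bil S A x x"
      by (simp only: S) (simp add: bil_def sum_distrib_right sum_distrib_left mult_ac)
    finally show ?thesis .
  qed
  also have "bil S A x x - L\<^sup>2 / A i i = bil S (schur i A) x x"
    unfolding y L_def by (rule bil_schur[symmetric]) (use assms(1) sym in auto)
  finally show "e * (\<Sum>a\<in>S. (x a)\<^sup>2) \<le> bil S (schur i A) x x" .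
qed (use pd_sym[OF assms(3)] in \<open>auto simp: schur_def\<close>)

lemma psd_offdiag:
  assumes "finite S" "pd 0 S A" "i \<in> S" "j \<in> S"
  shows "(A i j)\<^sup>2 \<le> A i i * A j j"
proof -
  have sym: "A a i = A i a" if "a \<in> S" for a using pd_sym[OF assms(2) that assms(3)] .
  have ii: "0 \<le> A i i" and jj: "0 \<le> A j j" using pd_diag[OF assms(1,2)] assms(3,4) by auto
  have q: "0 \<le> A j j + 2 * t * A i j + t\<^sup>2 * A i i" for t
  proof -
    let ?x = "\<lambda>a. 0 + (if a = j then 1 else 0 :: real)"
    have "bil S A ?x ?x = A j j"
      by (subst bil_shift[OF assms(1,4)]) (use pd_sym[OF assms(2)] assms(4) in \<open>auto simp: bil_def\<close>)
    moreover have "(\<Sum>b\<in>S. A i b * ?x b) = A i j"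
      using assms(1,4) by (simp add: if_distrib[of "\<lambda>z. _ * z"] cong: if_cong)
    ultimately show ?thesis
      using psd_bil[OF assms(2), of "\<lambda>a. ?x a + (if a = i then t else 0)"]
      by (simp only: bil_shift[of S i A, OF assms(1,3) sym])
  qed
  show ?thesis
  proof (cases "A i i = 0")
    case True
    have "A i j = 0"
    proof (rule ccontr)
      \<comment> \<open>With zero pivot the expression \<open>q\<close> is affine in
        \<open>t\<close>; the chosen \<open>t\<close> makes it equal to -1.\<close>
      assume "A i j \<noteq> 0"
      then show False using q[of "- (A j j + 1) / (2 * A i j)"] True by (simp add: field_simps)
    qed
    then show ?thesis using True by simp
  next
    case False
    then have "A i i > 0" using ii by simp
    then show ?thesis using q[of "- A i j / A i i"]
      by (simp add: power2_eq_square field_simps)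
  qed
qed

lemma psd_zero_row:
  assumes "finite S" "pd 0 S A" "i \<in> S" "j \<in> S" "A i i = 0"
  shows "A i j = 0"
  using psd_offdiag[OF assms(1-4)] assms(5) by simp

lemma fdet_idm: "finite S \<Longrightarrow> fdet S idm = 1"
proof (induction S rule: finite_induct)
  case (insert i S)
  then show ?case by (subst fdet_insert_unit_row) auto
qed simp

lemma fdet_schur:
  assumes "finite S" "i \<notin> S" "A i i \<noteq> 0"
  shows "fdet (insert i S) A = A i i * fdet S (schur i A)"
proof -
  \<comment> \<open>Gaussian elimination: left multiplication by this matrix of determinant 1 clears
    column \<open>i\<close> below the pivot. The transposition further down turns the cleared column
    into a row, where \<open>fdet_insert_unit_row\<close> applies.\<close>
  let ?G = "\<lambda>a b. if a = b then 1 else if b = i then - A a i / A i i else 0"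
  have "fdet (insert i S) ?G = fdet S ?G"
    by (subst fdet_insert_unit_row) (use assms in auto)
  also have "\<dots> = fdet S idm" by (rule fdet_cong) (use assms in auto)
  finally have G: "fdet (insert i S) ?G = 1" using assms by (simp add: fdet_idm)
  let ?B = "\<lambda>a j. \<Sum>k\<in>insert i S. ?G a k * A k j"
  have Bi: "?B i j = A i j" for j
    using assms by (simp add: sum.neutral)
  have B: "?B a j = schur i A a j" if "a \<in> S" for a j
  proof -
    have "(\<Sum>k\<in>S. ?G a k * A k j) = (\<Sum>k\<in>S. if a = k then A k j else 0)"
      using assms that by (intro sum.cong) auto
    then show ?thesis using assms that by (auto simp: schur_def)
  qed
  have "fdet (insert i S) A = fdet (insert i S) ?B"
    by (subst fdet_mult) (use assms G in auto)
  also have "\<dots> = fdet (insert i S) (\<lambda>a j. ?B j a)"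
    by (rule fdet_transpose[symmetric]) (use assms in auto)
  also have "\<dots> = ?B i i * fdet S (\<lambda>a j. ?B j a)"
    by (rule fdet_insert_unit_row) (use assms B in \<open>auto simp: schur_def\<close>)
  also have "fdet S (\<lambda>a j. ?B j a) = fdet S (\<lambda>a j. schur i A j a)"
    by (rule fdet_cong) (use B in auto)
  also have "\<dots> = fdet S (schur i A)" by (rule fdet_transpose) (use assms in auto)
  finally show ?thesis using Bi by simp
qed

text \<open>The alternative behind the inductions on semidefinite matrices: a zero pivot forces its
  whole row to vanish, and a positive pivot can be eliminated without losing
  semidefiniteness.\<close>

lemma psd_fdet_insert_cases [consumes 3]:
  assumes "finite S" "i \<notin> S" "pd 0 (insert i S) A"
  obtains "A i i = 0" "fdet (insert i S) A = 0" "\<And>j. j \<in> S \<Longrightarrow> A i j = 0"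
  | "A i i > 0" "fdet (insert i S) A = A i i * fdet S (schur i A)" "pd 0 S (schur i A)"
proof (cases "A i i = 0")
  case True
  have "A i j = 0" if "j \<in> insert i S" for j
    using psd_zero_row[OF _ assms(3) _ that True] assms(1) by simp
  then show ?thesis using that(1) True fdet_zero_row[of "insert i S" i A] assms(1) by auto
next
  case False
  then have "A i i > 0" using pd_diag[OF _ assms(3), of i] assms(1) by simp
  then show ?thesis using that(2) fdet_schur[OF assms(1,2)] pd_schur[OF assms] by simp
qed

text \<open>Elimination multiplies by a nonnegative pivot and can only lower the other diagonal
  entries.\<close>

lemma fdet_nonneg_hadamard:
  assumes "finite S" "pd 0 S A"
  shows "0 \<le> fdet S A \<and> fdet S A \<le> (\<Prod>i\<in>S. A i i)"
  using assms
proof (induction S arbitrary: A rule: finite_induct)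
  case (insert i S)
  have nn: "0 \<le> A j j" if "j \<in> insert i S" for j
    using pd_diag[OF _ insert.prems that] insert.hyps by simp
  from insert.hyps insert.prems show ?case
  proof (cases rule: psd_fdet_insert_cases)
    case 1
    then show ?thesis using nn insert.hyps by (auto intro!: mult_nonneg_nonneg prod_nonneg)
  next
    case 2
    have "(\<Prod>j\<in>S. schur i A j j) \<le> (\<Prod>j\<in>S. A j j)"
    proof (rule prod_mono)
      fix j assume j: "j \<in> S"
      have "A j i = A i j" using pd_sym[OF insert.prems] j by auto
      then have "schur i A j j \<le> A j j" using 2 by (simp add: schur_def)
      then show "0 \<le> schur i A j j \<and> schur i A j j \<le> A j j"
        using pd_diag[OF insert.hyps(1) 2(3) j] by simp
    qed
    then show ?thesis using insert.IH[OF 2(3)] 2 insert.hyps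
      by (auto intro: order_trans)
  qed
qed simp

lemmas fdet_nonneg = fdet_nonneg_hadamard[THEN conjunct1]
lemmas fdet_hadamard = fdet_nonneg_hadamard[THEN conjunct2]

lemma fdet_ge_of_le_one:
  assumes "finite S" "pd 0 S E" "pd 0 S (\<lambda>a b. idm a b - E a b)"
  shows "1 - (\<Sum>i\<in>S. 1 - E i i) \<le> fdet S E"
  using assms
proof (induction S arbitrary: E rule: finite_induct)
  case (insert i S)
  let ?S = "insert i S"
  have le: "E j j \<le> 1" if "j \<in> ?S" for j
    using pd_diag[OF _ insert.prems(2) that] insert.hyps by simp
  from insert.hyps insert.prems(1) show ?case
  proof (cases rule: psd_fdet_insert_cases)
    case 1
    have "0 \<le> (\<Sum>j\<in>S. 1 - E j j)" using le by (intro sum_nonneg) auto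
    then show ?thesis using 1 insert.hyps by simp
  next
    case 2
    let ?e = "E i i"
    have sym: "E a i = E i a" if "a \<in> S" for a using pd_sym[OF insert.prems(1), of a i] that by simp
    have bs: "bil S (schur i E) x x = bil S E x x - (\<Sum>b\<in>S. E i b * x b)\<^sup>2 / ?e" for x
      by (rule bil_schur) (use insert.hyps sym in blast)+
    have "pd 0 S (\<lambda>a b. idm a b - schur i E a b)"
    proof (rule pdI)
      fix x
      have "0 \<le> bil S (\<lambda>a b. idm a b - E a b) x x"
        using pd_subset[OF _ insert.prems(2), of S] insert.hyps by (intro psd_bil) auto
      also have "\<dots> \<le> bil S idm x x - bil S (schur i E) x x"
        using 2(1) by (simp add: bil_diff_mat bs)
      finally show "0 * (\<Sum>a\<in>S. (x a)\<^sup>2) \<le> bil S (\<lambda>a b. idm a b - schur i E a b) x x"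
        by (simp add: bil_diff_mat)
    qed (use pd_sym[OF 2(3)] in auto)
    from insert.IH[OF 2(3) this]
    have "?e * (1 - (\<Sum>j\<in>S. 1 - schur i E j j)) \<le> fdet ?S E"
      using 2 by simp
    moreover have "?e * (\<Sum>j\<in>S. 1 - schur i E j j) = ?e * (\<Sum>j\<in>S. 1 - E j j) + (\<Sum>j\<in>S. (E i j)\<^sup>2)"
      unfolding sum_distrib_left sum.distrib[symmetric]
      using 2(1) by (intro sum.cong) (auto simp: schur_def sym field_simps power2_eq_square)
    moreover have "(\<Sum>j\<in>S. (E i j)\<^sup>2) \<le> (1 - ?e) * (\<Sum>j\<in>S. 1 - E j j)"
      unfolding sum_distrib_left
    proof (rule sum_mono)
      fix j assume j: "j \<in> S"
      then show "(E i j)\<^sup>2 \<le> (1 - ?e) * (1 - E j j)"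
        using psd_offdiag[OF _ insert.prems(2), of i j] insert.hyps by (auto split: if_splits)
    qed
    moreover have "(\<Sum>j\<in>?S. 1 - E j j) = (1 - ?e) + (\<Sum>j\<in>S. 1 - E j j)"
      using insert.hyps by simp
    ultimately show ?thesis
      by (simp only: right_diff_distrib left_diff_distrib mult_1_left mult_1_right)
  qed
qed simp

lemma fdet_ge_of_ge_one:
  assumes "finite S" "pd 0 S (\<lambda>a b. E a b - idm a b)"
  shows "1 + (\<Sum>i\<in>S. E i i - 1) \<le> fdet S E"
  using assms
proof (induction S arbitrary: E rule: finite_induct)
  case (insert i S)
  let ?S = "insert i S" and ?e = "E i i"
  have fin: "finite ?S" using insert.hyps by simp
  have ge: "1 \<le> E j j" if "j \<in> ?S" for j
    using pd_diag[OF fin insert.prems that] by simp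
  have sym: "E a i = E i a" if "a \<in> S" for a
    using pd_sym[OF insert.prems, of a i] that insert.hyps(2) by (auto split: if_splits)
  have e1: "1 \<le> ?e" using ge by simp
  have S: "pd 0 S (\<lambda>a b. E a b - idm a b)" using pd_subset[OF fin insert.prems] by auto
  have off: "(E i j)\<^sup>2 \<le> (?e - 1) * (E j j - 1)" if "j \<in> S" for j
    using psd_offdiag[OF fin insert.prems, of i j] that insert.hyps by (auto split: if_splits)
  have "pd 0 S (\<lambda>a b. schur i E a b - idm a b)"
  proof (rule pdI)
    fix x
    let ?l = "\<Sum>b\<in>S. E i b * x b"
    have b: "bil S (schur i E) x x = bil S E x x - ?l\<^sup>2 / ?e"
      by (rule bil_schur) (use insert.hyps sym in blast)+
    show "0 * (\<Sum>a\<in>S. (x a)\<^sup>2) \<le> bil S (\<lambda>a b. schur i E a b - idm a b) x x"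
    proof (cases "?e = 1")
      case True
      then have "E i j = 0" if "j \<in> S" for j using off[OF that] by simp
      then have "?l = 0" by (simp add: sum.neutral)
      then show ?thesis using psd_bil[OF S, of x] by (simp add: bil_diff_mat b)
    next
      case False
      \<comment> \<open>\<open>E\<close> and \<open>?D\<close> agree off the diagonal, but the pivot
        of \<open>?D\<close> is smaller by 1. Its Schur complement therefore subtracts more, so
        positivity for \<open>?D\<close> implies the claim for \<open>E\<close>.\<close>
      let ?D = "\<lambda>a b. E a b - idm a b"
      have pos: "?D i i > 0" using False e1 by simp
      have "0 \<le> bil S (schur i ?D) x x"
        by (rule psd_bil, rule pd_schur) (use insert pos in auto)
      also have "\<dots> = bil S ?D x x - (\<Sum>b\<in>S. ?D i b * x b)\<^sup>2 / (?e - 1)"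
        by (subst bil_schur) (use insert.hyps sym in \<open>auto split: if_splits\<close>)
      also have "(\<Sum>b\<in>S. ?D i b * x b) = ?l"
        using insert.hyps by (intro sum.cong) auto
      finally have "?l\<^sup>2 / (?e - 1) \<le> bil S ?D x x" by simp
      moreover have "?l\<^sup>2 / ?e \<le> ?l\<^sup>2 / (?e - 1)"
        using pos by (intro divide_left_mono) auto
      ultimately show ?thesis by (simp add: bil_diff_mat b)
    qed
  next
    fix a b assume "a \<in> S" "b \<in> S"
    then show "schur i E a b - idm a b = schur i E b a - idm b a"
      using pd_sym[OF S, of a b] sym[of a] sym[of b] by (auto simp: schur_def split: if_splits)
  qed
  from insert.IH[OF this]
  have "?e * (1 + (\<Sum>j\<in>S. schur i E j j - 1)) \<le> fdet ?S E"
    using e1 insert.hyps by (subst fdet_schur) auto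
  moreover have "?e * (\<Sum>j\<in>S. schur i E j j - 1) = ?e * (\<Sum>j\<in>S. E j j - 1) - (\<Sum>j\<in>S. (E i j)\<^sup>2)"
    unfolding sum_distrib_left sum_subtractf[symmetric]
    using e1 by (intro sum.cong) (auto simp: schur_def sym field_simps power2_eq_square)
  moreover have "(\<Sum>j\<in>S. (E i j)\<^sup>2) \<le> (?e - 1) * (\<Sum>j\<in>S. E j j - 1)"
    unfolding sum_distrib_left by (rule sum_mono) (use off in auto)
  moreover have "(\<Sum>j\<in>?S. E j j - 1) = (?e - 1) + (\<Sum>j\<in>S. E j j - 1)"
    using insert.hyps by simp
  ultimately show ?case
    by (simp only: distrib_left left_diff_distrib mult_1_left mult_1_right)
qed simp

section \<open>Decorrelation of two diagonal blocks\<close>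

definition congr :: "'i set \<Rightarrow> ('i \<Rightarrow> 'i \<Rightarrow> real) \<Rightarrow> ('i \<Rightarrow> 'i \<Rightarrow> real) \<Rightarrow> 'i \<Rightarrow> 'i \<Rightarrow> real" where
  "congr S G A = (\<lambda>i j. bil S A (G i) (G j))"

lemma fdet_congr:
  assumes "finite S"
  shows "fdet S (congr S G A) = (fdet S G)\<^sup>2 * fdet S A"
proof -
  have "congr S G A = (\<lambda>i j. \<Sum>b\<in>S. (\<Sum>a\<in>S. G i a * A a b) * G j b)"
    unfolding congr_def bil_def fun_eq_iff sum_distrib_right by (intro allI) (rule sum.swap)
  then have "fdet S (congr S G A) = fdet S (\<lambda>i b. \<Sum>a\<in>S. G i a * A a b) * fdet S (\<lambda>b j. G j b)"
    by (simp only: fdet_mult[OF assms])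
  then show ?thesis
    by (simp only: fdet_mult[OF assms] fdet_transpose[OF assms, of G]) (simp add: power2_eq_square)
qed

lemma psd_congr:
  assumes "finite S" "pd 0 S A"
  shows "pd 0 S (congr S G A)"
proof (rule pdI)
  fix x :: "'a \<Rightarrow> real"
  let ?y = "\<lambda>a. \<Sum>i\<in>S. x i * G i a"
  have "bil S A ?y ?y = (\<Sum>a\<in>S. \<Sum>b\<in>S. \<Sum>i\<in>S. \<Sum>j\<in>S. x i * G i a * A a b * (x j * G j b))"
    by (simp add: bil_def sum_distrib_left sum_distrib_right) (rule sum.cong[OF refl], rule sum.cong[OF refl], rule sum.swap)
  also have "\<dots> = (\<Sum>a\<in>S. \<Sum>i\<in>S. \<Sum>j\<in>S. \<Sum>b\<in>S. x i * G i a * A a b * (x j * G j b))"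
    by (rule sum.cong[OF refl], subst sum.swap, rule sum.cong[OF refl], rule sum.swap)
  also have "\<dots> = (\<Sum>i\<in>S. \<Sum>j\<in>S. \<Sum>a\<in>S. \<Sum>b\<in>S. x i * G i a * A a b * (x j * G j b))"
    by (subst sum.swap, rule sum.cong[OF refl], rule sum.swap)
  also have "\<dots> = bil S (congr S G A) x x"
    by (simp add: bil_def congr_def sum_distrib_left sum_distrib_right mult_ac)
  finally show "0 * (\<Sum>a\<in>S. (x a)\<^sup>2) \<le> bil S (congr S G A) x x"
    using psd_bil[OF assms(2), of ?y] by simp
next
  fix i j
  have "bil S A (G i) (G j) = (\<Sum>b\<in>S. \<Sum>a\<in>S. G i a * A a b * G j b)"
    unfolding bil_def by (rule sum.swap)
  also have "\<dots> = bil S A (G j) (G i)"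
    unfolding bil_def by (intro sum.cong refl) (auto simp: pd_sym[OF assms(2)])
  finally show "congr S G A i j = congr S G A j i" by (simp add: congr_def)
qed

lemma bil_supp:
  assumes "finite S" "T \<subseteq> S" "R \<subseteq> S" "\<And>a. a \<in> S - T \<Longrightarrow> x a = 0" "\<And>a. a \<in> S - R \<Longrightarrow> y a = 0"
  shows "bil S A x y = (\<Sum>a\<in>T. \<Sum>b\<in>R. x a * A a b * y b)"
proof -
  have "bil S A x y = (\<Sum>a\<in>T. \<Sum>b\<in>S. x a * A a b * y b)"
    unfolding bil_def by (rule sum.mono_neutral_right) (use assms in auto)
  also have "\<dots> = (\<Sum>a\<in>T. \<Sum>b\<in>R. x a * A a b * y b)"
    by (intro sum.cong refl sum.mono_neutral_right) (use assms in auto)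
  finally show ?thesis .
qed

lemma bil_sym:
  assumes "pd e S A"
  shows "bil S A x y = bil S A y x"
proof -
  have "bil S A x y = (\<Sum>b\<in>S. \<Sum>a\<in>S. x a * A a b * y b)"
    unfolding bil_def by (rule sum.swap)
  also have "\<dots> = bil S A y x"
    unfolding bil_def by (intro sum.cong refl) (auto simp: pd_sym[OF assms])
  finally show ?thesis .
qed

text \<open>Gram-Schmidt for the inner product given by \<open>A\<close>, carried out through Schur
  complements: the rows of \<open>G\<close> are orthonormal, that is, $G A G^T = I$.\<close>

lemma ex_orthonormal_rows:
  assumes "finite S" "pd e S A" "e > 0"
  shows "\<exists>G. \<forall>i\<in>S. \<forall>j\<in>S. bil S A (G i) (G j) = idm i j"
  using assms(1,2)
proof (induction S arbitrary: A rule: finite_induct)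
  case (insert i S)
  let ?S = "insert i S"
  have pos: "A i i > 0" using pd_diag[OF _ insert.prems, of i] insert.hyps assms(3) by simp
  obtain G where G: "\<And>k l. k \<in> S \<Longrightarrow> l \<in> S \<Longrightarrow> bil S (schur i A) (G k) (G l) = idm k l"
    using insert.IH[OF pd_schur[OF insert.hyps(1,2) insert.prems pos]] assms(3) by fastforce
  \<comment> \<open>Lifts a vector on \<open>S\<close> to the vector orthogonal, with respect to
    \<open>A\<close>, to the basis vector of \<open>i\<close>. On such lifts the form of
    \<open>A\<close> is that of the Schur complement.\<close>
  define ext where "ext x = (\<lambda>a. if a = i then - (\<Sum>b\<in>S. A i b * x b) / A i i else x a)" for x
  have row: "(\<Sum>b\<in>?S. A a b * ext y b) = (\<Sum>b\<in>S. schur i A a b * y b)" for a y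
  proof -
    have "(\<Sum>b\<in>S. A a b * ext y b) = (\<Sum>b\<in>S. A a b * y b)"
      using insert.hyps by (intro sum.cong) (auto simp: ext_def)
    moreover have "A a i * ext y i = - (\<Sum>b\<in>S. A a i * A i b / A i i * y b)"
      by (simp add: ext_def sum_distrib_left sum_divide_distrib mult_ac)
    ultimately show ?thesis using insert.hyps
      by (simp add: schur_def left_diff_distrib sum_subtractf)
  qed
  have b: "bil ?S A x (ext y) = (\<Sum>a\<in>S. x a * (\<Sum>b\<in>S. schur i A a b * y b))" for x y
  proof -
    have "bil ?S A x (ext y) = (\<Sum>a\<in>?S. x a * (\<Sum>b\<in>?S. A a b * ext y b))"
      by (simp only: bil_def sum_distrib_left mult.assoc)
    also have "\<dots> = x i * (\<Sum>b\<in>S. schur i A i b * y b) + (\<Sum>a\<in>S. x a * (\<Sum>b\<in>S. schur i A a b * y b))"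
      unfolding row using insert.hyps by simp
    also have "(\<Sum>b\<in>S. schur i A i b * y b) = 0"
      using pos by (simp add: schur_def)
    finally show ?thesis by simp
  qed
  have bb: "bil ?S A (ext x) (ext y) = bil S (schur i A) x y" for x y
  proof -
    have "bil ?S A (ext x) (ext y) = (\<Sum>a\<in>S. ext x a * (\<Sum>b\<in>S. schur i A a b * y b))"
      by (rule b)
    also have "\<dots> = bil S (schur i A) x y"
      unfolding bil_def sum_distrib_left using insert.hyps
      by (intro sum.cong refl) (auto simp: ext_def mult.assoc)
    finally show ?thesis .
  qed
  let ?u = "\<lambda>a. if a = i then 1 / sqrt (A i i) else 0"
  have u0: "bil ?S A ?u (ext y) = 0" for y
    unfolding b using insert.hyps by (intro sum.neutral) auto
  have uu: "bil ?S A ?u ?u = 1"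
    by (subst bil_supp[of _ "{i}" "{i}"]) (use insert.hyps pos in auto)
  have u0': "bil ?S A (ext y) ?u = 0" for y
    using bil_sym[OF insert.prems] u0 by metis
  let ?G = "\<lambda>k. if k = i then ?u else ext (G k)"
  have "bil ?S A (?G k) (?G l) = idm k l" if "k \<in> ?S" "l \<in> ?S" for k l
    using that by (cases "k = i"; cases "l = i") (simp_all add: u0 u0' uu bb G)
  then show ?case by (intro exI[of _ ?G] ballI)
qed simp

text \<open>Since $G A G^T = I$ gives $G^T G = A^{-1}$, the left sum is the trace of $A^{-1}$, whose
  diagonal entries are the minors on the right divided by the determinant. Only one inequality is
  needed, and it is obtained without inverse matrices.\<close>

lemma orthonormal_rows_norm:
  assumes S: "finite S" and A: "pd e S A" "e > 0"
    and G: "\<And>i j. i \<in> S \<Longrightarrow> j \<in> S \<Longrightarrow> bil S A (G i) (G j) = idm i j"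
  shows "(\<Sum>i\<in>S. \<Sum>k\<in>S. (G i k)\<^sup>2) * fdet S A \<le> (\<Sum>k\<in>S. fdet (S - {k}) A)"
proof -
  have "fdet S (congr S G A) = fdet S idm"
    by (rule fdet_cong) (simp add: congr_def G)
  then have det1: "(fdet S G)\<^sup>2 * fdet S A = 1" by (simp add: fdet_congr[OF S] fdet_idm[OF S])
  have nn: "0 \<le> fdet S A" using fdet_nonneg[OF S pd_mono[OF A(1)]] A(2) by simp
  have *: "(\<Sum>i\<in>S. (G i k)\<^sup>2) * fdet S A \<le> fdet (S - {k}) A" if k: "k \<in> S" for k
  proof -
    \<comment> \<open>Adding 1 to the diagonal entry at \<open>k\<close> raises the determinant by
      the minor without \<open>k\<close>. After congruence the perturbed matrix is $I + g g^T$ with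
      $g$ the column \<open>k\<close> of \<open>G\<close>, whose determinant is at least $1 +
      |g|^2$.\<close>
    let ?A = "\<lambda>a b. A a b + (if a = k \<and> b = k then 1 else 0)"
    have "fdet (insert k (S - {k})) ?A = fdet (insert k (S - {k})) A + 1 * fdet (S - {k}) A"
      by (rule fdet_insert_add_diag) (use S in auto)
    then have d: "fdet S ?A = fdet S A + fdet (S - {k}) A" using k by (simp add: insert_absorb)
    have c: "congr S G ?A i j = idm i j + G i k * G j k" if "i \<in> S" "j \<in> S" for i j
    proof -
      have "bil S (\<lambda>a b. if a = k \<and> b = k then 1 else 0) (G i) (G j) = G i k * G j k"
        unfolding bil_def using k S
        by (subst sum.remove[of _ k], simp, simp, subst sum.remove[of _ k]) (auto intro!: sum.neutral)
      then show ?thesis by (simp add: congr_def bil_add_mat G that)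
    qed
    have "1 + (\<Sum>i\<in>S. congr S G ?A i i - 1) \<le> fdet S (congr S G ?A)"
    proof (rule fdet_ge_of_ge_one[OF S], rule pdI)
      fix x :: "'a \<Rightarrow> real"
      have "bil S (\<lambda>a b. congr S G ?A a b - idm a b) x x = bil S (\<lambda>a b. G a k * G b k) x x"
        by (rule bil_cong) (simp add: c)
      also have "\<dots> = (\<Sum>a\<in>S. x a * G a k)\<^sup>2"
        by (simp add: bil_def power2_eq_square sum_product mult_ac)
      finally show "0 * (\<Sum>a\<in>S. (x a)\<^sup>2) \<le> bil S (\<lambda>a b. congr S G ?A a b - idm a b) x x" by simp
    qed (auto simp: c)
    also have "(\<Sum>i\<in>S. congr S G ?A i i - 1) = (\<Sum>i\<in>S. (G i k)\<^sup>2)"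
      by (intro sum.cong) (auto simp: c power2_eq_square)
    also have "fdet S (congr S G ?A) = (fdet S G)\<^sup>2 * fdet S A + (fdet S G)\<^sup>2 * fdet (S - {k}) A"
      by (simp add: fdet_congr[OF S] d distrib_left)
    finally have "(\<Sum>i\<in>S. (G i k)\<^sup>2) \<le> (fdet S G)\<^sup>2 * fdet (S - {k}) A"
      using det1 by simp
    then have "(\<Sum>i\<in>S. (G i k)\<^sup>2) * fdet S A \<le> (fdet S G)\<^sup>2 * fdet (S - {k}) A * fdet S A"
      using nn by (rule mult_right_mono)
    also have "\<dots> = ((fdet S G)\<^sup>2 * fdet S A) * fdet (S - {k}) A" by (simp only: mult_ac)
    finally show ?thesis by (simp add: det1)
  qed
  have "(\<Sum>i\<in>S. \<Sum>k\<in>S. (G i k)\<^sup>2) * fdet S A = (\<Sum>k\<in>S. (\<Sum>i\<in>S. (G i k)\<^sup>2) * fdet S A)"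
    by (subst sum.swap) (simp add: sum_distrib_right)
  also have "\<dots> \<le> (\<Sum>k\<in>S. fdet (S - {k}) A)" by (intro sum_mono *)
  finally show ?thesis .
qed

lemma fdet_block_diag:
  assumes "finite U" "finite V" "U \<inter> V = {}" "pd 0 (U \<union> V) M" "\<And>u v. u \<in> U \<Longrightarrow> v \<in> V \<Longrightarrow> M u v = 0"
  shows "fdet (U \<union> V) M = fdet U M * fdet V M"
  using assms(1,3-5)
proof (induction U arbitrary: M rule: finite_induct)
  case (insert i U)
  have fin: "finite (U \<union> V)" and ni: "i \<notin> U \<union> V" using insert assms(2) by auto
  have p: "pd 0 (insert i (U \<union> V)) M" using insert.prems(2) by simp
  from fin ni p show ?case
  proof (cases rule: psd_fdet_insert_cases)
    case 1
    then have "fdet (insert i U) M = 0"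
      using insert.hyps by (intro fdet_zero_row[of _ i]) auto
    then show ?thesis using 1 by simp
  next
    case 2
    have vi: "M v i = 0" "M i v = 0" if "v \<in> V" for v
      using insert.prems(3)[of i v] that pd_sym[OF p, of i v] by auto
    have "fdet (U \<union> V) (schur i M) = fdet U (schur i M) * fdet V (schur i M)"
      by (rule insert.IH) (use insert.prems 2 vi in \<open>auto simp: schur_def\<close>)
    also have "fdet V (schur i M) = fdet V M"
      by (rule fdet_cong) (simp add: schur_def vi)
    finally show ?thesis using 2 insert.hyps by (simp add: fdet_schur)
  qed
qed simp

lemma fdet_ge_of_identity_block:
  assumes "finite U" "finite V" "U \<inter> V = {}" "pd 0 (U \<union> V) M"
    and "\<And>a b. a \<in> U \<Longrightarrow> b \<in> U \<Longrightarrow> M a b = idm a b" "pd 0 V (\<lambda>a b. idm a b - M a b)"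
  shows "1 - (\<Sum>v\<in>V. 1 - M v v) - (\<Sum>u\<in>U. \<Sum>v\<in>V. (M u v)\<^sup>2) \<le> fdet (U \<union> V) M"
  using assms(1,3-6)
proof (induction U arbitrary: M rule: finite_induct)
  case empty
  then show ?case using fdet_ge_of_le_one[OF assms(2)] by simp
next
  case (insert i U)
  have fin: "finite (U \<union> V)" and ni: "i \<notin> U \<union> V" using insert assms(2) by auto
  have p: "pd 0 (insert i (U \<union> V)) M" using insert.prems(2) by simp
  have ii: "M i i = 1" and iu: "M i u = 0" if "u \<in> U" for u
    using insert.prems(3)[of i i] insert.prems(3)[of i u] that insert.hyps by auto
  have ii: "M i i = 1" using insert.prems(3)[of i i] by simp
  have sym: "M a i = M i a" if "a \<in> U \<union> V" for a using pd_sym[OF p, of a i] that by simp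
  have sU: "schur i M u a = M u a" "schur i M a u = M a u" if "u \<in> U" for u a
    using iu[OF that] sym[of u] that by (auto simp: schur_def)
  have "1 - (\<Sum>v\<in>V. 1 - schur i M v v) - (\<Sum>u\<in>U. \<Sum>v\<in>V. (schur i M u v)\<^sup>2) \<le> fdet (U \<union> V) (schur i M)"
  proof (rule insert.IH)
    show "U \<inter> V = {}" using insert.prems by auto
    show "pd 0 (U \<union> V) (schur i M)" using pd_schur[OF fin ni p] ii by simp
    show "schur i M a b = idm a b" if "a \<in> U" "b \<in> U" for a b
      using that insert.prems(3) by (simp add: sU)
    show "pd 0 V (\<lambda>a b. idm a b - schur i M a b)"
    proof (rule pdI)
      fix x
      have "bil V (schur i M) x x = bil V M x x - (\<Sum>b\<in>V. M i b * x b)\<^sup>2 / M i i"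
        by (rule bil_schur) (use assms(2) sym in auto)
      then show "0 * (\<Sum>a\<in>V. (x a)\<^sup>2) \<le> bil V (\<lambda>a b. idm a b - schur i M a b) x x"
        using psd_bil[OF insert.prems(4), of x] ii zero_le_power2[of "\<Sum>b\<in>V. M i b * x b"]
        by (simp only: bil_diff_mat div_by_1 mult_zero_left)
    next
      fix a b assume "a \<in> V" "b \<in> V"
      then show "idm a b - schur i M a b = idm b a - schur i M b a"
        using pd_sym[OF p, of a b] sym[of a] sym[of b] by (simp add: schur_def)
    qed
  qed
  moreover have "(\<Sum>v\<in>V. 1 - schur i M v v) = (\<Sum>v\<in>V. 1 - M v v) + (\<Sum>v\<in>V. (M i v)\<^sup>2)"
    unfolding sum.distrib[symmetric]
    by (intro sum.cong) (auto simp: schur_def ii sym power2_eq_square)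
  moreover have "(\<Sum>u\<in>U. \<Sum>v\<in>V. (schur i M u v)\<^sup>2) = (\<Sum>u\<in>U. \<Sum>v\<in>V. (M u v)\<^sup>2)"
    by (intro sum.cong) (auto simp: sU)
  moreover have "fdet (insert i U \<union> V) M = fdet (U \<union> V) (schur i M)"
    using fdet_schur[OF fin ni, of M] ii by simp
  ultimately show ?case using insert.hyps by simp
qed

lemma pd_fdet_block:
  assumes U: "finite U" and V: "finite V" and UV: "U \<inter> V = {}" and M: "pd e (U \<union> V) M" "e > 0"
    and w: "\<And>u v. u \<in> U \<Longrightarrow> v \<in> V \<Longrightarrow> \<bar>M u v\<bar> \<le> w"
  shows "\<bar>fdet (U \<union> V) M - fdet U M * fdet V M\<bar>
       \<le> (\<Sum>u\<in>U. fdet (U - {u}) M) * (\<Sum>v\<in>V. fdet (V - {v}) M) * (real (card U * card V) * w\<^sup>2)"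
proof -
  define S where "S = U \<union> V"
  have S: "finite S" "U \<subseteq> S" "V \<subseteq> S" using U V by (auto simp: S_def)
  have M0: "pd 0 S M" using pd_mono[OF M(1)] M(2) by (simp add: S_def)
  have MU: "pd e U M" and MV: "pd e V M" using pd_subset[of S e M] M S by (auto simp: S_def)
  obtain GU GV where GU: "\<And>i j. i \<in> U \<Longrightarrow> j \<in> U \<Longrightarrow> bil U M (GU i) (GU j) = idm i j"
    and GV: "\<And>i j. i \<in> V \<Longrightarrow> j \<in> V \<Longrightarrow> bil V M (GV i) (GV j) = idm i j"
    using ex_orthonormal_rows[OF U MU M(2)] ex_orthonormal_rows[OF V MV M(2)] by metis
  define G where "G i k = (if i \<in> U \<and> k \<in> U then GU i k else if i \<in> V \<and> k \<in> V then GV i k else 0)" for i k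
  define D where "D a b = (if a \<in> U \<and> b \<in> U \<or> a \<in> V \<and> b \<in> V then M a b else 0)" for a b
  define N where "N = congr S G M"
  have VnU: "v \<notin> U" if "v \<in> V" for v using that UV by auto
  have bs: "bil S A (G i) (G j) = (\<Sum>a\<in>T. \<Sum>b\<in>R. G i a * A a b * G j b)"
    if "i \<in> T" "j \<in> R" "T = U \<or> T = V" "R = U \<or> R = V" for A i j T R
    by (rule bil_supp) (use S that VnU in \<open>auto simp: G_def\<close>)
  have NU: "bil S A (G i) (G j) = idm i j" if "i \<in> U" "j \<in> U" "\<And>a b. a \<in> U \<Longrightarrow> b \<in> U \<Longrightarrow> A a b = M a b" for A i j
    using that by (subst bs[of i U j U]) (auto simp: G_def simp flip: GU bil_def intro!: bil_cong)
  have NV: "bil S A (G i) (G j) = idm i j" if "i \<in> V" "j \<in> V" "\<And>a b. a \<in> V \<Longrightarrow> b \<in> V \<Longrightarrow> A a b = M a b" for A i j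
    using that VnU by (subst bs[of i V j V]) (auto simp: G_def simp flip: GV bil_def intro!: bil_cong)
  have N0: "pd 0 S N" unfolding N_def by (rule psd_congr[OF S(1) M0])
  \<comment> \<open>Cauchy-Schwarz over \<open>U \<times> V\<close> separates the entries of
    \<open>G\<close> from those of \<open>M\<close>. The second factor contributes the number of
    pairs times \<open>w\<^sup>2\<close>.\<close>
  have Z: "(N i j)\<^sup>2 \<le> (\<Sum>a\<in>U. (G i a)\<^sup>2) * (\<Sum>b\<in>V. (G j b)\<^sup>2) * (real (card U * card V) * w\<^sup>2)"
    if "i \<in> U" "j \<in> V" for i j
  proof -
    have "N i j = (\<Sum>a\<in>U. \<Sum>b\<in>V. G i a * M a b * G j b)"
      unfolding N_def congr_def by (rule bs) (use that in auto)
    also have "\<dots> = (\<Sum>(a, b)\<in>U \<times> V. (G i a * G j b) * M a b)"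
      by (simp add: sum.cartesian_product mult_ac)
    finally have "(N i j)\<^sup>2 = (\<Sum>p\<in>U \<times> V. (G i (fst p) * G j (snd p)) * M (fst p) (snd p))\<^sup>2"
      by (simp add: case_prod_unfold)
    also have "\<dots> \<le> (\<Sum>p\<in>U \<times> V. (G i (fst p) * G j (snd p))\<^sup>2) * (\<Sum>p\<in>U \<times> V. (M (fst p) (snd p))\<^sup>2)"
      by (rule Cauchy_Schwarz_ineq_sum)
    also have "\<dots> \<le> (\<Sum>p\<in>U \<times> V. (G i (fst p) * G j (snd p))\<^sup>2) * (\<Sum>p\<in>U \<times> V. w\<^sup>2)"
    proof (intro mult_left_mono sum_mono sum_nonneg)
      fix p assume "p \<in> U \<times> V"
      then have "\<bar>M (fst p) (snd p)\<bar>\<^sup>2 \<le> w\<^sup>2" by (intro power_mono w) auto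
      then show "(M (fst p) (snd p))\<^sup>2 \<le> w\<^sup>2" by simp
    qed auto
    also have "(\<Sum>p\<in>U \<times> V. (G i (fst p) * G j (snd p))\<^sup>2) = (\<Sum>a\<in>U. (G i a)\<^sup>2) * (\<Sum>b\<in>V. (G j b)\<^sup>2)"
      by (simp add: sum_product sum.cartesian_product case_prod_unfold power_mult_distrib)
    finally show ?thesis by (simp add: card_cartesian_product)
  qed
  define FU where "FU = (\<Sum>i\<in>U. \<Sum>a\<in>U. (G i a)\<^sup>2)"
  define FV where "FV = (\<Sum>i\<in>V. \<Sum>a\<in>V. (G i a)\<^sup>2)"
  have FU: "FU = (\<Sum>i\<in>U. \<Sum>a\<in>U. (GU i a)\<^sup>2)" unfolding FU_def by (intro sum.cong) (auto simp: G_def)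
  have FV: "FV = (\<Sum>i\<in>V. \<Sum>a\<in>V. (GV i a)\<^sup>2)" unfolding FV_def by (intro sum.cong) (auto simp: G_def VnU)
  have "1 - (\<Sum>v\<in>V. 1 - N v v) - (\<Sum>u\<in>U. \<Sum>v\<in>V. (N u v)\<^sup>2) \<le> fdet (U \<union> V) N"
  proof (rule fdet_ge_of_identity_block[OF U V UV])
    show "pd 0 (U \<union> V) N" using N0 by (simp add: S_def)
    show "N a b = idm a b" if "a \<in> U" "b \<in> U" for a b
      unfolding N_def congr_def by (rule NU) (use that in auto)
    have "N a b = idm a b" if "a \<in> V" "b \<in> V" for a b
      unfolding N_def congr_def by (rule NV) (use that in auto)
    then show "pd 0 V (\<lambda>a b. idm a b - N a b)"
      by (intro pdI) (auto simp: bil_def intro!: sum_nonneg)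
  qed
  moreover have NVV: "N v v = 1" if "v \<in> V" for v
    using NV[of v v M] that by (simp add: N_def congr_def)
  moreover have "(\<Sum>u\<in>U. \<Sum>v\<in>V. (N u v)\<^sup>2) \<le> FU * FV * (real (card U * card V) * w\<^sup>2)"
  proof -
    have "(\<Sum>u\<in>U. \<Sum>v\<in>V. (N u v)\<^sup>2)
        \<le> (\<Sum>u\<in>U. \<Sum>v\<in>V. (\<Sum>a\<in>U. (G u a)\<^sup>2) * (\<Sum>b\<in>V. (G v b)\<^sup>2) * (real (card U * card V) * w\<^sup>2))"
      by (intro sum_mono Z)
    also have "\<dots> = FU * FV * (real (card U * card V) * w\<^sup>2)"
    proof -
      have "(\<Sum>u\<in>U. \<Sum>v\<in>V. f u * g v * c) = sum f U * sum g V * c" for f g and c :: real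
        unfolding sum_product by (simp only: sum_distrib_right)
      then show ?thesis unfolding FU_def FV_def .
    qed
    finally show ?thesis .
  qed
  ultimately have low: "1 - fdet S N \<le> FU * FV * (real (card U * card V) * w\<^sup>2)"
    by (simp add: S_def)
  have "N u u = 1" if "u \<in> U" for u
    using NU[of u u M] that by (simp add: N_def congr_def)
  then have "(\<Prod>i\<in>S. N i i) = 1" using NVV by (intro prod.neutral) (auto simp: S_def)
  then have up: "fdet S N \<le> 1" using fdet_hadamard[OF S(1) N0] by simp
  have "congr S G D i j = idm i j" if ij: "i \<in> S" "j \<in> S" for i j
  proof -
    consider "i \<in> U" "j \<in> U" | "i \<in> V" "j \<in> V" | "i \<in> U" "j \<in> V" | "i \<in> V" "j \<in> U"
      using ij by (auto simp: S_def)
    then show ?thesis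
    proof cases
      case 1 then show ?thesis unfolding congr_def by (intro NU) (auto simp: D_def)
    next
      case 2 then show ?thesis unfolding congr_def by (intro NV) (auto simp: D_def)
    next
      case 3 then show ?thesis unfolding congr_def using UV VnU
        by (subst bs[of i U j V]) (auto simp: D_def intro!: sum.neutral)
    next
      case 4 then show ?thesis unfolding congr_def using UV VnU
        by (subst bs[of i V j U]) (auto simp: D_def intro!: sum.neutral)
    qed
  qed
  then have "fdet S (congr S G D) = fdet S idm" by (intro fdet_cong) auto
  then have "(fdet S G)\<^sup>2 * fdet S D = 1" by (simp add: fdet_congr S fdet_idm)
  moreover have "fdet S D = fdet U M * fdet V M"
  proof -
    have "pd 0 S D"
    proof (rule pdI)
      fix x :: "'a \<Rightarrow> real"
      have "bil S D x x = (\<Sum>a\<in>U. \<Sum>b\<in>S. x a * D a b * x b) + (\<Sum>a\<in>V. \<Sum>b\<in>S. x a * D a b * x b)"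
        unfolding bil_def S_def by (rule sum.union_disjoint[OF U V UV])
      also have "(\<Sum>a\<in>U. \<Sum>b\<in>S. x a * D a b * x b) = bil U M x x"
        unfolding bil_def by (intro sum.cong refl sum.mono_neutral_cong_right) (use S VnU in \<open>auto simp: D_def\<close>)
      also have "(\<Sum>a\<in>V. \<Sum>b\<in>S. x a * D a b * x b) = bil V M x x"
        unfolding bil_def by (intro sum.cong refl sum.mono_neutral_cong_right) (use S VnU in \<open>auto simp: D_def\<close>)
      finally show "0 * (\<Sum>a\<in>S. (x a)\<^sup>2) \<le> bil S D x x"
        using psd_bil[of U M x] psd_bil[of V M x] pd_mono[OF MU, of 0] pd_mono[OF MV, of 0] M(2) by simp
    qed (auto simp: D_def pd_sym[OF M0])
    then have "fdet S D = fdet U D * fdet V D"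
      unfolding S_def by (intro fdet_block_diag[OF U V UV]) (use UV VnU in \<open>auto simp: D_def\<close>)
    also have "fdet U D = fdet U M" by (rule fdet_cong) (simp add: D_def)
    also have "fdet V D = fdet V M" by (rule fdet_cong) (simp add: D_def)
    finally show ?thesis .
  qed
  ultimately have g: "(fdet S G)\<^sup>2 * (fdet U M * fdet V M) = 1" by simp
  have "fdet S M = ((fdet S G)\<^sup>2 * (fdet U M * fdet V M)) * fdet S M" by (simp add: g)
  also have "\<dots> = fdet S N * (fdet U M * fdet V M)"
    unfolding N_def fdet_congr[OF S(1)] by (simp only: mult_ac)
  finally have eq: "fdet S M = fdet S N * (fdet U M * fdet V M)" .
  have U0: "0 \<le> fdet U M" and V0: "0 \<le> fdet V M"
    using fdet_nonneg[OF U pd_mono[OF MU]] fdet_nonneg[OF V pd_mono[OF MV]] M(2) by auto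
  have "\<bar>fdet S M - fdet U M * fdet V M\<bar> = (1 - fdet S N) * (fdet U M * fdet V M)"
  proof -
    have "fdet S M - fdet U M * fdet V M = - ((1 - fdet S N) * (fdet U M * fdet V M))"
      unfolding eq by (simp add: algebra_simps)
    then show ?thesis using up U0 V0 by (simp add: abs_mult)
  qed
  also have "\<dots> \<le> (FU * FV * (real (card U * card V) * w\<^sup>2)) * (fdet U M * fdet V M)"
    using low U0 V0 by (intro mult_right_mono) auto
  also have "\<dots> = (FU * fdet U M) * (FV * fdet V M) * (real (card U * card V) * w\<^sup>2)"
    by (simp only: mult_ac)
  also have "\<dots> \<le> (\<Sum>u\<in>U. fdet (U - {u}) M) * (\<Sum>v\<in>V. fdet (V - {v}) M) * (real (card U * card V) * w\<^sup>2)"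
  proof (intro mult_right_mono mult_mono)
    show "FU * fdet U M \<le> (\<Sum>u\<in>U. fdet (U - {u}) M)"
      unfolding FU by (rule orthonormal_rows_norm[OF U MU M(2) GU])
    show "FV * fdet V M \<le> (\<Sum>u\<in>V. fdet (V - {u}) M)"
      unfolding FV by (rule orthonormal_rows_norm[OF V MV M(2) GV])
    show "0 \<le> (\<Sum>u\<in>U. fdet (U - {u}) M)"
      using U by (intro sum_nonneg fdet_nonneg pd_mono[OF pd_subset[OF U MU]]) (use M(2) in auto)
    show "0 \<le> FV * fdet V M" using V0 by (simp add: FV sum_nonneg)
  qed auto
  finally show ?thesis by (simp add: S_def)
qed

lemma tendsto_fdet:
  assumes "finite S" "\<And>i j. i \<in> S \<Longrightarrow> j \<in> S \<Longrightarrow> ((\<lambda>n. A n i j) \<longlongrightarrow> B i j) F"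
  shows "((\<lambda>n. fdet S (A n)) \<longlongrightarrow> fdet S B) F"
  unfolding fdet_def
  by (intro tendsto_sum tendsto_mult tendsto_const tendsto_prod assms(2)) (auto simp: permutes_in_image)

lemma psd_fdet_block:
  assumes U: "finite U" and V: "finite V" and UV: "U \<inter> V = {}" and M: "pd 0 (U \<union> V) M"
    and w: "\<And>u v. u \<in> U \<Longrightarrow> v \<in> V \<Longrightarrow> \<bar>M u v\<bar> \<le> w"
  shows "\<bar>fdet (U \<union> V) M - fdet U M * fdet V M\<bar>
       \<le> (\<Sum>u\<in>U. fdet (U - {u}) M) * (\<Sum>v\<in>V. fdet (V - {v}) M) * (real (card U * card V) * w\<^sup>2)"
proof -
  define A where "A n = (\<lambda>i j. M i j + (if i = j then inverse (real (Suc n)) else 0))" for n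
  have A: "(\<lambda>n. A n i j) \<longlonglongrightarrow> M i j" for i j
  proof -
    have "(\<lambda>n. M i j + inverse (real (Suc n))) \<longlonglongrightarrow> M i j + 0"
      by (intro tendsto_add tendsto_const LIMSEQ_inverse_real_of_nat)
    then show ?thesis by (cases "i = j") (simp_all add: A_def del: of_nat_Suc)
  qed
  have lim: "(\<lambda>n. fdet T (A n)) \<longlonglongrightarrow> fdet T M" if "finite T" for T
    by (rule tendsto_fdet[OF that A])
  show ?thesis
  proof (rule LIMSEQ_le)
    show "(\<lambda>n. \<bar>fdet (U \<union> V) (A n) - fdet U (A n) * fdet V (A n)\<bar>) \<longlonglongrightarrow> \<bar>fdet (U \<union> V) M - fdet U M * fdet V M\<bar>"
      using U V by (intro tendsto_intros lim) auto
    show "(\<lambda>n. (\<Sum>u\<in>U. fdet (U - {u}) (A n)) * (\<Sum>v\<in>V. fdet (V - {v}) (A n)) * (real (card U * card V) * w\<^sup>2))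
      \<longlonglongrightarrow> (\<Sum>u\<in>U. fdet (U - {u}) M) * (\<Sum>v\<in>V. fdet (V - {v}) M) * (real (card U * card V) * w\<^sup>2)"
      using U V by (intro tendsto_intros lim) auto
    show "\<exists>N. \<forall>n\<ge>N. \<bar>fdet (U \<union> V) (A n) - fdet U (A n) * fdet V (A n)\<bar>
       \<le> (\<Sum>u\<in>U. fdet (U - {u}) (A n)) * (\<Sum>v\<in>V. fdet (V - {v}) (A n)) * (real (card U * card V) * w\<^sup>2)"
    proof (intro exI allI impI pd_fdet_block[OF U V UV])
      fix n
      show "pd (0 + inverse (real (Suc n))) (U \<union> V) (A n)"
        unfolding A_def using U V by (intro pd_add_diag M) auto
      show "0 + inverse (real (Suc n)) > 0" by simp
      show "\<bar>A n u v\<bar> \<le> w" if "u \<in> U" "v \<in> V" for u v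
        using w[OF that] that UV by (auto simp: A_def)
    qed
  qed
qed

section \<open>Positive contractions of bounded rank\<close>

definition minors_vanish :: "nat \<Rightarrow> 'i set \<Rightarrow> ('i \<Rightarrow> 'i \<Rightarrow> real) \<Rightarrow> bool" where
  "minors_vanish N I M \<longleftrightarrow>
    (\<forall>n f. N < n \<longrightarrow> f ` {..<n} \<subseteq> I \<longrightarrow> fdet {..<n} (\<lambda>a b. M (f a) (f b)) = 0)"

lemma psd_contraction_row_norm:
  assumes S: "finite S" and M: "pd 0 S M" "pd 0 S (\<lambda>a b. idm a b - M a b)" and i: "i \<in> S"
  shows "(\<Sum>a\<in>S. (M a i)\<^sup>2) \<le> M i i"
proof -
  let ?y = "\<lambda>a. - M i a"
  let ?q = "\<Sum>a\<in>S. (M a i)\<^sup>2"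
  have q: "(\<Sum>a\<in>S. (?y a)\<^sup>2) = ?q"
    by (intro sum.cong) (simp_all add: pd_sym[OF M(1) i])
  have "bil S M ?y ?y \<le> ?q"
    using psd_bil[OF M(2), of ?y] bil_diag[OF S, of "\<lambda>_. 1" ?y] q by (simp add: bil_diff_mat)
  moreover have "0 \<le> bil S M (\<lambda>a. ?y a + (if a = i then 1 else 0)) (\<lambda>a. ?y a + (if a = i then 1 else 0))"
    by (rule psd_bil[OF M(1)])
  moreover have "bil S M (\<lambda>a. ?y a + (if a = i then 1 else 0)) (\<lambda>a. ?y a + (if a = i then 1 else 0))
     = bil S M ?y ?y + 2 * 1 * (\<Sum>b\<in>S. M i b * ?y b) + 1\<^sup>2 * M i i"
    by (rule bil_shift[OF S i]) (use pd_sym[OF M(1) i] in auto)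
  moreover have "(\<Sum>b\<in>S. M i b * ?y b) = - ?q"
    by (simp add: sum_negf[symmetric] pd_sym[OF M(1) i] power2_eq_square cong: sum.cong)
  ultimately show ?thesis by simp
qed

text \<open>One elimination keeps a positive contraction, lowers the rank by one and lowers the
  trace by at most one, because the drop is $|M e_i|^2 / M_{ii}$.\<close>

lemma schur_step:
  assumes S: "finite S" and M: "pd 0 S M" "pd 0 S (\<lambda>a b. idm a b - M a b)"
    and N: "minors_vanish N S M" and i: "i \<in> S" and pos: "M i i > 0"
  shows "pd 0 S (schur i M)" "pd 0 S (\<lambda>a b. idm a b - schur i M a b)"
    "minors_vanish (N - 1) S (schur i M)" "N \<ge> 1"
    "(\<Sum>a\<in>S. M a a) \<le> 1 + (\<Sum>a\<in>S. schur i M a a)"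
proof -
  have sym: "M a i = M i a" if "a \<in> S" for a using pd_sym[OF M(1) that i] .
  show 1: "pd 0 S (schur i M)" by (rule psd_schur_full[OF S M(1) i pos])
  show "pd 0 S (\<lambda>a b. idm a b - schur i M a b)"
  proof (rule pdI)
    fix x
    have "bil S (schur i M) x x = bil S M x x - (\<Sum>b\<in>S. M i b * x b)\<^sup>2 / M i i"
      by (rule bil_schur[OF S]) (use sym in auto)
    moreover have "0 \<le> (\<Sum>b\<in>S. M i b * x b)\<^sup>2 / M i i" using pos by simp
    ultimately show "0 * (\<Sum>a\<in>S. (x a)\<^sup>2) \<le> bil S (\<lambda>a b. idm a b - schur i M a b) x x"
      using psd_bil[OF M(2), of x] by (simp add: bil_diff_mat)
  qed (use pd_sym[OF 1] in auto)
  show N1: "N \<ge> 1"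
  proof (rule ccontr)
    assume "\<not> N \<ge> 1"
    then have "fdet {..<1::nat} (\<lambda>a b. M i i) = 0"
      using N i unfolding minors_vanish_def by (elim allE[of _ 1] allE[of _ "\<lambda>_. i"]) auto
    moreover have "fdet {..<1::nat} (\<lambda>a b. M i i) = M i i"
      using fdet_insert_unit_row[of "{}" "0::nat" "\<lambda>a b. M i i"] by (simp add: lessThan_Suc)
    ultimately show False using pos by simp
  qed
  show "minors_vanish (N - 1) S (schur i M)"
    unfolding minors_vanish_def
  proof (intro allI impI)
    fix n and f :: "nat \<Rightarrow> 'a" assume n: "N - 1 < n" and f: "f ` {..<n} \<subseteq> S"
    \<comment> \<open>The pivot is appended as last entry of the tuple, so a minor of the Schur
      complement becomes a larger minor of \<open>M\<close>. As \<open>minors_vanish\<close> admits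
      repetitions, \<open>i\<close> may already occur in \<open>f\<close>; such a minor has two
      equal rows and is zero anyway.\<close>
    let ?f = "f(n := i)"
    have "fdet {..<Suc n} (\<lambda>a b. M (?f a) (?f b)) = 0"
      using N n f i unfolding minors_vanish_def
      by (elim allE[of _ "Suc n"] allE[of _ ?f]) (auto simp: lessThan_Suc)
    moreover have "fdet (insert n {..<n}) (\<lambda>a b. M (?f a) (?f b))
        = M i i * fdet {..<n} (schur n (\<lambda>a b. M (?f a) (?f b)))"
      using pos by (subst fdet_schur) auto
    moreover have "fdet {..<n} (schur n (\<lambda>a b. M (?f a) (?f b))) = fdet {..<n} (\<lambda>a b. schur i M (f a) (f b))"
      by (rule fdet_cong) (auto simp: schur_def)
    ultimately show "fdet {..<n} (\<lambda>a b. schur i M (f a) (f b)) = 0"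
      using pos by (simp add: lessThan_Suc)
  qed
  have "(\<Sum>a\<in>S. (M a i)\<^sup>2) / M i i \<le> 1"
    using psd_contraction_row_norm[OF S M i] pos by (simp add: divide_le_eq_1)
  moreover have "(\<Sum>a\<in>S. M a a) = (\<Sum>a\<in>S. schur i M a a) + (\<Sum>a\<in>S. (M a i)\<^sup>2) / M i i"
    by (simp add: schur_def sum_divide_distrib sum_subtractf power2_eq_square sym cong: sum.cong)
  ultimately show "(\<Sum>a\<in>S. M a a) \<le> 1 + (\<Sum>a\<in>S. schur i M a a)" by simp
qed

lemma psd_contraction_trace_le_rank:
  assumes S: "finite S" and "pd 0 S M" "pd 0 S (\<lambda>a b. idm a b - M a b)" "minors_vanish N S M"
  shows "(\<Sum>a\<in>S. M a a) \<le> real N"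
  using assms(2-)
proof (induction N arbitrary: M)
  case 0
  have "M i i = 0" if "i \<in> S" for i
    using schur_step(4)[OF S 0 that] pd_diag[OF S 0(1) that] by fastforce
  then show ?case by simp
next
  case (Suc N)
  show ?case
  proof (cases "\<exists>i\<in>S. M i i > 0")
    case True
    then obtain i where i: "i \<in> S" "M i i > 0" by blast
    note s = schur_step[OF S Suc.prems i]
    have "(\<Sum>a\<in>S. schur i M a a) \<le> real N"
      using s by (intro Suc.IH) auto
    then show ?thesis using s(5) by simp
  next
    case False
    then have "(\<Sum>a\<in>S. M a a) \<le> 0" by (intro sum_nonpos) (auto simp: not_less)
    then show ?thesis by simp
  qed
qed

lemma sum_PiE_lessThan_Suc:
  fixes h :: "(nat \<Rightarrow> 'i) \<Rightarrow> real"
  assumes "finite I"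
  shows "(\<Sum>f\<in>{..<Suc n} \<rightarrow>\<^sub>E I. h f) = (\<Sum>i\<in>I. \<Sum>g\<in>{..<n} \<rightarrow>\<^sub>E I. h (g(n := i)))"
proof -
  have "inj_on (\<lambda>(y, g). g(n := y)) (I \<times> ({..<n} \<rightarrow>\<^sub>E I))"
    by (rule inj_combinator) auto
  then show ?thesis
    unfolding lessThan_Suc PiE_insert_eq
    by (subst sum.reindex) (auto simp: sum.cartesian_product case_prod_unfold)
qed

text \<open>The sum is $n!$ times the $n$-th elementary symmetric function of the eigenvalues.
  Fixing the last entry \<open>i\<close> leaves \<open>M i i\<close> times the same sum for a Schur
  complement of rank $N-1$, and the trace is at most $N$. Truncated subtraction makes the product
  zero for $n > N$.\<close>

lemma sum_tuple_minors_le: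
  assumes S: "finite S" and "pd 0 S M" "pd 0 S (\<lambda>a b. idm a b - M a b)" "minors_vanish N S M"
  shows "(\<Sum>f\<in>{..<n} \<rightarrow>\<^sub>E S. fdet {..<n} (\<lambda>a b. M (f a) (f b))) \<le> (\<Prod>j<n. real (N - j))"
  using assms(2-)
proof (induction n arbitrary: M N)
  case (Suc n)
  let ?T = "\<lambda>n M. \<Sum>f\<in>{..<n} \<rightarrow>\<^sub>E S. fdet {..<n} (\<lambda>a b. M (f a) (f b))"
  have step: "(\<Sum>g\<in>{..<n} \<rightarrow>\<^sub>E S. fdet {..<Suc n} (\<lambda>a b. M ((g(n := i)) a) ((g(n := i)) b)))
      \<le> M i i * (\<Prod>j<n. real (N - 1 - j))" if i: "i \<in> S" for i
  proof (cases "M i i = 0")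
    case True
    have "fdet {..<Suc n} (\<lambda>a b. M ((g(n := i)) a) ((g(n := i)) b)) = 0" if "g \<in> {..<n} \<rightarrow>\<^sub>E S" for g
    proof (rule fdet_zero_row[of _ n])
      fix j assume "j \<in> {..<Suc n}"
      then have "(g(n := i)) j \<in> S" using that i by (auto simp: PiE_iff lessThan_Suc)
      then show "M ((g(n := i)) n) ((g(n := i)) j) = 0"
        using psd_zero_row[OF S Suc.prems(1) i _ True, of "(g(n := i)) j"] by simp
    qed auto
    then show ?thesis using True by (simp add: sum.neutral)
  next
    case False
    then have pos: "M i i > 0" using pd_diag[OF S Suc.prems(1) i] by simp
    note s = schur_step[OF S Suc.prems i pos]
    have "fdet {..<Suc n} (\<lambda>a b. M ((g(n := i)) a) ((g(n := i)) b))
        = M i i * fdet {..<n} (\<lambda>a b. schur i M (g a) (g b))" for g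
    proof -
      have "fdet (insert n {..<n}) (\<lambda>a b. M ((g(n := i)) a) ((g(n := i)) b))
          = M i i * fdet {..<n} (schur n (\<lambda>a b. M ((g(n := i)) a) ((g(n := i)) b)))"
        using pos by (subst fdet_schur) auto
      also have "fdet {..<n} (schur n (\<lambda>a b. M ((g(n := i)) a) ((g(n := i)) b)))
          = fdet {..<n} (\<lambda>a b. schur i M (g a) (g b))"
        by (rule fdet_cong) (auto simp: schur_def)
      finally show ?thesis by (simp add: lessThan_Suc)
    qed
    then have "(\<Sum>g\<in>{..<n} \<rightarrow>\<^sub>E S. fdet {..<Suc n} (\<lambda>a b. M ((g(n := i)) a) ((g(n := i)) b)))
        = M i i * ?T n (schur i M)"
      by (simp add: sum_distrib_left)
    also have "\<dots> \<le> M i i * (\<Prod>j<n. real (N - 1 - j))"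
      using pos s by (intro mult_left_mono Suc.IH) auto
    finally show ?thesis .
  qed
  have "?T (Suc n) M \<le> (\<Sum>i\<in>S. M i i * (\<Prod>j<n. real (N - 1 - j)))"
    unfolding sum_PiE_lessThan_Suc[OF S] by (intro sum_mono step)
  also have "\<dots> = (\<Sum>i\<in>S. M i i) * (\<Prod>j<n. real (N - 1 - j))"
    by (simp add: sum_distrib_right)
  also have "\<dots> \<le> real N * (\<Prod>j<n. real (N - 1 - j))"
    by (intro mult_right_mono psd_contraction_trace_le_rank[OF S Suc.prems] prod_nonneg) auto
  also have "\<dots> = (\<Prod>j<Suc n. real (N - j))"
    by (simp only: prod.lessThan_Suc_shift) simp
  finally show ?case .
qed simp

section \<open>Cells and averaged kernels\<close>

text \<open>The sets that \<open>G\<close> approximates in measure form a sigma-algebra when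
  \<open>G\<close> is an algebra; only countable unions need an argument.\<close>

lemma approx_by_algebra:
  assumes "finite_measure M" and A: "A \<in> sigma_sets (space M) E"
    and G: "G \<subseteq> sets M" "E \<subseteq> G" "{} \<in> G" "\<And>a. a \<in> G \<Longrightarrow> space M - a \<in> G" "\<And>a b. a \<in> G \<Longrightarrow> b \<in> G \<Longrightarrow> a \<union> b \<in> G"
  shows "A \<in> sets M \<and> (\<forall>e>0. \<exists>B\<in>G. measure M ((A - B) \<union> (B - A)) < e)"
  using A
proof induction
  interpret finite_measure M by fact
  {
    case (Basic a)
    then show ?case using G(1,2) by (auto intro!: bexI[of _ a])
  next
    case Empty
    then show ?case using G(3) by (auto intro!: bexI[of _ "{}"])
  next
    case (Compl a)
    show ?case
    proof (intro conjI allI impI)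
      show "space M - a \<in> sets M" using Compl.IH by auto
      fix e :: real assume "e > 0"
      then obtain B where B: "B \<in> G" "measure M ((a - B) \<union> (B - a)) < e" using Compl.IH by blast
      have "a \<subseteq> space M" "B \<subseteq> space M" using Compl.IH B(1) G(1) by (auto dest: sets.sets_into_space)
      then have "((space M - a) - (space M - B)) \<union> ((space M - B) - (space M - a)) = (a - B) \<union> (B - a)" by auto
      then show "\<exists>B\<in>G. measure M (((space M - a) - B) \<union> (B - (space M - a))) < e"
        using B G(4) by (auto intro!: bexI[of _ "space M - B"])
    qed
  next
    case (Union a)
    have a: "a i \<in> sets M" for i using Union.IH by blast
    show ?case
    proof (intro conjI allI impI)
      show "\<Union> (range a) \<in> sets M" using a by auto
      fix e :: real assume e: "e > 0"
      \<comment> \<open>Half of \<open>e\<close> is distributed geometrically over the sets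
        \<open>a i\<close>; the other half pays for truncating the union.\<close>
      have "\<exists>B. B \<in> G \<and> measure M ((a i - B) \<union> (B - a i)) < e / 2 * (1/2) ^ Suc i" for i
      proof -
        have "e / 2 * (1/2) ^ Suc i > 0" using e by simp
        then show ?thesis using Union.IH by blast
      qed
      then obtain B where B: "\<And>i. B i \<in> G" "\<And>i. measure M ((a i - B i) \<union> (B i - a i)) < e / 2 * (1/2) ^ Suc i"
        by metis
      have Bm: "B i \<in> sets M" for i using B(1) G(1) by auto
      have "(\<lambda>n. measure M (\<Union>i<n. a i)) \<longlonglongrightarrow> measure M (\<Union>n. \<Union>i<n. a i)"
        using a by (intro finite_Lim_measure_incseq) (auto simp: incseq_def, force)
      also have "(\<Union>n. \<Union>i<n. a i) = \<Union> (range a)" by auto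
      finally have "eventually (\<lambda>n. measure M (\<Union>i<n. a i) > measure M (\<Union> (range a)) - e / 2) sequentially"
        using e by (intro order_tendstoD(1)) auto
      then obtain n where n: "measure M (\<Union>i<n. a i) > measure M (\<Union> (range a)) - e / 2"
        by (auto simp: eventually_sequentially)
      let ?B = "\<Union>i<n. B i"
      have BG: "?B \<in> G"
      proof (induction n)
        case (Suc n)
        then show ?case using G(5)[of "\<Union>i<n. B i" "B n"] B(1)
          by (simp add: lessThan_Suc Un_commute)
      qed (use G(3) in simp)
      have "(\<Union> (range a) - ?B) \<union> (?B - \<Union> (range a))
        \<subseteq> (\<Union> (range a) - (\<Union>i<n. a i)) \<union> (\<Union>i<n. (a i - B i) \<union> (B i - a i))" by auto
      then have "measure M ((\<Union> (range a) - ?B) \<union> (?B - \<Union> (range a)))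
        \<le> measure M ((\<Union> (range a) - (\<Union>i<n. a i)) \<union> (\<Union>i<n. (a i - B i) \<union> (B i - a i)))"
        using a Bm by (intro finite_measure_mono) auto
      also have "\<dots> \<le> measure M (\<Union> (range a) - (\<Union>i<n. a i)) + measure M (\<Union>i<n. (a i - B i) \<union> (B i - a i))"
        using a Bm by (intro measure_Un_le) auto
      also have "measure M (\<Union> (range a) - (\<Union>i<n. a i)) = measure M (\<Union> (range a)) - measure M (\<Union>i<n. a i)"
        using a by (intro finite_measure_Diff) auto
      also have "measure M (\<Union>i<n. (a i - B i) \<union> (B i - a i)) \<le> (\<Sum>i<n. measure M ((a i - B i) \<union> (B i - a i)))"
        using a Bm by (intro finite_measure_subadditive_finite) auto
      also have "\<dots> \<le> (\<Sum>i<n. e / 2 * (1/2) ^ Suc i)"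
        by (intro sum_mono less_imp_le B(2))
      also have "\<dots> = e / 2 * (1 - (1/2) ^ n)"
        by (simp add: sum_distrib_left[symmetric] sum_gp_strict flip: sum_divide_distrib)
      also have "\<dots> \<le> e / 2" using e by (simp add: mult_le_cancel_left1)
      finally have "measure M ((\<Union> (range a) - ?B) \<union> (?B - \<Union> (range a))) < e"
        using n by linarith
      then show "\<exists>B\<in>G. measure M ((\<Union> (range a) - B) \<union> (B - \<Union> (range a))) < e"
        using BG by blast
    qed
  }
qed

text \<open>The cells are the atoms of the algebra generated by \<open>F\<close>. Describing a
  partition by a generating family makes the common refinement of two partitions simply the union of
  their families.\<close>

definition cell :: "'a set set \<Rightarrow> 'a \<Rightarrow> 'a set" where
  "cell F x = {y. \<forall>A\<in>F. y \<in> A \<longleftrightarrow> x \<in> A}"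

abbreviation cells :: "'a set set \<Rightarrow> 'a set set" where
  "cells F \<equiv> range (cell F)"

lemma cell_self [simp]: "x \<in> cell F x"
  by (simp add: cell_def)

lemma cell_eq: "y \<in> cell F x \<longleftrightarrow> cell F y = cell F x"
  by (auto simp: cell_def)

lemma cell_mono: "F \<subseteq> G \<Longrightarrow> cell G x \<subseteq> cell F x"
  by (auto simp: cell_def)

lemma cell_refine: "F \<subseteq> G \<Longrightarrow> cell G x = cell G y \<Longrightarrow> cell F x = cell F y"
  using cell_mono cell_eq by (metis cell_self subsetD)

lemma mem_cells_iff: "Q \<in> cells F \<Longrightarrow> x \<in> Q \<longleftrightarrow> cell F x = Q"
  by (metis cell_eq imageE)

lemma finite_cells: "finite F \<Longrightarrow> finite (cells F)"
proof -
  assume F: "finite F"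
  have "cell F x = {y. {A\<in>F. y \<in> A} = {A\<in>F. x \<in> A}}" for x
    by (auto simp: cell_def)
  then have "cells F \<subseteq> (\<lambda>S. {y. {A\<in>F. y \<in> A} = S}) ` Pow F" by auto
  then show ?thesis using F by (meson finite_Pow_iff finite_imageI finite_subset)
qed

lemma cell_measurable_set:
  assumes "finite F" "F \<subseteq> sets M" "space M = UNIV"
  shows "cell F x \<in> sets M"
proof -
  have "cell F x = (\<Inter>A\<in>F. if x \<in> A then A else space M - A)"
    using assms(3) by (auto simp: cell_def split: if_splits)
  moreover have "(\<Inter>A\<in>F. if x \<in> A then A else space M - A) \<in> sets M"
  proof (cases "F = {}")
    case True
    then show ?thesis using assms(3) by (simp, metis sets.top)
  next
    case False
    have "UNIV - A \<in> sets M" if "A \<in> sets M" for A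
      using sets.compl_sets[OF that] assms(3) by simp
    then show ?thesis using False assms by (intro sets.finite_INT) auto
  qed
  ultimately show ?thesis by simp
qed

locale cell_space = finite_measure \<nu> for \<nu> :: "'a measure" +
  assumes space_UNIV: "space \<nu> = UNIV"
begin

abbreviation "\<nu>2 \<equiv> \<nu> \<Otimes>\<^sub>M \<nu>"

definition fam :: "'a set set \<Rightarrow> bool" where
  "fam F \<longleftrightarrow> finite F \<and> F \<subseteq> sets \<nu>"

lemma fam_Un: "fam F \<Longrightarrow> fam G \<Longrightarrow> fam (F \<union> G)"
  by (auto simp: fam_def)

lemma fam_cells: "fam F \<Longrightarrow> finite (cells F)" "fam F \<Longrightarrow> Q \<in> cells F \<Longrightarrow> Q \<in> sets \<nu>"
  "fam F \<Longrightarrow> cell F x \<in> sets \<nu>"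
  using finite_cells cell_measurable_set space_UNIV by (auto simp: fam_def)

lemma cell_fun_eq:
  fixes g :: "'a set \<Rightarrow> real"
  assumes "fam F"
  shows "g (cell F x) = (\<Sum>Q\<in>cells F. g Q * indicator Q x)"
proof -
  have "(\<Sum>Q\<in>cells F. g Q * indicator Q x) = (\<Sum>Q\<in>cells F. if Q = cell F x then g Q else 0)"
    by (intro sum.cong) (auto simp: indicator_def mem_cells_iff)
  then show ?thesis using fam_cells[OF assms] by simp
qed

lemma cell_fun_eq2:
  fixes g :: "'a set \<Rightarrow> 'a set \<Rightarrow> real"
  assumes "fam F"
  shows "g (cell F x) (cell F y) = (\<Sum>P\<in>cells F. \<Sum>Q\<in>cells F. g P Q * (indicator P x * indicator Q y))"
proof -
  have "g (cell F x) (cell F y) = (\<Sum>P\<in>cells F. (\<Sum>Q\<in>cells F. g P Q * indicator Q y) * indicator P x)"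
    by (simp only: cell_fun_eq[OF assms, of "g P" y for P, symmetric] cell_fun_eq[OF assms, of "\<lambda>P. g P (cell F y)" x, symmetric])
  then show ?thesis by (simp add: sum_distrib_left sum_distrib_right mult_ac)
qed

lemma cell_fun_measurable [measurable]:
  fixes g :: "'a set \<Rightarrow> real"
  assumes "fam F"
  shows "(\<lambda>x. g (cell F x)) \<in> borel_measurable \<nu>"
  unfolding cell_fun_eq[OF assms] using fam_cells[OF assms] by measurable

lemma cell_fun_measurable2:
  fixes g :: "'a set \<Rightarrow> 'a set \<Rightarrow> real"
  assumes "fam F"
  shows "(\<lambda>z. g (cell F (fst z)) (cell F (snd z))) \<in> borel_measurable \<nu>2"
  unfolding cell_fun_eq2[OF assms] using fam_cells[OF assms] by measurable

lemma measure_rect: "A \<in> sets \<nu> \<Longrightarrow> B \<in> sets \<nu> \<Longrightarrow>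
    (\<integral>z. indicator A (fst z) * indicator B (snd z) \<partial>\<nu>2) = measure \<nu> A * measure \<nu> B"
proof -
  assume A: "A \<in> sets \<nu>" and B: "B \<in> sets \<nu>"
  have "(\<integral>z. indicator A (fst z) * indicator B (snd z) \<partial>\<nu>2) = (\<integral>z. (indicator (A \<times> B) z :: real) \<partial>\<nu>2)"
    by (intro Bochner_Integration.integral_cong) (auto simp: indicator_def)
  also have "\<dots> = measure \<nu>2 (A \<times> B)"
    using A B sets.sets_into_space[of "A \<times> B" \<nu>2] by (simp add: Int_absorb2)
  also have "\<dots> = measure \<nu> A * measure \<nu> B"
    using A B by (simp add: measure_def emeasure_pair_measure_Times enn2real_mult)
  finally show ?thesis .
qed

sublocale P: finite_measure \<nu>2
  by (intro finite_measure_pair_measure finite_measure_axioms)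

sublocale pair_sigma_finite \<nu> \<nu> ..

lemma integrable_bounded:
  fixes f :: "'a \<Rightarrow> real"
  shows "f \<in> borel_measurable \<nu> \<Longrightarrow> (\<And>x. \<bar>f x\<bar> \<le> B) \<Longrightarrow> integrable \<nu> f"
  by (rule integrable_const_bound[of _ B]) auto

lemma integrable_bounded2:
  fixes f :: "'a \<times> 'a \<Rightarrow> real"
  shows "f \<in> borel_measurable \<nu>2 \<Longrightarrow> (\<And>x. \<bar>f x\<bar> \<le> B) \<Longrightarrow> integrable \<nu>2 f"
  by (rule P.integrable_const_bound[of _ B]) auto

lemma integrable_rect [simp]:
  "A \<in> sets \<nu> \<Longrightarrow> B \<in> sets \<nu> \<Longrightarrow> integrable \<nu>2 (\<lambda>z. indicator A (fst z) * indicator B (snd z) :: real)"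
  by (rule integrable_bounded2[of _ 1]) (auto simp: indicator_def)

lemma integral_cell_fun:
  fixes g :: "'a set \<Rightarrow> real"
  assumes "fam F"
  shows "integrable \<nu> (\<lambda>x. g (cell F x))" "(\<integral>x. g (cell F x) \<partial>\<nu>) = (\<Sum>Q\<in>cells F. measure \<nu> Q * g Q)"
proof -
  have i: "integrable \<nu> (indicator Q :: _ \<Rightarrow> real)" if "Q \<in> cells F" for Q
    using fam_cells[OF assms] that by (intro integrable_bounded[of _ 1]) (auto simp: indicator_def)
  then show "integrable \<nu> (\<lambda>x. g (cell F x))"
    unfolding cell_fun_eq[OF assms] by auto
  show "(\<integral>x. g (cell F x) \<partial>\<nu>) = (\<Sum>Q\<in>cells F. measure \<nu> Q * g Q)"
    unfolding cell_fun_eq[OF assms] using i fam_cells[OF assms] space_UNIV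
    by (subst Bochner_Integration.integral_sum) (auto intro!: sum.cong simp: mult.commute)
qed

lemma integral_cell_fun2:
  fixes g :: "'a set \<Rightarrow> 'a set \<Rightarrow> real"
  assumes "fam F"
  shows "integrable \<nu>2 (\<lambda>z. g (cell F (fst z)) (cell F (snd z)))"
    "(\<integral>z. g (cell F (fst z)) (cell F (snd z)) \<partial>\<nu>2)
      = (\<Sum>P\<in>cells F. \<Sum>Q\<in>cells F. measure \<nu> P * measure \<nu> Q * g P Q)"
proof -
  show "integrable \<nu>2 (\<lambda>z. g (cell F (fst z)) (cell F (snd z)))"
    unfolding cell_fun_eq2[OF assms] using fam_cells[OF assms] by auto
  show "(\<integral>z. g (cell F (fst z)) (cell F (snd z)) \<partial>\<nu>2)
      = (\<Sum>P\<in>cells F. \<Sum>Q\<in>cells F. measure \<nu> P * measure \<nu> Q * g P Q)"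
    unfolding cell_fun_eq2[OF assms] using fam_cells[OF assms]
    by (simp add: Bochner_Integration.integral_sum measure_rect mult.commute)
qed

lemma integral_partition2:
  fixes h :: "'a \<times> 'a \<Rightarrow> real"
  assumes "fam F" "integrable \<nu>2 h"
  shows "(\<integral>z. h z \<partial>\<nu>2) = (\<Sum>P\<in>cells F. \<Sum>Q\<in>cells F. \<integral>z. indicator P (fst z) * indicator Q (snd z) * h z \<partial>\<nu>2)"
proof -
  have i: "integrable \<nu>2 (\<lambda>z. indicator P (fst z) * indicator Q (snd z) * h z)" if "P \<in> cells F" "Q \<in> cells F" for P Q
  proof (rule Bochner_Integration.integrable_bound[OF assms(2)])
    show "(\<lambda>z. indicator P (fst z) * indicator Q (snd z) * h z) \<in> borel_measurable \<nu>2"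
      using fam_cells[OF assms(1)] that assms(2) by measurable
  qed (auto simp: indicator_def)
  have "h z = (\<Sum>P\<in>cells F. \<Sum>Q\<in>cells F. indicator P (fst z) * indicator Q (snd z) * h z)" for z
    using cell_fun_eq2[OF assms(1), of "\<lambda>_ _. h z" "fst z" "snd z"] by (simp add: mult_ac)
  then have "(\<integral>z. h z \<partial>\<nu>2) = (\<integral>z. (\<Sum>P\<in>cells F. \<Sum>Q\<in>cells F. indicator P (fst z) * indicator Q (snd z) * h z) \<partial>\<nu>2)"
    by presburger
  also have "\<dots> = (\<Sum>P\<in>cells F. \<Sum>Q\<in>cells F. \<integral>z. indicator P (fst z) * indicator Q (snd z) * h z \<partial>\<nu>2)"
    using i by (simp add: Bochner_Integration.integral_sum)
  finally show ?thesis .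
qed

text \<open>Functions constant on products of cells are dense in $L^1$ of the product: indicators
  are handled by \<open>approx_by_algebra\<close>, sums by a common refinement, and limits by
  dominated convergence.\<close>

lemma approx_cell_fun2:
  fixes h :: "'a \<times> 'a \<Rightarrow> real"
  assumes "integrable \<nu>2 h" "e > 0"
  shows "\<exists>F g. fam F \<and> (\<integral>z. \<bar>h z - g (cell F (fst z)) (cell F (snd z))\<bar> \<partial>\<nu>2) < e"
  using assms
proof (induction arbitrary: e rule: integrable_induct)
  case (base A c)
  \<comment> \<open>The algebra of sets in which membership of a pair depends only on the cells of
    its two coordinates, for some finite family.\<close>
  define G where "G = {S \<in> sets \<nu>2. \<exists>F. fam F \<and> (\<forall>x x' y y'. cell F x = cell F x' \<longrightarrow> cell F y = cell F y' \<longrightarrow> ((x, y) \<in> S \<longleftrightarrow> (x', y') \<in> S))}"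
  have sp: "space \<nu>2 = UNIV" by (simp add: space_pair_measure space_UNIV)
  have "A \<in> sigma_sets (space \<nu>2) {a \<times> b |a b. a \<in> sets \<nu> \<and> b \<in> sets \<nu>}"
    using base(1) by (simp add: sets_pair_measure space_pair_measure)
  moreover have "G \<subseteq> sets \<nu>2" by (auto simp: G_def)
  moreover have "{a \<times> b |a b. a \<in> sets \<nu> \<and> b \<in> sets \<nu>} \<subseteq> G"
  proof safe
    fix a b assume ab: "a \<in> sets \<nu>" "b \<in> sets \<nu>"
    have "(x, y) \<in> a \<times> b \<longleftrightarrow> (x', y') \<in> a \<times> b" if "cell {a, b} x = cell {a, b} x'" "cell {a, b} y = cell {a, b} y'" for x x' y y'
      using that by (auto simp: cell_def)
    moreover have "fam {a, b}" "a \<times> b \<in> sets \<nu>2" using ab by (auto simp: fam_def)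
    ultimately show "a \<times> b \<in> G" unfolding G_def by (intro CollectI conjI exI[of _ "{a, b}"] allI impI)
  qed
  moreover have "{} \<in> G"
  proof -
    have "fam {}" by (simp add: fam_def)
    then show ?thesis unfolding G_def by blast
  qed
  moreover have "space \<nu>2 - a \<in> G" if "a \<in> G" for a
  proof -
    from that obtain F where F: "fam F"
      "\<And>x x' y y'. cell F x = cell F x' \<Longrightarrow> cell F y = cell F y' \<Longrightarrow> ((x, y) \<in> a \<longleftrightarrow> (x', y') \<in> a)"
      and a: "a \<in> sets \<nu>2"
      unfolding G_def by blast
    have "space \<nu>2 - a \<in> sets \<nu>2" using a by (rule sets.compl_sets)
    moreover have "(x, y) \<in> space \<nu>2 - a \<longleftrightarrow> (x', y') \<in> space \<nu>2 - a"
      if "cell F x = cell F x'" "cell F y = cell F y'" for x x' y y'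
      using F(2)[OF that] sp by simp
    ultimately show ?thesis using F(1) unfolding G_def by (intro CollectI conjI exI[of _ F] allI impI)
  qed
  moreover have "a \<union> b \<in> G" if "a \<in> G" "b \<in> G" for a b
  proof -
    from that obtain F1 F2 where F: "fam F1" "fam F2"
      "\<And>x x' y y'. cell F1 x = cell F1 x' \<Longrightarrow> cell F1 y = cell F1 y' \<Longrightarrow> ((x, y) \<in> a \<longleftrightarrow> (x', y') \<in> a)"
      "\<And>x x' y y'. cell F2 x = cell F2 x' \<Longrightarrow> cell F2 y = cell F2 y' \<Longrightarrow> ((x, y) \<in> b \<longleftrightarrow> (x', y') \<in> b)"
      and ab: "a \<in> sets \<nu>2" "b \<in> sets \<nu>2"
      unfolding G_def by blast
    have r: "cell F1 x = cell F1 y" "cell F2 x = cell F2 y" if "cell (F1 \<union> F2) x = cell (F1 \<union> F2) y" for x y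
      using cell_refine[OF _ that] by auto
    have "(x, y) \<in> a \<union> b \<longleftrightarrow> (x', y') \<in> a \<union> b"
      if "cell (F1 \<union> F2) x = cell (F1 \<union> F2) x'" "cell (F1 \<union> F2) y = cell (F1 \<union> F2) y'" for x x' y y'
      using F(3)[OF r(1)[OF that(1)] r(1)[OF that(2)]] F(4)[OF r(2)[OF that(1)] r(2)[OF that(2)]] by simp
    moreover have "a \<union> b \<in> sets \<nu>2" using ab by auto
    ultimately show ?thesis using fam_Un[OF F(1,2)] unfolding G_def
      by (intro CollectI conjI exI[of _ "F1 \<union> F2"] allI impI)
  qed
  ultimately have ap: "\<forall>e>0. \<exists>B\<in>G. measure \<nu>2 ((A - B) \<union> (B - A)) < e"
    by (rule conjunct2[OF approx_by_algebra[OF P.finite_measure_axioms]])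
  have "e / (\<bar>c\<bar> + 1) > 0" using base by simp
  then obtain B where B: "B \<in> G" "measure \<nu>2 ((A - B) \<union> (B - A)) < e / (\<bar>c\<bar> + 1)" using ap by blast
  then obtain F where F: "fam F" and FB: "\<And>x x' y y'. cell F x = cell F x' \<Longrightarrow> cell F y = cell F y' \<Longrightarrow> ((x, y) \<in> B \<longleftrightarrow> (x', y') \<in> B)"
    unfolding G_def by blast
  have Bm: "B \<in> sets \<nu>2" using B by (simp add: G_def)
  define g where "g P Q = (if \<exists>x\<in>P. \<exists>y\<in>Q. (x, y) \<in> B then c else 0)" for P Q
  have g: "g (cell F (fst z)) (cell F (snd z)) = indicator B z * c" for z
  proof -
    have "(\<exists>x\<in>cell F (fst z). \<exists>y\<in>cell F (snd z). (x, y) \<in> B) \<longleftrightarrow> z \<in> B"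
    proof
      assume "\<exists>x\<in>cell F (fst z). \<exists>y\<in>cell F (snd z). (x, y) \<in> B"
      then show "z \<in> B" using FB[of _ "fst z" _ "snd z"] by (auto simp: cell_eq)
    next
      assume "z \<in> B"
      then show "\<exists>x\<in>cell F (fst z). \<exists>y\<in>cell F (snd z). (x, y) \<in> B"
        by (intro bexI[of _ "fst z"] bexI[of _ "snd z"]) auto
    qed
    then show ?thesis by (simp add: g_def indicator_def)
  qed
  have "(\<integral>z. \<bar>indicator A z *\<^sub>R c - g (cell F (fst z)) (cell F (snd z))\<bar> \<partial>\<nu>2) = (\<integral>z. indicator ((A - B) \<union> (B - A)) z * \<bar>c\<bar> \<partial>\<nu>2)"
    by (intro Bochner_Integration.integral_cong) (auto simp: g indicator_def)
  also have "\<dots> = measure \<nu>2 ((A - B) \<union> (B - A)) * \<bar>c\<bar>"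
    using base(1) Bm by (simp add: sp)
  also have "\<dots> \<le> measure \<nu>2 ((A - B) \<union> (B - A)) * (\<bar>c\<bar> + 1)"
    by (intro mult_left_mono) auto
  also have "\<dots> < e"
    using B(2) by (simp add: pos_less_divide_eq)
  finally show ?case using F by (intro exI[of _ F] exI[of _ g]) auto
next
  case (add f f')
  from add.prems have "e / 2 > 0" by simp
  note add.IH(1)[OF this] add.IH(2)[OF this]
  then obtain F1 g1 F2 g2 where 1: "fam F1" "(\<integral>z. \<bar>f z - g1 (cell F1 (fst z)) (cell F1 (snd z))\<bar> \<partial>\<nu>2) < e / 2"
    and 2: "fam F2" "(\<integral>z. \<bar>f' z - g2 (cell F2 (fst z)) (cell F2 (snd z))\<bar> \<partial>\<nu>2) < e / 2"
    by (elim exE conjE)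
  define F where "F = F1 \<union> F2"
  have F: "fam F" using fam_Un 1 2 by (simp add: F_def)
  \<comment> \<open>A cell of the refinement determines the coarser cells of all its points, so any
    representative gives the right values.\<close>
  define g where "g P Q = (let x = SOME x. x \<in> P; y = SOME y. y \<in> Q in g1 (cell F1 x) (cell F1 y) + g2 (cell F2 x) (cell F2 y))" for P Q
  have some: "cell F (SOME y. y \<in> cell F x) = cell F x" for x
    using someI[of "\<lambda>y. y \<in> cell F x" x] by (simp add: cell_eq)
  have g: "g (cell F x) (cell F y) = g1 (cell F1 x) (cell F1 y) + g2 (cell F2 x) (cell F2 y)" for x y
  proof -
    have "cell F1 (SOME y. y \<in> cell F x) = cell F1 x" "cell F2 (SOME y. y \<in> cell F x) = cell F2 x" for x
      using cell_refine[OF _ some] by (auto simp: F_def)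
    then show ?thesis by (simp add: g_def Let_def)
  qed
  note i1 = integral_cell_fun2(1)[OF 1(1), of g1] and i2 = integral_cell_fun2(1)[OF 2(1), of g2]
  have "(\<integral>z. \<bar>f z + f' z - g (cell F (fst z)) (cell F (snd z))\<bar> \<partial>\<nu>2)
      \<le> (\<integral>z. \<bar>f z - g1 (cell F1 (fst z)) (cell F1 (snd z))\<bar> + \<bar>f' z - g2 (cell F2 (fst z)) (cell F2 (snd z))\<bar> \<partial>\<nu>2)"
    unfolding g using add.hyps i1 i2 by (intro integral_mono) auto
  also have "\<dots> < e"
    using add.hyps i1 i2 1(2) 2(2) by (subst Bochner_Integration.integral_add) auto
  finally show ?case by (intro exI[of _ F] exI[of _ g] conjI F)
next
  case (lim f s)
  have "(\<lambda>i. \<integral>z. \<bar>f z - s i z\<bar> \<partial>\<nu>2) \<longlonglongrightarrow> (\<integral>z. 0 \<partial>\<nu>2)"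
  proof (rule integral_dominated_convergence[where w = "\<lambda>z. 3 * norm (f z)"])
    show "AE z in \<nu>2. (\<lambda>i. \<bar>f z - s i z\<bar>) \<longlonglongrightarrow> 0"
    proof (rule AE_I2)
      fix z assume "z \<in> space \<nu>2"
      then have "(\<lambda>i. \<bar>f z - s i z\<bar>) \<longlonglongrightarrow> \<bar>f z - f z\<bar>" by (intro tendsto_intros lim.hyps)
      then show "(\<lambda>i. \<bar>f z - s i z\<bar>) \<longlonglongrightarrow> 0" by simp
    qed
    show "AE z in \<nu>2. norm \<bar>f z - s i z\<bar> \<le> 3 * norm (f z)" for i
    proof (rule AE_I2)
      fix z assume "z \<in> space \<nu>2"
      then have "norm (s i z) \<le> 2 * norm (f z)" by (rule lim.hyps)
      then show "norm \<bar>f z - s i z\<bar> \<le> 3 * norm (f z)" by simp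
    qed
  qed (use lim.hyps in auto)
  then have "eventually (\<lambda>i. (\<integral>z. \<bar>f z - s i z\<bar> \<partial>\<nu>2) < e / 2) sequentially"
    using lim.prems by (intro order_tendstoD) auto
  then obtain i where i: "(\<integral>z. \<bar>f z - s i z\<bar> \<partial>\<nu>2) < e / 2" by (auto simp: eventually_sequentially)
  have "\<exists>F g. fam F \<and> (\<integral>z. \<bar>s i z - g (cell F (fst z)) (cell F (snd z))\<bar> \<partial>\<nu>2) < e / 2"
    by (rule lim.IH) (use lim.prems in simp)
  then obtain F g where F: "fam F" "(\<integral>z. \<bar>s i z - g (cell F (fst z)) (cell F (snd z))\<bar> \<partial>\<nu>2) < e / 2"
    by (elim exE conjE)
  note i1 = integral_cell_fun2(1)[OF F(1), of g]
  have "(\<integral>z. \<bar>f z - g (cell F (fst z)) (cell F (snd z))\<bar> \<partial>\<nu>2)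
      \<le> (\<integral>z. \<bar>f z - s i z\<bar> + \<bar>s i z - g (cell F (fst z)) (cell F (snd z))\<bar> \<partial>\<nu>2)"
    using lim.hyps i1 by (intro integral_mono) auto
  also have "\<dots> < e"
    using lim.hyps i1 i F(2) by (subst Bochner_Integration.integral_add) auto
  finally show ?case by (intro exI[of _ F] exI[of _ g] conjI F)
qed

end

section \<open>Cell averages of a bounded kernel\<close>

locale bounded_kernel = cell_space \<nu> for \<nu> :: "'a measure" +
  fixes K :: "'a \<Rightarrow> 'a \<Rightarrow> real" and k :: real
  assumes K_meas: "(\<lambda>z. K (fst z) (snd z)) \<in> borel_measurable (\<nu> \<Otimes>\<^sub>M \<nu>)"
    and K_sym: "K x y = K y x"
    and K_bd: "\<bar>K x y\<bar> \<le> k"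
    and K_pos: "f \<in> borel_measurable \<nu> \<Longrightarrow> (\<And>x. \<bar>f x\<bar> \<le> B) \<Longrightarrow>
      0 \<le> (\<integral>z. f (fst z) * K (fst z) (snd z) * f (snd z) \<partial>(\<nu> \<Otimes>\<^sub>M \<nu>))"
    and K_le: "f \<in> borel_measurable \<nu> \<Longrightarrow> (\<And>x. \<bar>f x\<bar> \<le> B) \<Longrightarrow>
      (\<integral>z. f (fst z) * K (fst z) (snd z) * f (snd z) \<partial>(\<nu> \<Otimes>\<^sub>M \<nu>)) \<le> (\<integral>x. (f x)\<^sup>2 \<partial>\<nu>)"
begin

lemma k_nonneg: "0 \<le> k"
  using K_bd order_trans[OF abs_ge_zero] by blast

abbreviation "w \<equiv> measure \<nu>"

definition kk :: "'a set \<Rightarrow> 'a set \<Rightarrow> real" where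
  "kk A B = (\<integral>z. indicator A (fst z) * indicator B (snd z) * K (fst z) (snd z) \<partial>\<nu>2)"

text \<open>The value 0 assigned when one of the sets is null is consistent with
  \<open>avg_kk\<close>, since \<open>kk\<close> vanishes there.\<close>

definition avg :: "'a set \<Rightarrow> 'a set \<Rightarrow> real" where
  "avg A B = kk A B / (w A * w B)"

definition Kc :: "'a set set \<Rightarrow> 'a \<Rightarrow> 'a \<Rightarrow> real" where
  "Kc F x y = avg (cell F x) (cell F y)"

lemma integrable_kk [simp]:
  "A \<in> sets \<nu> \<Longrightarrow> B \<in> sets \<nu> \<Longrightarrow> integrable \<nu>2 (\<lambda>z. indicator A (fst z) * indicator B (snd z) * K (fst z) (snd z))"
proof (rule integrable_bounded2[of _ k])
  assume [measurable]: "A \<in> sets \<nu>" "B \<in> sets \<nu>"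
  note K_meas[measurable]
  show "(\<lambda>z. indicator A (fst z) * indicator B (snd z) * K (fst z) (snd z)) \<in> borel_measurable \<nu>2"
    by measurable
qed (use K_bd k_nonneg in \<open>auto simp: indicator_def\<close>)

lemma kk_sym: "A \<in> sets \<nu> \<Longrightarrow> B \<in> sets \<nu> \<Longrightarrow> kk A B = kk B A"
proof -
  assume A: "A \<in> sets \<nu>" and B: "B \<in> sets \<nu>"
  let ?f = "\<lambda>z. indicator A (fst z) * indicator B (snd z) * K (fst z) (snd z)"
  note A[measurable] B[measurable] K_meas[measurable]
  have "(\<integral>(x,y). ?f (y, x) \<partial>\<nu>2) = integral\<^sup>L \<nu>2 ?f"
    by (intro integral_product_swap) measurable
  moreover have "(\<integral>(x,y). ?f (y, x) \<partial>\<nu>2) = kk B A"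
    unfolding kk_def by (intro Bochner_Integration.integral_cong) (auto simp: K_sym mult_ac)
  ultimately show ?thesis by (simp add: kk_def)
qed

lemma kk_bd:
  assumes "A \<in> sets \<nu>" "B \<in> sets \<nu>"
  shows "\<bar>kk A B\<bar> \<le> k * (w A * w B)"
proof -
  have "\<bar>kk A B\<bar> \<le> (\<integral>z. \<bar>indicator A (fst z) * indicator B (snd z) * K (fst z) (snd z)\<bar> \<partial>\<nu>2)"
    unfolding kk_def by (rule integral_abs_bound)
  also have "\<dots> \<le> (\<integral>z. k * (indicator A (fst z) * indicator B (snd z)) \<partial>\<nu>2)"
    using assms K_bd k_nonneg
    by (intro integral_mono integrable_abs integrable_kk Bochner_Integration.integrable_mult_right integrable_rect)
       (auto simp: indicator_def)
  also have "\<dots> = k * (w A * w B)"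
    using assms by (simp add: measure_rect)
  finally show ?thesis .
qed

lemma kk_null: "A \<in> sets \<nu> \<Longrightarrow> B \<in> sets \<nu> \<Longrightarrow> w A = 0 \<or> w B = 0 \<Longrightarrow> kk A B = 0"
  using kk_bd[of A B] by auto

lemma avg_kk: "A \<in> sets \<nu> \<Longrightarrow> B \<in> sets \<nu> \<Longrightarrow> w A * w B * avg A B = kk A B"
  using kk_null[of A B] by (auto simp: avg_def)

lemma avg_sym: "A \<in> sets \<nu> \<Longrightarrow> B \<in> sets \<nu> \<Longrightarrow> avg A B = avg B A"
  by (simp add: avg_def kk_sym mult.commute)

lemma avg_bd: "A \<in> sets \<nu> \<Longrightarrow> B \<in> sets \<nu> \<Longrightarrow> \<bar>avg A B\<bar> \<le> k"
proof -
  assume "A \<in> sets \<nu>" "B \<in> sets \<nu>"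
  from kk_bd[OF this] show ?thesis
    using k_nonneg by (cases "w A * w B = 0") (auto simp: avg_def abs_mult divide_le_eq zero_less_mult_iff less_le)
qed

lemma bil_kk:
  assumes "finite S" "S \<subseteq> sets \<nu>"
  shows "bil S kk \<xi> \<xi> = (\<integral>z. (\<Sum>Q\<in>S. \<xi> Q * indicator Q (fst z)) * K (fst z) (snd z) * (\<Sum>Q\<in>S. \<xi> Q * indicator Q (snd z)) \<partial>\<nu>2)"
proof -
  have "bil S kk \<xi> \<xi> = (\<Sum>P\<in>S. \<Sum>Q\<in>S. \<integral>z. (\<xi> P * \<xi> Q) * (indicator P (fst z) * indicator Q (snd z) * K (fst z) (snd z)) \<partial>\<nu>2)"
    using assms by (simp add: bil_def kk_def mult_ac)
  also have "\<dots> = (\<Sum>P\<in>S. \<integral>z. (\<Sum>Q\<in>S. (\<xi> P * \<xi> Q) * (indicator P (fst z) * indicator Q (snd z) * K (fst z) (snd z))) \<partial>\<nu>2)"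
    using assms by (intro sum.cong refl Bochner_Integration.integral_sum[symmetric] Bochner_Integration.integrable_mult_right integrable_kk) auto
  also have "\<dots> = (\<integral>z. (\<Sum>P\<in>S. \<Sum>Q\<in>S. (\<xi> P * \<xi> Q) * (indicator P (fst z) * indicator Q (snd z) * K (fst z) (snd z))) \<partial>\<nu>2)"
    using assms by (intro Bochner_Integration.integral_sum[symmetric] Bochner_Integration.integrable_sum Bochner_Integration.integrable_mult_right integrable_kk) auto
  also have "\<dots> = (\<integral>z. (\<Sum>Q\<in>S. \<xi> Q * indicator Q (fst z)) * K (fst z) (snd z) * (\<Sum>Q\<in>S. \<xi> Q * indicator Q (snd z)) \<partial>\<nu>2)"
  proof (intro Bochner_Integration.integral_cong refl)
    fix z
    have "(\<Sum>Q\<in>S. \<xi> Q * indicator Q (fst z)) * K (fst z) (snd z) * (\<Sum>Q\<in>S. \<xi> Q * indicator Q (snd z))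
        = ((\<Sum>Q\<in>S. \<xi> Q * indicator Q (fst z)) * (\<Sum>Q\<in>S. \<xi> Q * indicator Q (snd z))) * K (fst z) (snd z)"
      by (simp only: mult_ac)
    also have "\<dots> = (\<Sum>P\<in>S. \<Sum>Q\<in>S. (\<xi> P * indicator P (fst z)) * (\<xi> Q * indicator Q (snd z)) * K (fst z) (snd z))"
      by (subst sum_product) (simp only: sum_distrib_right)
    finally show "(\<Sum>P\<in>S. \<Sum>Q\<in>S. (\<xi> P * \<xi> Q) * (indicator P (fst z) * indicator Q (snd z) * K (fst z) (snd z)))
        = (\<Sum>Q\<in>S. \<xi> Q * indicator Q (fst z)) * K (fst z) (snd z) * (\<Sum>Q\<in>S. \<xi> Q * indicator Q (snd z))"
      by (simp only: mult_ac)
  qed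
  finally show ?thesis .
qed

lemma simple_fun:
  fixes \<xi> :: "'a set \<Rightarrow> real"
  assumes "finite S" "S \<subseteq> sets \<nu>"
  shows "(\<lambda>x. \<Sum>Q\<in>S. \<xi> Q * indicator Q x) \<in> borel_measurable \<nu>"
    "\<bar>\<Sum>Q\<in>S. \<xi> Q * indicator Q x\<bar> \<le> (\<Sum>Q\<in>S. \<bar>\<xi> Q\<bar>)"
proof -
  show "(\<lambda>x. \<Sum>Q\<in>S. \<xi> Q * indicator Q x) \<in> borel_measurable \<nu>"
    using assms by (intro borel_measurable_sum) auto
  show "\<bar>\<Sum>Q\<in>S. \<xi> Q * indicator Q x\<bar> \<le> (\<Sum>Q\<in>S. \<bar>\<xi> Q\<bar>)"
    by (rule order_trans[OF sum_abs]) (auto intro!: sum_mono simp: indicator_def)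
qed

lemma psd_kk:
  assumes "finite S" "S \<subseteq> sets \<nu>"
  shows "pd 0 S kk"
proof (rule pdI)
  fix \<xi>
  show "0 * (\<Sum>a\<in>S. (\<xi> a)\<^sup>2) \<le> bil S kk \<xi> \<xi>"
    unfolding bil_kk[OF assms] using K_pos[OF simple_fun[OF assms]] by simp
qed (use assms kk_sym in auto)

lemma bil_scale: "bil S (\<lambda>a b. c a * A a b * c b) x y = bil S A (\<lambda>a. c a * x a) (\<lambda>b. c b * y b)"
  by (simp add: bil_def mult_ac)

lemma pd0_scale:
  assumes "pd 0 S A"
  shows "pd 0 S (\<lambda>a b. c a * A a b * c b)"
proof (rule pdI)
  fix x show "0 * (\<Sum>a\<in>S. (x a)\<^sup>2) \<le> bil S (\<lambda>a b. c a * A a b * c b) x x"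
    using psd_bil[OF assms, of "\<lambda>a. c a * x a"] by (simp add: bil_scale)
qed (use pd_sym[OF assms] in auto)

lemma psd_avg:
  assumes "finite S" "S \<subseteq> sets \<nu>"
  shows "pd 0 S avg"
proof -
  have "avg = (\<lambda>a b. inverse (w a) * kk a b * inverse (w b))"
    by (auto simp: avg_def fun_eq_iff field_simps)
  then show ?thesis using pd0_scale[OF psd_kk[OF assms]] by simp
qed

definition Mc :: "'a set \<Rightarrow> 'a set \<Rightarrow> real" where
  "Mc P Q = sqrt (w P) * avg P Q * sqrt (w Q)"

lemma psd_Mc: "fam F \<Longrightarrow> pd 0 (cells F) Mc"
  unfolding Mc_def using fam_cells by (intro pd0_scale psd_avg) auto

lemma psd_idm_Mc:
  assumes F: "fam F"
  shows "pd 0 (cells F) (\<lambda>a b. idm a b - Mc a b)"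
proof (rule pdI)
  fix \<xi> :: "'a set \<Rightarrow> real"
  let ?S = "cells F"
  have S: "finite ?S" "?S \<subseteq> sets \<nu>" using fam_cells[OF F] by auto
  let ?c = "\<lambda>Q. inverse (sqrt (w Q))"
  have Mc: "Mc = (\<lambda>a b. ?c a * kk a b * ?c b)"
  proof (intro ext)
    fix a b
    have "sqrt (w a) * avg a b * sqrt (w b) = (sqrt (w a) / w a) * kk a b * (sqrt (w b) / w b)"
      by (simp add: avg_def)
    moreover have "sqrt (w Q) / w Q = ?c Q" for Q
      by (simp add: sqrt_divide_self_eq)
    ultimately show "Mc a b = ?c a * kk a b * ?c b" by (simp only: Mc_def)
  qed
  let ?f = "\<lambda>x. \<Sum>Q\<in>?S. (?c Q * \<xi> Q) * indicator Q x"
  have "bil ?S Mc \<xi> \<xi> \<le> (\<integral>x. (?f x)\<^sup>2 \<partial>\<nu>)"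
    unfolding Mc bil_scale bil_kk[OF S] by (rule K_le[OF simple_fun[OF S]])
  also have "\<dots> = (\<integral>x. (?c (cell F x) * \<xi> (cell F x))\<^sup>2 \<partial>\<nu>)"
    by (simp only: cell_fun_eq[OF F, of "\<lambda>Q. ?c Q * \<xi> Q", symmetric])
  also have "\<dots> = (\<Sum>Q\<in>?S. w Q * (?c Q * \<xi> Q)\<^sup>2)"
    by (rule integral_cell_fun(2)[OF F])
  \<comment> \<open>Null cells contribute nothing on the left, so this is an inequality instead of
    an identity.\<close>
  also have "\<dots> \<le> (\<Sum>Q\<in>?S. (\<xi> Q)\<^sup>2)"
  proof (rule sum_mono)
    fix Q
    have "w Q * (?c Q * \<xi> Q)\<^sup>2 = (w Q * inverse (w Q)) * (\<xi> Q)\<^sup>2"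
      by (simp add: power_mult_distrib power_inverse)
    also have "\<dots> \<le> 1 * (\<xi> Q)\<^sup>2" by (intro mult_right_mono) (auto simp: field_simps)
    finally show "w Q * (?c Q * \<xi> Q)\<^sup>2 \<le> (\<xi> Q)\<^sup>2" by simp
  qed
  finally show "0 * (\<Sum>a\<in>?S. (\<xi> a)\<^sup>2) \<le> bil ?S (\<lambda>a b. idm a b - Mc a b) \<xi> \<xi>"
    using bil_diag[OF S(1), of "\<lambda>_. 1" \<xi>] by (simp add: bil_diff_mat)
qed (use pd_sym[OF psd_Mc[OF F]] in auto)

definition tr :: "'a set set \<Rightarrow> real" where
  "tr F = (\<integral>x. Kc F x x \<partial>\<nu>)"

lemma Kc_bd: "fam F \<Longrightarrow> \<bar>Kc F x y\<bar> \<le> k"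
  unfolding Kc_def by (intro avg_bd fam_cells)

lemma Kc_diag_nonneg: "fam F \<Longrightarrow> 0 \<le> Kc F x x"
  unfolding Kc_def using pd_diag[OF _ psd_avg, of "{cell F x}" "cell F x"] fam_cells(3) by auto

lemma Kc_diag_measurable: "fam F \<Longrightarrow> (\<lambda>x. Kc F x x) \<in> borel_measurable \<nu>"
  unfolding Kc_def using cell_fun_measurable[of F "\<lambda>Q. avg Q Q"] by simp

lemma Kc_measurable2: "fam F \<Longrightarrow> (\<lambda>z. Kc F (fst z) (snd z)) \<in> borel_measurable \<nu>2"
  unfolding Kc_def by (rule cell_fun_measurable2)

lemma tr_bd: "fam F \<Longrightarrow> tr F \<le> k * w UNIV"
proof -
  assume F: "fam F"
  have "tr F \<le> (\<integral>x. k \<partial>\<nu>)"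
    unfolding tr_def using F Kc_bd[OF F] k_nonneg Kc_diag_measurable[OF F]
    by (intro integral_mono integrable_bounded[of _ k]) (auto intro: order_trans[OF abs_ge_self])
  then show ?thesis by (simp add: space_UNIV mult.commute)
qed

lemma kk_split:
  assumes F: "fam F" and A: "A \<in> sets \<nu>" and B: "B \<in> sets \<nu>" "B = \<Union>S" "S \<subseteq> cells F"
  shows "kk A B = (\<Sum>P\<in>S. kk A P)"
proof -
  have S: "finite S" "\<And>P. P \<in> S \<Longrightarrow> P \<in> sets \<nu>"
    using B fam_cells[OF F] finite_subset by auto
  have ind: "indicator B y = (\<Sum>P\<in>S. indicator P y :: real)" for y
  proof -
    have m: "y \<in> P \<longleftrightarrow> P = cell F y" if "P \<in> S" for P
      using mem_cells_iff[of P F y] B(3) that by auto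
    have mB: "cell F y \<in> S \<longleftrightarrow> y \<in> B"
      using m B(2) by (metis Union_iff cell_self)
    have "(\<Sum>P\<in>S. indicator P y :: real) = (\<Sum>P\<in>S. if P = cell F y then 1 else 0)"
      by (intro sum.cong refl) (simp add: m indicator_eq_0_iff indicator_eq_1_iff)
    also have "\<dots> = indicator B y"
      using S(1) mB by (simp add: indicator_def)
    finally show ?thesis ..
  qed
  have "kk A B = (\<integral>z. (\<Sum>P\<in>S. indicator A (fst z) * indicator P (snd z) * K (fst z) (snd z)) \<partial>\<nu>2)"
    unfolding kk_def ind by (simp add: sum_distrib_left sum_distrib_right)
  also have "\<dots> = (\<Sum>P\<in>S. kk A P)"
    unfolding kk_def using A S by (intro Bochner_Integration.integral_sum integrable_kk) auto
  finally show ?thesis .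
qed

text \<open>Within a coarse cell the fine averages against that cell add up to the coarse diagonal
  average. This is the martingale property of the averages and yields the Pythagorean identity in
  \<open>tr_diff\<close>.\<close>

lemma integral_avg_refine:
  assumes F: "fam F" and G: "fam G" and FG: "F \<subseteq> G"
  shows "(\<integral>x. avg (cell F x) (cell G x) \<partial>\<nu>) = tr F"
proof -
  have sub: "cell G x \<subseteq> cell F x" for x using cell_mono[OF FG] .
  define par where "par P = cell F (SOME x. x \<in> P)" for P
  have some: "cell G (SOME y. y \<in> cell G x) = cell G x" for x
    using someI[of "\<lambda>y. y \<in> cell G x" x] by (simp add: cell_eq)
  have par: "par (cell G x) = cell F x" for x
    unfolding par_def by (rule cell_refine[OF FG some])
  have parc: "par P \<in> cells F" for P by (simp add: par_def)
  have "(\<integral>x. avg (cell F x) (cell G x) \<partial>\<nu>) = (\<integral>x. avg (par (cell G x)) (cell G x) \<partial>\<nu>)"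
    by (simp add: par)
  also have "\<dots> = (\<Sum>P\<in>cells G. w P * avg (par P) P)"
    by (rule integral_cell_fun(2)[OF G])
  also have "\<dots> = (\<Sum>P\<in>cells G. kk (par P) P / w (par P))"
  proof (intro sum.cong refl)
    fix P assume P: "P \<in> cells G"
    have m: "P \<in> sets \<nu>" "par P \<in> sets \<nu>" using fam_cells[OF F] fam_cells[OF G] P parc by auto
    show "w P * avg (par P) P = kk (par P) P / w (par P)"
      using kk_null[OF m(2,1)] by (auto simp: avg_def)
  qed
  also have "\<dots> = (\<Sum>Q\<in>cells F. \<Sum>P | P \<in> cells G \<and> par P = Q. kk (par P) P / w (par P))"
    using fam_cells[OF F] fam_cells[OF G] parc by (intro sum.group[symmetric]) auto
  also have "\<dots> = (\<Sum>Q\<in>cells F. w Q * avg Q Q)"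
  proof (intro sum.cong refl)
    fix Q assume Q: "Q \<in> cells F"
    have Qm: "Q \<in> sets \<nu>" using fam_cells[OF F] Q by auto
    have U: "Q = \<Union>{P. P \<in> cells G \<and> par P = Q}"
    proof (intro equalityI subsetI)
      fix x assume "x \<in> Q"
      then show "x \<in> \<Union>{P. P \<in> cells G \<and> par P = Q}"
        using Q by (intro UnionI[of "cell G x"]) (auto simp: par mem_cells_iff)
    next
      fix x assume "x \<in> \<Union>{P. P \<in> cells G \<and> par P = Q}"
      then obtain y where "x \<in> cell G y" "cell F y = Q" using par by auto
      then show "x \<in> Q" using sub by auto
    qed
    have "(\<Sum>P | P \<in> cells G \<and> par P = Q. kk (par P) P / w (par P)) = (\<Sum>P | P \<in> cells G \<and> par P = Q. kk Q P) / w Q"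
      by (simp add: sum_divide_distrib)
    also have "(\<Sum>P | P \<in> cells G \<and> par P = Q. kk Q P) = kk Q Q"
      by (rule kk_split[OF G Qm Qm U, symmetric]) auto
    also have "kk Q Q / w Q = w Q * avg Q Q" by (simp add: avg_def)
    finally show "(\<Sum>P | P \<in> cells G \<and> par P = Q. kk (par P) P / w (par P)) = w Q * avg Q Q" .
  qed
  also have "\<dots> = tr F"
    unfolding tr_def Kc_def by (rule integral_cell_fun(2)[OF F, of "\<lambda>Q. avg Q Q", symmetric])
  finally show ?thesis .
qed

lemma tr_diff:
  assumes F: "fam F" and G: "fam G" and FG: "F \<subseteq> G" and c: "c > 0"
  shows "tr F \<le> tr G"
    "(\<integral>x. \<bar>Kc G x x - Kc F x x\<bar> \<partial>\<nu>) \<le> (c * (tr G - tr F) + 4 * k * w UNIV / c) / 2"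
proof -
  define s where "s x = Kc G x x + Kc F x x - 2 * avg (cell F x) (cell G x)" for x
  have mixm: "integrable \<nu> (\<lambda>x. avg (cell F x) (cell G x))"
  proof -
    define par where "par P = cell F (SOME x. x \<in> P)" for P
    have some: "cell G (SOME y. y \<in> cell G x) = cell G x" for x
      using someI[of "\<lambda>y. y \<in> cell G x" x] by (simp add: cell_eq)
    have "par (cell G x) = cell F x" for x
      unfolding par_def by (rule cell_refine[OF FG some])
    then show ?thesis using integral_cell_fun(1)[OF G, of "\<lambda>P. avg (par P) P"] by simp
  qed
  have iG: "integrable \<nu> (\<lambda>x. Kc G x x)" "integrable \<nu> (\<lambda>x. Kc F x x)"
    using Kc_bd[OF G] Kc_diag_measurable[OF G] Kc_bd[OF F] Kc_diag_measurable[OF F]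
    by (auto intro!: integrable_bounded[of _ k])
  have ints: "(\<integral>x. s x \<partial>\<nu>) = tr G - tr F" "integrable \<nu> s"
    unfolding s_def using mixm iG by (simp_all add: integral_avg_refine[OF F G FG] flip: tr_def)
  have q: "0 \<le> a\<^sup>2 * Kc G x x + 2 * (a * b) * avg (cell F x) (cell G x) + b\<^sup>2 * Kc F x x" for a b x
  proof -
    let ?P = "cell G x" and ?Q = "cell F x"
    have m: "?P \<in> sets \<nu>" "?Q \<in> sets \<nu>" using fam_cells(3) F G by auto
    show ?thesis
    proof (cases "?P = ?Q")
      case True
      have "0 \<le> (a + b)\<^sup>2 * Kc G x x" using Kc_diag_nonneg[OF G] by simp
      then show ?thesis using True by (simp add: Kc_def power2_eq_square algebra_simps)
    next
      case False
      have "0 \<le> bil {?P, ?Q} avg (\<lambda>R. if R = ?P then a else b) (\<lambda>R. if R = ?P then a else b)"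
        by (rule psd_bil[OF psd_avg]) (use m in auto)
      then show ?thesis using False avg_sym[OF m] by (simp add: bil_def Kc_def power2_eq_square algebra_simps)
    qed
  qed
  have s0: "0 \<le> s x" for x using q[of 1 x "-1"] by (simp add: s_def)
  have "0 \<le> (\<integral>x. s x \<partial>\<nu>)" by (intro Bochner_Integration.integral_nonneg s0)
  then show "tr F \<le> tr G" using ints by simp
  have pt: "\<bar>Kc G x x - Kc F x x\<bar> \<le> (c * s x + 4 * k / c) / 2" for x
  proof -
    let ?a = "Kc G x x" and ?b = "Kc F x x" and ?h = "avg (cell F x) (cell G x)"
    have k: "?a \<le> k" "?b \<le> k" "0 \<le> ?a" "0 \<le> ?b" using Kc_bd[OF G, of x x] Kc_bd[OF F, of x x] Kc_diag_nonneg F G by auto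
    define r where "r = sqrt c"
    have r: "r > 0" "r\<^sup>2 = c" using c by (auto simp: r_def)
    \<comment> \<open>These coefficients expand $|r(a-b) + (a+b)/r|^2$ and $|r(a-b) - (a+b)/r|^2$ in
      the vectors $a$, $b$; the two signs give the two sides of the absolute value.\<close>
    have e1: "(r + 1/r)\<^sup>2 = c + 2 + 1/c" "(r - 1/r)\<^sup>2 = c - 2 + 1/c" "(r + 1/r) * (1/r - r) = 1/c - c"
      "(r - 1/r) * (- r - 1/r) = 1/c - c"
      "(1/r - r)\<^sup>2 = c - 2 + 1/c" "(- r - 1/r)\<^sup>2 = c + 2 + 1/c"
      using r by (auto simp: field_simps power2_eq_square)
    have A: "0 \<le> (c + 2 + 1/c) * ?a + 2 * (1/c - c) * ?h + (c - 2 + 1/c) * ?b"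
      using q[of "r + 1/r" x "1/r - r"] by (simp only: e1)
    have B: "0 \<le> (c - 2 + 1/c) * ?a + 2 * (1/c - c) * ?h + (c + 2 + 1/c) * ?b"
      using q[of "r - 1/r" x "- r - 1/r"] by (simp only: e1)
    have C: "(?a + ?b + 2 * ?h) / c \<le> 4 * k / c"
      using k s0[of x] c by (intro divide_right_mono) (auto simp: s_def)
    have ce: "c * s x + (?a + ?b + 2 * ?h) / c = (c + 1/c) * ?a + 2 * (1/c - c) * ?h + (c + 1/c) * ?b"
      using c by (simp add: s_def field_simps)
    have "2 * \<bar>?a - ?b\<bar> \<le> c * s x + (?a + ?b + 2 * ?h) / c"
      using A B unfolding ce by (auto simp: abs_if algebra_simps)
    then have "2 * \<bar>?a - ?b\<bar> \<le> c * s x + 4 * k / c" using C by (meson add_left_mono order_trans)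
    then show ?thesis by simp
  qed
  have "(\<integral>x. \<bar>Kc G x x - Kc F x x\<bar> \<partial>\<nu>) \<le> (\<integral>x. (c * s x + 4 * k / c) / 2 \<partial>\<nu>)"
    using iG ints(2) by (intro integral_mono pt) auto
  also have "\<dots> = (c * (tr G - tr F) + 4 * k * w UNIV / c) / 2"
    using ints by (simp add: space_UNIV)
  finally show "(\<integral>x. \<bar>Kc G x x - Kc F x x\<bar> \<partial>\<nu>) \<le> (c * (tr G - tr F) + 4 * k * w UNIV / c) / 2" .
qed

text \<open>Averaging over cells fixes cell functions and contracts $L^1$. If a cell function is
  within \<open>e / 2\<close> of \<open>K\<close>, the averages over any finer partition are
  therefore within \<open>e / 2\<close> of that function.\<close>

lemma Kc_approx:
  assumes "e > 0"
  shows "\<exists>F. fam F \<and> (\<forall>G. fam G \<longrightarrow> F \<subseteq> G \<longrightarrow> (\<integral>z. \<bar>K (fst z) (snd z) - Kc G (fst z) (snd z)\<bar> \<partial>\<nu>2) \<le> e)"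
proof -
  let ?K = "\<lambda>z. K (fst z) (snd z)"
  have iK: "integrable \<nu>2 ?K" using K_meas K_bd by (intro integrable_bounded2[of _ k])
  have "e / 2 > 0" using assms by simp
  from approx_cell_fun2[OF iK this]
  obtain F g where F: "fam F" and Fg: "(\<integral>z. \<bar>?K z - g (cell F (fst z)) (cell F (snd z))\<bar> \<partial>\<nu>2) < e / 2"
    by (elim exE conjE)
  show ?thesis
  proof (intro exI[of _ F] conjI allI impI F)
    fix G assume G: "fam G" and FG: "F \<subseteq> G"
    define par where "par P = cell F (SOME x. x \<in> P)" for P
    have some: "cell G (SOME y. y \<in> cell G x) = cell G x" for x
      using someI[of "\<lambda>y. y \<in> cell G x" x] by (simp add: cell_eq)
    have par: "par (cell G x) = cell F x" for x
      unfolding par_def by (rule cell_refine[OF FG some])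
    define h where "h P Q = g (par P) (par Q)" for P Q
    have h: "g (cell F x) (cell F y) = h (cell G x) (cell G y)" for x y by (simp add: h_def par)
    have ih: "integrable \<nu>2 (\<lambda>z. h (cell G (fst z)) (cell G (snd z)))"
      by (rule integral_cell_fun2(1)[OF G])
    have iKc: "integrable \<nu>2 (\<lambda>z. Kc G (fst z) (snd z))"
      unfolding Kc_def by (rule integral_cell_fun2(1)[OF G])
    have Fh: "(\<integral>z. \<bar>?K z - h (cell G (fst z)) (cell G (snd z))\<bar> \<partial>\<nu>2) < e / 2"
      using Fg by (simp add: h)
    have "(\<integral>z. \<bar>h (cell G (fst z)) (cell G (snd z)) - Kc G (fst z) (snd z)\<bar> \<partial>\<nu>2)
        = (\<Sum>P\<in>cells G. \<Sum>Q\<in>cells G. w P * w Q * \<bar>h P Q - avg P Q\<bar>)"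
      unfolding Kc_def by (rule integral_cell_fun2(2)[OF G])
    also have "\<dots> \<le> (\<Sum>P\<in>cells G. \<Sum>Q\<in>cells G. \<integral>z. indicator P (fst z) * indicator Q (snd z) * \<bar>?K z - h (cell G (fst z)) (cell G (snd z))\<bar> \<partial>\<nu>2)"
    proof (intro sum_mono)
      fix P Q assume PQ: "P \<in> cells G" "Q \<in> cells G"
      then have m: "P \<in> sets \<nu>" "Q \<in> sets \<nu>" using fam_cells[OF G] by auto
      have "w P * w Q * \<bar>h P Q - avg P Q\<bar> = \<bar>w P * w Q * h P Q - kk P Q\<bar>"
        unfolding avg_kk[OF m, symmetric] by (simp add: abs_mult flip: right_diff_distrib)
      also have "w P * w Q * h P Q - kk P Q = (\<integral>z. indicator P (fst z) * indicator Q (snd z) * h P Q - indicator P (fst z) * indicator Q (snd z) * ?K z \<partial>\<nu>2)"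
        using m by (subst Bochner_Integration.integral_diff) (auto simp: kk_def measure_rect)
      also have "\<dots> = (\<integral>z. indicator P (fst z) * indicator Q (snd z) * (h (cell G (fst z)) (cell G (snd z)) - ?K z) \<partial>\<nu>2)"
        using PQ by (intro Bochner_Integration.integral_cong) (auto simp: indicator_def mem_cells_iff algebra_simps)
      also have "\<bar>\<dots>\<bar> \<le> (\<integral>z. \<bar>indicator P (fst z) * indicator Q (snd z) * (h (cell G (fst z)) (cell G (snd z)) - ?K z)\<bar> \<partial>\<nu>2)"
        by (rule integral_abs_bound)
      also have "\<dots> = (\<integral>z. indicator P (fst z) * indicator Q (snd z) * \<bar>?K z - h (cell G (fst z)) (cell G (snd z))\<bar> \<partial>\<nu>2)"
        by (intro Bochner_Integration.integral_cong) (auto simp: indicator_def abs_minus_commute)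
      finally show "w P * w Q * \<bar>h P Q - avg P Q\<bar> \<le> (\<integral>z. indicator P (fst z) * indicator Q (snd z) * \<bar>?K z - h (cell G (fst z)) (cell G (snd z))\<bar> \<partial>\<nu>2)" .
    qed
    also have "\<dots> = (\<integral>z. \<bar>?K z - h (cell G (fst z)) (cell G (snd z))\<bar> \<partial>\<nu>2)"
      using iK ih by (intro integral_partition2[OF G, symmetric]) auto
    finally have "(\<integral>z. \<bar>h (cell G (fst z)) (cell G (snd z)) - Kc G (fst z) (snd z)\<bar> \<partial>\<nu>2) < e / 2"
      using Fh by simp
    moreover have "(\<integral>z. \<bar>?K z - Kc G (fst z) (snd z)\<bar> \<partial>\<nu>2)
      \<le> (\<integral>z. \<bar>?K z - h (cell G (fst z)) (cell G (snd z))\<bar> + \<bar>h (cell G (fst z)) (cell G (snd z)) - Kc G (fst z) (snd z)\<bar> \<partial>\<nu>2)"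
      using iK ih iKc by (intro integral_mono) auto
    moreover have "\<dots> = (\<integral>z. \<bar>?K z - h (cell G (fst z)) (cell G (snd z))\<bar> \<partial>\<nu>2) + (\<integral>z. \<bar>h (cell G (fst z)) (cell G (snd z)) - Kc G (fst z) (snd z)\<bar> \<partial>\<nu>2)"
      using iK ih iKc by (intro Bochner_Integration.integral_add) auto
    ultimately show "(\<integral>z. \<bar>?K z - Kc G (fst z) (snd z)\<bar> \<partial>\<nu>2) \<le> e" using Fh by linarith
  qed
qed

end

text \<open>The sum of the absolute values has finite integral by monotone convergence, hence is
  finite almost everywhere.\<close>

lemma AE_summable_of_integral_bound:
  fixes f :: "nat \<Rightarrow> 'b \<Rightarrow> real"
  assumes i: "\<And>l. integrable M (f l)" and b: "\<And>l. (\<integral>x. \<bar>f l x\<bar> \<partial>M) \<le> C * (1/2) ^ l"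
  shows "AE x in M. summable (\<lambda>l. \<bar>f l x\<bar>)"
proof -
  have "0 \<le> (\<integral>x. \<bar>f 0 x\<bar> \<partial>M)" by simp
  also have "\<dots> \<le> C" using b[of 0] by simp
  finally have C: "0 \<le> C" .
  have "(\<integral>\<^sup>+x. (\<Sum>l. ennreal \<bar>f l x\<bar>) \<partial>M) = (\<Sum>l. \<integral>\<^sup>+x. ennreal \<bar>f l x\<bar> \<partial>M)"
    using i by (intro nn_integral_suminf) auto
  also have "\<dots> = (\<Sum>l. ennreal (\<integral>x. \<bar>f l x\<bar> \<partial>M))"
    using i by (intro suminf_cong nn_integral_eq_integral) auto
  also have "\<dots> \<le> (\<Sum>l. ennreal (C * (1/2) ^ l))"
    by (intro suminf_le ennreal_leI b) auto
  also have "\<dots> = ennreal (\<Sum>l. C * (1/2) ^ l)"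
    using C by (intro suminf_ennreal2 summable_mult summable_geometric) auto
  also have "\<dots> < \<infinity>" by simp
  finally have "(\<integral>\<^sup>+x. (\<Sum>l. ennreal \<bar>f l x\<bar>) \<partial>M) \<noteq> \<infinity>" by simp
  then have "AE x in M. (\<Sum>l. ennreal \<bar>f l x\<bar>) \<noteq> \<infinity>"
    using i by (intro nn_integral_PInf_AE) auto
  then show ?thesis
    by eventually_elim (auto intro: summable_suminf_not_top)
qed

lemma psd_limit:
  assumes "\<And>l::nat. pd 0 S (A l)" "\<And>i j. i \<in> S \<Longrightarrow> j \<in> S \<Longrightarrow> (\<lambda>l. A l i j) \<longlonglongrightarrow> B i j"
  shows "pd 0 S B"
proof (rule pdI)
  fix i j assume ij: "i \<in> S" "j \<in> S"
  show "B i j = B j i"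
    by (rule LIMSEQ_unique[OF assms(2)[OF ij]]) (use assms(2)[OF ij(2,1)] pd_sym[OF assms(1) ij] in simp)
next
  fix x
  have "(\<lambda>l. bil S (A l) x x) \<longlonglongrightarrow> bil S B x x"
    unfolding bil_def by (intro tendsto_intros assms(2))
  then have "0 \<le> bil S B x x"
    by (rule LIMSEQ_le_const) (use psd_bil[OF assms(1)] in auto)
  then show "0 * (\<Sum>a\<in>S. (x a)\<^sup>2) \<le> bil S B x x" by simp
qed

lemma fdet_scale:
  assumes "finite S"
  shows "fdet S (\<lambda>a b. c a * A a b * c b) = (\<Prod>a\<in>S. c a)\<^sup>2 * fdet S A"
  unfolding fdet_def sum_distrib_left
proof (intro sum.cong refl)
  fix p assume "p \<in> {p. p permutes S}"
  then have "(\<Prod>i\<in>S. c (p i)) = (\<Prod>i\<in>S. c i)"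
    using prod.permute[of p S c] by (simp add: o_def)
  then show "of_int (sign p) * (\<Prod>i\<in>S. c i * A i (p i) * c (p i)) = (\<Prod>a\<in>S. c a)\<^sup>2 * (of_int (sign p) * (\<Prod>i\<in>S. A i (p i)))"
    by (simp add: prod.distrib power2_eq_square)
qed

lemma minors_vanish_scale: "minors_vanish N I A \<Longrightarrow> minors_vanish N I (\<lambda>a b. c a * A a b * c b)"
  unfolding minors_vanish_def by (simp add: fdet_scale[of "{..<_}" "\<lambda>i. c (_ i)"])

lemma minors_vanish_subset: "minors_vanish N I A \<Longrightarrow> J \<subseteq> I \<Longrightarrow> minors_vanish N J A"
  unfolding minors_vanish_def by blast

context cell_space
begin

lemma product_sigma_finite_const: "product_sigma_finite (\<lambda>_. \<nu>)"
  by unfold_locales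

lemma AE_PiM_single:
  assumes I: "finite I" "i \<in> I" and P: "AE x in \<nu>. P x"
  shows "AE x in PiM I (\<lambda>_. \<nu>). P (x i)"
proof -
  interpret S: product_sigma_finite "\<lambda>_. \<nu>" by (rule product_sigma_finite_const)
  obtain N where N: "{x\<in>space \<nu>. \<not> P x} \<subseteq> N" "N \<in> null_sets \<nu>" using P unfolding eventually_ae_filter by auto
  have Nm[measurable]: "N \<in> sets \<nu>" using N by auto
  have II: "insert i (I - {i}) = I" using I by auto
  have meas: "(\<lambda>x. indicator N (x i) :: ennreal) \<in> borel_measurable (PiM I (\<lambda>_. \<nu>))"
    using I by measurable
  have "(\<integral>\<^sup>+x. indicator N (x i) \<partial>PiM (insert i (I - {i})) (\<lambda>_. \<nu>)) = (\<integral>\<^sup>+x. (\<integral>\<^sup>+y. indicator N ((x(i := y)) i) \<partial>\<nu>) \<partial>PiM (I - {i}) (\<lambda>_. \<nu>))"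
    using meas I by (intro S.product_nn_integral_insert) (auto simp: II)
  also have "\<dots> = 0" using N by (auto simp: null_sets_def)
  finally have "(\<integral>\<^sup>+x. indicator N (x i) \<partial>PiM I (\<lambda>_. \<nu>)) = 0" unfolding II .
  then have "AE x in PiM I (\<lambda>_. \<nu>). indicator N (x i) = (0::ennreal)"
    using meas by (simp add: nn_integral_0_iff_AE)
  then show ?thesis
    by eventually_elim (use N space_UNIV in \<open>auto simp: indicator_def split: if_splits\<close>)
qed

text \<open>Distinct coordinates are jointly distributed like the product of two copies of the
  measure. This fails for equal coordinates, which is why the diagonal requires a convergence
  statement of its own.\<close>

lemma AE_PiM_pair:
  assumes I: "finite I" "i \<in> I" "j \<in> I" "i \<noteq> j" and P: "AE z in \<nu>2. P z"
  shows "AE x in PiM I (\<lambda>_. \<nu>). P (x i, x j)"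
proof -
  interpret S: product_sigma_finite "\<lambda>_. \<nu>" by (rule product_sigma_finite_const)
  obtain N where N: "{x\<in>space \<nu>2. \<not> P x} \<subseteq> N" "N \<in> null_sets \<nu>2" using P unfolding eventually_ae_filter by auto
  have Nm[measurable]: "N \<in> sets \<nu>2" using N by auto
  let ?J = "I - {i, j}" and ?K = "I - {i}"
  have II: "insert i ?K = I" "insert j ?J = ?K" using I by auto
  have meas: "(\<lambda>x. indicator N (x i, x j) :: ennreal) \<in> borel_measurable (PiM I (\<lambda>_. \<nu>))"
    using I by measurable
  have m2: "(\<lambda>t. \<integral>\<^sup>+y. indicator N (y, t) \<partial>\<nu>) \<in> borel_measurable \<nu>" by measurable
  have jK: "j \<in> ?K" using I by auto
  have m3: "(\<lambda>x. \<integral>\<^sup>+y. indicator N (y, x j) \<partial>\<nu>) \<in> borel_measurable (PiM ?K (\<lambda>_. \<nu>))"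
    by (rule measurable_compose[OF measurable_component_singleton[OF jK] m2])
  have "(\<integral>\<^sup>+x. indicator N (x i, x j) \<partial>PiM (insert i ?K) (\<lambda>_. \<nu>)) = (\<integral>\<^sup>+x. (\<integral>\<^sup>+y. indicator N ((x(i := y)) i, (x(i := y)) j) \<partial>\<nu>) \<partial>PiM ?K (\<lambda>_. \<nu>))"
    using meas I II by (intro S.product_nn_integral_insert) auto
  also have "\<dots> = (\<integral>\<^sup>+x. (\<integral>\<^sup>+y. indicator N (y, x j) \<partial>\<nu>) \<partial>PiM (insert j ?J) (\<lambda>_. \<nu>))"
    using I(4) II by simp
  also have "\<dots> = (\<integral>\<^sup>+x. (\<integral>\<^sup>+t. (\<integral>\<^sup>+y. indicator N (y, (x(j := t)) j) \<partial>\<nu>) \<partial>\<nu>) \<partial>PiM ?J (\<lambda>_. \<nu>))"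
    using m3 I II by (intro S.product_nn_integral_insert) auto
  also have "\<dots> = (\<integral>\<^sup>+x. (\<integral>\<^sup>+z. indicator N z \<partial>\<nu>2) \<partial>PiM ?J (\<lambda>_. \<nu>))"
    by (simp add: nn_integral_snd del: nn_integral_indicator)
  also have "\<dots> = 0" using N by (auto simp: null_sets_def)
  finally have "(\<integral>\<^sup>+x. indicator N (x i, x j) \<partial>PiM I (\<lambda>_. \<nu>)) = 0" unfolding II .
  then have "AE x in PiM I (\<lambda>_. \<nu>). indicator N (x i, x j) = (0::ennreal)"
    using meas by (simp add: nn_integral_0_iff_AE)
  then show ?thesis
    by eventually_elim (use N space_UNIV in \<open>auto simp: indicator_def space_pair_measure split: if_splits\<close>)
qed

lemma AE_fst_snd:
  assumes "AE x in \<nu>. P x"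
  shows "AE z in \<nu>2. P (fst z)" "AE z in \<nu>2. P (snd z)"
proof -
  obtain N where N: "{x\<in>space \<nu>. \<not> P x} \<subseteq> N" "N \<in> null_sets \<nu>" using assms unfolding eventually_ae_filter by auto
  have *: "N \<times> UNIV \<in> null_sets \<nu>2" "UNIV \<times> N \<in> null_sets \<nu>2"
    using N sets.top[of \<nu>] space_UNIV by (auto simp: null_sets_def emeasure_pair_measure_Times)
  show "AE z in \<nu>2. P (fst z)" by (rule AE_I'[OF *(1)]) (use N space_UNIV in auto)
  show "AE z in \<nu>2. P (snd z)" by (rule AE_I'[OF *(2)]) (use N space_UNIV in auto)
qed

end

section \<open>The limit of the averages and the canonical diagonal\<close>

context bounded_kernel
begin

text \<open>Traces increase under refinement and are bounded, so families of nearly maximal trace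
  have small increments after all further refinement. The rate $16^{-l}$ is chosen so that
  \<open>tr_diff\<close> with $c = 4^l$ still gives a summable bound.\<close>

lemma ex_sequence:
  "\<exists>Fs. (\<forall>l. fam (Fs l)) \<and> (\<forall>l. Fs l \<subseteq> Fs (Suc l)) \<and> (\<forall>l. tr (Fs (Suc l)) - tr (Fs l) \<le> (1/16) ^ l) \<and>
    (\<forall>l. (\<integral>z. \<bar>K (fst z) (snd z) - Kc (Fs l) (fst z) (snd z)\<bar> \<partial>\<nu>2) \<le> (1/2) ^ l)"
proof -
  let ?T = "SUP F\<in>Collect fam. tr F"
  have f0: "fam {}" by (simp add: fam_def)
  have bdd: "bdd_above (tr ` Collect fam)" using tr_bd by (intro bdd_aboveI[of _ "k * w UNIV"]) auto
  have le: "tr F \<le> ?T" if "fam F" for F using bdd that by (intro cSUP_upper) auto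
  have "\<exists>A. fam A \<and> ?T - (1/16) ^ l < tr A" for l :: nat
  proof -
    have "?T - (1/16) ^ l < ?T" by simp
    then show ?thesis using less_cSUP_iff[of "Collect fam" tr "?T - (1/16) ^ l"] bdd f0 by auto
  qed
  then obtain A where A: "\<And>l. fam (A l)" "\<And>l::nat. ?T - (1/16) ^ l < tr (A l)" by metis
  have "\<exists>F. fam F \<and> (\<forall>G. fam G \<longrightarrow> F \<subseteq> G \<longrightarrow> (\<integral>z. \<bar>K (fst z) (snd z) - Kc G (fst z) (snd z)\<bar> \<partial>\<nu>2) \<le> (1/2) ^ l)" for l
    by (rule Kc_approx) simp
  then obtain B where B: "\<And>l. fam (B l)"
    "\<And>l G. fam G \<Longrightarrow> B l \<subseteq> G \<Longrightarrow> (\<integral>z. \<bar>K (fst z) (snd z) - Kc G (fst z) (snd z)\<bar> \<partial>\<nu>2) \<le> (1/2) ^ l" by metis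
  define Fs where "Fs l = (\<Union>j\<le>l. A j \<union> B j)" for l
  have F: "fam (Fs l)" for l using A(1) B(1) by (auto simp: Fs_def fam_def)
  have AB: "A l \<subseteq> Fs l" "B l \<subseteq> Fs l" for l by (auto simp: Fs_def)
  have mono: "Fs l \<subseteq> Fs (Suc l)" for l unfolding Fs_def by (intro UN_mono) auto
  have "tr (Fs (Suc l)) - tr (Fs l) \<le> (1/16) ^ l" for l
    using le[OF F[of "Suc l"]] A(2)[of l] tr_diff(1)[OF A(1)[of l] F[of l] AB(1)[of l], of 1] by linarith
  then show ?thesis using F mono B(2)[OF F AB(2)] by blast
qed

lemma ex_limit:
  "\<exists>d Fs. d \<in> borel_measurable \<nu> \<and> (\<forall>x. 0 \<le> d x \<and> d x \<le> k) \<and> (\<forall>l. fam (Fs l)) \<and>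
    (AE z in \<nu>2. (\<lambda>l. Kc (Fs l) (fst z) (snd z)) \<longlonglongrightarrow> K (fst z) (snd z)) \<and>
    (AE x in \<nu>. (\<lambda>l. Kc (Fs l) x x) \<longlonglongrightarrow> d x) \<and> (\<lambda>l. tr (Fs l)) \<longlonglongrightarrow> (\<integral>x. d x \<partial>\<nu>)"
proof -
  obtain Fs where F: "\<And>l. fam (Fs l)" and mono: "\<And>l. Fs l \<subseteq> Fs (Suc l)"
    and tr: "\<And>l. tr (Fs (Suc l)) - tr (Fs l) \<le> (1/16) ^ l"
    and L1: "\<And>l. (\<integral>z. \<bar>K (fst z) (snd z) - Kc (Fs l) (fst z) (snd z)\<bar> \<partial>\<nu>2) \<le> (1/2) ^ l"
    using ex_sequence by blast
  \<comment> \<open>\<open>lim\<close> is unspecified where the averages diverge; clamping gives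
    bounds valid everywhere and changes nothing where they converge.\<close>
  define d where "d x = max 0 (min k (lim (\<lambda>l. Kc (Fs l) x x)))" for x
  have dm: "d \<in> borel_measurable \<nu>"
    unfolding d_def using Kc_diag_measurable[OF F] by (intro borel_measurable_max borel_measurable_min borel_measurable_lim_metric) auto
  have iK: "integrable \<nu>2 (\<lambda>z. K (fst z) (snd z) - Kc (Fs l) (fst z) (snd z))" for l
    using K_meas K_bd Kc_measurable2[OF F] Kc_bd[OF F]
    by (intro Bochner_Integration.integrable_diff integrable_bounded2[of _ k]) auto
  have off: "AE z in \<nu>2. (\<lambda>l. Kc (Fs l) (fst z) (snd z)) \<longlonglongrightarrow> K (fst z) (snd z)"
  proof -
    have "AE z in \<nu>2. summable (\<lambda>l. \<bar>K (fst z) (snd z) - Kc (Fs l) (fst z) (snd z)\<bar>)"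
      by (rule AE_summable_of_integral_bound[OF iK, where C = 1]) (use L1 in simp)
    then show ?thesis
    proof eventually_elim
      case (elim z)
      then have "(\<lambda>l. K (fst z) (snd z) - Kc (Fs l) (fst z) (snd z)) \<longlonglongrightarrow> 0"
        by (intro tendsto_rabs_zero_cancel[OF summable_LIMSEQ_zero])
      then have "(\<lambda>l. K (fst z) (snd z) - (K (fst z) (snd z) - Kc (Fs l) (fst z) (snd z))) \<longlonglongrightarrow> K (fst z) (snd z) - 0"
        by (intro tendsto_diff tendsto_const)
      then show ?case by simp
    qed
  qed
  have id: "integrable \<nu> (\<lambda>x. Kc (Fs l) x x)" for l
    using Kc_diag_measurable[OF F] Kc_bd[OF F] by (intro integrable_bounded[of _ k]) auto
  have diag: "AE x in \<nu>. (\<lambda>l. Kc (Fs l) x x) \<longlonglongrightarrow> d x"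
  proof -
    have "AE x in \<nu>. summable (\<lambda>l. \<bar>Kc (Fs (Suc l)) x x - Kc (Fs l) x x\<bar>)"
    proof (rule AE_summable_of_integral_bound)
      fix l
      show "integrable \<nu> (\<lambda>x. Kc (Fs (Suc l)) x x - Kc (Fs l) x x)" using id by auto
      \<comment> \<open>With $c = 4^l$ both terms of \<open>tr_diff\<close> are of order
        $4^{-l}$.\<close>
      have "(\<integral>x. \<bar>Kc (Fs (Suc l)) x x - Kc (Fs l) x x\<bar> \<partial>\<nu>)
          \<le> (4 ^ l * (tr (Fs (Suc l)) - tr (Fs l)) + 4 * k * w UNIV / 4 ^ l) / 2"
        by (rule tr_diff(2)[OF F F mono]) simp
      also have "\<dots> \<le> (4 ^ l * (1/16) ^ l + 4 * k * w UNIV / 4 ^ l) / 2"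
        using tr by (intro divide_right_mono add_right_mono mult_left_mono) auto
      also have "4 ^ l * (1/16) ^ l = (1/4 :: real) ^ l" by (simp flip: power_mult_distrib)
      also have "((1/4) ^ l + 4 * k * w UNIV / 4 ^ l) / 2 = ((1 + 4 * k * w UNIV) / 2) * (1/4) ^ l"
        by (simp add: power_divide field_simps)
      also have "\<dots> \<le> ((1 + 4 * k * w UNIV) / 2) * (1/2) ^ l"
        using k_nonneg by (intro mult_left_mono power_mono) auto
      finally show "(\<integral>x. \<bar>Kc (Fs (Suc l)) x x - Kc (Fs l) x x\<bar> \<partial>\<nu>) \<le> ((1 + 4 * k * w UNIV) / 2) * (1/2) ^ l" .
    qed
    then show ?thesis
    proof eventually_elim
      case (elim x)
      let ?d = "\<lambda>l. Kc (Fs l) x x"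
      have "summable (\<lambda>l. ?d (Suc l) - ?d l)"
        using elim by (simp add: summable_rabs_cancel)
      then have "(\<lambda>n. \<Sum>l<n. ?d (Suc l) - ?d l) \<longlonglongrightarrow> (\<Sum>l. ?d (Suc l) - ?d l)"
        by (rule summable_LIMSEQ)
      then have "(\<lambda>n. (?d n - ?d 0) + ?d 0) \<longlonglongrightarrow> (\<Sum>l. ?d (Suc l) - ?d l) + ?d 0"
        by (intro tendsto_add tendsto_const) (simp add: sum_lessThan_telescope[of ?d])
      then have "convergent ?d" by (simp add: convergentI)
      then have L: "?d \<longlonglongrightarrow> lim ?d" by (simp add: convergent_LIMSEQ_iff)
      have "0 \<le> lim ?d" using Kc_diag_nonneg[OF F] by (intro LIMSEQ_le_const[OF L]) auto
      moreover have "lim ?d \<le> k" using Kc_bd[OF F, of _ x x] by (intro LIMSEQ_le_const2[OF L]) (auto simp: abs_le_iff)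
      ultimately show ?case using L by (simp add: d_def)
    qed
  qed
  have "(\<lambda>l. tr (Fs l)) \<longlonglongrightarrow> (\<integral>x. d x \<partial>\<nu>)"
    unfolding tr_def
  proof (rule integral_dominated_convergence[where w = "\<lambda>_. k"])
    show "AE x in \<nu>. (\<lambda>l. Kc (Fs l) x x) \<longlonglongrightarrow> d x" by (rule diag)
    show "AE x in \<nu>. norm (Kc (Fs l) x x) \<le> k" for l using Kc_bd[OF F] by simp
  qed (use dm Kc_diag_measurable[OF F] in auto)
  moreover have "0 \<le> d x \<and> d x \<le> k" for x using k_nonneg by (auto simp: d_def)
  ultimately show ?thesis using dm F off diag by blast
qed

end

locale kernel_limit = bounded_kernel +
  fixes d :: "'a \<Rightarrow> real" and Fs :: "nat \<Rightarrow> 'a set set"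
  assumes d_meas: "d \<in> borel_measurable \<nu>" and d_bd: "0 \<le> d x" "d x \<le> k"
    and Fs: "fam (Fs l)"
    and off_lim: "AE z in \<nu>2. (\<lambda>l. Kc (Fs l) (fst z) (snd z)) \<longlonglongrightarrow> K (fst z) (snd z)"
    and diag_lim: "AE x in \<nu>. (\<lambda>l. Kc (Fs l) x x) \<longlonglongrightarrow> d x"
    and tr_lim: "(\<lambda>l. tr (Fs l)) \<longlonglongrightarrow> (\<integral>x. d x \<partial>\<nu>)"
begin

text \<open>The diagonal value is attached to equal indices, not to equal points. At an atom two
  different indices may carry the same point; there \<open>AE_diag_eq_at_atom\<close> shows that
  both conventions agree.\<close>

definition km :: "('i \<Rightarrow> 'a) \<Rightarrow> 'i \<Rightarrow> 'i \<Rightarrow> real" where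
  "km x = (\<lambda>i j. if i = j then d (x i) else K (x i) (x j))"

lemma AE_km_lim:
  assumes I: "finite I"
  shows "AE x in PiM I (\<lambda>_. \<nu>). \<forall>i\<in>I. \<forall>j\<in>I. (\<lambda>l. Kc (Fs l) (x i) (x j)) \<longlonglongrightarrow> km x i j"
proof (intro AE_finite_allI I)
  fix i j assume ij: "i \<in> I" "j \<in> I"
  show "AE x in PiM I (\<lambda>_. \<nu>). (\<lambda>l. Kc (Fs l) (x i) (x j)) \<longlonglongrightarrow> km x i j"
  proof (cases "i = j")
    case True
    then show ?thesis using AE_PiM_single[OF I ij(1) diag_lim] by (simp add: km_def)
  next
    case False
    then show ?thesis using AE_PiM_pair[OF I ij False off_lim] by (simp add: km_def)
  qed
qed

lemma psd_Kc: "finite I \<Longrightarrow> pd 0 I (\<lambda>i j. Kc (Fs l) (x i) (x j))"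
  unfolding Kc_def
  by (rule psd_pullback[of "cells (Fs l)" I avg "\<lambda>i. cell (Fs l) (x i)", OF _ _ psd_avg])
     (use fam_cells[OF Fs] in auto)

lemma AE_psd_km:
  assumes I: "finite I"
  shows "AE x in PiM I (\<lambda>_. \<nu>). pd 0 I (km x)"
  using AE_km_lim[OF I]
proof eventually_elim
  case (elim x)
  show ?case
    by (rule psd_limit[of I "\<lambda>l i j. Kc (Fs l) (x i) (x j)"]) (use elim psd_Kc[OF I] in auto)
qed

lemma AE_fdet_lim:
  assumes I: "finite I"
  shows "AE x in PiM I (\<lambda>_. \<nu>). (\<lambda>l. fdet I (\<lambda>i j. Kc (Fs l) (x i) (x j))) \<longlonglongrightarrow> fdet I (km x)"
  using AE_km_lim[OF I] by eventually_elim (rule tendsto_fdet[OF I], blast)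

lemma AE_fdet_km_eq_0:
  assumes rk: "minors_vanish N (sets \<nu>) kk" and I: "finite I" "N < card I"
  shows "AE x in PiM I (\<lambda>_. \<nu>). fdet I (km x) = 0"
  using AE_fdet_lim[OF I(1)]
proof eventually_elim
  case (elim x)
  obtain e where e: "bij_betw e {..<card I} I"
    using ex_bij_betw_nat_finite[OF I(1)] by (auto simp: lessThan_atLeast0)
  have avg: "minors_vanish N (sets \<nu>) avg"
  proof -
    have "avg = (\<lambda>a b. inverse (w a) * kk a b * inverse (w b))"
      by (auto simp: avg_def fun_eq_iff field_simps)
    then show ?thesis using minors_vanish_scale[OF rk] by simp
  qed
  have "fdet I (\<lambda>i j. Kc (Fs l) (x i) (x j)) = 0" for l
  proof -
    have "fdet {..<card I} (\<lambda>a b. avg (cell (Fs l) (x (e a))) (cell (Fs l) (x (e b)))) = 0"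
      using avg[unfolded minors_vanish_def, rule_format, of "card I" "\<lambda>a. cell (Fs l) (x (e a))"] I fam_cells(3)[OF Fs] by auto
    then show ?thesis by (simp add: fdet_reindex[OF e] Kc_def)
  qed
  then show ?case using elim by (simp add: LIMSEQ_const_iff)
qed

text \<open>The integrand is constant on products of cells, so the integral is the sum of the minors
  of \<open>Mc\<close> over all \<open>n\<close>-tuples of cells, to which
  \<open>sum_tuple_minors_le\<close> applies. The cell masses are exactly the normalising factors in
  \<open>Mc\<close>.\<close>

lemma fdet_Kc_integral_le:
  assumes rk: "minors_vanish N (sets \<nu>) kk"
  shows "(\<integral>\<^sup>+x. ennreal (fdet {..<n} (\<lambda>i j. Kc (Fs l) (x i) (x j))) \<partial>PiM {..<n} (\<lambda>_. \<nu>)) \<le> ennreal (\<Prod>j<n. real (N - j))"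
proof -
  interpret S: product_sigma_finite "\<lambda>_. \<nu>" by (rule product_sigma_finite_const)
  let ?F = "Fs l" let ?C = "cells (Fs l)" and ?I = "{..<n}"
  note F = Fs[of l] and C = fam_cells[OF Fs[of l]]
  let ?T = "?I \<rightarrow>\<^sub>E ?C"
  have fT: "finite ?T" using C by (intro finite_PiE) auto
  let ?c = "\<lambda>f. fdet ?I (\<lambda>a b. avg (f a) (f b))"
  have c0: "0 \<le> ?c f" if "f \<in> ?T" for f
  proof (rule fdet_nonneg)
    show "pd 0 ?I (\<lambda>a b. avg (f a) (f b))"
      by (rule psd_pullback[of ?C ?I avg f, OF _ _ psd_avg]) (use C that in auto)
  qed simp
  have eq: "ennreal (fdet ?I (\<lambda>i j. Kc ?F (x i) (x j))) = (\<Sum>f\<in>?T. ennreal (?c f) * (\<Prod>a\<in>?I. indicator (f a) (x a)))" for x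
  proof -
    let ?f = "restrict (\<lambda>a. cell ?F (x a)) ?I"
    have fm: "?f \<in> ?T" by auto
    have "(\<Prod>a\<in>?I. indicator (f a) (x a)) = (if f = ?f then 1 else 0 :: ennreal)" if "f \<in> ?T" for f
    proof (cases "f = ?f")
      case True
      then show ?thesis by (auto intro!: prod.neutral)
    next
      case False
      have "\<exists>a\<in>?I. f a \<noteq> cell ?F (x a)"
      proof (rule ccontr)
        assume "\<not> (\<exists>a\<in>?I. f a \<noteq> cell ?F (x a))"
        then have "f = ?f" by (intro PiE_ext[OF that fm]) simp
        with False show False by blast
      qed
      then obtain a where a: "a \<in> ?I" "f a \<noteq> cell ?F (x a)" by blast
      have fa: "f a \<in> ?C" using that a by auto
      have "x a \<notin> f a" unfolding mem_cells_iff[OF fa] using a(2) by (rule not_sym)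
      then have "(\<Prod>a\<in>?I. indicator (f a) (x a)) = (0 :: ennreal)"
        using a by (intro prod_zero bexI[of _ a]) auto
      then show ?thesis using False by simp
    qed
    then have "(\<Sum>f\<in>?T. ennreal (?c f) * (\<Prod>a\<in>?I. indicator (f a) (x a))) = (\<Sum>f\<in>?T. if f = ?f then ennreal (?c f) else 0)"
      by (intro sum.cong) auto
    also have "\<dots> = ennreal (?c ?f)" using fT fm by simp
    also have "?c ?f = fdet ?I (\<lambda>i j. Kc ?F (x i) (x j))"
      by (rule fdet_cong) (simp add: Kc_def)
    finally show ?thesis ..
  qed
  have ind: "(\<lambda>x. \<Prod>a\<in>?I. indicator (f a) (x a) :: ennreal) \<in> borel_measurable (PiM ?I (\<lambda>_. \<nu>))" if "f \<in> ?T" for f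
  proof (rule borel_measurable_prod_ennreal)
    fix a assume a: "a \<in> ?I"
    then have [measurable]: "f a \<in> sets \<nu>" using that C by auto
    show "(\<lambda>x. indicator (f a) (x a) :: ennreal) \<in> borel_measurable (PiM ?I (\<lambda>_. \<nu>))"
      using a by measurable
  qed
  have "(\<integral>\<^sup>+x. ennreal (fdet ?I (\<lambda>i j. Kc ?F (x i) (x j))) \<partial>PiM ?I (\<lambda>_. \<nu>))
      = (\<Sum>f\<in>?T. \<integral>\<^sup>+x. ennreal (?c f) * (\<Prod>a\<in>?I. indicator (f a) (x a)) \<partial>PiM ?I (\<lambda>_. \<nu>))"
    unfolding eq using ind by (intro nn_integral_sum) auto
  also have "\<dots> = (\<Sum>f\<in>?T. ennreal (fdet ?I (\<lambda>a b. Mc (f a) (f b))))"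
  proof (intro sum.cong refl)
    fix f assume f: "f \<in> ?T"
    have fa: "f a \<in> sets \<nu>" if "a \<in> ?I" for a using f that C by auto
    have "(\<integral>\<^sup>+x. ennreal (?c f) * (\<Prod>a\<in>?I. indicator (f a) (x a)) \<partial>PiM ?I (\<lambda>_. \<nu>)) = ennreal (?c f) * (\<integral>\<^sup>+x. (\<Prod>a\<in>?I. indicator (f a) (x a)) \<partial>PiM ?I (\<lambda>_. \<nu>))"
      using ind[OF f] by (simp add: nn_integral_cmult)
    also have "(\<integral>\<^sup>+x. (\<Prod>a\<in>?I. indicator (f a) (x a)) \<partial>PiM ?I (\<lambda>_. \<nu>)) = (\<Prod>a\<in>?I. \<integral>\<^sup>+y. indicator (f a) y \<partial>\<nu>)"
      by (rule S.product_nn_integral_prod) (use fa in auto)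
    also have "\<dots> = (\<Prod>a\<in>?I. emeasure \<nu> (f a))"
      by (intro prod.cong) (use fa in auto)
    also have "(\<Prod>a\<in>?I. emeasure \<nu> (f a)) = ennreal (\<Prod>a\<in>?I. w (f a))"
      by (simp add: emeasure_eq_measure prod_ennreal)
    also have "ennreal (?c f) * ennreal (\<Prod>a\<in>?I. w (f a)) = ennreal ((\<Prod>a\<in>?I. w (f a)) * ?c f)"
      using c0[OF f] by (simp add: ennreal_mult prod_nonneg mult.commute)
    also have "(\<Prod>a\<in>?I. w (f a)) * ?c f = fdet ?I (\<lambda>a b. Mc (f a) (f b))"
      unfolding Mc_def by (subst fdet_scale) (simp_all add: prod_power_distrib)
    finally show "(\<integral>\<^sup>+x. ennreal (?c f) * (\<Prod>a\<in>?I. indicator (f a) (x a)) \<partial>PiM ?I (\<lambda>_. \<nu>)) = ennreal (fdet ?I (\<lambda>a b. Mc (f a) (f b)))" .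
  qed
  also have "\<dots> = ennreal (\<Sum>f\<in>?T. fdet ?I (\<lambda>a b. Mc (f a) (f b)))"
  proof (rule sum_ennreal)
    fix f assume f: "f \<in> ?T"
    show "0 \<le> fdet ?I (\<lambda>a b. Mc (f a) (f b))"
      by (intro fdet_nonneg psd_pullback[of ?C ?I Mc f, OF _ _ psd_Mc[OF F]]) (use C f in auto)
  qed
  also have "\<dots> \<le> ennreal (\<Prod>j<n. real (N - j))"
  proof (intro ennreal_leI sum_tuple_minors_le C psd_Mc psd_idm_Mc F)
    have "avg = (\<lambda>a b. inverse (w a) * kk a b * inverse (w b))"
      by (auto simp: avg_def fun_eq_iff field_simps)
    then have "minors_vanish N (sets \<nu>) avg" using minors_vanish_scale[OF rk] by simp
    then have "minors_vanish N (sets \<nu>) Mc" unfolding Mc_def by (rule minors_vanish_scale)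
    then show "minors_vanish N ?C Mc" by (rule minors_vanish_subset) (use C in auto)
  qed
  finally show ?thesis .
qed

lemma fdet_measurable:
  assumes I: "finite I" and A: "\<And>i j. i \<in> I \<Longrightarrow> j \<in> I \<Longrightarrow> (\<lambda>x. A x i j) \<in> borel_measurable M"
  shows "(\<lambda>x. fdet I (A x) :: real) \<in> borel_measurable M"
  unfolding fdet_def
  by (intro borel_measurable_sum borel_measurable_times borel_measurable_const borel_measurable_prod A)
     (auto simp: permutes_in_image)

lemma K_measurable_PiM:
  assumes "i \<in> I" "j \<in> I"
  shows "(\<lambda>x. K (x i) (x j)) \<in> borel_measurable (PiM I (\<lambda>_. \<nu>))"
proof -
  note K_meas[measurable]
  have "(\<lambda>x. (x i, x j)) \<in> measurable (PiM I (\<lambda>_. \<nu>)) \<nu>2" using assms by measurable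
  from measurable_compose[OF this K_meas] show ?thesis by simp
qed

lemma km_measurable:
  assumes "i \<in> I" "j \<in> I"
  shows "(\<lambda>x. km x i j) \<in> borel_measurable (PiM I (\<lambda>_. \<nu>))"
  using assms K_measurable_PiM[OF assms] measurable_compose[OF measurable_component_singleton[OF assms(1)] d_meas]
  by (cases "i = j") (simp_all add: km_def)

lemma fdet_km_measurable: "finite I \<Longrightarrow> (\<lambda>x. fdet I (km x)) \<in> borel_measurable (PiM I (\<lambda>_. \<nu>))"
  by (intro fdet_measurable km_measurable)

text \<open>Fatou transfers the bound from the averaged kernels.\<close>

lemma fdet_km_integral_le:
  assumes rk: "minors_vanish N (sets \<nu>) kk"
  shows "(\<integral>\<^sup>+x. ennreal (fdet {..<n} (km x)) \<partial>PiM {..<n} (\<lambda>_. \<nu>)) \<le> ennreal (\<Prod>j<n. real (N - j))"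
proof -
  let ?f = "\<lambda>l x. ennreal (fdet {..<n} (\<lambda>i j. Kc (Fs l) (x i) (x j)))"
  let ?P = "PiM {..<n} (\<lambda>_. \<nu>)"
  have m: "?f l \<in> borel_measurable ?P" for l
  proof -
    have "(\<lambda>x. Kc (Fs l) (x i) (x j)) \<in> borel_measurable ?P" if "i \<in> {..<n}" "j \<in> {..<n}" for i j
    proof -
      have "(\<lambda>x. (x i, x j)) \<in> measurable ?P \<nu>2" using that by measurable
      from measurable_compose[OF this Kc_measurable2[OF Fs, of l]] show ?thesis by simp
    qed
    then show ?thesis by (intro measurable_compose[OF fdet_measurable]) auto
  qed
  have "(\<integral>\<^sup>+x. ennreal (fdet {..<n} (km x)) \<partial>?P) = (\<integral>\<^sup>+x. liminf (\<lambda>l. ?f l x) \<partial>?P)"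
  proof (rule nn_integral_cong_AE)
    show "AE x in ?P. ennreal (fdet {..<n} (km x)) = liminf (\<lambda>l. ?f l x)"
      using AE_fdet_lim[OF finite_lessThan[of n]]
      by eventually_elim (auto intro!: lim_imp_Liminf[symmetric] tendsto_ennrealI)
  qed
  also have "\<dots> \<le> liminf (\<lambda>l. \<integral>\<^sup>+x. ?f l x \<partial>?P)"
    by (rule nn_integral_liminf) (rule m)
  also have "\<dots> \<le> liminf (\<lambda>l::nat. ennreal (\<Prod>j<n. real (N - j)))"
    by (intro Liminf_mono always_eventually allI fdet_Kc_integral_le rk)
  also have "\<dots> = ennreal (\<Prod>j<n. real (N - j))" by (rule Liminf_const) simp
  finally show ?thesis .
qed

end

section \<open>The diagonal of the kernel dominates the canonical diagonal\<close>

lemma fdet_diag_const: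
  fixes a b :: real
  assumes S: "finite S"
  shows "fdet S (\<lambda>i j. if i = j then a else b) = (a - b) ^ card S + real (card S) * (b * (a - b) ^ (card S - 1))"
proof -
  let ?c = "a - b"
  have "fdet S (\<lambda>i j. if i = j then a else b) = fdet S (\<lambda>i j. b + (if i = j then ?c else 0))"
    by (rule fdet_cong) auto
  also have "\<dots> = (\<Sum>U\<in>Pow S. fdet U (\<lambda>i j. b) * (\<Prod>i\<in>S - U. ?c))"
    by (rule fdet_add_diag[OF S])
  \<comment> \<open>A constant matrix has rank at most one, so only minors of size 0 and 1 survive
    in the expansion.\<close>
  also have "\<dots> = (\<Sum>U\<in>insert {} ((\<lambda>i. {i}) ` S). fdet U (\<lambda>i j. b) * (\<Prod>i\<in>S - U. ?c))"
  proof (rule sum.mono_neutral_right)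
    show "\<forall>U\<in>Pow S - insert {} ((\<lambda>i. {i}) ` S). fdet U (\<lambda>i j. b) * (\<Prod>i\<in>S - U. ?c) = 0"
    proof
      fix U assume U: "U \<in> Pow S - insert {} ((\<lambda>i. {i}) ` S)"
      then obtain i where i: "i \<in> U" by auto
      have "U \<noteq> {i}" using U i by auto
      then obtain j where j: "j \<in> U" "j \<noteq> i" using i by blast
      have fU: "finite U" using U S finite_subset by auto
      have "fdet U (\<lambda>i j. b) = 0"
      proof (rule fdet_kernel[OF fU _ i])
        fix r
        have "(\<Sum>s\<in>U. b * (if s = i then 1 else if s = j then - 1 else 0)) = (\<Sum>s\<in>{i, j}. b * (if s = i then 1 else if s = j then - 1 else 0))"
          using i j fU by (intro sum.mono_neutral_right) auto
        then show "(\<Sum>s\<in>U. b * (if s = i then 1 else if s = j then - 1 else 0)) = 0"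
          using j by simp
      qed simp
      then show "fdet U (\<lambda>i j. b) * (\<Prod>i\<in>S - U. ?c) = 0" by simp
    qed
  qed (use S in auto)
  also have "\<dots> = ?c ^ card S + (\<Sum>i\<in>S. b * ?c ^ (card S - 1))"
  proof -
    have 1: "fdet {i} (\<lambda>i j. b) = b" for i :: 'a
      using fdet_insert_unit_row[of "{}" i "\<lambda>i j. b"] by simp
    have "(\<Sum>U\<in>(\<lambda>i. {i}) ` S. fdet U (\<lambda>i j. b) * (\<Prod>i\<in>S - U. ?c)) = (\<Sum>i\<in>S. b * ?c ^ (card S - 1))"
      using S by (subst sum.reindex) (auto simp: 1 intro!: sum.cong)
    moreover have "{} \<notin> (\<lambda>i. {i}) ` S" by auto
    ultimately show ?thesis using S by simp
  qed
  finally show ?thesis by (simp add: mult_ac)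
qed

lemma fdet_near:
  assumes S: "finite S" and e: "e > 0"
  shows "\<exists>\<delta>>0. \<forall>B. (\<forall>i\<in>S. \<forall>j\<in>S. \<bar>B i j - A i j\<bar> < \<delta>) \<longrightarrow> \<bar>fdet S B - fdet S A\<bar> < e"
proof (rule ccontr)
  assume neg: "\<not> ?thesis"
  have "\<exists>B. (\<forall>i\<in>S. \<forall>j\<in>S. \<bar>B i j - A i j\<bar> < inverse (real (Suc n))) \<and> e \<le> \<bar>fdet S B - fdet S A\<bar>" for n
  proof -
    have "inverse (real (Suc n)) > 0" by simp
    then show ?thesis using neg not_less by blast
  qed
  then obtain B where B: "\<And>n i j. i \<in> S \<Longrightarrow> j \<in> S \<Longrightarrow> \<bar>B n i j - A i j\<bar> < inverse (real (Suc n))"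
    "\<And>n. e \<le> \<bar>fdet S (B n) - fdet S A\<bar>" by metis
  have "(\<lambda>n. B n i j) \<longlonglongrightarrow> A i j" if "i \<in> S" "j \<in> S" for i j
    by (rule LIM_zero_cancel, rule Lim_null_comparison[OF always_eventually LIMSEQ_inverse_real_of_nat])
       (use B(1)[OF that] in \<open>auto intro: less_imp_le\<close>)
  then have "(\<lambda>n. fdet S (B n)) \<longlonglongrightarrow> fdet S A" by (rule tendsto_fdet[OF S])
  then have "(\<lambda>n. \<bar>fdet S (B n) - fdet S A\<bar>) \<longlonglongrightarrow> 0" by (intro tendsto_rabs_zero LIM_zero)
  from LIMSEQ_le_const[OF this, of e] B(2) have "e \<le> 0" by auto
  with e show False by simp
qed

text \<open>Otherwise every point of \<open>E\<close> has a basic open neighbourhood of its value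
  with null preimage in \<open>E\<close>, and countably many of these preimages would cover
  \<open>E\<close>.\<close>

lemma ex_essential_value:
  fixes f :: "'b \<Rightarrow> real \<times> real"
  assumes f: "f \<in> borel_measurable M" and E: "E \<in> sets M" "E \<notin> null_sets M"
  shows "\<exists>x\<in>E. \<forall>\<delta>>0. {y\<in>E. dist (f y) (f x) < \<delta>} \<notin> null_sets M"
proof (rule ccontr)
  assume "\<not> ?thesis"
  then have *: "\<forall>x\<in>E. \<exists>\<delta>>0. {y\<in>E. dist (f y) (f x) < \<delta>} \<in> null_sets M" by blast
  obtain \<B> :: "(real \<times> real) set set" where \<B>: "countable \<B>" "\<And>C. C \<in> \<B> \<Longrightarrow> open C"
    "\<And>S. open S \<Longrightarrow> \<exists>U. U \<subseteq> \<B> \<and> S = \<Union>U"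
    using univ_second_countable by metis
  let ?\<N> = "{C \<in> \<B>. {y\<in>E. f y \<in> C} \<in> null_sets M}"
  have "E \<subseteq> (\<Union>C\<in>?\<N>. {y\<in>E. f y \<in> C})"
  proof
    fix x assume x: "x \<in> E"
    then obtain \<delta> where \<delta>: "\<delta> > 0" "{y\<in>E. dist (f y) (f x) < \<delta>} \<in> null_sets M" using * by blast
    obtain U where U: "U \<subseteq> \<B>" "ball (f x) \<delta> = \<Union>U" using \<B>(3)[OF open_ball] by metis
    have "f x \<in> \<Union>U" using U(2) \<delta>(1) by (metis centre_in_ball)
    then obtain C where C: "C \<in> U" "f x \<in> C" by blast
    have "C \<subseteq> ball (f x) \<delta>" using C U by auto
    then have "{y\<in>E. f y \<in> C} \<subseteq> {y\<in>E. dist (f y) (f x) < \<delta>}" by (auto simp: dist_commute)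
    moreover have "{y\<in>E. f y \<in> C} \<in> sets M"
    proof -
      have "f -` C \<inter> space M \<in> sets M" using f \<B>(2) C U by (intro measurable_sets) auto
      then have "E \<inter> (f -` C \<inter> space M) \<in> sets M" using E(1) by auto
      moreover have "E \<inter> (f -` C \<inter> space M) = {y\<in>E. f y \<in> C}" using E(1) sets.sets_into_space by auto
      ultimately show ?thesis by simp
    qed
    ultimately have "{y\<in>E. f y \<in> C} \<in> null_sets M" using \<delta>(2) null_sets_subset by blast
    then show "x \<in> (\<Union>C\<in>?\<N>. {y\<in>E. f y \<in> C})" using C U x by auto
  qed
  moreover have "(\<Union>C\<in>?\<N>. {y\<in>E. f y \<in> C}) \<in> null_sets M"
    using \<B>(1) by (intro null_sets_UN') auto
  ultimately show False using E null_sets_subset by blast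
qed

context kernel_limit
begin

text \<open>The squared distance between the feature vectors of $x$ and $y$, when the kernel is read as an inner product of features.\<close>

definition gap :: "'a \<Rightarrow> 'a \<Rightarrow> real" where
  "gap x y = d x + d y - 2 * K x y"

lemma gap_measurable: "(\<lambda>z. gap (fst z) (snd z)) \<in> borel_measurable \<nu>2"
  unfolding gap_def
  using K_meas measurable_compose[OF measurable_fst d_meas] measurable_compose[OF measurable_snd d_meas]
  by (intro borel_measurable_diff borel_measurable_add borel_measurable_times) auto

lemma gap_bd: "\<bar>gap x y\<bar> \<le> 4 * k"
  using d_bd[of x] d_bd[of y] K_bd[of x y] unfolding gap_def by linarith

definition good :: "'a \<Rightarrow> 'a \<Rightarrow> bool" where
  "good x y \<longleftrightarrow> (\<lambda>l. Kc (Fs l) x y) \<longlonglongrightarrow> K x y \<and> (\<lambda>l. Kc (Fs l) x x) \<longlonglongrightarrow> d x \<and> (\<lambda>l. Kc (Fs l) y y) \<longlonglongrightarrow> d y"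

lemma AE_good: "AE z in \<nu>2. good (fst z) (snd z)"
  using off_lim AE_fst_snd[OF diag_lim] unfolding good_def by eventually_elim auto

text \<open>The points are indexed by 0, 1, 2 so that they may coincide or share a cell.\<close>

lemma Kc_gap_triangle:
  fixes x y z :: 'a
  defines "s \<equiv> \<lambda>l y z. Kc (Fs l) y y + Kc (Fs l) z z - 2 * Kc (Fs l) y z"
  shows "0 \<le> s l y z" "s l y z \<le> 2 * s l x y + 2 * s l x z"
proof -
  let ?p = "\<lambda>i. if i = (0::nat) then x else if i = 1 then y else z"
  let ?I = "{0, 1, 2 :: nat}"
  have psd: "pd 0 ?I (\<lambda>i j. Kc (Fs l) (?p i) (?p j))" by (rule psd_Kc) simp
  have sym: "Kc (Fs l) a b = Kc (Fs l) b a" for a b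
    unfolding Kc_def by (intro avg_sym fam_cells(3)[OF Fs])
  show "0 \<le> s l y z"
    using psd_bil[OF psd, of "\<lambda>i. if i = 0 then 0 else if i = 1 then 1 else -1"]
    by (simp add: bil_def s_def sym[of z y])
  show "s l y z \<le> 2 * s l x y + 2 * s l x z"
    \<comment> \<open>The vector (-2, 1, 1) expresses that $|(y-x)+(z-x)|^2$ is nonnegative in
      feature space, which is the parallelogram law.\<close>
    using psd_bil[OF psd, of "\<lambda>i. if i = 0 then -2 else 1"]
    by (simp add: bil_def s_def sym[of z y] sym[of y x] sym[of z x])
qed

lemma good_gap_nonneg: "good x y \<Longrightarrow> 0 \<le> gap x y"
proof -
  assume "good x y"
  then have "(\<lambda>l. Kc (Fs l) x x + Kc (Fs l) y y - 2 * Kc (Fs l) x y) \<longlonglongrightarrow> gap x y"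
    unfolding good_def gap_def by (intro tendsto_intros) auto
  then show ?thesis by (rule LIMSEQ_le_const) (use Kc_gap_triangle(1) in auto)
qed

lemma good_gap_triangle: "good x y \<Longrightarrow> good x z \<Longrightarrow> good y z \<Longrightarrow> gap y z \<le> 2 * gap x y + 2 * gap x z"
proof -
  assume "good x y" "good x z" "good y z"
  then have 1: "(\<lambda>l. Kc (Fs l) y y + Kc (Fs l) z z - 2 * Kc (Fs l) y z) \<longlonglongrightarrow> gap y z"
    and 2: "(\<lambda>l. 2 * (Kc (Fs l) x x + Kc (Fs l) y y - 2 * Kc (Fs l) x y) + 2 * (Kc (Fs l) x x + Kc (Fs l) z z - 2 * Kc (Fs l) x z))
      \<longlonglongrightarrow> 2 * gap x y + 2 * gap x z"
    unfolding good_def gap_def by (auto intro!: tendsto_intros)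
  show ?thesis by (rule LIMSEQ_le[OF 1 2]) (use Kc_gap_triangle(2) in auto)
qed

text \<open>Averaged over pairs in a common cell, the gap integrates to twice the integral of
  \<open>d\<close> minus twice the trace, and the traces converge to that integral. Hence the
  features are nearly constant on most cells.\<close>

lemma gap_average_tendsto_0:
  "(\<lambda>l. \<Sum>Q\<in>cells (Fs l). (\<integral>z. indicator Q (fst z) * indicator Q (snd z) * gap (fst z) (snd z) \<partial>\<nu>2) / w Q) \<longlonglongrightarrow> 0"
proof -
  have eq: "(\<Sum>Q\<in>cells (Fs l). (\<integral>z. indicator Q (fst z) * indicator Q (snd z) * gap (fst z) (snd z) \<partial>\<nu>2) / w Q)
      = 2 * (\<integral>x. d x \<partial>\<nu>) - 2 * tr (Fs l)" for l
  proof -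
    let ?C = "cells (Fs l)"
    note C = fam_cells[OF Fs[of l]]
    have id: "integrable \<nu> d" using d_meas d_bd by (intro integrable_bounded[of _ k]) auto
    have dQ: "integrable \<nu> (\<lambda>x. indicator Q x * d x)" if "Q \<in> sets \<nu>" for Q
      using d_meas d_bd that k_nonneg by (intro integrable_bounded[of _ k]) (auto simp: indicator_def)
    have one: "(\<integral>z. indicator Q (fst z) * indicator Q (snd z) * gap (fst z) (snd z) \<partial>\<nu>2) / w Q
        = 2 * (\<integral>x. indicator Q x * d x \<partial>\<nu>) - 2 * (w Q * avg Q Q)" if Q: "Q \<in> ?C" for Q
    proof -
      have Qm: "Q \<in> sets \<nu>" using C Q by auto
      have i1: "integrable \<nu>2 (\<lambda>z. (indicator Q (fst z) * d (fst z)) * indicator Q (snd z))"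
        and i2: "integrable \<nu>2 (\<lambda>z. indicator Q (fst z) * (indicator Q (snd z) * d (snd z)))"
        using Qm measurable_compose[OF measurable_fst d_meas] measurable_compose[OF measurable_snd d_meas] d_bd k_nonneg
        by (intro integrable_bounded2[of _ k] borel_measurable_times borel_measurable_indicator'; auto simp: indicator_def)+
      have e1: "(\<integral>z. (indicator Q (fst z) * d (fst z)) * indicator Q (snd z) \<partial>\<nu>2) = (\<integral>x. indicator Q x * d x \<partial>\<nu>) * w Q"
        using integral_fst'[OF i1] Qm space_UNIV by simp
      have e2: "(\<integral>z. indicator Q (fst z) * (indicator Q (snd z) * d (snd z)) \<partial>\<nu>2) = w Q * (\<integral>x. indicator Q x * d x \<partial>\<nu>)"
        using integral_fst'[OF i2] Qm space_UNIV by simp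
      have "(\<integral>z. indicator Q (fst z) * indicator Q (snd z) * gap (fst z) (snd z) \<partial>\<nu>2)
         = (\<integral>z. (indicator Q (fst z) * d (fst z)) * indicator Q (snd z) + indicator Q (fst z) * (indicator Q (snd z) * d (snd z))
            - 2 * (indicator Q (fst z) * indicator Q (snd z) * K (fst z) (snd z)) \<partial>\<nu>2)"
        by (intro Bochner_Integration.integral_cong refl) (simp add: gap_def algebra_simps)
      also have "\<dots> = 2 * (w Q * (\<integral>x. indicator Q x * d x \<partial>\<nu>)) - 2 * kk Q Q"
        using i1 i2 Qm by (simp add: e1 e2 kk_def)
      finally have I: "(\<integral>z. indicator Q (fst z) * indicator Q (snd z) * gap (fst z) (snd z) \<partial>\<nu>2)
        = 2 * (w Q * (\<integral>x. indicator Q x * d x \<partial>\<nu>)) - 2 * kk Q Q" .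
      show ?thesis
      proof (cases "w Q = 0")
        case True
        have "\<bar>\<integral>x. indicator Q x * d x \<partial>\<nu>\<bar> \<le> (\<integral>x. \<bar>indicator Q x * d x\<bar> \<partial>\<nu>)" by (rule integral_abs_bound)
        also have "\<dots> \<le> (\<integral>x. k * indicator Q x \<partial>\<nu>)"
        proof (intro integral_mono)
          have "integrable \<nu> (indicator Q :: 'a \<Rightarrow> real)"
            using Qm by (intro integrable_bounded[of _ 1]) (auto simp: indicator_def)
          then show "integrable \<nu> (\<lambda>x. k * indicator Q x)" by simp
        qed (use dQ[OF Qm] d_bd in \<open>auto simp: indicator_def\<close>)
        also have "\<dots> = 0" using True Qm space_UNIV by simp
        finally show ?thesis using True by simp
      next
        case False
        then show ?thesis unfolding I by (simp add: avg_def field_simps)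
      qed
    qed
    have "(\<Sum>Q\<in>?C. \<integral>x. indicator Q x * d x \<partial>\<nu>) = (\<integral>x. (\<Sum>Q\<in>?C. indicator Q x * d x) \<partial>\<nu>)"
      using dQ C by (intro Bochner_Integration.integral_sum[symmetric]) auto
    also have "\<dots> = (\<integral>x. d x \<partial>\<nu>)"
      using cell_fun_eq[OF Fs[of l], of "\<lambda>_. 1"] by (simp add: sum_distrib_right[symmetric])
    finally have "(\<Sum>Q\<in>?C. \<integral>x. indicator Q x * d x \<partial>\<nu>) = (\<integral>x. d x \<partial>\<nu>)" .
    moreover have "(\<Sum>Q\<in>?C. w Q * avg Q Q) = tr (Fs l)"
      unfolding tr_def Kc_def by (rule integral_cell_fun(2)[OF Fs[of l], of "\<lambda>Q. avg Q Q", symmetric])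
    ultimately show ?thesis
      by (simp add: one sum_subtractf flip: sum_distrib_left)
  qed
  have "(\<lambda>l. 2 * (\<integral>x. d x \<partial>\<nu>) - 2 * tr (Fs l)) \<longlonglongrightarrow> 2 * (\<integral>x. d x \<partial>\<nu>) - 2 * (\<integral>x. d x \<partial>\<nu>)"
    by (intro tendsto_intros tr_lim)
  then show ?thesis unfolding eq by simp
qed

lemma not_AE_gap_ge:
  assumes E: "E \<in> sets \<nu>" "w E > 0" and \<delta>: "\<delta> > 0"
  shows "\<not> (AE z in \<nu>2. fst z \<in> E \<longrightarrow> snd z \<in> E \<longrightarrow> \<delta> \<le> gap (fst z) (snd z))"
proof
  assume AE: "AE z in \<nu>2. fst z \<in> E \<longrightarrow> snd z \<in> E \<longrightarrow> \<delta> \<le> gap (fst z) (snd z)"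
  have UNIV: "w E \<le> w UNIV" using finite_measure_mono[of E UNIV] E(1) space_UNIV sets.top[of \<nu>] by auto
  have low: "\<delta> * (w E)\<^sup>2 / w UNIV \<le> (\<Sum>Q\<in>cells (Fs l). (\<integral>z. indicator Q (fst z) * indicator Q (snd z) * gap (fst z) (snd z) \<partial>\<nu>2) / w Q)" for l
  proof -
    let ?C = "cells (Fs l)"
    note C = fam_cells[OF Fs[of l]]
    have wle: "w (Q \<inter> E) \<le> w Q" if "Q \<in> ?C" for Q using C that by (intro finite_measure_mono) auto
    have sumw: "(\<Sum>Q\<in>?C. w Q) = w UNIV"
      using integral_cell_fun(2)[OF Fs[of l], of "\<lambda>_. 1"] space_UNIV by simp
    have sumE: "(\<Sum>Q\<in>?C. w (Q \<inter> E)) = w E"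
    proof -
      have "w E = w (\<Union>Q\<in>?C. Q \<inter> E)" by (rule arg_cong[where f = w]) (auto, metis cell_self)
      also have "\<dots> = (\<Sum>Q\<in>?C. w (Q \<inter> E))"
      proof (rule finite_measure_finite_Union)
        show "disjoint_family_on (\<lambda>Q. Q \<inter> E) ?C"
          unfolding disjoint_family_on_def
        proof (intro ballI impI)
          fix P Q assume PQ: "P \<in> ?C" "Q \<in> ?C" "P \<noteq> Q"
          have "x \<notin> Q" if "x \<in> P" for x using that PQ mem_cells_iff[of P "Fs l" x] mem_cells_iff[of Q "Fs l" x] by metis
          then show "P \<inter> E \<inter> (Q \<inter> E) = {}" by auto
        qed
      qed (use C E in auto)
      finally show ?thesis ..
    qed
    have "(w E)\<^sup>2 = (\<Sum>Q\<in>?C. (w (Q \<inter> E) / sqrt (w Q)) * sqrt (w Q))\<^sup>2"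
      unfolding sumE[symmetric]
    proof (intro arg_cong[where f = "\<lambda>x. x\<^sup>2"] sum.cong refl)
      fix Q assume "Q \<in> ?C"
      from wle[OF this] show "w (Q \<inter> E) = w (Q \<inter> E) / sqrt (w Q) * sqrt (w Q)"
        by (cases "w Q = 0") (auto simp: measure_le_0_iff)
    qed
    also have "\<dots> \<le> (\<Sum>Q\<in>?C. (w (Q \<inter> E) / sqrt (w Q))\<^sup>2) * (\<Sum>Q\<in>?C. (sqrt (w Q))\<^sup>2)"
      by (rule Cauchy_Schwarz_ineq_sum)
    finally have CS: "(w E)\<^sup>2 / w UNIV \<le> (\<Sum>Q\<in>?C. (w (Q \<inter> E))\<^sup>2 / w Q)"
      using E(2) UNIV by (simp add: sumw power_divide divide_le_eq)
    have "\<delta> * (w E)\<^sup>2 / w UNIV \<le> \<delta> * (\<Sum>Q\<in>?C. (w (Q \<inter> E))\<^sup>2 / w Q)"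
      using mult_left_mono[OF CS, of \<delta>] \<delta> by simp
    also have "\<dots> = (\<Sum>Q\<in>?C. \<delta> * (w (Q \<inter> E))\<^sup>2 / w Q)" by (simp add: sum_distrib_left)
    also have "\<dots> \<le> (\<Sum>Q\<in>?C. (\<integral>z. indicator Q (fst z) * indicator Q (snd z) * gap (fst z) (snd z) \<partial>\<nu>2) / w Q)"
    proof (intro sum_mono divide_right_mono measure_nonneg)
      fix Q assume "Q \<in> ?C"
      then have Q: "Q \<in> sets \<nu>" using C by auto
      have "\<delta> * (w (Q \<inter> E))\<^sup>2 = (\<integral>z. \<delta> * (indicator (Q \<inter> E) (fst z) * indicator (Q \<inter> E) (snd z)) \<partial>\<nu>2)"
        using Q E by (simp add: measure_rect power2_eq_square)
      also have "\<dots> \<le> (\<integral>z. indicator Q (fst z) * indicator Q (snd z) * gap (fst z) (snd z) \<partial>\<nu>2)"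
      proof (rule integral_mono_AE)
        show "integrable \<nu>2 (\<lambda>z. \<delta> * (indicator (Q \<inter> E) (fst z) * indicator (Q \<inter> E) (snd z)))"
          using Q E by (intro Bochner_Integration.integrable_mult_right integrable_rect) auto
        note Q[measurable] gap_measurable[measurable]
        have "(\<lambda>z. indicator Q (fst z) * indicator Q (snd z) * gap (fst z) (snd z)) \<in> borel_measurable \<nu>2" by measurable
        then show "integrable \<nu>2 (\<lambda>z. indicator Q (fst z) * indicator Q (snd z) * gap (fst z) (snd z))"
          using gap_bd k_nonneg by (intro integrable_bounded2[of _ "4 * k"]) (auto simp: indicator_def)
        show "AE z in \<nu>2. \<delta> * (indicator (Q \<inter> E) (fst z) * indicator (Q \<inter> E) (snd z)) \<le> indicator Q (fst z) * indicator Q (snd z) * gap (fst z) (snd z)"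
          using AE AE_good by eventually_elim (auto simp: indicator_def dest: good_gap_nonneg)
      qed
      finally show "\<delta> * (w (Q \<inter> E))\<^sup>2 \<le> (\<integral>z. indicator Q (fst z) * indicator Q (snd z) * gap (fst z) (snd z) \<partial>\<nu>2)" .
    qed
    finally show ?thesis .
  qed
  have "\<delta> * (w E)\<^sup>2 / w UNIV \<le> 0"
    by (rule LIMSEQ_le_const[OF gap_average_tendsto_0]) (use low in auto)
  moreover have "\<delta> * (w E)\<^sup>2 / w UNIV > 0"
    using E(2) UNIV \<delta> by (intro divide_pos_pos mult_pos_pos) auto
  ultimately show False by simp
qed

lemma ex_nearly_constant_subset:
  assumes E: "E \<in> sets \<nu>" "w E > 0" and \<delta>: "\<delta> > 0"
  shows "\<exists>E'\<in>sets \<nu>. E' \<subseteq> E \<and> w E' > 0 \<and> (AE z in \<nu>2. fst z \<in> E' \<longrightarrow> snd z \<in> E' \<longrightarrow> 0 \<le> gap (fst z) (snd z) \<and> gap (fst z) (snd z) < \<delta>)"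
proof -
  note gap_measurable[measurable] E(1)[measurable]
  \<comment> \<open>The subset will consist of points with gap below \<open>\<delta> / 4\<close> to
    a fixed \<open>x\<close>; the factors 2 in the triangle inequality bring their mutual gaps to at
    most \<open>\<delta>\<close>.\<close>
  let ?P = "\<lambda>z. fst z \<in> E \<longrightarrow> snd z \<in> E \<longrightarrow> \<delta> / 4 \<le> gap (fst z) (snd z)"
  have "{z \<in> space \<nu>2. ?P z} \<in> sets \<nu>2" by measurable
  moreover have "\<not> (AE z in \<nu>2. ?P z)" using not_AE_gap_ge[OF E, of "\<delta> / 4"] \<delta> by simp
  ultimately have np: "\<not> (AE x in \<nu>. AE y in \<nu>. ?P (x, y))" using AE_pair_measure[of ?P] by blast
  have g: "AE x in \<nu>. AE y in \<nu>. good x y"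
    using AE_pair[OF AE_good] by simp
  obtain x where x: "AE y in \<nu>. good x y" "\<not> (AE y in \<nu>. ?P (x, y))"
  proof (rule ccontr)
    assume "\<not> thesis"
    then have "(AE y in \<nu>. good x y) \<Longrightarrow> (AE y in \<nu>. ?P (x, y))" for x using that by blast
    then have "AE x in \<nu>. AE y in \<nu>. ?P (x, y)" by (rule eventually_mono[OF g])
    with np show False by (rule notE)
  qed
  let ?E = "{y \<in> E. gap x y < \<delta> / 4}"
  have xs: "x \<in> E" using x(2) by (rule contrapos_np) simp
  have gm: "gap x \<in> borel_measurable \<nu>"
    using measurable_compose[OF measurable_Pair1'[of x \<nu> \<nu>] gap_measurable] space_UNIV by simp
  have "?E = E \<inter> {y \<in> space \<nu>. gap x y < \<delta> / 4}" using space_UNIV by auto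
  also have "\<dots> \<in> sets \<nu>" using gm by measurable
  finally have Em: "?E \<in> sets \<nu>" .
  have "w ?E \<noteq> 0"
  proof
    assume "w ?E = 0"
    then have "?E \<in> null_sets \<nu>" using Em by (auto simp: null_sets_def emeasure_eq_measure)
    then have "AE y in \<nu>. y \<notin> ?E" by (rule AE_not_in)
    then have "AE y in \<nu>. ?P (x, y)" by eventually_elim (auto simp: not_less)
    then show False using x(2) by simp
  qed
  then have "w ?E > 0" by (simp add: zero_less_measure_iff)
  moreover have "AE z in \<nu>2. fst z \<in> ?E \<longrightarrow> snd z \<in> ?E \<longrightarrow> 0 \<le> gap (fst z) (snd z) \<and> gap (fst z) (snd z) < \<delta>"
    using AE_good AE_fst_snd[OF x(1)]
  proof eventually_elim
    case (elim z)
    then show ?case using good_gap_triangle[of x "fst z" "snd z"] good_gap_nonneg by fastforce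
  qed
  ultimately show ?thesis using Em by (intro bexI[of _ ?E]) auto
qed

text \<open>The $n$-th factorial moment of the number of points in $E$.\<close>

definition fmom :: "nat \<Rightarrow> 'a set \<Rightarrow> ennreal" where
  "fmom n E = (\<integral>\<^sup>+x. (\<Prod>i<n. indicator E (x i)) * ennreal (fdet {..<n} (\<lambda>i j. K (x i) (x j))) \<partial>PiM {..<n} (\<lambda>_. \<nu>))"

lemma indicator_prod_measurable:
  assumes "E \<in> sets \<nu>"
  shows "(\<lambda>x. \<Prod>i<n. indicator E (x i) :: ennreal) \<in> borel_measurable (PiM {..<n} (\<lambda>_. \<nu>))"
proof (rule borel_measurable_prod_ennreal)
  note assms[measurable]
  fix i assume "i \<in> {..<n}"
  then show "(\<lambda>x. indicator E (x i) :: ennreal) \<in> borel_measurable (PiM {..<n} (\<lambda>_. \<nu>))" by measurable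
qed

lemma fmom_eq_0:
  assumes "AE x in PiM {..<n} (\<lambda>_. \<nu>). (\<forall>i<n. x i \<in> E) \<longrightarrow> fdet {..<n} (\<lambda>i j. K (x i) (x j)) \<le> 0"
  shows "fmom n E = 0"
proof -
  have "fmom n E = (\<integral>\<^sup>+x. 0 \<partial>PiM {..<n} (\<lambda>_. \<nu>))"
    unfolding fmom_def
  proof (rule nn_integral_cong_AE)
    show "AE x in PiM {..<n} (\<lambda>_. \<nu>). (\<Prod>i<n. indicator E (x i)) * ennreal (fdet {..<n} (\<lambda>i j. K (x i) (x j))) = 0"
      using assms
    proof eventually_elim
      case (elim x)
      show ?case
      proof (cases "\<forall>i<n. x i \<in> E")
        case True
        then show ?thesis using elim by (simp add: ennreal_neg)
      next
        case False
        then have "(\<Prod>i<n. indicator E (x i)) = (0::ennreal)" by (intro prod_zero) (auto simp: indicator_def)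
        then show ?thesis by simp
      qed
    qed
  qed
  then show ?thesis by simp
qed

lemma fmom_neq_0:
  assumes E: "E \<in> sets \<nu>" "w E > 0"
    and pos: "AE x in PiM {..<n} (\<lambda>_. \<nu>). (\<forall>i<n. x i \<in> E) \<longrightarrow> 0 < fdet {..<n} (\<lambda>i j. K (x i) (x j))"
  shows "fmom n E \<noteq> 0"
proof
  interpret S: product_sigma_finite "\<lambda>_. \<nu>" by (rule product_sigma_finite_const)
  let ?P = "PiM {..<n} (\<lambda>_. \<nu>)"
  assume "fmom n E = 0"
  moreover have "(\<lambda>x. (\<Prod>i<n. indicator E (x i)) * ennreal (fdet {..<n} (\<lambda>i j. K (x i) (x j)))) \<in> borel_measurable ?P"
    by (intro borel_measurable_times_ennreal indicator_prod_measurable E(1) measurable_compose[OF fdet_measurable measurable_ennreal] K_measurable_PiM) auto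
  ultimately have "AE x in ?P. (\<Prod>i<n. indicator E (x i)) * ennreal (fdet {..<n} (\<lambda>i j. K (x i) (x j))) = 0"
    unfolding fmom_def by (simp add: nn_integral_0_iff_AE)
  then have "AE x in ?P. (\<Prod>i<n. indicator E (x i)) = (0::ennreal)"
    using pos
  proof eventually_elim
    case (elim x)
    show ?case
    proof (cases "\<forall>i<n. x i \<in> E")
      case True
      then show ?thesis using elim by (simp add: ennreal_eq_0_iff)
    next
      case False
      then show ?thesis by (intro prod_zero) (auto simp: indicator_def)
    qed
  qed
  then have "(\<integral>\<^sup>+x. (\<Prod>i<n. indicator E (x i)) \<partial>?P) = 0"
    using indicator_prod_measurable[OF E(1), of n] by (simp add: nn_integral_0_iff_AE)
  moreover have "(\<integral>\<^sup>+x. (\<Prod>i<n. indicator E (x i)) \<partial>?P) = (\<Prod>i<n. \<integral>\<^sup>+y. indicator E y \<partial>\<nu>)"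
    by (rule S.product_nn_integral_prod) (use E in auto)
  moreover have "(\<Prod>i<n. \<integral>\<^sup>+y. indicator E y \<partial>\<nu>) = ennreal (w E) ^ n" using E by (simp add: emeasure_eq_measure)
  ultimately have "ennreal (w E) ^ n = 0" by (simp only:)
  then show False using E(2) by (simp add: ennreal_eq_0_iff)
qed

text \<open>If the claim fails, there is a nonnull set on which $K(x,x)$ is close to some
  \<open>a\<close> and all other entries are close to some \<open>b > a\<close>. On it the
  intensities of orders 1, 2, 3 are close to $a$, $(a-b)(a+b)$ and $(a-b)^2(a+2b)$. Whatever
  \<open>a\<close> is, a negative one is followed by a positive one of higher order. Negative
  intensities are cut off at 0 by \<open>ennreal\<close>, so a vanishing factorial moment would
  precede a nonvanishing one.\<close>

lemma diag_dominates:
  assumes H1: "\<And>E. E \<in> sets \<nu> \<Longrightarrow> fmom 1 E = 0 \<Longrightarrow> fmom 2 E = 0"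
    and H2: "\<And>E. E \<in> sets \<nu> \<Longrightarrow> fmom 2 E = 0 \<Longrightarrow> fmom 3 E = 0"
    and Kd[measurable]: "(\<lambda>x. K x x) \<in> borel_measurable \<nu>"
  shows "AE x in \<nu>. d x \<le> K x x"
proof (rule ccontr)
  note d_meas[measurable]
  let ?E = "{x \<in> space \<nu>. K x x < d x}"
  assume neg: "\<not> (AE x in \<nu>. d x \<le> K x x)"
  have Em: "?E \<in> sets \<nu>" by measurable
  have "?E \<notin> null_sets \<nu>"
  proof
    assume "?E \<in> null_sets \<nu>"
    then have "AE x in \<nu>. x \<notin> ?E" by (rule AE_not_in)
    then have "AE x in \<nu>. d x \<le> K x x" by eventually_elim (use space_UNIV in \<open>auto simp: not_less\<close>)
    with neg show False by simp
  qed
  moreover have fm: "(\<lambda>x. (K x x, d x)) \<in> borel_measurable \<nu>" by measurable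
  ultimately obtain x0 where x0: "x0 \<in> ?E" and near: "\<And>\<delta>. \<delta> > 0 \<Longrightarrow> {y\<in>?E. dist (K y y, d y) (K x0 x0, d x0) < \<delta>} \<notin> null_sets \<nu>"
    using ex_essential_value[OF fm Em] by blast
  define a where "a = K x0 x0"
  define b where "b = d x0"
  have ab: "a < b" "0 \<le> b" using x0 d_bd by (auto simp: a_def b_def)
  let ?A = "\<lambda>i j. if i = j then a else b"
  have Adet: "fdet {..<n} (?A :: nat \<Rightarrow> nat \<Rightarrow> real) = (a - b) ^ n + real n * (b * (a - b) ^ (n - 1))" for n
    by (subst fdet_diag_const) auto
  have step: "\<exists>E\<in>sets \<nu>. w E > 0 \<and> (\<forall>n\<in>{1,2,3::nat}. AE x in PiM {..<n} (\<lambda>_. \<nu>). (\<forall>i<n. x i \<in> E) \<longrightarrow>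
      \<bar>fdet {..<n} (\<lambda>i j. K (x i) (x j)) - fdet {..<n} ?A\<bar> < e)" if e: "e > 0" for e :: real
  proof -
    let ?near = "\<lambda>n \<delta>. \<delta> > 0 \<and> (\<forall>B::nat \<Rightarrow> nat \<Rightarrow> real. (\<forall>i\<in>{..<n}. \<forall>j\<in>{..<n}. \<bar>B i j - ?A i j\<bar> < \<delta>) \<longrightarrow> \<bar>fdet {..<n} B - fdet {..<n} ?A\<bar> < e)"
    have "\<forall>n::nat. \<exists>\<delta>. ?near n \<delta>"
      by (intro allI fdet_near[OF finite_lessThan e])
    from choice[OF this] obtain \<delta>' where near': "\<forall>n. ?near n (\<delta>' n)" by (elim exE)
    have \<delta>': "\<delta>' n > 0"
      "(\<And>i j. i < n \<Longrightarrow> j < n \<Longrightarrow> \<bar>B i j - ?A i j\<bar> < \<delta>' n) \<Longrightarrow> \<bar>fdet {..<n} B - fdet {..<n} ?A\<bar> < e"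
      for n and B :: "nat \<Rightarrow> nat \<Rightarrow> real"
      using near'[rule_format, of n] by auto
    define \<delta> where "\<delta> = Min {\<delta>' 1, \<delta>' 2, \<delta>' 3} / 2"
    have \<delta>: "\<delta> > 0" using \<delta>'(1) by (simp add: \<delta>_def)
    have \<delta>le: "2 * \<delta> \<le> \<delta>' n" if "n \<in> {1,2,3}" for n using that by (auto simp: \<delta>_def min_def)
    let ?N = "{y\<in>?E. dist (K y y, d y) (K x0 x0, d x0) < \<delta>}"
    have Nm: "?N \<in> sets \<nu>"
    proof -
      have "?N = {y \<in> space \<nu>. K y y < d y \<and> dist (K y y, d y) (K x0 x0, d x0) < \<delta>}" by auto
      also have "\<dots> \<in> sets \<nu>" unfolding dist_Pair_Pair by measurable
      finally show ?thesis .
    qed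
    have "w ?N > 0" using near[OF \<delta>] Nm by (auto simp: null_sets_def emeasure_eq_measure zero_less_measure_iff)
    then obtain E where E: "E \<in> sets \<nu>" "E \<subseteq> ?N" "w E > 0"
      and g: "AE z in \<nu>2. fst z \<in> E \<longrightarrow> snd z \<in> E \<longrightarrow> 0 \<le> gap (fst z) (snd z) \<and> gap (fst z) (snd z) < \<delta>"
      using ex_nearly_constant_subset[OF Nm _ \<delta>] by blast
    have pt: "\<bar>K y y - a\<bar> < \<delta>" "\<bar>d y - b\<bar> < \<delta>" if "y \<in> E" for y
    proof -
      have "dist (K y y, d y) (a, b) < \<delta>" using that E(2) by (auto simp: a_def b_def)
      then show "\<bar>K y y - a\<bar> < \<delta>" "\<bar>d y - b\<bar> < \<delta>"
        using dist_fst_le[of "(K y y, d y)" "(a, b)"] dist_snd_le[of "(K y y, d y)" "(a, b)"] by (auto simp: dist_real_def)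
    qed
    have "AE x in PiM {..<n} (\<lambda>_. \<nu>). (\<forall>i<n. x i \<in> E) \<longrightarrow> \<bar>fdet {..<n} (\<lambda>i j. K (x i) (x j)) - fdet {..<n} ?A\<bar> < e"
      if n: "n \<in> {1,2,3}" for n :: nat
    proof -
      have "AE x in PiM {..<n} (\<lambda>_. \<nu>). \<forall>i\<in>{..<n}. \<forall>j\<in>{..<n}. i \<noteq> j \<longrightarrow> x i \<in> E \<longrightarrow> x j \<in> E \<longrightarrow> 0 \<le> gap (x i) (x j) \<and> gap (x i) (x j) < \<delta>"
      proof (intro AE_finite_allI finite_lessThan)
        fix i j assume ij: "i \<in> {..<n}" "j \<in> {..<n}"
        show "AE x in PiM {..<n} (\<lambda>_. \<nu>). i \<noteq> j \<longrightarrow> x i \<in> E \<longrightarrow> x j \<in> E \<longrightarrow> 0 \<le> gap (x i) (x j) \<and> gap (x i) (x j) < \<delta>"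
          using AE_PiM_pair[OF finite_lessThan ij _ g] by (cases "i = j") auto
      qed
      then show ?thesis
      proof (eventually_elim, intro impI)
        fix x assume gx: "\<forall>i\<in>{..<n}. \<forall>j\<in>{..<n}. i \<noteq> j \<longrightarrow> x i \<in> E \<longrightarrow> x j \<in> E \<longrightarrow> 0 \<le> gap (x i) (x j) \<and> gap (x i) (x j) < \<delta>"
          and xE: "\<forall>i<n. x i \<in> E"
        show "\<bar>fdet {..<n} (\<lambda>i j. K (x i) (x j)) - fdet {..<n} ?A\<bar> < e"
        proof (rule \<delta>'(2))
          fix i j assume ij: "i < n" "j < n"
          show "\<bar>K (x i) (x j) - ?A i j\<bar> < \<delta>' n"
          proof (cases "i = j")
            case True
            then show ?thesis using pt(1)[of "x i"] xE ij \<delta>le[OF n] \<delta> by auto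
          next
            case False
            then have "0 \<le> gap (x i) (x j)" "gap (x i) (x j) < \<delta>" using gx xE ij by auto
            then have "\<bar>K (x i) (x j) - b\<bar> < 2 * \<delta>"
              using pt(2)[of "x i"] pt(2)[of "x j"] xE ij unfolding gap_def by (auto simp: abs_if split: if_splits)
            then show ?thesis using False \<delta>le[OF n] by simp
          qed
        qed
      qed
    qed
    then show ?thesis using E by blast
  qed
  have neg0: False if n: "n \<in> {1,2,3}" "n' \<in> {1,2,3}" and dn: "fdet {..<n} (?A :: nat \<Rightarrow> nat \<Rightarrow> real) < 0"
    and dn': "0 < fdet {..<n'} (?A :: nat \<Rightarrow> nat \<Rightarrow> real)"
    and imp: "\<And>E. E \<in> sets \<nu> \<Longrightarrow> fmom n E = 0 \<Longrightarrow> fmom n' E = 0" for n n'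
  proof -
    let ?e = "min (- fdet {..<n} (?A :: nat \<Rightarrow> nat \<Rightarrow> real)) (fdet {..<n'} (?A :: nat \<Rightarrow> nat \<Rightarrow> real))"
    have "?e > 0" using dn dn' by simp
    from step[OF this] obtain E where E: "E \<in> sets \<nu>" "w E > 0"
      and A: "\<forall>n\<in>{1,2,3::nat}. AE x in PiM {..<n} (\<lambda>_. \<nu>). (\<forall>i<n. x i \<in> E) \<longrightarrow> \<bar>fdet {..<n} (\<lambda>i j. K (x i) (x j)) - fdet {..<n} ?A\<bar> < ?e"
      by blast
    have "fmom n E = 0"
      by (rule fmom_eq_0) (use A[rule_format, OF n(1)] in \<open>eventually_elim, auto\<close>)
    moreover have "fmom n' E \<noteq> 0"
      by (rule fmom_neq_0[OF E]) (use A[rule_format, OF n(2)] in \<open>eventually_elim, auto\<close>)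
    ultimately show False using imp E(1) by blast
  qed
  have D1: "fdet {..<1} (?A :: nat \<Rightarrow> nat \<Rightarrow> real) = a"
    and D2: "fdet {..<2} (?A :: nat \<Rightarrow> nat \<Rightarrow> real) = (a - b) * (a + b)"
    and D3: "fdet {..<3} (?A :: nat \<Rightarrow> nat \<Rightarrow> real) = (a - b)\<^sup>2 * (a + 2 * b)"
    unfolding Adet by (simp_all add: power2_eq_square power3_eq_cube algebra_simps)
  consider "a < - b" | "- b \<le> a" "a < 0" | "0 \<le> a" by linarith
  then show False
  proof cases
    case 1
    then have "0 < (a - b) * (a + b)" using ab by (intro mult_neg_neg) auto
    then show False by (intro neg0[of 1 2] H1) (use 1 ab D1 D2 in auto)
  next
    case 2
    then have "0 < (a - b)\<^sup>2 * (a + 2 * b)" using ab by (intro mult_pos_pos) auto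
    then show False by (intro neg0[of 1 3] H2 H1) (use 2 D1 D3 in auto)
  next
    case 3
    then have "0 < (a - b)\<^sup>2 * (a + 2 * b)" "(a - b) * (a + b) < 0" using ab
      by (auto intro!: mult_pos_pos mult_neg_pos)
    then show False by (intro neg0[of 2 3] H2) (use D2 D3 in auto)
  qed
qed

text \<open>At an atom the pair (\<open>a\<close>, \<open>a\<close>) has positive mass, so the
  off-diagonal convergence holds there too and must give the same limit as the diagonal one.\<close>

lemma AE_diag_eq_at_atom:
  assumes Kd: "(\<lambda>x. K x x) \<in> borel_measurable \<nu>" and a: "{a} \<in> sets \<nu>" "w {a} > 0"
  shows "d a = K a a"
proof -
  have eq: "{(a, a)} = {a} \<times> {a}" by auto
  have "{(a, a)} \<in> sets \<nu>2" unfolding eq using a by (intro pair_measureI)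
  moreover have "emeasure \<nu>2 {(a, a)} \<noteq> 0"
    using a unfolding eq by (simp only: emeasure_pair_measure_Times) (simp add: emeasure_eq_measure)
  moreover obtain N where N: "{z \<in> space \<nu>2. \<not> good (fst z) (snd z)} \<subseteq> N" "N \<in> null_sets \<nu>2"
    using AE_good unfolding eventually_ae_filter by auto
  ultimately have "(a, a) \<notin> N"
    using emeasure_mono[of "{(a, a)}" N \<nu>2] by (auto simp: null_sets_def)
  then have "good a a"
    using subsetD[OF N(1), of "(a, a)"] space_UNIV by (auto simp: space_pair_measure)
  then show ?thesis unfolding good_def by (auto dest: LIMSEQ_unique)
qed

end

section \<open>Multi-affine expansions and cell moments\<close>

lemma sum_Pow_Un:
  assumes "A \<inter> B = {}"
  shows "(\<Sum>Z\<in>Pow (A \<union> B). f Z) = (\<Sum>V\<in>Pow A. \<Sum>W\<in>Pow B. f (V \<union> W))"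
proof -
  have "bij_betw (\<lambda>(V, W). V \<union> W) (Pow A \<times> Pow B) (Pow (A \<union> B))"
    by (rule bij_betw_byWitness[where f' = "\<lambda>Z. (Z \<inter> A, Z \<inter> B)"]) (use assms in auto)
  from sum.reindex_bij_betw[OF this, of f] show ?thesis
    by (simp add: sum.cartesian_product case_prod_unfold)
qed

lemma sum_Pow_superset:
  assumes "R \<subseteq> I"
  shows "(\<Sum>S\<in>{S \<in> Pow I. R \<subseteq> S}. f S) = (\<Sum>W\<in>Pow (I - R). f (R \<union> W))"
proof -
  have "bij_betw (\<lambda>W. R \<union> W) (Pow (I - R)) {S \<in> Pow I. R \<subseteq> S}"
    by (rule bij_betw_byWitness[where f' = "\<lambda>S. S - R"]) (use assms in auto)
  from sum.reindex_bij_betw[OF this, of f] show ?thesis by simp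
qed

lemma prod_one_minus_expand:
  fixes y :: "'i \<Rightarrow> real"
  assumes "finite A"
  shows "(\<Prod>i\<in>A. 1 - y i) = (\<Sum>W\<in>Pow A. (- 1) ^ card W * (\<Prod>i\<in>W. y i))"
proof -
  have "(\<Prod>i\<in>A. - y i + 1) = (\<Sum>W\<in>Pow A. (\<Prod>i\<in>W. - y i) * (\<Prod>i\<in>A - W. 1))"
    by (rule prod_add[OF assms])
  also have "\<dots> = (\<Sum>W\<in>Pow A. (- 1) ^ card W * (\<Prod>i\<in>W. y i))"
  proof (intro sum.cong refl)
    fix W
    have "(\<Prod>i\<in>W. - y i) = (\<Prod>i\<in>W. - 1 * y i)" by simp
    also have "\<dots> = (- 1) ^ card W * (\<Prod>i\<in>W. y i)" by (subst prod.distrib) simp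
    finally show "(\<Prod>i\<in>W. - y i) * (\<Prod>i\<in>A - W. 1) = (- 1) ^ card W * (\<Prod>i\<in>W. y i)" by simp
  qed
  finally show ?thesis by (simp add: add.commute)
qed

definition mlin :: "('i set \<Rightarrow> real) \<Rightarrow> 'i set \<Rightarrow> ('i \<Rightarrow> real) \<Rightarrow> real" where
  "mlin \<phi> I y = (\<Sum>Z\<in>Pow I. \<phi> Z * ((\<Prod>i\<in>Z. y i) * (\<Prod>i\<in>I - Z. 1 - y i)))"

text \<open>Moebius inversion: the monomial coefficients of \<open>mlin\<close>.\<close>

definition mcoef :: "('i set \<Rightarrow> real) \<Rightarrow> 'i set \<Rightarrow> real" where
  "mcoef \<phi> S = (\<Sum>Z\<in>Pow S. \<phi> Z * (- 1) ^ card (S - Z))"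

text \<open>The monomial coefficients of the same polynomial after recentring the variables at
  \<open>\<gamma>\<close>.\<close>

definition shcoef :: "('i set \<Rightarrow> real) \<Rightarrow> 'i set \<Rightarrow> ('i \<Rightarrow> real) \<Rightarrow> 'i set \<Rightarrow> real" where
  "shcoef \<phi> I \<gamma> U = (\<Sum>S\<in>{S \<in> Pow I. U \<subseteq> S}. mcoef \<phi> S * (\<Prod>i\<in>S - U. \<gamma> i))"

lemma shcoef_eq:
  assumes I: "finite I" and U: "U \<subseteq> I"
  shows "shcoef \<phi> I \<gamma> U = (\<Sum>Z\<in>Pow I. \<phi> Z * ((- 1) ^ card (U - Z) * (\<Prod>i\<in>Z - U. \<gamma> i) * (\<Prod>i\<in>I - (U \<union> Z). 1 - \<gamma> i)))"
proof -
  have fin: "finite S" if "S \<subseteq> I" for S using that I finite_subset by auto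
  have "shcoef \<phi> I \<gamma> U = (\<Sum>S\<in>{S \<in> Pow I. U \<subseteq> S}. \<Sum>Z\<in>{Z \<in> Pow I. Z \<subseteq> S}. \<phi> Z * ((- 1) ^ card (S - Z) * (\<Prod>i\<in>S - U. \<gamma> i)))"
    unfolding shcoef_def mcoef_def sum_distrib_right
    by (intro sum.cong) (auto simp: mult.assoc)
  also have "\<dots> = (\<Sum>Z\<in>Pow I. \<Sum>S\<in>{S \<in> {S \<in> Pow I. U \<subseteq> S}. Z \<subseteq> S}. \<phi> Z * ((- 1) ^ card (S - Z) * (\<Prod>i\<in>S - U. \<gamma> i)))"
    by (rule sum.swap_restrict) (use I in auto)
  also have "\<dots> = (\<Sum>Z\<in>Pow I. \<phi> Z * ((- 1) ^ card (U - Z) * (\<Prod>i\<in>Z - U. \<gamma> i) * (\<Prod>i\<in>I - (U \<union> Z). 1 - \<gamma> i)))"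
  proof (intro sum.cong refl)
    fix Z assume Z: "Z \<in> Pow I"
    have "(\<Sum>S\<in>{S \<in> {S \<in> Pow I. U \<subseteq> S}. Z \<subseteq> S}. \<phi> Z * ((- 1) ^ card (S - Z) * (\<Prod>i\<in>S - U. \<gamma> i)))
        = (\<Sum>S\<in>{S \<in> Pow I. U \<union> Z \<subseteq> S}. \<phi> Z * ((- 1) ^ card (S - Z) * (\<Prod>i\<in>S - U. \<gamma> i)))"
      by (rule sum.cong) auto
    also have "\<dots> = (\<Sum>W\<in>Pow (I - (U \<union> Z)). \<phi> Z * ((- 1) ^ card ((U \<union> Z) \<union> W - Z) * (\<Prod>i\<in>(U \<union> Z) \<union> W - U. \<gamma> i)))"
      by (rule sum_Pow_superset) (use U Z in auto)
    also have "\<dots> = (\<Sum>W\<in>Pow (I - (U \<union> Z)). (\<phi> Z * ((- 1) ^ card (U - Z) * (\<Prod>i\<in>Z - U. \<gamma> i))) * ((- 1) ^ card W * (\<Prod>i\<in>W. \<gamma> i)))"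
    proof (intro sum.cong refl)
      fix W assume W: "W \<in> Pow (I - (U \<union> Z))"
      have 1: "(U \<union> Z) \<union> W - Z = (U - Z) \<union> W" "(U \<union> Z) \<union> W - U = (Z - U) \<union> W" using W by auto
      have f: "finite (U - Z)" "finite (Z - U)" "finite W" using U Z W by (auto intro!: fin)
      have "card ((U - Z) \<union> W) = card (U - Z) + card W"
        using f W by (intro card_Un_disjoint) auto
      moreover have "(\<Prod>i\<in>(Z - U) \<union> W. \<gamma> i) = (\<Prod>i\<in>Z - U. \<gamma> i) * (\<Prod>i\<in>W. \<gamma> i)"
        using f W by (intro prod.union_disjoint) auto
      ultimately show "\<phi> Z * ((- 1) ^ card ((U \<union> Z) \<union> W - Z) * (\<Prod>i\<in>(U \<union> Z) \<union> W - U. \<gamma> i))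
        = (\<phi> Z * ((- 1) ^ card (U - Z) * (\<Prod>i\<in>Z - U. \<gamma> i))) * ((- 1) ^ card W * (\<Prod>i\<in>W. \<gamma> i))"
        unfolding 1 by (simp add: power_add)
    qed
    also have "\<dots> = (\<phi> Z * ((- 1) ^ card (U - Z) * (\<Prod>i\<in>Z - U. \<gamma> i))) * (\<Prod>i\<in>I - (U \<union> Z). 1 - \<gamma> i)"
      unfolding sum_distrib_left[symmetric] using I by (subst prod_one_minus_expand) auto
    finally show "(\<Sum>S\<in>{S \<in> {S \<in> Pow I. U \<subseteq> S}. Z \<subseteq> S}. \<phi> Z * ((- 1) ^ card (S - Z) * (\<Prod>i\<in>S - U. \<gamma> i)))
      = \<phi> Z * ((- 1) ^ card (U - Z) * (\<Prod>i\<in>Z - U. \<gamma> i) * (\<Prod>i\<in>I - (U \<union> Z). 1 - \<gamma> i))"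
      by (simp only: mult.assoc)
  qed
  finally show ?thesis .
qed

lemma mlin_expand:
  assumes "finite I"
  shows "mlin \<phi> I y = (\<Sum>S\<in>Pow I. mcoef \<phi> S * (\<Prod>i\<in>S. y i))"
  using shcoef_eq[OF assms, of "{}" \<phi> y] by (simp add: shcoef_def mlin_def Pow_def)

lemma mlin_01:
  assumes "finite I" "\<And>i. i \<in> I \<Longrightarrow> y i = 0 \<or> y i = 1"
  shows "mlin \<phi> I y = \<phi> {i \<in> I. y i = 1}"
proof -
  have "(\<Prod>i\<in>Z. y i) * (\<Prod>i\<in>I - Z. 1 - y i) = (if Z = {i \<in> I. y i = 1} then 1 else 0)" if Z: "Z \<in> Pow I" for Z
  proof (cases "Z = {i \<in> I. y i = 1}")
    case True
    then have "(\<Prod>i\<in>Z. y i) = 1" by (intro prod.neutral) auto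
    moreover have "(\<Prod>i\<in>I - Z. 1 - y i) = 1" using True assms(2) by (intro prod.neutral) auto
    ultimately show ?thesis using True by simp
  next
    case False
    then consider i where "i \<in> Z" "y i = 0" | i where "i \<in> I - Z" "y i = 1" using Z assms(2) by blast
    then have "(\<Prod>i\<in>Z. y i) = 0 \<or> (\<Prod>i\<in>I - Z. 1 - y i) = 0"
    proof cases
      case 1
      then have "(\<Prod>i\<in>Z. y i) = 0" using Z assms(1) finite_subset by (intro prod_zero bexI[of _ i]) auto
      then show ?thesis ..
    next
      case 2
      then have "(\<Prod>i\<in>I - Z. 1 - y i) = 0" using assms(1) by (intro prod_zero bexI[of _ i]) auto
      then show ?thesis ..
    qed
    then show ?thesis using False by auto
  qed
  then have "mlin \<phi> I y = (\<Sum>Z\<in>Pow I. if Z = {i \<in> I. y i = 1} then \<phi> Z else 0)"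
    unfolding mlin_def by (intro sum.cong) auto
  then show ?thesis using assms(1) by (simp add: sum.delta)
qed

lemma mlin_bound:
  assumes "finite I" "\<And>Z. \<bar>\<phi> Z\<bar> \<le> 1"
  shows "\<bar>mlin \<phi> I y\<bar> \<le> (\<Prod>i\<in>I. \<bar>y i\<bar> + \<bar>1 - y i\<bar>)"
proof -
  have "\<bar>mlin \<phi> I y\<bar> \<le> (\<Sum>Z\<in>Pow I. \<bar>\<phi> Z * ((\<Prod>i\<in>Z. y i) * (\<Prod>i\<in>I - Z. 1 - y i))\<bar>)"
    unfolding mlin_def by (rule sum_abs)
  also have "\<dots> \<le> (\<Sum>Z\<in>Pow I. (\<Prod>i\<in>Z. \<bar>y i\<bar>) * (\<Prod>i\<in>I - Z. \<bar>1 - y i\<bar>))"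
  proof (rule sum_mono)
    fix Z
    have "\<bar>\<phi> Z\<bar> * ((\<Prod>i\<in>Z. \<bar>y i\<bar>) * (\<Prod>i\<in>I - Z. \<bar>1 - y i\<bar>)) \<le> 1 * ((\<Prod>i\<in>Z. \<bar>y i\<bar>) * (\<Prod>i\<in>I - Z. \<bar>1 - y i\<bar>))"
      by (intro mult_right_mono assms mult_nonneg_nonneg prod_nonneg) auto
    then show "\<bar>\<phi> Z * ((\<Prod>i\<in>Z. y i) * (\<Prod>i\<in>I - Z. 1 - y i))\<bar> \<le> (\<Prod>i\<in>Z. \<bar>y i\<bar>) * (\<Prod>i\<in>I - Z. \<bar>1 - y i\<bar>)"
      by (simp add: abs_mult abs_prod)
  qed
  also have "\<dots> = (\<Prod>i\<in>I. \<bar>y i\<bar> + \<bar>1 - y i\<bar>)"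
    by (rule prod_add[OF assms(1), symmetric])
  finally show ?thesis .
qed

text \<open>In the closed form \<open>shcoef_eq\<close> the coordinates outside \<open>U\<close>
  carry Bernoulli weights with parameters \<open>\<gamma>\<close>, of total mass 1, while the part
  of \<open>Z\<close> inside \<open>U\<close> is free, which gives $2^{|U|}$. Summing over
  \<open>a\<close> before estimating makes the bound independent of the number of functions;
  positivity of the weights is where \<open>\<gamma> \<le> 1\<close> enters.\<close>

lemma sum_abs_shcoef_le:
  assumes I: "finite I" and U: "U \<subseteq> I" and \<gamma>: "\<And>i. i \<in> I \<Longrightarrow> 0 \<le> \<gamma> i" "\<And>i. i \<in> I \<Longrightarrow> \<gamma> i \<le> 1"
    and A: "finite A" and \<phi>: "\<And>a Z. a \<in> A \<Longrightarrow> 0 \<le> \<phi> a Z" "\<And>Z. (\<Sum>a\<in>A. \<phi> a Z) \<le> 1"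
  shows "(\<Sum>a\<in>A. \<bar>shcoef (\<phi> a) I \<gamma> U\<bar>) \<le> 2 ^ card U"
proof -
  let ?q = "\<lambda>Z. (\<Prod>i\<in>Z - U. \<gamma> i) * (\<Prod>i\<in>I - (U \<union> Z). 1 - \<gamma> i)"
  have q0: "0 \<le> ?q Z" if "Z \<in> Pow I" for Z
    using \<gamma> that by (intro mult_nonneg_nonneg prod_nonneg) auto
  have "(\<Sum>a\<in>A. \<bar>shcoef (\<phi> a) I \<gamma> U\<bar>) \<le> (\<Sum>a\<in>A. \<Sum>Z\<in>Pow I. \<phi> a Z * ?q Z)"
  proof (rule sum_mono)
    fix a assume a: "a \<in> A"
    have "\<bar>shcoef (\<phi> a) I \<gamma> U\<bar> \<le> (\<Sum>Z\<in>Pow I. \<bar>\<phi> a Z * ((- 1) ^ card (U - Z) * (\<Prod>i\<in>Z - U. \<gamma> i) * (\<Prod>i\<in>I - (U \<union> Z). 1 - \<gamma> i))\<bar>)"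
      unfolding shcoef_eq[OF I U] by (rule sum_abs)
    also have "\<dots> = (\<Sum>Z\<in>Pow I. \<phi> a Z * ?q Z)"
    proof (intro sum.cong refl)
      fix Z assume Z: "Z \<in> Pow I"
      have "\<bar>\<phi> a Z * ((- 1) ^ card (U - Z) * (\<Prod>i\<in>Z - U. \<gamma> i) * (\<Prod>i\<in>I - (U \<union> Z). 1 - \<gamma> i))\<bar> = \<bar>\<phi> a Z\<bar> * \<bar>?q Z\<bar>"
        by (simp add: abs_mult power_abs)
      then show "\<bar>\<phi> a Z * ((- 1) ^ card (U - Z) * (\<Prod>i\<in>Z - U. \<gamma> i) * (\<Prod>i\<in>I - (U \<union> Z). 1 - \<gamma> i))\<bar> = \<phi> a Z * ?q Z"
        using \<phi>(1)[OF a] q0[OF Z] by simp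
    qed
    finally show "\<bar>shcoef (\<phi> a) I \<gamma> U\<bar> \<le> (\<Sum>Z\<in>Pow I. \<phi> a Z * ?q Z)" .
  qed
  also have "\<dots> = (\<Sum>Z\<in>Pow I. (\<Sum>a\<in>A. \<phi> a Z) * ?q Z)"
    unfolding sum_distrib_right by (rule sum.swap)
  also have "\<dots> \<le> (\<Sum>Z\<in>Pow I. 1 * ?q Z)"
    by (intro sum_mono mult_right_mono \<phi> q0)
  also have "\<dots> = (\<Sum>Z\<in>Pow (U \<union> (I - U)). ?q Z)" using U by (simp add: Un_absorb1)
  also have "\<dots> = (\<Sum>V\<in>Pow U. \<Sum>W\<in>Pow (I - U). ?q (V \<union> W))" by (rule sum_Pow_Un) auto
  also have "\<dots> = (\<Sum>V\<in>Pow U. \<Sum>W\<in>Pow (I - U). (\<Prod>i\<in>W. \<gamma> i) * (\<Prod>i\<in>(I - U) - W. 1 - \<gamma> i))"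
    by (intro sum.cong refl arg_cong2[where f = "(*)"] prod.cong) auto
  also have "\<dots> = (\<Sum>V\<in>Pow U. \<Prod>i\<in>I - U. \<gamma> i + (1 - \<gamma> i))"
    using I by (intro sum.cong refl prod_add[symmetric]) auto
  also have "\<dots> = 2 ^ card U" using finite_subset[OF U I] by (simp add: card_Pow)
  finally show ?thesis .
qed

text \<open>Exchanging the finite sums collects, for each fixed pair of \<open>U\<close> and
  \<open>V\<close>, the terms of all larger \<open>S\<close> and \<open>T\<close> into recentred
  coefficients.\<close>

lemma sum_mcoef_shift:
  assumes I: "finite I" and J: "finite J"
  shows "(\<Sum>S\<in>Pow I. \<Sum>T\<in>Pow J. mcoef \<phi> S * mcoef \<psi> T * (\<Sum>U\<in>Pow S. \<Sum>V\<in>Pow T. D U V * ((\<Prod>i\<in>S - U. \<gamma> i) * (\<Prod>i\<in>T - V. \<gamma> i))))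
       = (\<Sum>U\<in>Pow I. \<Sum>V\<in>Pow J. shcoef \<phi> I \<gamma> U * shcoef \<psi> J \<gamma> V * D U V)"
proof -
  let ?a = "\<lambda>S U. mcoef \<phi> S * (\<Prod>i\<in>S - U. \<gamma> i)" and ?b = "\<lambda>T V. mcoef \<psi> T * (\<Prod>i\<in>T - V. \<gamma> i)"
  have sw: "(\<Sum>S\<in>Pow L. \<Sum>U\<in>Pow S. h S U) = (\<Sum>U\<in>Pow L. \<Sum>S\<in>{S \<in> Pow L. U \<subseteq> S}. h S U)"
    if "finite L" for L and h :: "'a set \<Rightarrow> 'a set \<Rightarrow> real"
  proof -
    have "(\<Sum>S\<in>Pow L. \<Sum>U\<in>Pow S. h S U) = (\<Sum>S\<in>Pow L. \<Sum>U\<in>{U \<in> Pow L. U \<subseteq> S}. h S U)"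
      by (intro sum.cong) auto
    also have "\<dots> = (\<Sum>U\<in>Pow L. \<Sum>S\<in>{S \<in> Pow L. U \<subseteq> S}. h S U)"
      by (rule sum.swap_restrict) (use that in auto)
    finally show ?thesis .
  qed
  have "(\<Sum>S\<in>Pow I. \<Sum>T\<in>Pow J. mcoef \<phi> S * mcoef \<psi> T * (\<Sum>U\<in>Pow S. \<Sum>V\<in>Pow T. D U V * ((\<Prod>i\<in>S - U. \<gamma> i) * (\<Prod>i\<in>T - V. \<gamma> i))))
      = (\<Sum>S\<in>Pow I. \<Sum>T\<in>Pow J. \<Sum>U\<in>Pow S. \<Sum>V\<in>Pow T. ?a S U * ?b T V * D U V)"
    by (simp add: sum_distrib_left mult_ac)
  also have "\<dots> = (\<Sum>S\<in>Pow I. \<Sum>U\<in>Pow S. \<Sum>T\<in>Pow J. \<Sum>V\<in>Pow T. ?a S U * ?b T V * D U V)"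
    by (rule sum.cong[OF refl], rule sum.swap)
  also have "\<dots> = (\<Sum>U\<in>Pow I. \<Sum>S\<in>{S \<in> Pow I. U \<subseteq> S}. \<Sum>V\<in>Pow J. \<Sum>T\<in>{T \<in> Pow J. V \<subseteq> T}. ?a S U * ?b T V * D U V)"
    by (simp only: sw[OF I] sw[OF J])
  also have "\<dots> = (\<Sum>U\<in>Pow I. \<Sum>V\<in>Pow J. \<Sum>S\<in>{S \<in> Pow I. U \<subseteq> S}. \<Sum>T\<in>{T \<in> Pow J. V \<subseteq> T}. ?a S U * ?b T V * D U V)"
    by (rule sum.cong[OF refl], rule sum.swap)
  also have "\<dots> = (\<Sum>U\<in>Pow I. \<Sum>V\<in>Pow J. shcoef \<phi> I \<gamma> U * shcoef \<psi> J \<gamma> V * D U V)"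
  proof (intro sum.cong refl)
    fix U V
    show "(\<Sum>S\<in>{S \<in> Pow I. U \<subseteq> S}. \<Sum>T\<in>{T \<in> Pow J. V \<subseteq> T}. ?a S U * ?b T V * D U V) = shcoef \<phi> I \<gamma> U * shcoef \<psi> J \<gamma> V * D U V"
      unfolding shcoef_def sum_product by (simp only: sum_distrib_right)
  qed
  finally show ?thesis .
qed

lemma sum_abs_shcoef_pairs_le:
  assumes I: "finite I" and J: "finite J" and \<gamma>: "\<And>i. i \<in> I \<union> J \<Longrightarrow> 0 \<le> \<gamma> i" "\<And>i. i \<in> I \<union> J \<Longrightarrow> \<gamma> i \<le> 1"
    and A: "finite A" "\<And>a Z. a \<in> A \<Longrightarrow> 0 \<le> \<phi> a Z" "\<And>Z. (\<Sum>a\<in>A. \<phi> a Z) \<le> 1"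
    and B: "finite B" "\<And>b Z. b \<in> B \<Longrightarrow> 0 \<le> \<psi> b Z" "\<And>Z. (\<Sum>b\<in>B. \<psi> b Z) \<le> 1"
  shows "(\<Sum>a\<in>A. \<Sum>b\<in>B. \<bar>\<Sum>U\<in>Pow I. \<Sum>V\<in>Pow J. shcoef (\<phi> a) I \<gamma> U * shcoef (\<psi> b) J \<gamma> V * D U V\<bar>)
    \<le> (\<Sum>U\<in>Pow I. \<Sum>V\<in>Pow J. 2 ^ card U * 2 ^ card V * \<bar>D U V\<bar>)"
proof -
  let ?f = "\<lambda>a U. \<bar>shcoef (\<phi> a) I \<gamma> U\<bar>" and ?g = "\<lambda>b V. \<bar>shcoef (\<psi> b) J \<gamma> V\<bar>"
  have "(\<Sum>a\<in>A. \<Sum>b\<in>B. \<bar>\<Sum>U\<in>Pow I. \<Sum>V\<in>Pow J. shcoef (\<phi> a) I \<gamma> U * shcoef (\<psi> b) J \<gamma> V * D U V\<bar>)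
     \<le> (\<Sum>a\<in>A. \<Sum>b\<in>B. \<Sum>U\<in>Pow I. \<Sum>V\<in>Pow J. ?f a U * ?g b V * \<bar>D U V\<bar>)"
    by (intro sum_mono order_trans[OF sum_abs] sum_mono) (simp add: abs_mult)
  also have "\<dots> = (\<Sum>a\<in>A. \<Sum>U\<in>Pow I. \<Sum>b\<in>B. \<Sum>V\<in>Pow J. ?f a U * ?g b V * \<bar>D U V\<bar>)"
    by (rule sum.cong[OF refl], rule sum.swap)
  also have "\<dots> = (\<Sum>U\<in>Pow I. \<Sum>a\<in>A. \<Sum>V\<in>Pow J. \<Sum>b\<in>B. ?f a U * ?g b V * \<bar>D U V\<bar>)"
    by (subst sum.swap, rule sum.cong[OF refl], rule sum.cong[OF refl], rule sum.swap)
  also have "\<dots> = (\<Sum>U\<in>Pow I. \<Sum>V\<in>Pow J. \<Sum>a\<in>A. \<Sum>b\<in>B. ?f a U * ?g b V * \<bar>D U V\<bar>)"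
    by (rule sum.cong[OF refl], rule sum.swap)
  also have "\<dots> = (\<Sum>U\<in>Pow I. \<Sum>V\<in>Pow J. (\<Sum>a\<in>A. ?f a U) * (\<Sum>b\<in>B. ?g b V) * \<bar>D U V\<bar>)"
    by (intro sum.cong refl, subst sum_product) (simp only: sum_distrib_right)
  also have "\<dots> \<le> (\<Sum>U\<in>Pow I. \<Sum>V\<in>Pow J. 2 ^ card U * 2 ^ card V * \<bar>D U V\<bar>)"
    by (intro sum_mono mult_right_mono mult_mono sum_abs_shcoef_le I J A B sum_nonneg) (use \<gamma> in auto)
  finally show ?thesis .
qed

lemma fdet_abs_le:
  assumes S: "finite S" and A: "\<And>i j. i \<in> S \<Longrightarrow> j \<in> S \<Longrightarrow> \<bar>A i j\<bar> \<le> k"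
  shows "\<bar>fdet S A\<bar> \<le> fact (card S) * k ^ card S"
proof -
  have "\<bar>fdet S A\<bar> \<le> (\<Sum>p | p permutes S. \<bar>of_int (sign p) * (\<Prod>i\<in>S. A i (p i))\<bar>)"
    unfolding fdet_def by (rule sum_abs)
  also have "\<dots> \<le> (\<Sum>p | p permutes S. k ^ card S)"
  proof (rule sum_mono)
    fix p assume p: "p \<in> {p. p permutes S}"
    have "\<bar>of_int (sign p) * (\<Prod>i\<in>S. A i (p i))\<bar> = (\<Prod>i\<in>S. \<bar>A i (p i)\<bar>)"
      by (simp add: abs_mult sign_def abs_prod)
    also have "\<dots> \<le> (\<Prod>i\<in>S. k)"
      using p by (intro prod_mono) (auto intro!: A simp: permutes_in_image)
    finally show "\<bar>of_int (sign p) * (\<Prod>i\<in>S. A i (p i))\<bar> \<le> k ^ card S" by simp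
  qed
  also have "\<dots> = fact (card S) * k ^ card S"
    using card_permutations[OF refl S] by simp
  finally show ?thesis .
qed

section \<open>Integrals over families of cells\<close>

context cell_space
begin

lemma finite_measure_PiM:
  assumes "finite I"
  shows "finite_measure (PiM I (\<lambda>_. \<nu>))"
proof
  interpret S: product_sigma_finite "\<lambda>_. \<nu>" by (rule product_sigma_finite_const)
  have "emeasure (PiM I (\<lambda>_. \<nu>)) (space (PiM I (\<lambda>_. \<nu>))) = (\<Prod>i\<in>I. emeasure \<nu> (space \<nu>))"
    unfolding space_PiM by (rule S.emeasure_PiM) (use assms in auto)
  then show "emeasure (PiM I (\<lambda>_. \<nu>)) (space (PiM I (\<lambda>_. \<nu>))) \<noteq> \<infinity>"
    by (simp add: emeasure_eq_measure ennreal_power)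
qed

lemma integrable_bounded_PiM:
  fixes f :: "('i \<Rightarrow> 'a) \<Rightarrow> real"
  assumes "finite I" "f \<in> borel_measurable (PiM I (\<lambda>_. \<nu>))" "\<And>x. \<bar>f x\<bar> \<le> B"
  shows "integrable (PiM I (\<lambda>_. \<nu>)) f"
  using assms by (intro finite_measure.integrable_const_bound[OF finite_measure_PiM, of _ _ B]) auto

text \<open>Integrands are defined on all functions, whereas product measures live on extensional
  ones. Dependence on the coordinates in \<open>U\<close> alone allows one formula to be integrated
  over different index sets.\<close>

definition local_on :: "'i set \<Rightarrow> (('i \<Rightarrow> 'a) \<Rightarrow> real) \<Rightarrow> bool" where
  "local_on U f \<longleftrightarrow> f \<in> borel_measurable (PiM U (\<lambda>_. \<nu>)) \<and> (\<exists>B. \<forall>x. \<bar>f x\<bar> \<le> B) \<and>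
     (\<forall>x y. (\<forall>i\<in>U. x i = y i) \<longrightarrow> f x = f y)"

lemma local_on_superset:
  assumes f: "local_on U f" and UV: "U \<subseteq> V"
  shows "local_on V f"
proof -
  have "(\<lambda>x. f (restrict x U)) \<in> borel_measurable (PiM V (\<lambda>_. \<nu>))"
    using f by (intro measurable_compose[OF measurable_restrict_subset[OF UV]]) (simp add: local_on_def)
  moreover have "(\<lambda>x. f (restrict x U)) = f"
  proof
    fix x show "f (restrict x U) = f x" using f unfolding local_on_def by (metis restrict_apply')
  qed
  ultimately show ?thesis using f UV unfolding local_on_def by (metis subsetD)
qed

lemma local_on_mult:
  assumes "local_on U f" "local_on U g"
  shows "local_on U (\<lambda>x. f x * g x)"
proof -
  obtain B C where "\<And>x. \<bar>f x\<bar> \<le> B" "\<And>x. \<bar>g x\<bar> \<le> C" using assms unfolding local_on_def by metis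
  then have "\<bar>f x * g x\<bar> \<le> B * C" for x
    unfolding abs_mult using order_trans[OF abs_ge_zero] by (intro mult_mono) auto
  then show ?thesis using assms unfolding local_on_def
    by (intro conjI borel_measurable_times exI[of _ "B * C"]) metis+
qed

lemma local_on_integrable:
  "finite U \<Longrightarrow> local_on U f \<Longrightarrow> integrable (PiM U (\<lambda>_. \<nu>)) f"
  unfolding local_on_def by (metis integrable_bounded_PiM)

lemma integral_split:
  assumes fin: "finite U" "finite V" and UV: "U \<inter> V = {}" and f: "local_on U f" and g: "local_on V g"
  shows "(\<integral>x. f x * g x \<partial>PiM (U \<union> V) (\<lambda>_. \<nu>)) = (\<integral>x. f x \<partial>PiM U (\<lambda>_. \<nu>)) * (\<integral>x. g x \<partial>PiM V (\<lambda>_. \<nu>))"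
proof -
  interpret S: product_sigma_finite "\<lambda>_. \<nu>" by (rule product_sigma_finite_const)
  have fg: "local_on (U \<union> V) (\<lambda>x. f x * g x)"
    by (intro local_on_mult local_on_superset[OF f] local_on_superset[OF g]) auto
  have "(\<integral>x. f x * g x \<partial>PiM (U \<union> V) (\<lambda>_. \<nu>)) = (\<integral>x. (\<integral>y. f (merge U V (x, y)) * g (merge U V (x, y)) \<partial>PiM V (\<lambda>_. \<nu>)) \<partial>PiM U (\<lambda>_. \<nu>))"
    using fin by (intro S.product_integral_fold UV local_on_integrable fg) auto
  also have "\<dots> = (\<integral>x. (\<integral>y. f x * g y \<partial>PiM V (\<lambda>_. \<nu>)) \<partial>PiM U (\<lambda>_. \<nu>))"
  proof -
    have "f (merge U V (x, y)) = f x" for x y using f unfolding local_on_def by (auto simp: merge_def)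
    moreover have "g (merge U V (x, y)) = g y" for x y
    proof -
      have "\<forall>i\<in>V. merge U V (x, y) i = y i" using UV by (auto simp: merge_def)
      then show ?thesis using g unfolding local_on_def by blast
    qed
    ultimately show ?thesis by simp
  qed
  finally show ?thesis by simp
qed

lemma distr_PiM_bij:
  assumes T: "finite T" and e: "bij_betw e T S"
  shows "distr (PiM S (\<lambda>_. \<nu>)) (PiM T (\<lambda>_. \<nu>)) (\<lambda>x. \<lambda>a\<in>T. x (e a)) = PiM T (\<lambda>_. \<nu>)"
proof -
  interpret P: product_sigma_finite "\<lambda>_. \<nu>" by (rule product_sigma_finite_const)
  have S: "finite S" using T e bij_betw_finite by blast
  have eS: "e a \<in> S" if "a \<in> T" for a using e that by (auto simp: bij_betw_def)
  have m: "(\<lambda>x. \<lambda>a\<in>T. x (e a)) \<in> measurable (PiM S (\<lambda>_. \<nu>)) (PiM T (\<lambda>_. \<nu>))"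
    using eS by (intro measurable_restrict measurable_component_singleton) auto
  show ?thesis
  proof (rule P.PiM_eqI[OF T])
    fix A assume A: "\<And>i. i \<in> T \<Longrightarrow> A i \<in> sets \<nu>"
    let ?g = "inv_into T e"
    have g: "?g (e a) = a" if "a \<in> T" for a using e that by (auto simp: bij_betw_def)
    have gT: "?g s \<in> T" if "s \<in> S" for s using e that by (metis bij_betw_def inv_into_into)
    have eg: "e (?g s) = s" if "s \<in> S" for s using e that by (metis bij_betw_def f_inv_into_f)
    have "emeasure (distr (PiM S (\<lambda>_. \<nu>)) (PiM T (\<lambda>_. \<nu>)) (\<lambda>x. \<lambda>a\<in>T. x (e a))) (Pi\<^sub>E T A)
        = emeasure (PiM S (\<lambda>_. \<nu>)) ((\<lambda>x. \<lambda>a\<in>T. x (e a)) -` Pi\<^sub>E T A \<inter> space (PiM S (\<lambda>_. \<nu>)))"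
      using A T by (intro emeasure_distr m sets_PiM_I_finite) auto
    also have "(\<lambda>x. \<lambda>a\<in>T. x (e a)) -` Pi\<^sub>E T A \<inter> space (PiM S (\<lambda>_. \<nu>)) = Pi\<^sub>E S (\<lambda>s. A (?g s))"
    proof (intro equalityI subsetI)
      fix x assume x: "x \<in> (\<lambda>x. \<lambda>a\<in>T. x (e a)) -` Pi\<^sub>E T A \<inter> space (PiM S (\<lambda>_. \<nu>))"
      have "x s \<in> A (?g s)" if s: "s \<in> S" for s
      proof -
        have "(\<lambda>a\<in>T. x (e a)) (?g s) \<in> A (?g s)" using x gT[OF s] by auto
        then show ?thesis using gT[OF s] eg[OF s] by simp
      qed
      then show "x \<in> Pi\<^sub>E S (\<lambda>s. A (?g s))" using x by (auto simp: space_PiM PiE_iff)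
    next
      fix x assume x: "x \<in> Pi\<^sub>E S (\<lambda>s. A (?g s))"
      have "x (e a) \<in> A a" if "a \<in> T" for a
        using x eS[OF that] g[OF that] by (auto simp: PiE_iff dest!: bspec[of S _ "e a"])
      then show "x \<in> (\<lambda>x. \<lambda>a\<in>T. x (e a)) -` Pi\<^sub>E T A \<inter> space (PiM S (\<lambda>_. \<nu>))"
        using x space_UNIV by (auto simp: space_PiM PiE_iff)
    qed
    also have "emeasure (PiM S (\<lambda>_. \<nu>)) (Pi\<^sub>E S (\<lambda>s. A (?g s))) = (\<Prod>s\<in>S. emeasure \<nu> (A (?g s)))"
      using S A gT by (intro P.emeasure_PiM) auto
    also have "\<dots> = (\<Prod>a\<in>T. emeasure \<nu> (A (?g (e a))))"
      by (rule prod.reindex_bij_betw[OF e, symmetric])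
    also have "\<dots> = (\<Prod>a\<in>T. emeasure \<nu> (A a))"
      by (intro prod.cong) (auto simp: g)
    finally show "emeasure (distr (PiM S (\<lambda>_. \<nu>)) (PiM T (\<lambda>_. \<nu>)) (\<lambda>x. \<lambda>a\<in>T. x (e a))) (Pi\<^sub>E T A) = (\<Prod>i\<in>T. emeasure \<nu> (A i))" .
  qed simp
qed

lemma integral_PiM_bij:
  fixes f :: "('i \<Rightarrow> 'a) \<Rightarrow> real"
  assumes T: "finite T" and e: "bij_betw e T S" and f: "f \<in> borel_measurable (PiM T (\<lambda>_. \<nu>))"
  shows "(\<integral>x. f x \<partial>PiM T (\<lambda>_. \<nu>)) = (\<integral>x. f (\<lambda>a\<in>T. x (e a)) \<partial>PiM S (\<lambda>_. \<nu>))"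
proof -
  have eS: "e a \<in> S" if "a \<in> T" for a using e that by (auto simp: bij_betw_def)
  have m: "(\<lambda>x. \<lambda>a\<in>T. x (e a)) \<in> measurable (PiM S (\<lambda>_. \<nu>)) (PiM T (\<lambda>_. \<nu>))"
    using eS by (intro measurable_restrict measurable_component_singleton) auto
  show ?thesis
    by (subst distr_PiM_bij[OF T e, symmetric]) (rule integral_distr[OF m f])
qed

text \<open>Each cell indexes the coordinate that has to lie in it. Unions of families of cells then
  correspond to products of measures without any enumeration.\<close>

definition ci :: "'a set set \<Rightarrow> ('a set \<Rightarrow> 'a) \<Rightarrow> real" where
  "ci S x = (\<Prod>Q\<in>S. indicator Q (x Q))"

lemma ci_nonneg: "0 \<le> ci S x" and ci_le: "ci S x \<le> 1"
  unfolding ci_def by (auto intro!: prod_nonneg prod_le_1 simp: indicator_def)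

lemma local_on_ci: "finite S \<Longrightarrow> S \<subseteq> sets \<nu> \<Longrightarrow> local_on S (ci S)"
  unfolding local_on_def
proof (intro conjI exI allI impI)
  assume S: "finite S" "S \<subseteq> sets \<nu>"
  show "ci S \<in> borel_measurable (PiM S (\<lambda>_. \<nu>))"
    unfolding ci_def
  proof (rule borel_measurable_prod)
    fix Q assume Q: "Q \<in> S"
    then have [measurable]: "Q \<in> sets \<nu>" using S by auto
    show "(\<lambda>x. indicator Q (x Q) :: real) \<in> borel_measurable (PiM S (\<lambda>_. \<nu>))" using Q by measurable
  qed
  show "\<bar>ci S x\<bar> \<le> 1" for x using ci_nonneg ci_le by simp
  show "ci S x = ci S y" if "\<forall>i\<in>S. x i = y i" for x y unfolding ci_def using that by (intro prod.cong) auto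
qed

lemma ci_Un: "finite U \<Longrightarrow> finite V \<Longrightarrow> U \<inter> V = {} \<Longrightarrow> ci (U \<union> V) x = ci U x * ci V x"
  unfolding ci_def by (rule prod.union_disjoint)

end

context kernel_limit
begin

abbreviation rho :: "'i set \<Rightarrow> ('i \<Rightarrow> 'a) \<Rightarrow> real" where
  "rho S x \<equiv> fdet S (km x)"

lemma km_bd: "\<bar>km x i j\<bar> \<le> k"
  using K_bd d_bd by (simp add: km_def)

lemma local_on_rho: "finite S \<Longrightarrow> local_on S (rho S)"
  unfolding local_on_def
proof (intro conjI exI allI impI)
  assume S: "finite S"
  show "rho S \<in> borel_measurable (PiM S (\<lambda>_. \<nu>))" by (rule fdet_km_measurable[OF S])
  show "\<bar>rho S x\<bar> \<le> fact (card S) * k ^ card S" for x by (rule fdet_abs_le[OF S km_bd])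
  show "rho S x = rho S y" if "\<forall>i\<in>S. x i = y i" for x y
    using that by (intro fdet_cong) (simp add: km_def)
qed

lemma AE_rho_bounds:
  assumes "finite S"
  shows "AE x in PiM S (\<lambda>_. \<nu>). 0 \<le> rho S x \<and> rho S x \<le> k ^ card S"
  using AE_psd_km[OF assms]
proof eventually_elim
  case (elim x)
  have "(\<Prod>i\<in>S. km x i i) \<le> (\<Prod>i\<in>S. k)"
    using d_bd by (intro prod_mono) (auto simp: km_def)
  then show ?case using fdet_nonneg[OF assms elim] fdet_hadamard[OF assms elim] by simp
qed

text \<open>For a set $S$ of disjoint cells, \<open>aI S\<close> is the mean of the product of the cell counts, \<open>bI S\<close> the
  same integral with the canonical diagonal in place of $K(x,x)$, and \<open>gI\<close> the mass of the diagonal excess.\<close>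

definition bI :: "'a set set \<Rightarrow> real" where
  "bI S = (\<integral>x. ci S x * rho S x \<partial>PiM S (\<lambda>_. \<nu>))"

definition aI :: "'a set set \<Rightarrow> real" where
  "aI S = (\<integral>x. ci S x * fdet S (\<lambda>P Q. K (x P) (x Q)) \<partial>PiM S (\<lambda>_. \<nu>))"

definition gI :: "'a set \<Rightarrow> real" where
  "gI Q = (\<integral>x. indicator Q x * (K x x - d x) \<partial>\<nu>)"

lemma bI_empty [simp]: "bI {} = 1"
  by (simp add: bI_def ci_def PiM_empty space_PiM_empty measure_def emeasure_PiM_empty lebesgue_integral_count_space_finite)

lemma bI_bounds:
  assumes S: "finite S" "S \<subseteq> sets \<nu>"
  shows "0 \<le> bI S" "bI S \<le> (\<Prod>Q\<in>S. k * w Q)"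
proof -
  interpret P: product_sigma_finite "\<lambda>_. \<nu>" by (rule product_sigma_finite_const)
  have loc: "local_on S (\<lambda>x. ci S x * rho S x)"
    by (intro local_on_mult local_on_ci local_on_rho S)
  show "0 \<le> bI S"
    unfolding bI_def
  proof (rule integral_nonneg_AE)
    show "AE x in PiM S (\<lambda>_. \<nu>). 0 \<le> ci S x * rho S x"
      using AE_rho_bounds[OF S(1)] by eventually_elim (simp add: ci_nonneg)
  qed
  have "bI S \<le> (\<integral>x. ci S x * k ^ card S \<partial>PiM S (\<lambda>_. \<nu>))"
    unfolding bI_def
  proof (rule integral_mono_AE)
    show "AE x in PiM S (\<lambda>_. \<nu>). ci S x * rho S x \<le> ci S x * k ^ card S"
      using AE_rho_bounds[OF S(1)] by eventually_elim (auto intro!: mult_left_mono ci_nonneg)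
  qed (use local_on_integrable[OF S(1) loc] local_on_integrable[OF S(1) local_on_ci[OF S]] in auto)
  also have "\<dots> = (\<integral>x. ci S x \<partial>PiM S (\<lambda>_. \<nu>)) * k ^ card S" by simp
  also have "(\<integral>x. ci S x \<partial>PiM S (\<lambda>_. \<nu>)) = (\<Prod>Q\<in>S. \<integral>x. indicator Q x \<partial>\<nu>)"
    unfolding ci_def using S
    by (intro P.product_integral_prod) (auto intro!: integrable_bounded[of _ 1] simp: indicator_def)
  also have "\<dots> = (\<Prod>Q\<in>S. w Q)"
    using space_UNIV by (intro prod.cong) auto
  finally show "bI S \<le> (\<Prod>Q\<in>S. k * w Q)" by (simp add: prod.distrib mult.commute)
qed

text \<open>\<open>fdet_add_diag\<close> applied pointwise to the excess $K(x,x) - d(x)$; each term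
  is a function of the coordinates in \<open>U\<close> times a product over the others, so the
  integrals factor.\<close>

lemma aI_expand:
  assumes S: "finite S" "S \<subseteq> sets \<nu>" and Kd: "(\<lambda>x. K x x) \<in> borel_measurable \<nu>"
  shows "aI S = (\<Sum>U\<in>Pow S. bI U * (\<Prod>Q\<in>S - U. gI Q))"
proof -
  interpret P: product_sigma_finite "\<lambda>_. \<nu>" by (rule product_sigma_finite_const)
  let ?c = "\<lambda>x. K x x - d x"
  have cb: "\<bar>?c x\<bar> \<le> 2 * k" for x using K_bd[of x x] d_bd[of x] by linarith
  have hm: "(\<lambda>x. indicator Q x * ?c x) \<in> borel_measurable \<nu>" if "Q \<in> sets \<nu>" for Q
    using that Kd d_meas by measurable
  have hb: "\<bar>indicator Q x * ?c x\<bar> \<le> 2 * k" for Q x using cb[of x] k_nonneg by (auto simp: indicator_def)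
  have eq: "ci S x * fdet S (\<lambda>P Q. K (x P) (x Q))
      = (\<Sum>U\<in>Pow S. (ci U x * rho U x) * (\<Prod>Q\<in>S - U. indicator Q (x Q) * ?c (x Q)))" for x
  proof -
    have "fdet S (\<lambda>P Q. K (x P) (x Q)) = fdet S (\<lambda>P Q. km x P Q + (if P = Q then ?c (x P) else 0))"
      by (rule fdet_cong) (auto simp: km_def)
    also have "\<dots> = (\<Sum>U\<in>Pow S. rho U x * (\<Prod>Q\<in>S - U. ?c (x Q)))"
      by (rule fdet_add_diag[OF S(1)])
    finally have 1: "fdet S (\<lambda>P Q. K (x P) (x Q)) = (\<Sum>U\<in>Pow S. rho U x * (\<Prod>Q\<in>S - U. ?c (x Q)))" .
    have "ci S x * (rho U x * (\<Prod>Q\<in>S - U. ?c (x Q))) = (ci U x * rho U x) * (\<Prod>Q\<in>S - U. indicator Q (x Q) * ?c (x Q))"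
      if U: "U \<in> Pow S" for U
    proof -
      have "ci (U \<union> (S - U)) x = ci U x * ci (S - U) x"
        using S U finite_subset by (intro ci_Un) auto
      moreover have "U \<union> (S - U) = S" using U by auto
      ultimately show ?thesis by (simp add: ci_def prod.distrib mult_ac)
    qed
    then show ?thesis unfolding 1 sum_distrib_left by (intro sum.cong) auto
  qed
  have tm: "integrable (PiM S (\<lambda>_. \<nu>)) (\<lambda>x. (ci U x * rho U x) * (\<Prod>Q\<in>S - U. indicator Q (x Q) * ?c (x Q))) \<and>
      (\<integral>x. (ci U x * rho U x) * (\<Prod>Q\<in>S - U. indicator Q (x Q) * ?c (x Q)) \<partial>PiM S (\<lambda>_. \<nu>)) = bI U * (\<Prod>Q\<in>S - U. gI Q)"
    if U: "U \<in> Pow S" for U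
  proof -
    have fU: "finite U" "finite (S - U)" "U \<subseteq> sets \<nu>" "S - U \<subseteq> sets \<nu>" using U S finite_subset by auto
    have l1: "local_on U (\<lambda>x. ci U x * rho U x)" by (intro local_on_mult local_on_ci local_on_rho fU)
    have l2: "local_on (S - U) (\<lambda>x. \<Prod>Q\<in>S - U. indicator Q (x Q) * ?c (x Q))"
      unfolding local_on_def
    proof (intro conjI exI allI impI)
      show "(\<lambda>x. \<Prod>Q\<in>S - U. indicator Q (x Q) * ?c (x Q)) \<in> borel_measurable (PiM (S - U) (\<lambda>_. \<nu>))"
      proof (rule borel_measurable_prod)
        fix Q assume Q: "Q \<in> S - U"
        then have "Q \<in> sets \<nu>" using fU by auto
        from measurable_compose[OF measurable_component_singleton[OF Q] hm[OF this]]
        show "(\<lambda>x. indicator Q (x Q) * ?c (x Q)) \<in> borel_measurable (PiM (S - U) (\<lambda>_. \<nu>))" .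
      qed
      show "\<bar>\<Prod>Q\<in>S - U. indicator Q (x Q) * ?c (x Q)\<bar> \<le> (2 * k) ^ card (S - U)" for x
      proof -
        have "(\<Prod>Q\<in>S - U. \<bar>indicator Q (x Q) * ?c (x Q)\<bar>) \<le> (\<Prod>Q\<in>S - U. 2 * k)"
          by (intro prod_mono conjI abs_ge_zero hb)
        then show ?thesis unfolding abs_prod prod_constant .
      qed
    qed (auto intro!: prod.cong)
    have SU: "U \<union> (S - U) = S" using U by auto
    have "local_on S (\<lambda>x. (ci U x * rho U x) * (\<Prod>Q\<in>S - U. indicator Q (x Q) * ?c (x Q)))"
      using U by (intro local_on_mult local_on_superset[OF l1] local_on_superset[OF l2]) auto
    then have "integrable (PiM S (\<lambda>_. \<nu>)) (\<lambda>x. (ci U x * rho U x) * (\<Prod>Q\<in>S - U. indicator Q (x Q) * ?c (x Q)))"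
      by (rule local_on_integrable[OF S(1)])
    moreover have "(\<integral>x. (ci U x * rho U x) * (\<Prod>Q\<in>S - U. indicator Q (x Q) * ?c (x Q)) \<partial>PiM (U \<union> (S - U)) (\<lambda>_. \<nu>))
      = bI U * (\<integral>x. (\<Prod>Q\<in>S - U. indicator Q (x Q) * ?c (x Q)) \<partial>PiM (S - U) (\<lambda>_. \<nu>))"
      unfolding bI_def by (rule integral_split[OF fU(1,2) _ l1 l2]) auto
    moreover have "(\<integral>x. (\<Prod>Q\<in>S - U. indicator Q (x Q) * ?c (x Q)) \<partial>PiM (S - U) (\<lambda>_. \<nu>)) = (\<Prod>Q\<in>S - U. gI Q)"
      unfolding gI_def using fU
      by (intro P.product_integral_prod[where f = "\<lambda>Q y. indicator Q y * ?c y"] integrable_bounded[OF hm hb]) auto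
    ultimately show ?thesis unfolding SU by simp
  qed
  show ?thesis
    unfolding aI_def eq using tm by (simp add: Bochner_Integration.integral_sum)
qed

text \<open>\<open>psd_fdet_block\<close> holds for almost every choice of points in the cells and
  is integrated. In each minor one coordinate no longer occurs and integrates to the mass of its
  cell.\<close>

lemma bI_decorrelation:
  assumes U: "finite U" "U \<subseteq> sets \<nu>" and V: "finite V" "V \<subseteq> sets \<nu>" and UV: "U \<inter> V = {}"
    and \<omega>: "\<And>P Q x y. P \<in> U \<Longrightarrow> Q \<in> V \<Longrightarrow> x \<in> P \<Longrightarrow> y \<in> Q \<Longrightarrow> \<bar>K x y\<bar> \<le> \<omega>"
  shows "\<bar>bI (U \<union> V) - bI U * bI V\<bar>
    \<le> (\<Sum>P\<in>U. w P * bI (U - {P})) * (\<Sum>Q\<in>V. w Q * bI (V - {Q})) * (real (card U * card V) * \<omega>\<^sup>2)"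
proof -
  interpret PS: product_sigma_finite "\<lambda>_. \<nu>" by (rule product_sigma_finite_const)
  let ?UV = "PiM (U \<union> V) (\<lambda>_. \<nu>)"
  let ?c = "real (card U * card V) * \<omega>\<^sup>2"
  \<comment> \<open>The sum of minors in the block inequality, restricted to points lying in their
    cells.\<close>
  define s where "s S x = ci S x * (\<Sum>P\<in>S. rho (S - {P}) x)" for S x
  have fUV: "finite (U \<union> V)" using U V by auto
  have lS: "local_on S (\<lambda>x. ci S x * rho S x)" if "finite S" "S \<subseteq> sets \<nu>" for S
    using that by (intro local_on_mult local_on_ci local_on_rho)
  have lsum: "local_on S (\<lambda>x. \<Sum>P\<in>S. rho (S - {P}) x)" if "finite S" for S :: "'a set set"
  proof -
    have l: "local_on S (rho (S - {P}))" for P using that by (intro local_on_superset[OF local_on_rho]) auto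
    then obtain B where B: "\<And>P x. \<bar>rho (S - {P}) x\<bar> \<le> B P" unfolding local_on_def by metis
    show ?thesis
      unfolding local_on_def
    proof (intro conjI exI allI impI)
      show "(\<lambda>x. \<Sum>P\<in>S. rho (S - {P}) x) \<in> borel_measurable (PiM S (\<lambda>_. \<nu>))"
        using l unfolding local_on_def by (intro borel_measurable_sum) auto
      show "\<bar>\<Sum>P\<in>S. rho (S - {P}) x\<bar> \<le> (\<Sum>P\<in>S. B P)" for x
        by (rule order_trans[OF sum_abs sum_mono[OF B]])
      show "(\<Sum>P\<in>S. rho (S - {P}) x) = (\<Sum>P\<in>S. rho (S - {P}) y)" if "\<forall>i\<in>S. x i = y i" for x y
        using l that unfolding local_on_def by (intro sum.cong) auto
    qed
  qed
  have ls: "local_on S (s S)" if "finite S" "S \<subseteq> sets \<nu>" for S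
    unfolding s_def using that by (intro local_on_mult local_on_ci lsum)
  have ints: "(\<integral>x. s S x \<partial>PiM S (\<lambda>_. \<nu>)) = (\<Sum>P\<in>S. w P * bI (S - {P}))" if S: "finite S" "S \<subseteq> sets \<nu>" for S
  proof -
    have "(\<integral>x. s S x \<partial>PiM S (\<lambda>_. \<nu>)) = (\<integral>x. (\<Sum>P\<in>S. ci S x * rho (S - {P}) x) \<partial>PiM S (\<lambda>_. \<nu>))"
      by (simp add: s_def sum_distrib_left)
    also have "\<dots> = (\<Sum>P\<in>S. \<integral>x. ci S x * rho (S - {P}) x \<partial>PiM S (\<lambda>_. \<nu>))"
      using S by (intro Bochner_Integration.integral_sum local_on_integrable local_on_mult local_on_ci local_on_superset[OF local_on_rho]) auto
    also have "\<dots> = (\<Sum>P\<in>S. w P * bI (S - {P}))"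
    proof (intro sum.cong refl)
      fix P assume P: "P \<in> S"
      have SP: "(S - {P}) \<union> {P} = S" using P by auto
      have f: "finite (S - {P})" "S - {P} \<subseteq> sets \<nu>" "finite {P}" "{P} \<subseteq> sets \<nu>" using S P by auto
      have cS: "ci S x = ci (S - {P}) x * ci {P} x" for x
      proof -
        have "ci ((S - {P}) \<union> {P}) x = ci (S - {P}) x * ci {P} x" by (rule ci_Un) (use f in auto)
        then show ?thesis unfolding SP .
      qed
      have "(\<integral>x. ci S x * rho (S - {P}) x \<partial>PiM ((S - {P}) \<union> {P}) (\<lambda>_. \<nu>))
        = (\<integral>x. (ci (S - {P}) x * rho (S - {P}) x) * ci {P} x \<partial>PiM ((S - {P}) \<union> {P}) (\<lambda>_. \<nu>))"
        by (intro Bochner_Integration.integral_cong refl) (simp add: cS mult_ac)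
      also have "\<dots> = bI (S - {P}) * (\<integral>x. ci {P} x \<partial>PiM {P} (\<lambda>_. \<nu>))"
        unfolding bI_def by (rule integral_split) (use f lS local_on_ci in auto)
      also have "(\<integral>x. ci {P} x \<partial>PiM {P} (\<lambda>_. \<nu>)) = w P"
        using PS.product_integral_singleton[of "indicator P :: 'a \<Rightarrow> real" P] f space_UNIV by (simp add: ci_def)
      finally show "(\<integral>x. ci S x * rho (S - {P}) x \<partial>PiM S (\<lambda>_. \<nu>)) = w P * bI (S - {P})"
        unfolding SP by (simp add: mult.commute)
    qed
    finally show ?thesis .
  qed
  have lU: "local_on (U \<union> V) (\<lambda>x. (ci U x * rho U x) * (ci V x * rho V x))"
    by (intro local_on_mult[OF local_on_superset[OF lS[OF U]] local_on_superset[OF lS[OF V]]]) auto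
  have lUV: "local_on (U \<union> V) (\<lambda>x. ci (U \<union> V) x * rho (U \<union> V) x)"
    using U V by (intro lS) auto
  have lss: "local_on (U \<union> V) (\<lambda>x. s U x * s V x)"
    by (intro local_on_mult[OF local_on_superset[OF ls[OF U]] local_on_superset[OF ls[OF V]]]) auto
  note iU = local_on_integrable[OF fUV lU] and iUV = local_on_integrable[OF fUV lUV] and iss = local_on_integrable[OF fUV lss]
  have bb: "bI U * bI V = (\<integral>x. (ci U x * rho U x) * (ci V x * rho V x) \<partial>?UV)"
    unfolding bI_def by (rule integral_split[symmetric]) (use U V UV lS in auto)
  have eq: "bI (U \<union> V) - bI U * bI V = (\<integral>x. ci (U \<union> V) x * rho (U \<union> V) x - (ci U x * rho U x) * (ci V x * rho V x) \<partial>?UV)"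
    unfolding bb unfolding bI_def
    by (rule Bochner_Integration.integral_diff[symmetric]) (rule iUV iU)+
  have "\<bar>bI (U \<union> V) - bI U * bI V\<bar> \<le> (\<integral>x. \<bar>ci (U \<union> V) x * rho (U \<union> V) x - (ci U x * rho U x) * (ci V x * rho V x)\<bar> \<partial>?UV)"
    unfolding eq by (rule integral_abs_bound)
  also have "\<dots> \<le> (\<integral>x. s U x * s V x * ?c \<partial>?UV)"
  proof (rule integral_mono_AE)
    show "AE x in ?UV. \<bar>ci (U \<union> V) x * rho (U \<union> V) x - (ci U x * rho U x) * (ci V x * rho V x)\<bar> \<le> s U x * s V x * ?c"
      using AE_psd_km[OF fUV]
    proof eventually_elim
      case (elim x)
      have c: "ci (U \<union> V) x = ci U x * ci V x" using U V UV by (intro ci_Un)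
      show ?case
      proof (cases "ci (U \<union> V) x = 0")
        case True
        then have "ci U x = 0 \<or> ci V x = 0" by (simp add: c)
        then show ?thesis unfolding s_def c by auto
      next
        case False
        have mem: "x P \<in> P" if "P \<in> U \<union> V" for P
        proof (rule ccontr)
          assume "x P \<notin> P"
          then have "ci (U \<union> V) x = 0" unfolding ci_def using that fUV by (intro prod_zero bexI[of _ P]) auto
          with False show False by contradiction
        qed
        have "\<bar>rho (U \<union> V) x - rho U x * rho V x\<bar> \<le> (\<Sum>P\<in>U. rho (U - {P}) x) * (\<Sum>Q\<in>V. rho (V - {Q}) x) * ?c"
        proof (rule psd_fdet_block[OF U(1) V(1) UV elim])
          fix P Q assume PQ: "P \<in> U" "Q \<in> V"
          then have "P \<noteq> Q" using UV by auto
          then show "\<bar>km x P Q\<bar> \<le> \<omega>" using \<omega>[OF PQ] mem PQ by (simp add: km_def)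
        qed
        then have "ci (U \<union> V) x * \<bar>rho (U \<union> V) x - rho U x * rho V x\<bar> \<le> ci (U \<union> V) x * ((\<Sum>P\<in>U. rho (U - {P}) x) * (\<Sum>Q\<in>V. rho (V - {Q}) x) * ?c)"
          by (intro mult_left_mono ci_nonneg)
        moreover have "ci (U \<union> V) x * \<bar>rho (U \<union> V) x - rho U x * rho V x\<bar> = \<bar>ci (U \<union> V) x * (rho (U \<union> V) x - rho U x * rho V x)\<bar>"
          by (simp add: abs_mult ci_nonneg)
        ultimately show ?thesis unfolding s_def c by (simp add: algebra_simps)
      qed
    qed
  qed (use iU iUV iss in auto)
  also have "\<dots> = (\<integral>x. s U x * s V x \<partial>?UV) * ?c" by simp
  also have "(\<integral>x. s U x * s V x \<partial>?UV) = (\<Sum>P\<in>U. w P * bI (U - {P})) * (\<Sum>Q\<in>V. w Q * bI (V - {Q}))"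
    by (subst integral_split) (use U V UV ls in \<open>auto simp: ints\<close>)
  finally show ?thesis .
qed

lemma bI_eq_0:
  assumes "minors_vanish N (sets \<nu>) kk" "finite S" "N < card S"
  shows "bI S = 0"
proof -
  show ?thesis
    unfolding bI_def
  proof (rule integral_eq_zero_AE)
    show "AE x in PiM S (\<lambda>_. \<nu>). ci S x * rho S x = 0"
      using AE_fdet_km_eq_0[OF assms] by eventually_elim simp
  qed
qed

end

section \<open>Summation over families of cells\<close>

lemma sum_Pow_member:
  fixes b :: "'i set \<Rightarrow> real" and f :: "nat \<Rightarrow> real"
  assumes I: "finite I" and b: "\<And>U. U \<subseteq> I \<Longrightarrow> 0 \<le> b U" and w: "\<And>P. P \<in> I \<Longrightarrow> 0 \<le> w P" and f: "\<And>n. 0 \<le> f n"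
  shows "(\<Sum>U\<in>Pow I. f (card U) * (\<Sum>P\<in>U. w P * b (U - {P})))
    \<le> (\<Sum>P\<in>I. w P) * (\<Sum>U\<in>Pow I. f (Suc (card U)) * b U)"
proof -
  have "(\<Sum>U\<in>Pow I. f (card U) * (\<Sum>P\<in>U. w P * b (U - {P})))
      = (\<Sum>U\<in>Pow I. \<Sum>P\<in>{P \<in> I. P \<in> U}. f (card U) * (w P * b (U - {P})))"
    unfolding sum_distrib_left by (intro sum.cong) auto
  also have "\<dots> = (\<Sum>P\<in>I. \<Sum>U\<in>{U \<in> Pow I. P \<in> U}. f (card U) * (w P * b (U - {P})))"
    by (rule sum.swap_restrict) (use I in auto)
  also have "\<dots> \<le> (\<Sum>P\<in>I. w P * (\<Sum>U\<in>Pow I. f (Suc (card U)) * b U))"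
  proof (rule sum_mono)
    fix P assume P: "P \<in> I"
    have "(\<Sum>U\<in>{U \<in> Pow I. P \<in> U}. f (card U) * (w P * b (U - {P})))
        = (\<Sum>U\<in>{U \<in> Pow I. {P} \<subseteq> U}. f (card U) * (w P * b (U - {P})))"
      by (rule sum.cong) auto
    also have "\<dots> = (\<Sum>W\<in>Pow (I - {P}). f (card ({P} \<union> W)) * (w P * b ({P} \<union> W - {P})))"
      by (rule sum_Pow_superset) (use P in auto)
    also have "\<dots> = (\<Sum>W\<in>Pow (I - {P}). w P * (f (Suc (card W)) * b W))"
    proof (intro sum.cong refl)
      fix W assume W: "W \<in> Pow (I - {P})"
      then have "finite W" "P \<notin> W" using I finite_subset by auto
      moreover from this have "{P} \<union> W - {P} = W" by auto
      ultimately show "f (card ({P} \<union> W)) * (w P * b ({P} \<union> W - {P})) = w P * (f (Suc (card W)) * b W)"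
        by simp
    qed
    also have "\<dots> \<le> (\<Sum>W\<in>Pow I. w P * (f (Suc (card W)) * b W))"
      using I b w[OF P] f by (intro sum_mono2) (auto intro!: mult_nonneg_nonneg)
    finally show "(\<Sum>U\<in>{U \<in> Pow I. P \<in> U}. f (card U) * (w P * b (U - {P}))) \<le> w P * (\<Sum>U\<in>Pow I. f (Suc (card U)) * b U)"
      by (simp add: sum_distrib_left)
  qed
  finally show ?thesis by (simp add: sum_distrib_right)
qed

lemma sum_Pow_card_prod_le:
  fixes t :: "'i \<Rightarrow> real"
  assumes I: "finite I" and t: "\<And>i. i \<in> I \<Longrightarrow> 0 \<le> t i"
  shows "(\<Sum>U\<in>Pow I. real (card U + 1) * (\<Prod>i\<in>U. t i)) \<le> (1 + (\<Sum>i\<in>I. t i)) * exp (\<Sum>i\<in>I. t i)"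
proof -
  let ?b = "\<lambda>U. \<Prod>i\<in>U. t i"
  have b: "0 \<le> ?b U" if "U \<subseteq> I" for U using t that by (intro prod_nonneg) auto
  have p: "(\<Sum>U\<in>Pow I. ?b U) = (\<Prod>i\<in>I. t i + 1)" using prod_add[OF I, of t "\<lambda>_. 1"] by simp
  have "(\<Sum>U\<in>Pow I. real (card U) * ?b U) = (\<Sum>U\<in>Pow I. 1 * (\<Sum>i\<in>U. t i * ?b (U - {i})))"
  proof (intro sum.cong refl)
    fix U assume "U \<in> Pow I"
    then have "finite U" using I finite_subset by auto
    then have "(\<Sum>i\<in>U. t i * ?b (U - {i})) = (\<Sum>i\<in>U. ?b U)"
      by (intro sum.cong refl) (simp add: prod.remove)
    then show "real (card U) * ?b U = 1 * (\<Sum>i\<in>U. t i * ?b (U - {i}))" by simp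
  qed
  also have "\<dots> \<le> (\<Sum>i\<in>I. t i) * (\<Sum>U\<in>Pow I. 1 * ?b U)"
    by (rule sum_Pow_member[OF I b t, where f = "\<lambda>_. 1"]) auto
  finally have "(\<Sum>U\<in>Pow I. real (card U + 1) * ?b U) \<le> (1 + (\<Sum>i\<in>I. t i)) * (\<Prod>i\<in>I. t i + 1)"
    by (simp add: distrib_right sum.distrib p)
  also have "\<dots> \<le> (1 + (\<Sum>i\<in>I. t i)) * exp (\<Sum>i\<in>I. t i)"
  proof (rule mult_left_mono)
    show "(\<Prod>i\<in>I. t i + 1) \<le> exp (\<Sum>i\<in>I. t i)"
      unfolding exp_sum[OF I] using t by (intro prod_mono) (auto simp: add.commute intro: exp_ge_add_one_self)
    show "0 \<le> 1 + (\<Sum>i\<in>I. t i)" using t by (intro add_nonneg_nonneg sum_nonneg) auto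
  qed
  finally show ?thesis .
qed

lemma prod_falling_eq: "n \<le> N \<Longrightarrow> (\<Prod>j<n. real (N - j)) = fact n * real (N choose n)"
proof -
  assume n: "n \<le> N"
  have "fact n * real (N choose n) = (\<Prod>i = 0..<n. real N - real i)"
    using gbinomial_mult_fact[of n "real N"] by (simp add: binomial_gbinomial)
  moreover have "(\<Prod>i = 0..<n. real N - real i) = (\<Prod>j<n. real (N - j))"
    using n by (intro prod.cong) (auto simp: of_nat_diff)
  ultimately show ?thesis by simp
qed

context kernel_limit
begin

lemma sum_bI_card_eq_le:
  assumes rk: "minors_vanish N (sets \<nu>) kk" and I: "finite I" "I \<subseteq> sets \<nu>" and disj: "disjoint I" and n: "n \<le> N"
  shows "(\<Sum>U\<in>{U \<in> Pow I. card U = n}. bI U) \<le> real (N choose n)"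
proof -
  let ?T = "{..<n}" and ?P = "PiM {..<n} (\<lambda>_. \<nu>)"
  let ?E = "{f \<in> ?T \<rightarrow>\<^sub>E I. inj_on f ?T}"
  define h where "h f x = (\<Prod>a<n. indicator (f a) (x a) :: real)" for f :: "nat \<Rightarrow> 'a set" and x
  have fE: "finite (?T \<rightarrow>\<^sub>E I)" using I by (intro finite_PiE) auto
  have hm: "h f \<in> borel_measurable ?P" if "f \<in> ?T \<rightarrow>\<^sub>E I" for f
    unfolding h_def
  proof (rule borel_measurable_prod)
    fix a assume a: "a \<in> ?T"
    then have [measurable]: "f a \<in> sets \<nu>" using that I by auto
    show "(\<lambda>x. indicator (f a) (x a) :: real) \<in> borel_measurable ?P" using a by measurable
  qed
  have h01: "0 \<le> h f x" "h f x \<le> 1" for f x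
    unfolding h_def by (auto intro!: prod_nonneg prod_le_1 simp: indicator_def)
  have rhoi: "integrable ?P (rho ?T)" by (rule local_on_integrable[OF _ local_on_rho]) auto
  have hi: "integrable ?P (\<lambda>x. h f x * rho ?T x)" if "f \<in> ?T \<rightarrow>\<^sub>E I" for f
    using hm[OF that] h01 rhoi
    by (intro Bochner_Integration.integrable_bound[OF rhoi]) (auto simp: abs_mult intro!: AE_I2 mult_left_le_one_le)
  have one: "bI (f ` ?T) = (\<integral>x. h f x * rho ?T x \<partial>?P)" if f: "f \<in> ?E" for f
  proof -
    have bij: "bij_betw f ?T (f ` ?T)" using f by (simp add: bij_betw_def)
    have "(\<integral>x. h f x * rho ?T x \<partial>?P) = (\<integral>x. h f (\<lambda>a\<in>?T. x (f a)) * rho ?T (\<lambda>a\<in>?T. x (f a)) \<partial>PiM (f ` ?T) (\<lambda>_. \<nu>))"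
      using hi[of f] f by (intro integral_PiM_bij[OF _ bij]) auto
    also have "\<dots> = bI (f ` ?T)"
      unfolding bI_def
    proof (intro Bochner_Integration.integral_cong refl arg_cong2[where f = "(*)"])
      fix x
      show "h f (\<lambda>a\<in>?T. x (f a)) = ci (f ` ?T) x"
        unfolding h_def ci_def using f by (subst prod.reindex) (auto intro!: prod.cong)
      have "fdet (f ` ?T) (km x) = fdet ?T (\<lambda>i j. km x (f i) (f j))" by (rule fdet_reindex[OF bij]) simp
      also have "\<dots> = rho ?T (\<lambda>a\<in>?T. x (f a))"
        using f by (intro fdet_cong) (auto simp: km_def inj_on_def)
      finally show "rho ?T (\<lambda>a\<in>?T. x (f a)) = fdet (f ` ?T) (km x)" ..
    qed
    finally show ?thesis ..
  qed
  \<comment> \<open>Since the cells are disjoint, at most one tuple of cells contains a given tuple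
    of points.\<close>
  have sumh: "(\<Sum>f\<in>?E. h f x) \<le> 1" for x
  proof -
    have "(\<Sum>f\<in>?E. h f x) \<le> (\<Sum>f\<in>?T \<rightarrow>\<^sub>E I. h f x)" using fE h01 by (intro sum_mono2) auto
    also have "\<dots> = (\<Prod>a<n. \<Sum>Q\<in>I. indicator Q (x a))"
      unfolding h_def by (rule prod_sum_PiE[symmetric]) (use I in auto)
    also have "\<dots> \<le> 1"
    proof (intro prod_le_1 conjI)
      fix a
      show "0 \<le> (\<Sum>Q\<in>I. indicator Q (x a) :: real)" by (intro sum_nonneg) auto
      have "indicator (\<Union>Q\<in>I. id Q) (x a) = (\<Sum>Q\<in>I. indicator (id Q) (x a) :: real)"
        using I disj by (intro indicator_UN_disjoint) (auto simp: disjoint_family_on_def disjoint_def)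
      then have "(\<Sum>Q\<in>I. indicator Q (x a) :: real) = indicator (\<Union>I) (x a)" by simp
      then show "(\<Sum>Q\<in>I. indicator Q (x a) :: real) \<le> 1" by (simp add: indicator_def)
    qed
    finally show ?thesis .
  qed
  have "(\<Sum>f\<in>?E. bI (f ` ?T)) = (\<Sum>f\<in>?E. \<integral>x. h f x * rho ?T x \<partial>?P)" by (intro sum.cong) (auto simp: one)
  also have "\<dots> = (\<integral>x. (\<Sum>f\<in>?E. h f x * rho ?T x) \<partial>?P)"
    using hi by (intro Bochner_Integration.integral_sum[symmetric]) auto
  also have "\<dots> \<le> (\<integral>x. rho ?T x \<partial>?P)"
  proof (rule integral_mono_AE)
    show "AE x in ?P. (\<Sum>f\<in>?E. h f x * rho ?T x) \<le> rho ?T x"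
      using AE_rho_bounds[OF finite_lessThan[of n]]
    proof eventually_elim
      case (elim x)
      have "(\<Sum>f\<in>?E. h f x) * rho ?T x \<le> 1 * rho ?T x" using elim sumh by (intro mult_right_mono) auto
      then show ?case by (simp add: sum_distrib_right)
    qed
  qed (use hi rhoi in auto)
  also have "\<dots> \<le> (\<Prod>j<n. real (N - j))"
  proof -
    have nn: "AE x in ?P. 0 \<le> rho ?T x"
      using AE_rho_bounds[OF finite_lessThan[of n]] by eventually_elim simp
    have "ennreal (\<integral>x. rho ?T x \<partial>?P) = (\<integral>\<^sup>+x. ennreal (rho ?T x) \<partial>?P)"
      by (rule nn_integral_eq_integral[OF rhoi nn, symmetric])
    also have "\<dots> \<le> ennreal (\<Prod>j<n. real (N - j))" by (rule fdet_km_integral_le[OF rk])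
    finally show ?thesis by (subst (asm) ennreal_le_iff) (auto intro!: prod_nonneg)
  qed
  also have "\<dots> = fact n * real (N choose n)" by (rule prod_falling_eq[OF n])
  finally have up: "(\<Sum>f\<in>?E. bI (f ` ?T)) \<le> fact n * real (N choose n)" .
  let ?U = "{U \<in> Pow I. card U = n}"
  have "(\<Sum>f\<in>?E. bI (f ` ?T)) = (\<Sum>U\<in>?U. \<Sum>f\<in>{f \<in> ?E. f ` ?T = U}. bI (f ` ?T))"
    by (rule sum.group[symmetric]) (use fE I in \<open>auto simp: card_image\<close>)
  \<comment> \<open>Every family of \<open>n\<close> cells is the image of $n!$ injective
    tuples.\<close>
  also have "\<dots> = (\<Sum>U\<in>?U. fact n * bI U)"
  proof (intro sum.cong refl)
    fix U assume U: "U \<in> ?U"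
    then have fU: "finite U" using I finite_subset by auto
    have "{f \<in> ?E. f ` ?T = U} = {f \<in> ?T \<rightarrow>\<^sub>E U. inj_on f ?T}"
    proof (intro equalityI subsetI)
      fix f assume "f \<in> {f \<in> ?T \<rightarrow>\<^sub>E U. inj_on f ?T}"
      then have f: "f \<in> ?T \<rightarrow>\<^sub>E U" "inj_on f ?T" by auto
      have "f ` ?T = U" using f U fU by (intro card_subset_eq) (auto simp: card_image)
      moreover have "f \<in> ?T \<rightarrow>\<^sub>E I" using f U by (auto simp: PiE_iff)
      ultimately show "f \<in> {f \<in> ?E. f ` ?T = U}" using f by auto
    qed auto
    then have "card {f \<in> ?E. f ` ?T = U} = (\<Prod>i = 0..<n. n - i)"
      using card_inj_on_subset_funcset[of ?T U ?T] U fU by simp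
    also have "\<dots> = fact n" by (simp add: fact_prod_rev)
    finally have c: "card {f \<in> ?E. f ` ?T = U} = fact n" .
    have "(\<Sum>f\<in>{f \<in> ?E. f ` ?T = U}. bI (f ` ?T)) = (\<Sum>f\<in>{f \<in> ?E. f ` ?T = U}. bI U)"
      by (intro sum.cong) auto
    then show "(\<Sum>f\<in>{f \<in> ?E. f ` ?T = U}. bI (f ` ?T)) = fact n * bI U" using c by simp
  qed
  finally have "fact n * (\<Sum>U\<in>?U. bI U) \<le> fact n * real (N choose n)"
    using up by (simp add: sum_distrib_left)
  then show ?thesis by simp
qed

text \<open>The weight is $f(n) = 2^n$ in general. For a kernel of rank $N$ it is cut off at $n = N$, because then
  \<open>bI\<close> vanishes on more than $N$ cells.\<close>

definition Hs :: "(nat \<Rightarrow> real) \<Rightarrow> 'a set set \<Rightarrow> real" where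
  "Hs f I = (\<Sum>U\<in>Pow I. f (card U) * (real (card U) * (\<Sum>P\<in>U. w P * bI (U - {P}))))"

lemma Hs_le:
  assumes I: "finite I" "I \<subseteq> sets \<nu>" and f: "\<And>n. 0 \<le> f n"
  shows "0 \<le> Hs f I" "Hs f I \<le> (\<Sum>P\<in>I. w P) * (\<Sum>U\<in>Pow I. f (Suc (card U)) * real (card U + 1) * bI U)"
proof -
  have b: "0 \<le> bI U" if "U \<subseteq> I" for U using that I finite_subset by (intro bI_bounds) auto
  show "0 \<le> Hs f I" unfolding Hs_def
    by (intro sum_nonneg mult_nonneg_nonneg f b) auto
  show "Hs f I \<le> (\<Sum>P\<in>I. w P) * (\<Sum>U\<in>Pow I. f (Suc (card U)) * real (card U + 1) * bI U)"
    using sum_Pow_member[OF I(1) b, where w = w and f = "\<lambda>n. f n * real n"] f by (simp add: Hs_def mult.assoc add.commute)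
qed

lemma Hs_general:
  assumes I: "finite I" "I \<subseteq> sets \<nu>"
  shows "Hs (\<lambda>n. 2 ^ n) I \<le> 2 * (\<Sum>P\<in>I. w P) * ((1 + 2 * k * (\<Sum>P\<in>I. w P)) * exp (2 * k * (\<Sum>P\<in>I. w P)))"
proof -
  have "(\<Sum>U\<in>Pow I. 2 ^ Suc (card U) * real (card U + 1) * bI U) \<le> (\<Sum>U\<in>Pow I. 2 * (real (card U + 1) * (\<Prod>P\<in>U. 2 * k * w P)))"
  proof (rule sum_mono)
    fix U assume U: "U \<in> Pow I"
    then have "bI U \<le> (\<Prod>Q\<in>U. k * w Q)" using I finite_subset by (intro bI_bounds) auto
    then have "2 ^ Suc (card U) * real (card U + 1) * bI U \<le> 2 ^ Suc (card U) * real (card U + 1) * (\<Prod>Q\<in>U. k * w Q)"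
      by (intro mult_left_mono) auto
    also have "\<dots> = 2 * (real (card U + 1) * (\<Prod>P\<in>U. 2 * k * w P))"
      by (simp add: prod.distrib mult.assoc)
    finally show "2 ^ Suc (card U) * real (card U + 1) * bI U \<le> 2 * (real (card U + 1) * (\<Prod>P\<in>U. 2 * k * w P))" .
  qed
  also have "\<dots> = 2 * (\<Sum>U\<in>Pow I. real (card U + 1) * (\<Prod>P\<in>U. 2 * k * w P))" by (simp add: sum_distrib_left)
  also have "\<dots> \<le> 2 * ((1 + (\<Sum>P\<in>I. 2 * k * w P)) * exp (\<Sum>P\<in>I. 2 * k * w P))"
    using k_nonneg by (intro mult_left_mono sum_Pow_card_prod_le I) auto
  also have "(\<Sum>P\<in>I. 2 * k * w P) = 2 * k * (\<Sum>P\<in>I. w P)" by (simp add: sum_distrib_left)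
  finally have "(\<Sum>P\<in>I. w P) * (\<Sum>U\<in>Pow I. 2 ^ Suc (card U) * real (card U + 1) * bI U)
     \<le> (\<Sum>P\<in>I. w P) * (2 * ((1 + 2 * k * (\<Sum>P\<in>I. w P)) * exp (2 * k * (\<Sum>P\<in>I. w P))))"
    by (intro mult_left_mono sum_nonneg) auto
  then show ?thesis
    using Hs_le(2)[OF I, of "\<lambda>n. 2 ^ n"] by (simp only: mult_ac) (smt (verit) zero_le_power)
qed

lemma Hs_rank:
  assumes rk: "minors_vanish N (sets \<nu>) kk" and I: "finite I" "I \<subseteq> sets \<nu>" and disj: "disjoint I"
  shows "Hs (\<lambda>n. if n \<le> N then 2 ^ n else 0) I \<le> 2 * (\<Sum>P\<in>I. w P) * (real N * 3 ^ N)"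
proof -
  let ?f = "\<lambda>n. if n \<le> N then 2 ^ n else 0 :: real"
  have b: "0 \<le> bI U" if "U \<subseteq> I" for U using that I finite_subset by (intro bI_bounds) auto
  \<comment> \<open>The weight is taken at \<open>card U + 1\<close> because one cell has been
    removed. Hence the strict inequality, and \<open>card U + 1\<close> is at most
    \<open>N\<close>.\<close>
  let ?A = "{U \<in> Pow I. card U < N}"
  have "(\<Sum>U\<in>Pow I. ?f (Suc (card U)) * real (card U + 1) * bI U) = (\<Sum>U\<in>?A. 2 ^ Suc (card U) * real (card U + 1) * bI U)"
    using I by (intro sum.mono_neutral_cong_right) auto
  also have "\<dots> \<le> (\<Sum>U\<in>?A. 2 * real N * (2 ^ card U * bI U))"
  proof (rule sum_mono)
    fix U assume U: "U \<in> ?A"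
    then have "real (card U + 1) * (2 ^ card U * bI U) \<le> real N * (2 ^ card U * bI U)"
      using b[of U] by (intro mult_right_mono) auto
    then show "2 ^ Suc (card U) * real (card U + 1) * bI U \<le> 2 * real N * (2 ^ card U * bI U)" by (simp add: mult_ac)
  qed
  also have "\<dots> = 2 * real N * (\<Sum>U\<in>?A. 2 ^ card U * bI U)" by (simp add: sum_distrib_left)
  also have "(\<Sum>U\<in>?A. 2 ^ card U * bI U) = (\<Sum>n<N. \<Sum>U\<in>{U \<in> ?A. card U = n}. 2 ^ card U * bI U)"
    using I by (intro sum.group[symmetric]) auto
  also have "\<dots> \<le> (\<Sum>n<N. 2 ^ n * real (N choose n))"
  proof (rule sum_mono)
    fix n assume n: "n \<in> {..<N}"
    have "(\<Sum>U\<in>{U \<in> ?A. card U = n}. 2 ^ card U * bI U) = 2 ^ n * (\<Sum>U\<in>{U \<in> Pow I. card U = n}. bI U)"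
      unfolding sum_distrib_left using n by (intro sum.cong) auto
    also have "\<dots> \<le> 2 ^ n * real (N choose n)"
      using n by (intro mult_left_mono sum_bI_card_eq_le[OF rk I disj]) auto
    finally show "(\<Sum>U\<in>{U \<in> ?A. card U = n}. 2 ^ card U * bI U) \<le> 2 ^ n * real (N choose n)" .
  qed
  also have "\<dots> \<le> (\<Sum>n\<le>N. real (N choose n) * 2 ^ n * 1 ^ (N - n))"
  proof -
    have "(\<Sum>n<N. 2 ^ n * real (N choose n)) \<le> (\<Sum>n\<le>N. 2 ^ n * real (N choose n))"
      by (intro sum_mono2) auto
    then show ?thesis by (simp add: mult_ac)
  qed
  also have "\<dots> = 3 ^ N" using binomial_ring[of "2::real" 1 N] by simp
  finally have "(\<Sum>U\<in>Pow I. ?f (Suc (card U)) * real (card U + 1) * bI U) \<le> 2 * real N * 3 ^ N"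
    by (simp add: mult_left_mono)
  then have "(\<Sum>P\<in>I. w P) * (\<Sum>U\<in>Pow I. ?f (Suc (card U)) * real (card U + 1) * bI U) \<le> (\<Sum>P\<in>I. w P) * (2 * real N * 3 ^ N)"
    by (intro mult_left_mono sum_nonneg) auto
  moreover have "Hs ?f I \<le> (\<Sum>P\<in>I. w P) * (\<Sum>U\<in>Pow I. ?f (Suc (card U)) * real (card U + 1) * bI U)"
    by (rule Hs_le(2)[OF I]) auto
  ultimately show ?thesis by (simp add: mult_ac)
qed

text \<open>The condition on \<open>f\<close> permits dropping the weight only for cardinalities
  where \<open>bI\<close> of the family and of every larger one is zero, so that the difference is
  zero as well.\<close>

lemma sum_bI_decorrelation:
  assumes I: "finite I" "I \<subseteq> sets \<nu>" and J: "finite J" "J \<subseteq> sets \<nu>" and IJ: "I \<inter> J = {}"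
    and \<omega>: "\<And>P Q x y. P \<in> I \<Longrightarrow> Q \<in> J \<Longrightarrow> x \<in> P \<Longrightarrow> y \<in> Q \<Longrightarrow> \<bar>K x y\<bar> \<le> \<omega>"
    and f: "\<And>n. 0 \<le> f n" "\<And>S. finite S \<Longrightarrow> f (card S) = 2 ^ card S \<or> (\<forall>T. finite T \<longrightarrow> S \<subseteq> T \<longrightarrow> bI T = 0)"
  shows "(\<Sum>U\<in>Pow I. \<Sum>V\<in>Pow J. 2 ^ card U * 2 ^ card V * \<bar>bI (U \<union> V) - bI U * bI V\<bar>) \<le> Hs f I * Hs f J * \<omega>\<^sup>2"
proof -
  let ?s = "\<lambda>U. \<Sum>P\<in>U. w P * bI (U - {P})"
  have s0: "0 \<le> ?s U" if "U \<subseteq> I \<or> U \<subseteq> J" for U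
  proof (intro sum_nonneg mult_nonneg_nonneg measure_nonneg bI_bounds(1))
    fix P show "finite (U - {P})" "U - {P} \<subseteq> sets \<nu>" using that I J finite_subset by auto
  qed
  have "(\<Sum>U\<in>Pow I. \<Sum>V\<in>Pow J. 2 ^ card U * 2 ^ card V * \<bar>bI (U \<union> V) - bI U * bI V\<bar>)
      \<le> (\<Sum>U\<in>Pow I. \<Sum>V\<in>Pow J. (f (card U) * (real (card U) * ?s U)) * (f (card V) * (real (card V) * ?s V)) * \<omega>\<^sup>2)"
  proof (intro sum_mono)
    fix U V assume "U \<in> Pow I" "V \<in> Pow J"
    then have U: "finite U" "U \<subseteq> sets \<nu>" "U \<subseteq> I" and V: "finite V" "V \<subseteq> sets \<nu>" "V \<subseteq> J" and UV: "U \<inter> V = {}"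
      using I J IJ finite_subset by auto
    have ss: "0 \<le> ?s U * ?s V" using s0 U V by (intro mult_nonneg_nonneg) auto
    have nn: "0 \<le> (f (card U) * (real (card U) * ?s U)) * (f (card V) * (real (card V) * ?s V)) * \<omega>\<^sup>2"
      by (intro mult_nonneg_nonneg f(1)) (use s0 U V in auto)
    show "2 ^ card U * 2 ^ card V * \<bar>bI (U \<union> V) - bI U * bI V\<bar>
      \<le> (f (card U) * (real (card U) * ?s U)) * (f (card V) * (real (card V) * ?s V)) * \<omega>\<^sup>2"
    proof (cases "bI (U \<union> V) - bI U * bI V = 0")
      case True
      then show ?thesis using nn by simp
    next
      case False
      have "f (card U) = 2 ^ card U" using f(2)[OF U(1)] False U V by auto
      moreover have "f (card V) = 2 ^ card V" using f(2)[OF V(1)] False U V by auto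
      moreover have "\<bar>bI (U \<union> V) - bI U * bI V\<bar> \<le> ?s U * ?s V * (real (card U * card V) * \<omega>\<^sup>2)"
        by (rule bI_decorrelation[OF U(1,2) V(1,2) UV]) (use \<omega> U(3) V(3) in blast)
      then have "2 ^ card U * 2 ^ card V * \<bar>bI (U \<union> V) - bI U * bI V\<bar> \<le> 2 ^ card U * 2 ^ card V * (?s U * ?s V * (real (card U * card V) * \<omega>\<^sup>2))"
        by (intro mult_left_mono) auto
      ultimately show ?thesis by (simp add: mult_ac)
    qed
  qed
  also have "\<dots> = Hs f I * Hs f J * \<omega>\<^sup>2"
    unfolding Hs_def sum_product by (simp only: sum_distrib_right)
  finally show ?thesis .
qed

end

section \<open>Counts in small cells\<close>

text \<open>The falling factorial; truncated subtraction makes it 0 for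
  \<open>n > m\<close>.\<close>

definition falling :: "nat \<Rightarrow> nat \<Rightarrow> nat" where
  "falling n m = (\<Prod>i = 0..<n. m - i)"

lemma falling_eq: "falling n m = fact n * (m choose n)"
proof (cases "n \<le> m")
  case True
  have "real (falling n m) = (\<Prod>j<n. real (m - j))"
    by (simp add: falling_def atLeast0LessThan)
  also have "\<dots> = real (fact n * (m choose n))" using prod_falling_eq[OF True] by simp
  finally show ?thesis by (simp only: of_nat_eq_iff)
next
  case False
  then have "falling n m = 0" unfolding falling_def by (intro prod_zero) (auto intro!: bexI[of _ m])
  then show ?thesis using False by (simp add: binomial_eq_0)
qed

lemma dtuples_eq: "dtuples n S = {f \<in> {..<n} \<rightarrow>\<^sub>E S. inj_on f {..<n}}"
  unfolding dtuples_def by (auto simp: PiE_iff)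

lemma card_dtuples: "finite S \<Longrightarrow> card (dtuples n S) = falling n (card S)"
  unfolding dtuples_eq falling_def using card_inj_on_subset_funcset[of "{..<n}" S "{..<n}"] by simp

lemma finite_dtuples: "finite S \<Longrightarrow> finite (dtuples n S)"
  unfolding dtuples_eq by (rule finite_subset[of _ "{..<n} \<rightarrow>\<^sub>E S"]) (auto intro: finite_PiE)

locale point_counts = kernel_limit \<nu> K k d Fs + P: prob_space P
  for \<nu> :: "'a measure" and K :: "'a \<Rightarrow> 'a \<Rightarrow> real" and k d Fs and P :: "'w measure" +
  fixes X :: "'w \<Rightarrow> 'a set"
  assumes X_fin: "\<omega> \<in> space P \<Longrightarrow> finite (X \<omega>)"
    and X_meas: "E \<in> sets \<nu> \<Longrightarrow> (\<lambda>\<omega>. card (X \<omega> \<inter> E)) \<in> measurable P (count_space UNIV)"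
    and X_mom: "(\<And>a. a < n \<Longrightarrow> B a \<in> sets \<nu>) \<Longrightarrow>
      (\<integral>\<^sup>+\<omega>. of_nat (card {x \<in> dtuples n (X \<omega>). \<forall>a<n. x a \<in> B a}) \<partial>P)
      = (\<integral>\<^sup>+x. (\<Prod>a<n. indicator (B a) (x a)) * ennreal (fdet {..<n} (\<lambda>i j. K (x i) (x j))) \<partial>PiM {..<n} (\<lambda>_. \<nu>))"
    and K_diag: "(\<lambda>x. K x x) \<in> borel_measurable \<nu>"
begin

abbreviation num :: "'a set \<Rightarrow> 'w \<Rightarrow> nat" where
  "num E \<omega> \<equiv> card (X \<omega> \<inter> E)"

lemma num_meas [measurable]: "E \<in> sets \<nu> \<Longrightarrow> num E \<in> measurable P (count_space UNIV)"
  by (rule X_meas)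

lemma fmom_falling:
  assumes E: "E \<in> sets \<nu>"
  shows "(\<integral>\<^sup>+\<omega>. of_nat (falling n (num E \<omega>)) \<partial>P) = fmom n E"
proof -
  have "(\<integral>\<^sup>+\<omega>. of_nat (falling n (num E \<omega>)) \<partial>P) = (\<integral>\<^sup>+\<omega>. of_nat (card {x \<in> dtuples n (X \<omega>). \<forall>a<n. x a \<in> E}) \<partial>P)"
  proof (rule nn_integral_cong)
    fix \<omega> assume w: "\<omega> \<in> space P"
    have "{x \<in> dtuples n (X \<omega>). \<forall>a<n. x a \<in> E} = dtuples n (X \<omega> \<inter> E)"
      unfolding dtuples_eq by (auto simp: PiE_iff)
    then show "of_nat (falling n (num E \<omega>)) = (of_nat (card {x \<in> dtuples n (X \<omega>). \<forall>a<n. x a \<in> E}) :: ennreal)"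
      using X_fin[OF w] by (simp add: card_dtuples)
  qed
  then show ?thesis using X_mom[of n "\<lambda>_. E"] E by (simp add: fmom_def)
qed

text \<open>If the \<open>n\<close>-th factorial moment is zero, then almost surely there are fewer
  than \<open>n\<close> points in \<open>E\<close>, and all higher moments vanish too.\<close>

lemma fmom_0_imp:
  assumes E: "E \<in> sets \<nu>" and 0: "fmom n E = 0" and nm: "n \<le> m"
  shows "fmom m E = 0"
proof -
  have "(\<integral>\<^sup>+\<omega>. of_nat (falling n (num E \<omega>)) \<partial>P) = 0" using 0 fmom_falling[OF E] by simp
  then have "AE \<omega> in P. of_nat (falling n (num E \<omega>)) = (0::ennreal)"
    using E by (subst (asm) nn_integral_0_iff_AE) auto
  then have "AE \<omega> in P. of_nat (falling m (num E \<omega>)) = (0::ennreal)"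
    by eventually_elim (use nm in \<open>auto simp: falling_eq\<close>)
  then have "(\<integral>\<^sup>+\<omega>. of_nat (falling m (num E \<omega>)) \<partial>P) = 0"
    using E by (subst nn_integral_0_iff_AE) auto
  then show ?thesis using fmom_falling[OF E] by simp
qed

lemma AE_excess_nonneg: "AE x in \<nu>. d x \<le> K x x"
  by (rule diag_dominates[OF fmom_0_imp fmom_0_imp K_diag]) auto

lemma AE_psd_K:
  assumes S: "finite S"
  shows "AE x in PiM S (\<lambda>_. \<nu>). pd 0 S (\<lambda>i j. K (x i) (x j))"
proof -
  have "AE x in PiM S (\<lambda>_. \<nu>). \<forall>i\<in>S. d (x i) \<le> K (x i) (x i)"
    by (intro AE_finite_allI S AE_PiM_single[OF S _ AE_excess_nonneg])
  with AE_psd_km[OF S] show ?thesis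
  proof eventually_elim
    case (elim x)
    have "pd (0 + 0) S (\<lambda>i j. km x i j + (if i = j then K (x i) (x i) - d (x i) else 0))"
      by (rule pd_add_diag[OF S elim(1)]) (use elim(2) in auto)
    moreover have "km x i j + (if i = j then K (x i) (x i) - d (x i) else 0) = K (x i) (x j)" for i j
      by (simp add: km_def)
    ultimately show ?case by simp
  qed
qed

lemma AE_fdet_K_bounds:
  assumes S: "finite S"
  shows "AE x in PiM S (\<lambda>_. \<nu>). 0 \<le> fdet S (\<lambda>i j. K (x i) (x j)) \<and> fdet S (\<lambda>i j. K (x i) (x j)) \<le> k ^ card S"
  using AE_psd_K[OF S]
proof eventually_elim
  case (elim x)
  have "(\<Prod>i\<in>S. K (x i) (x i)) \<le> (\<Prod>i\<in>S. k)"
    using pd_diag[OF S elim] K_bd by (intro prod_mono) (auto intro: order_trans[OF abs_ge_self])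
  then show ?case using fdet_nonneg[OF S elim] fdet_hadamard[OF S elim] by simp
qed

lemma fmom_le: "fmom n UNIV \<le> ennreal ((k * w UNIV) ^ n)"
proof -
  interpret S: product_sigma_finite "\<lambda>_. \<nu>" by (rule product_sigma_finite_const)
  have "fmom n UNIV \<le> (\<integral>\<^sup>+x. ennreal (k ^ n) \<partial>PiM {..<n} (\<lambda>_. \<nu>))"
    unfolding fmom_def
  proof (rule nn_integral_mono_AE)
    show "AE x in PiM {..<n} (\<lambda>_. \<nu>). (\<Prod>i<n. indicator UNIV (x i)) * ennreal (fdet {..<n} (\<lambda>i j. K (x i) (x j))) \<le> ennreal (k ^ n)"
      using AE_fdet_K_bounds[OF finite_lessThan[of n]] by eventually_elim (auto intro: ennreal_leI)
  qed
  also have "\<dots> = ennreal (k ^ n) * (\<Prod>i<n. emeasure \<nu> UNIV)"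
    using S.emeasure_PiM[of "{..<n}" "\<lambda>_. UNIV"] space_UNIV sets.top[of \<nu>] by (simp add: space_PiM)
  also have "\<dots> = ennreal ((k * w UNIV) ^ n)"
    using k_nonneg by (simp add: emeasure_eq_measure ennreal_power ennreal_mult' power_mult_distrib)
  finally show ?thesis .
qed

lemma UNIV_sets: "UNIV \<in> sets \<nu>"
  using sets.top[of \<nu>] space_UNIV by simp

lemma integrable_three_power: "integrable P (\<lambda>\<omega>. 3 ^ num UNIV \<omega> :: real)"
proof (rule integrableI_nonneg)
  note UNIV_sets[measurable]
  show "(\<lambda>\<omega>. 3 ^ num UNIV \<omega> :: real) \<in> borel_measurable P" by measurable
  have pt: "ennreal (3 ^ m) = (\<Sum>n. ennreal (2 ^ n / fact n) * of_nat (falling n m))" for m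
  proof -
    have "(\<Sum>n. ennreal (2 ^ n / fact n) * of_nat (falling n m)) = (\<Sum>n\<in>{..m}. ennreal (2 ^ n / fact n) * of_nat (falling n m))"
      by (rule suminf_finite) (auto simp: falling_eq)
    also have "\<dots> = (\<Sum>n\<in>{..m}. ennreal (real (m choose n) * 2 ^ n * 1 ^ (m - n)))"
    proof (intro sum.cong refl)
      fix n
      have "ennreal (2 ^ n / fact n) * of_nat (falling n m) = ennreal (2 ^ n / fact n * real (falling n m))"
        by (subst ennreal_mult) (auto simp: ennreal_of_nat_eq_real_of_nat)
      also have "2 ^ n / fact n * real (falling n m) = real (m choose n) * 2 ^ n * 1 ^ (m - n)"
        by (simp add: falling_eq)
      finally show "ennreal (2 ^ n / fact n) * of_nat (falling n m) = ennreal (real (m choose n) * 2 ^ n * 1 ^ (m - n))" .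
    qed
    also have "\<dots> = ennreal (\<Sum>n\<in>{..m}. real (m choose n) * 2 ^ n * 1 ^ (m - n))" by (rule sum_ennreal) auto
    also have "(\<Sum>n\<in>{..m}. real (m choose n) * 2 ^ n * 1 ^ (m - n)) = 3 ^ m" using binomial_ring[of "2::real" 1 m] by simp
    finally show ?thesis ..
  qed
  have "(\<integral>\<^sup>+\<omega>. ennreal (3 ^ num UNIV \<omega>) \<partial>P) = (\<Sum>n. \<integral>\<^sup>+\<omega>. ennreal (2 ^ n / fact n) * of_nat (falling n (num UNIV \<omega>)) \<partial>P)"
    unfolding pt by (rule nn_integral_suminf) measurable
  also have "\<dots> = (\<Sum>n. ennreal (2 ^ n / fact n) * fmom n UNIV)"
  proof (intro suminf_cong)
    fix n
    have m: "(\<lambda>\<omega>. of_nat (falling n (num UNIV \<omega>)) :: ennreal) \<in> borel_measurable P" by measurable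
    show "(\<integral>\<^sup>+\<omega>. ennreal (2 ^ n / fact n) * of_nat (falling n (num UNIV \<omega>)) \<partial>P) = ennreal (2 ^ n / fact n) * fmom n UNIV"
      unfolding nn_integral_cmult[OF m] fmom_falling[OF UNIV_sets] ..
  qed
  also have "\<dots> \<le> (\<Sum>n. ennreal ((2 * (k * w UNIV)) ^ n / fact n))"
  proof (rule suminf_le)
    fix n
    have "ennreal (2 ^ n / fact n) * fmom n UNIV \<le> ennreal (2 ^ n / fact n) * ennreal ((k * w UNIV) ^ n)"
      by (intro mult_left_mono fmom_le) auto
    also have "\<dots> = ennreal ((2 * (k * w UNIV)) ^ n / fact n)"
      by (simp add: ennreal_mult' [symmetric] power_mult_distrib)
    finally show "ennreal (2 ^ n / fact n) * fmom n UNIV \<le> ennreal ((2 * (k * w UNIV)) ^ n / fact n)" .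
  qed auto
  also have "\<dots> = ennreal (\<Sum>n. (2 * (k * w UNIV)) ^ n / fact n)"
    using k_nonneg summable_exp[of "2 * (k * w UNIV)"]
    by (intro suminf_ennreal2) (auto simp: field_simps)
  also have "\<dots> < \<infinity>" by simp
  finally show "(\<integral>\<^sup>+\<omega>. ennreal (3 ^ num UNIV \<omega>) \<partial>P) < \<infinity>" .
qed auto

text \<open>The product of the counts is the number of tuples with one point in each cell. Such
  tuples are automatically injective because the cells are disjoint, so only the joint intensity is
  involved.\<close>

lemma cell_moment:
  assumes S: "finite S" "S \<subseteq> sets \<nu>" "disjoint S"
  shows "integrable P (\<lambda>\<omega>. \<Prod>Q\<in>S. real (num Q \<omega>))" "(\<integral>\<omega>. (\<Prod>Q\<in>S. real (num Q \<omega>)) \<partial>P) = aI S"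
proof -
  let ?n = "card S"
  obtain e where e: "bij_betw e {..<?n} S"
    using ex_bij_betw_nat_finite[OF S(1)] by (auto simp: lessThan_atLeast0)
  have eS: "e a \<in> S" if "a < ?n" for a using e that by (auto simp: bij_betw_def)
  have einj: "e a = e b \<Longrightarrow> a = b" if "a < ?n" "b < ?n" for a b using e that by (auto simp: bij_betw_def inj_on_def)
  have cnt: "card {x \<in> dtuples ?n (X \<omega>). \<forall>a<?n. x a \<in> e a} = (\<Prod>Q\<in>S. num Q \<omega>)" if w: "\<omega> \<in> space P" for \<omega>
  proof -
    have "{x \<in> dtuples ?n (X \<omega>). \<forall>a<?n. x a \<in> e a} = (\<Pi>\<^sub>E a\<in>{..<?n}. X \<omega> \<inter> e a)"
    proof (intro equalityI subsetI)
      fix x assume x: "x \<in> (\<Pi>\<^sub>E a\<in>{..<?n}. X \<omega> \<inter> e a)"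
      have "inj_on x {..<?n}"
      proof (rule inj_onI)
        fix a b assume ab: "a \<in> {..<?n}" "b \<in> {..<?n}" "x a = x b"
        have "x a \<in> e a" "x b \<in> e b" using x ab(1,2) by (auto simp: PiE_iff)
        then have "e a \<inter> e b \<noteq> {}" using ab(3) by auto
        then have "e a = e b" using S(3) eS ab(1,2) unfolding disjoint_def by blast
        then show "a = b" using einj ab by auto
      qed
      then show "x \<in> {x \<in> dtuples ?n (X \<omega>). \<forall>a<?n. x a \<in> e a}" using x unfolding dtuples_eq by (auto simp: PiE_iff)
    qed (auto simp: dtuples_eq PiE_iff)
    then have "card {x \<in> dtuples ?n (X \<omega>). \<forall>a<?n. x a \<in> e a} = (\<Prod>a<?n. num (e a) \<omega>)" by (simp add: card_PiE)
    also have "\<dots> = (\<Prod>Q\<in>S. num Q \<omega>)" by (rule prod.reindex_bij_betw[OF e])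
    finally show ?thesis .
  qed
  let ?P = "PiM {..<?n} (\<lambda>_. \<nu>)"
  let ?g = "\<lambda>x. (\<Prod>a<?n. indicator (e a) (x a)) * fdet {..<?n} (\<lambda>i j. K (x i) (x j)) :: real"
  have gm: "?g \<in> borel_measurable ?P"
  proof (intro borel_measurable_times borel_measurable_prod fdet_measurable K_measurable_PiM finite_lessThan)
    fix a assume a: "a \<in> {..<?n}"
    then have [measurable]: "e a \<in> sets \<nu>" using eS S by auto
    show "(\<lambda>x. indicator (e a) (x a) :: real) \<in> borel_measurable ?P" using a by measurable
  qed
  have gnn: "AE x in ?P. 0 \<le> ?g x"
    using AE_fdet_K_bounds[OF finite_lessThan[of ?n]] by eventually_elim (auto intro!: mult_nonneg_nonneg prod_nonneg)
  have gb: "\<bar>?g x\<bar> \<le> fact ?n * k ^ ?n" for x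
  proof -
    have "\<bar>?g x\<bar> \<le> 1 * (fact (card {..<?n}) * k ^ card {..<?n})"
      unfolding abs_mult using k_nonneg
      by (intro mult_mono fdet_abs_le K_bd) (auto simp: abs_prod indicator_def intro!: prod_le_1)
    then show ?thesis by simp
  qed
  have gi: "integrable ?P ?g" by (rule integrable_bounded_PiM[OF finite_lessThan gm gb])
  have "(\<integral>\<^sup>+\<omega>. ennreal (\<Prod>Q\<in>S. real (num Q \<omega>)) \<partial>P) = (\<integral>\<^sup>+\<omega>. of_nat (card {x \<in> dtuples ?n (X \<omega>). \<forall>a<?n. x a \<in> e a}) \<partial>P)"
    by (intro nn_integral_cong) (simp add: cnt ennreal_of_nat_eq_real_of_nat)
  also have "\<dots> = (\<integral>\<^sup>+x. (\<Prod>a<?n. indicator (e a) (x a)) * ennreal (fdet {..<?n} (\<lambda>i j. K (x i) (x j))) \<partial>?P)"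
    using eS S by (intro X_mom) auto
  also have "\<dots> = (\<integral>\<^sup>+x. ennreal (?g x) \<partial>?P)"
  proof (rule nn_integral_cong)
    fix x
    have "(\<Prod>a<?n. indicator (e a) (x a) :: ennreal) = ennreal (\<Prod>a<?n. indicator (e a) (x a))"
      by (subst prod_ennreal[symmetric]) (auto simp: ennreal_indicator)
    then show "(\<Prod>a<?n. indicator (e a) (x a)) * ennreal (fdet {..<?n} (\<lambda>i j. K (x i) (x j))) = ennreal (?g x)"
      by (simp add: ennreal_mult'' ennreal_mult' prod_nonneg)
  qed
  also have "\<dots> = ennreal (\<integral>x. ?g x \<partial>?P)" by (rule nn_integral_eq_integral[OF gi gnn])
  finally have nn1: "(\<integral>\<^sup>+\<omega>. ennreal (\<Prod>Q\<in>S. real (num Q \<omega>)) \<partial>P) = ennreal (\<integral>x. ?g x \<partial>?P)" .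
  have g1: "(\<integral>x. ?g x \<partial>?P) = (\<integral>x. ?g (\<lambda>a\<in>{..<?n}. x (e a)) \<partial>PiM S (\<lambda>_. \<nu>))"
    by (rule integral_PiM_bij[OF finite_lessThan e gm])
  have g2: "(\<integral>x. ?g (\<lambda>a\<in>{..<?n}. x (e a)) \<partial>PiM S (\<lambda>_. \<nu>)) = aI S"
    unfolding aI_def
  proof (intro Bochner_Integration.integral_cong refl arg_cong2[where f = "(*)"])
    fix x
    show "(\<Prod>a<?n. indicator (e a) ((\<lambda>a\<in>{..<?n}. x (e a)) a)) = ci S x"
      unfolding ci_def by (subst prod.reindex_bij_betw[OF e, symmetric]) (auto intro!: prod.cong)
    show "fdet {..<?n} (\<lambda>i j. K ((\<lambda>a\<in>{..<?n}. x (e a)) i) ((\<lambda>a\<in>{..<?n}. x (e a)) j)) = fdet S (\<lambda>P Q. K (x P) (x Q))"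
      unfolding fdet_reindex[OF e finite_lessThan] by (rule fdet_cong) auto
  qed
  have g: "(\<integral>x. ?g x \<partial>?P) = aI S" by (rule trans[OF g1 g2])
  have nn: "(\<integral>\<^sup>+\<omega>. ennreal (\<Prod>Q\<in>S. real (num Q \<omega>)) \<partial>P) = ennreal (aI S)" using nn1 unfolding g .
  have "0 \<le> (\<integral>x. ?g x \<partial>?P)" using gnn by (rule integral_nonneg_AE)
  then have a0: "0 \<le> aI S" unfolding g .
  have m: "(\<lambda>\<omega>. \<Prod>Q\<in>S. real (num Q \<omega>)) \<in> borel_measurable P"
  proof (rule borel_measurable_prod)
    fix Q assume "Q \<in> S"
    then have [measurable]: "Q \<in> sets \<nu>" using S by auto
    show "(\<lambda>\<omega>. real (num Q \<omega>)) \<in> borel_measurable P" by measurable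
  qed
  show i: "integrable P (\<lambda>\<omega>. \<Prod>Q\<in>S. real (num Q \<omega>))"
    using nn by (intro integrableI_nonneg m) (auto intro!: prod_nonneg)
  show "(\<integral>\<omega>. (\<Prod>Q\<in>S. real (num Q \<omega>)) \<partial>P) = aI S"
    using nn nn_integral_eq_integral[OF i] a0 by (simp add: prod_nonneg)
qed

text \<open>Both functions are expanded in monomials of the counts, and every mean \<open>aI\<close>
  in terms of \<open>bI\<close>. The excess factors of \<open>S \<union> T\<close> are the products
  of those of \<open>S\<close> and \<open>T\<close>, so they come out of the covariance and act
  exactly as a recentring at \<open>gI\<close>.\<close>

lemma mlin_moments:
  fixes \<phi> \<psi> :: "'a set set \<Rightarrow> real"
  assumes I: "finite I" "I \<subseteq> sets \<nu>" and J: "finite J" "J \<subseteq> sets \<nu>" and IJ: "I \<inter> J = {}" "disjoint (I \<union> J)"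
  defines "\<Phi> \<equiv> \<lambda>\<omega>. mlin \<phi> I (\<lambda>Q. real (num Q \<omega>))" and "\<Psi> \<equiv> \<lambda>\<omega>. mlin \<psi> J (\<lambda>Q. real (num Q \<omega>))"
  shows "(\<integral>\<omega>. \<Phi> \<omega> * \<Psi> \<omega> \<partial>P) - (\<integral>\<omega>. \<Phi> \<omega> \<partial>P) * (\<integral>\<omega>. \<Psi> \<omega> \<partial>P)
    = (\<Sum>U\<in>Pow I. \<Sum>V\<in>Pow J. shcoef \<phi> I gI U * shcoef \<psi> J gI V * (bI (U \<union> V) - bI U * bI V))"
proof -
  have sub: "finite S" "S \<subseteq> sets \<nu>" "disjoint S" if "S \<subseteq> I \<union> J" for S
  proof -
    show "finite S" using I(1) J(1) by (intro finite_subset[OF that]) auto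
    show "S \<subseteq> sets \<nu>" using I(2) J(2) that by auto
    show "disjoint S" using IJ(2) that unfolding disjoint_def by blast
  qed
  let ?N = "\<lambda>S \<omega>. \<Prod>Q\<in>S. real (num Q \<omega>)"
  have e1: "\<Phi> \<omega> = (\<Sum>S\<in>Pow I. mcoef \<phi> S * ?N S \<omega>)" "\<Psi> \<omega> = (\<Sum>T\<in>Pow J. mcoef \<psi> T * ?N T \<omega>)" for \<omega>
    unfolding \<Phi>_def \<Psi>_def by (rule mlin_expand, fact)+
  have E1: "(\<integral>\<omega>. \<Phi> \<omega> \<partial>P) = (\<Sum>S\<in>Pow I. mcoef \<phi> S * aI S)"
    unfolding e1
  proof (subst Bochner_Integration.integral_sum)
    fix U assume "U \<in> Pow I"
    then have "U \<subseteq> I \<union> J" by auto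
    from cell_moment(1)[OF sub[OF this]] show "integrable P (\<lambda>\<omega>. mcoef \<phi> U * ?N U \<omega>)" by simp
  next
    show "(\<Sum>U\<in>Pow I. \<integral>\<omega>. mcoef \<phi> U * ?N U \<omega> \<partial>P) = (\<Sum>U\<in>Pow I. mcoef \<phi> U * aI U)"
    proof (intro sum.cong refl)
      fix U assume "U \<in> Pow I"
      then have "U \<subseteq> I \<union> J" by auto
      from cell_moment(2)[OF sub[OF this]] show "(\<integral>\<omega>. mcoef \<phi> U * ?N U \<omega> \<partial>P) = mcoef \<phi> U * aI U" by simp
    qed
  qed
  have E2: "(\<integral>\<omega>. \<Psi> \<omega> \<partial>P) = (\<Sum>T\<in>Pow J. mcoef \<psi> T * aI T)"
    unfolding e1
  proof (subst Bochner_Integration.integral_sum)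
    fix U assume "U \<in> Pow J"
    then have "U \<subseteq> I \<union> J" by auto
    from cell_moment(1)[OF sub[OF this]] show "integrable P (\<lambda>\<omega>. mcoef \<psi> U * ?N U \<omega>)" by simp
  next
    show "(\<Sum>U\<in>Pow J. \<integral>\<omega>. mcoef \<psi> U * ?N U \<omega> \<partial>P) = (\<Sum>U\<in>Pow J. mcoef \<psi> U * aI U)"
    proof (intro sum.cong refl)
      fix U assume "U \<in> Pow J"
      then have "U \<subseteq> I \<union> J" by auto
      from cell_moment(2)[OF sub[OF this]] show "(\<integral>\<omega>. mcoef \<psi> U * ?N U \<omega> \<partial>P) = mcoef \<psi> U * aI U" by simp
    qed
  qed
  have e12: "\<Phi> \<omega> * \<Psi> \<omega> = (\<Sum>S\<in>Pow I. \<Sum>T\<in>Pow J. (mcoef \<phi> S * mcoef \<psi> T) * ?N (S \<union> T) \<omega>)" for \<omega>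
    unfolding e1 sum_product
  proof (intro sum.cong refl)
    fix S T assume ST: "S \<in> Pow I" "T \<in> Pow J"
    then have "?N (S \<union> T) \<omega> = ?N S \<omega> * ?N T \<omega>"
      using I J IJ finite_subset by (intro prod.union_disjoint) auto
    then show "mcoef \<phi> S * ?N S \<omega> * (mcoef \<psi> T * ?N T \<omega>) = (mcoef \<phi> S * mcoef \<psi> T) * ?N (S \<union> T) \<omega>" by simp
  qed
  have iST: "integrable P (\<lambda>\<omega>. (mcoef \<phi> S * mcoef \<psi> T) * ?N (S \<union> T) \<omega>)" if "S \<in> Pow I" "T \<in> Pow J" for S T
    using that by (intro Bochner_Integration.integrable_mult_right cell_moment sub) auto
  have "(\<integral>\<omega>. \<Phi> \<omega> * \<Psi> \<omega> \<partial>P) = (\<Sum>S\<in>Pow I. \<Sum>T\<in>Pow J. (mcoef \<phi> S * mcoef \<psi> T) * aI (S \<union> T))"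
  proof -
    have "(\<integral>\<omega>. \<Phi> \<omega> * \<Psi> \<omega> \<partial>P) = (\<Sum>S\<in>Pow I. \<integral>\<omega>. (\<Sum>T\<in>Pow J. (mcoef \<phi> S * mcoef \<psi> T) * ?N (S \<union> T) \<omega>) \<partial>P)"
      unfolding e12 using iST by (intro Bochner_Integration.integral_sum Bochner_Integration.integrable_sum) auto
    also have "\<dots> = (\<Sum>S\<in>Pow I. \<Sum>T\<in>Pow J. \<integral>\<omega>. (mcoef \<phi> S * mcoef \<psi> T) * ?N (S \<union> T) \<omega> \<partial>P)"
      using iST by (intro sum.cong refl Bochner_Integration.integral_sum) auto
    also have "\<dots> = (\<Sum>S\<in>Pow I. \<Sum>T\<in>Pow J. (mcoef \<phi> S * mcoef \<psi> T) * aI (S \<union> T))"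
    proof (intro sum.cong refl)
      fix S T assume "S \<in> Pow I" "T \<in> Pow J"
      then have "S \<union> T \<subseteq> I \<union> J" by auto
      from cell_moment(2)[OF sub[OF this]]
      show "(\<integral>\<omega>. (mcoef \<phi> S * mcoef \<psi> T) * ?N (S \<union> T) \<omega> \<partial>P) = (mcoef \<phi> S * mcoef \<psi> T) * aI (S \<union> T)" by simp
    qed
    finally show ?thesis .
  qed
  then have "(\<integral>\<omega>. \<Phi> \<omega> * \<Psi> \<omega> \<partial>P) - (\<integral>\<omega>. \<Phi> \<omega> \<partial>P) * (\<integral>\<omega>. \<Psi> \<omega> \<partial>P)
    = (\<Sum>S\<in>Pow I. \<Sum>T\<in>Pow J. mcoef \<phi> S * mcoef \<psi> T * (aI (S \<union> T) - aI S * aI T))"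
    unfolding E1 E2 sum_product by (simp add: sum_subtractf right_diff_distrib mult_ac)
  also have "\<dots> = (\<Sum>S\<in>Pow I. \<Sum>T\<in>Pow J. mcoef \<phi> S * mcoef \<psi> T *
      (\<Sum>U\<in>Pow S. \<Sum>V\<in>Pow T. (bI (U \<union> V) - bI U * bI V) * ((\<Prod>i\<in>S - U. gI i) * (\<Prod>i\<in>T - V. gI i))))"
  proof (intro sum.cong refl arg_cong2[where f = "(*)"])
    fix S T assume ST: "S \<in> Pow I" "T \<in> Pow J"
    then have dis: "S \<inter> T = {}" and fin: "finite S" "finite T" using IJ I J finite_subset by auto
    have s: "S \<union> T \<subseteq> I \<union> J" "S \<subseteq> I \<union> J" "T \<subseteq> I \<union> J" using ST by auto
    have "aI (S \<union> T) = (\<Sum>W\<in>Pow (S \<union> T). bI W * (\<Prod>Q\<in>S \<union> T - W. gI Q))"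
      by (rule aI_expand[OF sub(1,2)[OF s(1)] K_diag])
    also have "\<dots> = (\<Sum>U\<in>Pow S. \<Sum>V\<in>Pow T. bI (U \<union> V) * (\<Prod>Q\<in>S \<union> T - (U \<union> V). gI Q))"
      by (rule sum_Pow_Un[OF dis])
    also have "\<dots> = (\<Sum>U\<in>Pow S. \<Sum>V\<in>Pow T. bI (U \<union> V) * ((\<Prod>i\<in>S - U. gI i) * (\<Prod>i\<in>T - V. gI i)))"
    proof (intro sum.cong refl arg_cong2[where f = "(*)"])
      fix U V assume UV: "U \<in> Pow S" "V \<in> Pow T"
      have "S \<union> T - (U \<union> V) = (S - U) \<union> (T - V)" using UV dis by auto
      then show "(\<Prod>Q\<in>S \<union> T - (U \<union> V). gI Q) = (\<Prod>i\<in>S - U. gI i) * (\<Prod>i\<in>T - V. gI i)"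
        using fin dis by (simp, intro prod.union_disjoint) auto
    qed
    moreover have "aI S * aI T = (\<Sum>U\<in>Pow S. \<Sum>V\<in>Pow T. bI U * bI V * ((\<Prod>i\<in>S - U. gI i) * (\<Prod>i\<in>T - V. gI i)))"
      unfolding aI_expand[OF sub(1,2)[OF s(2)] K_diag] aI_expand[OF sub(1,2)[OF s(3)] K_diag] sum_product by (simp add: mult_ac)
    ultimately show "aI (S \<union> T) - aI S * aI T = (\<Sum>U\<in>Pow S. \<Sum>V\<in>Pow T. (bI (U \<union> V) - bI U * bI V) * ((\<Prod>i\<in>S - U. gI i) * (\<Prod>i\<in>T - V. gI i)))"
      by (simp add: left_diff_distrib sum_subtractf)
  qed
  also have "\<dots> = (\<Sum>U\<in>Pow I. \<Sum>V\<in>Pow J. shcoef \<phi> I gI U * shcoef \<psi> J gI V * (bI (U \<union> V) - bI U * bI V))"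
    by (rule sum_mcoef_shift[OF I(1) J(1)])
  finally show ?thesis .
qed

lemma mlin_num_bound:
  assumes I: "finite I" "disjoint I" and w: "\<omega> \<in> space P" and \<phi>: "\<And>Z. \<bar>\<phi> Z\<bar> \<le> 1"
  shows "\<bar>mlin \<phi> I (\<lambda>Q. real (num Q \<omega>))\<bar> \<le> 3 ^ num (\<Union>I) \<omega>"
proof -
  have "\<bar>mlin \<phi> I (\<lambda>Q. real (num Q \<omega>))\<bar> \<le> (\<Prod>Q\<in>I. \<bar>real (num Q \<omega>)\<bar> + \<bar>1 - real (num Q \<omega>)\<bar>)"
    by (rule mlin_bound[OF I(1) \<phi>])
  also have "\<dots> \<le> (\<Prod>Q\<in>I. 3 ^ num Q \<omega>)"
  proof (intro prod_mono conjI)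
    fix Q
    \<comment> \<open>For a natural number $m$ the factor $m + |1 - m|$ is at most $1 + 2m$;
      Bernoulli makes the bound multiplicative, so the cells combine to the total count.\<close>
    have "1 + 2 * real m \<le> 3 ^ m" for m using Bernoulli_inequality[of "2::real" m] by (simp add: mult.commute)
    from this[of "num Q \<omega>"] show "\<bar>real (num Q \<omega>)\<bar> + \<bar>1 - real (num Q \<omega>)\<bar> \<le> 3 ^ num Q \<omega>" by (simp add: abs_if)
  qed auto
  also have "\<dots> = 3 ^ (\<Sum>Q\<in>I. num Q \<omega>)" by (simp add: power_sum)
  also have "(\<Sum>Q\<in>I. num Q \<omega>) = card (\<Union>Q\<in>I. X \<omega> \<inter> Q)"
    using X_fin[OF w] I by (intro card_UN_disjoint[symmetric]) (auto simp: disjoint_def)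
  also have "(\<Union>Q\<in>I. X \<omega> \<inter> Q) = X \<omega> \<inter> \<Union>I" by auto
  finally show ?thesis .
qed

end

section \<open>Events coded by occupied cells\<close>

definition sub_cells :: "'a set set \<Rightarrow> 'a set \<Rightarrow> 'a set set" where
  "sub_cells F A = {Q \<in> cells F. Q \<subseteq> A}"

lemma disjoint_cells: "disjoint (cells F)"
  unfolding disjoint_def
proof (intro ballI impI)
  fix P Q assume P: "P \<in> cells F" and Q: "Q \<in> cells F" and "P \<noteq> Q"
  show "P \<inter> Q = {}"
  proof (rule equals0I)
    fix x assume x: "x \<in> P \<inter> Q"
    have "cell F x = P" "cell F x = Q"
      using x mem_cells_iff[OF P, of x] mem_cells_iff[OF Q, of x] by blast+
    then show False using \<open>P \<noteq> Q\<close> by simp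
  qed
qed

lemma disjoint_sub_cells: "disjoint (sub_cells F A)" "disjoint (sub_cells F A \<union> sub_cells F B)"
  using disjoint_cells[of F] unfolding disjoint_def sub_cells_def by blast+

lemma sub_cells_disjoint: "A \<inter> B = {} \<Longrightarrow> sub_cells F A \<inter> sub_cells F B = {}"
proof (rule equals0I)
  fix Q assume AB: "A \<inter> B = {}" and "Q \<in> sub_cells F A \<inter> sub_cells F B"
  then have "Q \<in> cells F" "Q \<subseteq> A \<inter> B" by (auto simp: sub_cells_def)
  then obtain x where "Q = cell F x" "Q = {}" using AB by auto
  then show False using cell_self[of x F] by simp
qed

lemma cell_subset: "A \<in> F \<Longrightarrow> x \<in> A \<Longrightarrow> cell F x \<subseteq> A"
  by (auto simp: cell_def)

lemma Union_sub_cells: "A \<in> F \<Longrightarrow> \<Union>(sub_cells F A) = A"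
  unfolding sub_cells_def
proof (intro equalityI subsetI)
  fix x assume "A \<in> F" "x \<in> A"
  then show "x \<in> \<Union>{Q \<in> cells F. Q \<subseteq> A}" using cell_subset[of A F x] cell_self[of x F] by blast
qed auto

lemma finite_sub_cells: "finite F \<Longrightarrow> finite (sub_cells F A)"
  unfolding sub_cells_def using finite_cells[of F] by (rule finite_subset[rotated]) auto

lemma finite_separated:
  fixes S :: "'a::metric_space set"
  assumes "finite S"
  obtains \<delta> where "\<delta> > 0" "\<And>x y. x \<in> S \<Longrightarrow> y \<in> S \<Longrightarrow> x \<noteq> y \<Longrightarrow> \<delta> \<le> dist x y"
proof
  let ?D = "insert 1 {dist x y | x y. x \<in> S \<and> y \<in> S \<and> x \<noteq> y}"
  have "?D \<subseteq> insert 1 ((\<lambda>(x, y). dist x y) ` (S \<times> S))" by auto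
  then have f: "finite ?D" by (rule finite_subset) (use assms in simp)
  show "Min ?D > 0" using f by (subst Min_gr_iff) auto
  fix x y assume "x \<in> S" "y \<in> S" "x \<noteq> y"
  then show "Min ?D \<le> dist x y" using f by (intro Min_le) auto
qed

definition counts_det :: "'w measure \<Rightarrow> ('w \<Rightarrow> 'a set) \<Rightarrow> 'a set set \<Rightarrow> 'w set \<Rightarrow> bool" where
  "counts_det P X \<D> E \<longleftrightarrow> (\<forall>\<omega>\<in>space P. \<forall>\<omega>'\<in>space P.
     (\<forall>D\<in>\<D>. card (X \<omega> \<inter> D) = card (X \<omega>' \<inter> D)) \<longrightarrow> \<omega> \<in> E \<longrightarrow> \<omega>' \<in> E)"

locale euclidean_counts = point_counts \<nu> K k d Fs P X
  for \<nu> :: "'a::euclidean_space measure" and K k d Fs and P :: "'w measure" and X +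
  fixes C :: "'a set"
  assumes sets_borel: "sets \<nu> = sets borel" and bounded_C: "bounded C"
begin

text \<open>Describes an event that is determined by the counts of the sets in \<open>\<D>\<close> through the set $Z$ of occupied cells.\<close>

definition event_code :: "'a set set \<Rightarrow> 'w set \<Rightarrow> 'a set set \<Rightarrow> real" where
  "event_code \<D> E Z = (if \<exists>\<omega>\<in>E. \<forall>D\<in>\<D>. num D \<omega> = card {Q \<in> Z. Q \<subseteq> D} then 1 else 0)"

lemma cells_borel: "finite F \<Longrightarrow> F \<subseteq> sets \<nu> \<Longrightarrow> sub_cells F A \<subseteq> sets \<nu>"
  using fam_cells[of F] unfolding fam_def sub_cells_def by auto

lemma num_eq_card_cells:
  assumes F: "finite F" "D \<in> F" and DA: "D \<subseteq> A" and w: "\<omega> \<in> space P"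
    and le1: "\<And>Q. Q \<in> sub_cells F A \<Longrightarrow> num Q \<omega> \<le> 1"
  shows "card {Q \<in> {Q \<in> sub_cells F A. real (num Q \<omega>) = 1}. Q \<subseteq> D} = num D \<omega>"
proof -
  have e: "{Q \<in> {Q \<in> sub_cells F A. real (num Q \<omega>) = 1}. Q \<subseteq> D} = {Q \<in> sub_cells F D. num Q \<omega> = 1}"
    using DA by (auto simp: sub_cells_def)
  have f: "finite (sub_cells F D)" using F(1) by (rule finite_sub_cells)
  have "num D \<omega> = card (\<Union>Q\<in>sub_cells F D. X \<omega> \<inter> Q)"
    using Union_sub_cells[OF F(2)] by (intro arg_cong[where f = card]) blast
  also have "\<dots> = (\<Sum>Q\<in>sub_cells F D. num Q \<omega>)"
    using X_fin[OF w] f disjoint_sub_cells(1)[of F D] by (intro card_UN_disjoint) (auto simp: disjoint_def)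
  also have "\<dots> = (\<Sum>Q\<in>sub_cells F D. if num Q \<omega> = 1 then 1 else 0)"
  proof (intro sum.cong refl)
    fix Q assume "Q \<in> sub_cells F D"
    then have "Q \<in> sub_cells F A" using DA by (auto simp: sub_cells_def)
    from le1[OF this] show "num Q \<omega> = (if num Q \<omega> = 1 then 1 else 0)" by auto
  qed
  also have "\<dots> = card {Q \<in> sub_cells F D. num Q \<omega> = 1}" using f by (simp add: sum.If_cases Int_def)
  finally show ?thesis unfolding e ..
qed

text \<open>If no cell carries two points, the counts form a vertex of the cube, and the number of
  points in each set of \<open>\<D>\<close> is the number of occupied cells inside it. The code
  therefore decides the event correctly.\<close>

lemma mlin_event_code:
  assumes F: "finite F" "\<D> \<subseteq> F" and DA: "\<And>D. D \<in> \<D> \<Longrightarrow> D \<subseteq> A" and w: "\<omega> \<in> space P"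
    and le1: "\<And>Q. Q \<in> sub_cells F A \<Longrightarrow> num Q \<omega> \<le> 1"
    and E: "E \<subseteq> space P" "counts_det P X \<D> E"
  shows "mlin (event_code \<D> E) (sub_cells F A) (\<lambda>Q. real (num Q \<omega>)) = indicator E \<omega>"
proof -
  let ?Z = "{Q \<in> sub_cells F A. real (num Q \<omega>) = 1}"
  have "mlin (event_code \<D> E) (sub_cells F A) (\<lambda>Q. real (num Q \<omega>)) = event_code \<D> E ?Z"
  proof (rule mlin_01[OF finite_sub_cells[OF F(1)]])
    fix Q assume "Q \<in> sub_cells F A"
    from le1[OF this] have "num Q \<omega> = 0 \<or> num Q \<omega> = 1" by linarith
    then show "real (num Q \<omega>) = 0 \<or> real (num Q \<omega>) = 1" by auto
  qed
  moreover have c: "card {Q \<in> ?Z. Q \<subseteq> D} = num D \<omega>" if "D \<in> \<D>" for D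
    using F DA that by (intro num_eq_card_cells w le1) auto
  have "(\<exists>\<omega>'\<in>E. \<forall>D\<in>\<D>. num D \<omega>' = card {Q \<in> ?Z. Q \<subseteq> D}) \<longleftrightarrow> \<omega> \<in> E"
  proof
    assume "\<exists>\<omega>'\<in>E. \<forall>D\<in>\<D>. num D \<omega>' = card {Q \<in> ?Z. Q \<subseteq> D}"
    then obtain \<omega>' where w': "\<omega>' \<in> E" "\<forall>D\<in>\<D>. num D \<omega>' = num D \<omega>" using c by auto
    show "\<omega> \<in> E" using E w w' unfolding counts_det_def by blast
  next
    assume "\<omega> \<in> E" then show "\<exists>\<omega>'\<in>E. \<forall>D\<in>\<D>. num D \<omega>' = card {Q \<in> ?Z. Q \<subseteq> D}"
      using c by (intro bexI[of _ \<omega>]) auto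
  qed
  ultimately show ?thesis by (simp add: event_code_def indicator_def)
qed

text \<open>Two outcomes coded by the same \<open>Z\<close> have equal counts, so an event
  determined by these counts contains both or neither; disjoint events cannot share a code.\<close>

lemma sum_event_code_le:
  assumes I: "finite I" "disjoint_family_on E I" and E: "\<And>i. i \<in> I \<Longrightarrow> E i \<subseteq> space P \<and> counts_det P X \<D> (E i)"
  shows "(\<Sum>i\<in>I. event_code \<D> (E i) Z) \<le> 1"
proof (cases "\<exists>i\<in>I. event_code \<D> (E i) Z = 1")
  case True
  then obtain i where i: "i \<in> I" "event_code \<D> (E i) Z = 1" by auto
  then obtain \<omega> where w: "\<omega> \<in> E i" "\<forall>D\<in>\<D>. num D \<omega> = card {Q \<in> Z. Q \<subseteq> D}"
    by (auto simp: event_code_def split: if_splits)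
  have "event_code \<D> (E j) Z = 0" if j: "j \<in> I - {i}" for j
  proof (rule ccontr)
    assume "event_code \<D> (E j) Z \<noteq> 0"
    then obtain \<omega>' where w': "\<omega>' \<in> E j" "\<forall>D\<in>\<D>. num D \<omega>' = card {Q \<in> Z. Q \<subseteq> D}"
      by (auto simp: event_code_def split: if_splits)
    then have "\<forall>D\<in>\<D>. num D \<omega>' = num D \<omega>" using w by auto
    then have "\<omega> \<in> E j" using w(1) w'(1) E[OF i(1)] E[of j] j unfolding counts_det_def by blast
    then show False using w(1) i(1) j I(2) unfolding disjoint_family_on_def by blast
  qed
  then show ?thesis using i I(1) by (simp add: sum.remove)
next
  case False
  moreover have "event_code \<D> (E i) Z = 0 \<or> event_code \<D> (E i) Z = 1" for i by (simp add: event_code_def)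
  ultimately have "event_code \<D> (E i) Z = 0" if "i \<in> I" for i using that by blast
  then show ?thesis by simp
qed

lemma excess_integrable:
  assumes "Q \<in> sets \<nu>"
  shows "integrable \<nu> (\<lambda>x. indicator Q x * (K x x - d x))"
proof (rule integrable_bounded)
  note K_diag[measurable] d_meas[measurable] assms[measurable]
  show "(\<lambda>x. indicator Q x * (K x x - d x)) \<in> borel_measurable \<nu>" by measurable
  show "\<bar>indicator Q x * (K x x - d x)\<bar> \<le> 2 * k" for x
    using K_bd[of x x] d_bd[of x] by (auto simp: indicator_def abs_le_iff)
qed

lemma gI_nonneg: "0 \<le> gI Q"
  unfolding gI_def
proof (rule integral_nonneg_AE)
  show "AE x in \<nu>. 0 \<le> indicator Q x * (K x x - d x)"
    using AE_excess_nonneg by eventually_elim auto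
qed

lemma gI_mono: "Q \<in> sets \<nu> \<Longrightarrow> R \<in> sets \<nu> \<Longrightarrow> Q \<subseteq> R \<Longrightarrow> gI Q \<le> gI R"
  unfolding gI_def
proof (rule integral_mono_AE[OF excess_integrable excess_integrable])
  assume QR: "Q \<subseteq> R"
  show "AE x in \<nu>. indicator Q x * (K x x - d x) \<le> indicator R x * (K x x - d x)"
    using AE_excess_nonneg by eventually_elim (use QR in \<open>auto simp: indicator_def\<close>)
qed

text \<open>A point of zero mass carries no excess trivially, and at an atom the two diagonals
  agree.\<close>

lemma gI_singleton: "gI {x} = 0"
proof -
  have s: "{x} \<in> sets \<nu>" unfolding sets_borel by simp
  have "gI {x} = (\<integral>y. indicator {x} y * (K x x - d x) \<partial>\<nu>)"
    unfolding gI_def by (intro Bochner_Integration.integral_cong) (auto simp: indicator_def)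
  also have "\<dots> = w {x} * (K x x - d x)" using s space_UNIV by simp
  also have "\<dots> = 0"
  proof (cases "w {x} = 0")
    case False
    then have "w {x} > 0" using measure_nonneg[of \<nu> "{x}"] by linarith
    from AE_diag_eq_at_atom[OF K_diag s this] show ?thesis by simp
  qed simp
  finally show ?thesis .
qed

lemma ex_ball_gI_le: "\<exists>\<delta>>0. gI (ball x \<delta>) \<le> 1"
proof -
  have "(\<lambda>n. gI (ball x (inverse (Suc n)))) \<longlonglongrightarrow> gI {x}"
    unfolding gI_def
  proof (rule integral_dominated_convergence[where w = "\<lambda>_. 2 * k"])
    show "(\<lambda>y. indicator {x} y * (K y y - d y)) \<in> borel_measurable \<nu>"
      by (rule borel_measurable_integrable[OF excess_integrable]) (simp add: sets_borel)
    show "(\<lambda>y. indicator (ball x (inverse (Suc n))) y * (K y y - d y)) \<in> borel_measurable \<nu>" for n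
      by (rule borel_measurable_integrable[OF excess_integrable]) (simp add: sets_borel)
    show "AE y in \<nu>. norm (indicator (ball x (inverse (Suc n))) y * (K y y - d y)) \<le> 2 * k" for n
    proof (rule AE_I2)
      fix y show "norm (indicator (ball x (inverse (Suc n))) y * (K y y - d y)) \<le> 2 * k"
        using K_bd[of y y] d_bd[of y] by (auto simp: indicator_def abs_le_iff)
    qed
    show "AE y in \<nu>. (\<lambda>n. indicator (ball x (inverse (Suc n))) y * (K y y - d y)) \<longlonglongrightarrow> indicator {x} y * (K y y - d y)"
    proof (rule AE_I2)
      fix y
      show "(\<lambda>n. indicator (ball x (inverse (Suc n))) y * (K y y - d y)) \<longlonglongrightarrow> indicator {x} y * (K y y - d y)"
      proof (cases "y = x")
        case True then show ?thesis by simp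
      next
        case False
        then have "0 < dist x y" by auto
        from order_tendstoD(2)[OF LIMSEQ_inverse_real_of_nat this]
        have "eventually (\<lambda>n. indicator (ball x (inverse (Suc n))) y * (K y y - d y) = indicator {x} y * (K y y - d y)) sequentially"
          by eventually_elim (use False in \<open>auto simp: indicator_def\<close>)
        then show ?thesis by (rule tendsto_eventually)
      qed
    qed
  qed simp
  then have "(\<lambda>n. gI (ball x (inverse (Suc n)))) \<longlonglongrightarrow> 0" by (simp add: gI_singleton)
  from order_tendstoD(2)[OF this, of 1] obtain n where "gI (ball x (inverse (Suc n))) < 1"
    by (auto simp: eventually_sequentially)
  then show ?thesis by (intro exI[of _ "inverse (real (Suc n))"]) auto
qed

text \<open>Atoms carry no excess, so by compactness the excess mass of all sufficiently small sets is at most 1.\<close>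

lemma ex_mesh_gI_le:
  obtains e where "e > 0" "\<And>Q y. Q \<in> sets \<nu> \<Longrightarrow> Q \<subseteq> C \<Longrightarrow> Q \<subseteq> ball y e \<Longrightarrow> gI Q \<le> 1"
proof -
  let ?G = "{ball x \<delta> | x \<delta>. \<delta> > 0 \<and> gI (ball x \<delta>) \<le> 1}"
  have cp: "compact (closure C)" using bounded_C by simp
  have "closure C \<subseteq> \<Union>?G"
  proof
    fix x obtain \<delta> where "\<delta> > 0" "gI (ball x \<delta>) \<le> 1" using ex_ball_gI_le by blast
    then show "x \<in> \<Union>?G" by (intro UnionI[of "ball x \<delta>"]) auto
  qed
  then obtain e where e: "e > 0" "\<And>x. x \<in> closure C \<Longrightarrow> \<exists>G\<in>?G. ball x e \<subseteq> G"
    by (rule Heine_Borel_lemma[OF cp]) auto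
  show ?thesis
  proof (rule that[of "e / 2"])
    show "e / 2 > 0" using e(1) by simp
    fix Q y assume Q: "Q \<in> sets \<nu>" "Q \<subseteq> C" "Q \<subseteq> ball y (e / 2)"
    show "gI Q \<le> 1"
    proof (cases "Q = {}")
      case True then show ?thesis by (simp add: gI_def)
    next
      case False
      then obtain x where x: "x \<in> Q" by auto
      then have "x \<in> closure C" using Q(2) closure_subset by auto
      from e(2)[OF this] obtain z \<delta> where z: "gI (ball z \<delta>) \<le> 1" "ball x e \<subseteq> ball z \<delta>" by auto
      have "Q \<subseteq> ball x e"
      proof
        fix u assume "u \<in> Q"
        then have "dist y u < e / 2" "dist y x < e / 2" using Q(3) x by auto
        then show "u \<in> ball x e" using dist_triangle2[of x u y] by (simp add: dist_commute)
      qed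
      then have "gI Q \<le> gI (ball z \<delta>)" using z(2) Q(1) by (intro gI_mono) (auto simp: sets_borel)
      then show ?thesis using z(1) by simp
    qed
  qed
qed

lemma event_code_bounds: "0 \<le> event_code \<D> E Z" "\<bar>event_code \<D> E Z\<bar> \<le> 1"
  by (auto simp: event_code_def)

lemma mlin_num_measurable:
  assumes I: "I \<subseteq> sets \<nu>"
  shows "(\<lambda>\<omega>. mlin \<phi> I (\<lambda>Q. real (num Q \<omega>))) \<in> borel_measurable P"
  unfolding mlin_def
proof (intro borel_measurable_sum borel_measurable_times borel_measurable_const borel_measurable_prod)
  fix Z Q assume "Z \<in> Pow I"
  { assume "Q \<in> Z"
    then have [measurable]: "Q \<in> sets \<nu>" using I \<open>Z \<in> Pow I\<close> by auto
    show "(\<lambda>\<omega>. real (num Q \<omega>)) \<in> borel_measurable P" by measurable }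
  { assume "Q \<in> I - Z"
    then have [measurable]: "Q \<in> sets \<nu>" using I by auto
    show "(\<lambda>\<omega>. 1 - real (num Q \<omega>)) \<in> borel_measurable P" by measurable }
qed

text \<open>For each sufficiently fine partition the covariances of the coded events satisfy the
  bound, uniformly in the mesh; the events themselves are reached in the limit. Keeping
  \<open>f\<close>, \<open>RA\<close> and \<open>RB\<close> abstract lets the general and the
  finite-rank estimate share this argument.\<close>

lemma count_events_decorrelate:
  fixes F :: "'i \<Rightarrow> 'w set" and G :: "'j \<Rightarrow> 'w set"
  assumes A: "A \<in> sets borel" "A \<subseteq> C" and B: "B \<in> sets borel" "B \<subseteq> C" and AB: "A \<inter> B = {}"
    and \<A>: "finite \<A>" "\<A> \<subseteq> sets borel" "\<And>D. D \<in> \<A> \<Longrightarrow> D \<subseteq> A"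
    and \<B>: "finite \<B>" "\<B> \<subseteq> sets borel" "\<And>D. D \<in> \<B> \<Longrightarrow> D \<subseteq> B"
    and F: "finite I0" "disjoint_family_on F I0" "\<And>i. i \<in> I0 \<Longrightarrow> F i \<in> sets P \<and> counts_det P X \<A> (F i)"
    and G: "finite J0" "disjoint_family_on G J0" "\<And>j. j \<in> J0 \<Longrightarrow> G j \<in> sets P \<and> counts_det P X \<B> (G j)"
    and om: "\<And>x y. x \<in> A \<Longrightarrow> y \<in> B \<Longrightarrow> \<bar>K x y\<bar> \<le> om"
    and f: "\<And>n. 0 \<le> f n" "\<And>S. finite S \<Longrightarrow> f (card S) = 2 ^ card S \<or> (\<forall>T. finite T \<longrightarrow> S \<subseteq> T \<longrightarrow> bI T = 0)"
    and RA: "\<And>I. finite I \<Longrightarrow> I \<subseteq> sets \<nu> \<Longrightarrow> disjoint I \<Longrightarrow> \<Union>I \<subseteq> A \<Longrightarrow> Hs f I \<le> RA"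
    and RB: "\<And>I. finite I \<Longrightarrow> I \<subseteq> sets \<nu> \<Longrightarrow> disjoint I \<Longrightarrow> \<Union>I \<subseteq> B \<Longrightarrow> Hs f I \<le> RB"
  shows "(\<Sum>i\<in>I0. \<Sum>j\<in>J0. \<bar>measure P (F i \<inter> G j) - measure P (F i) * measure P (G j)\<bar>) \<le> RA * RB * om\<^sup>2"
proof -
  have "\<exists>T. finite T \<and> closure C \<subseteq> (\<Union>x\<in>T. ball x (inverse (real (Suc l))))" for l
  proof -
    have "compact (closure C)" using bounded_C by simp
    then have "\<forall>e>0. \<exists>k. finite k \<and> closure C \<subseteq> (\<Union>x\<in>k. ball x e)"
      by (simp add: compact_eq_totally_bounded)
    moreover have "inverse (real (Suc l)) > 0" by simp
    ultimately show ?thesis by blast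
  qed
  then obtain T where T: "\<And>l. finite (T l)" "\<And>l. closure C \<subseteq> (\<Union>x\<in>T l. ball x (inverse (real (Suc l))))" by metis
  \<comment> \<open>Including a finite net of small balls forces every cell inside \<open>C\<close>
    into one of them. Including \<open>\<A>\<close>, \<open>\<B>\<close>, \<open>A\<close> and
    \<open>B\<close> makes these sets unions of cells.\<close>
  define \<F> where "\<F> l = \<A> \<union> \<B> \<union> {A, B} \<union> (\<lambda>x. ball x (inverse (real (Suc l)))) ` T l" for l
  have \<F>: "finite (\<F> l)" "\<F> l \<subseteq> sets \<nu>" "\<A> \<subseteq> \<F> l" "\<B> \<subseteq> \<F> l" "A \<in> \<F> l" "B \<in> \<F> l" for l
    using \<A> \<B> A B T(1) unfolding \<F>_def by (auto simp: sets_borel)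
  define I where "I l = sub_cells (\<F> l) A" for l
  define J where "J l = sub_cells (\<F> l) B" for l
  have I: "finite (I l)" "I l \<subseteq> sets \<nu>" "disjoint (I l)" "\<Union>(I l) = A"
    and J: "finite (J l)" "J l \<subseteq> sets \<nu>" "disjoint (J l)" "\<Union>(J l) = B"
    and IJ: "I l \<inter> J l = {}" "disjoint (I l \<union> J l)" for l
    unfolding I_def J_def
    using finite_sub_cells[OF \<F>(1)] cells_borel[OF \<F>(1,2)] disjoint_sub_cells Union_sub_cells[OF \<F>(5)]
      Union_sub_cells[OF \<F>(6)] sub_cells_disjoint[OF AB] by simp_all
  have small: "\<exists>y. Q \<subseteq> ball y (inverse (real (Suc l)))" "Q \<subseteq> C" if Q: "Q \<in> I l \<union> J l" for Q l
  proof -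
    have Qc: "Q \<in> cells (\<F> l)" "Q \<subseteq> A \<or> Q \<subseteq> B" using Q by (auto simp: I_def J_def sub_cells_def)
    then show QC: "Q \<subseteq> C" using A B by auto
    obtain x where x: "Q = cell (\<F> l) x" using Qc by auto
    then have "x \<in> closure C" using QC closure_subset[of C] cell_self[of x "\<F> l"] by blast
    then obtain y where y: "y \<in> T l" "x \<in> ball y (inverse (real (Suc l)))" using T(2)[of l] by blast
    then have "ball y (inverse (real (Suc l))) \<in> \<F> l" unfolding \<F>_def by blast
    from cell_subset[OF this y(2)] show "\<exists>y. Q \<subseteq> ball y (inverse (real (Suc l)))" unfolding x by (rule exI)
  qed
  \<comment> \<open>The required mesh depends on the smallest distance between the points of the
    configuration, hence on the outcome. The convergence is only pointwise, and domination is
    needed.\<close>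
  have ev1: "\<forall>\<^sub>F l in sequentially. \<forall>Q\<in>I l \<union> J l. num Q \<omega> \<le> 1" if w: "\<omega> \<in> space P" for \<omega>
  proof -
    obtain \<delta> where \<delta>: "\<delta> > 0" "\<And>x y. x \<in> X \<omega> \<Longrightarrow> y \<in> X \<omega> \<Longrightarrow> x \<noteq> y \<Longrightarrow> \<delta> \<le> dist x y"
      using finite_separated[OF X_fin[OF w]] by blast
    have "\<delta> / 2 > 0" using \<delta>(1) by simp
    from order_tendstoD(2)[OF LIMSEQ_inverse_real_of_nat this]
    show ?thesis
    proof eventually_elim
      case (elim l)
      show ?case
      proof
        fix Q assume "Q \<in> I l \<union> J l"
        from small(1)[OF this] obtain y where y: "Q \<subseteq> ball y (inverse (real (Suc l)))" by blast
        have "u = v" if uv: "u \<in> X \<omega> \<inter> Q" "v \<in> X \<omega> \<inter> Q" for u v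
        proof (rule ccontr)
          assume "u \<noteq> v"
          then have "\<delta> \<le> dist u v" using \<delta>(2) uv by auto
          moreover have "dist y u < \<delta> / 2" "dist y v < \<delta> / 2" using uv y elim by (auto simp: subset_iff intro: less_trans)
          ultimately show False using dist_triangle2[of u v y] by (simp add: dist_commute)
        qed
        then show "num Q \<omega> \<le> 1" using X_fin[OF w] by (auto simp: card_le_Suc0_iff_eq)
      qed
    qed
  qed
  define \<Phi> where "\<Phi> l i \<omega> = mlin (event_code \<A> (F i)) (I l) (\<lambda>Q. real (num Q \<omega>))" for l i \<omega>
  define \<Psi> where "\<Psi> l j \<omega> = mlin (event_code \<B> (G j)) (J l) (\<lambda>Q. real (num Q \<omega>))" for l j \<omega>
  have m: "\<Phi> l i \<in> borel_measurable P" "\<Psi> l j \<in> borel_measurable P" for l i j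
    unfolding \<Phi>_def \<Psi>_def by (rule mlin_num_measurable, rule I(2) J(2))+
  have b: "\<bar>\<Phi> l i \<omega>\<bar> \<le> 3 ^ num A \<omega>" "\<bar>\<Psi> l j \<omega>\<bar> \<le> 3 ^ num B \<omega>" if "\<omega> \<in> space P" for l i j \<omega>
    using mlin_num_bound[OF I(1)[of l] I(3)[of l] that event_code_bounds(2)[of \<A> "F i"]]
      mlin_num_bound[OF J(1)[of l] J(3)[of l] that event_code_bounds(2)[of \<B> "G j"]]
    unfolding \<Phi>_def \<Psi>_def I(4) J(4) by auto
  have b': "\<bar>\<Phi> l i \<omega>\<bar> \<le> 3 ^ num UNIV \<omega>" "\<bar>\<Psi> l j \<omega>\<bar> \<le> 3 ^ num UNIV \<omega>" "\<bar>\<Phi> l i \<omega> * \<Psi> l j \<omega>\<bar> \<le> 3 ^ num UNIV \<omega>"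
    if w: "\<omega> \<in> space P" for l i j \<omega>
  proof -
    \<comment> \<open>Because \<open>A\<close> and \<open>B\<close> are disjoint, even the product
      of the two polynomials is dominated by a single power of 3.\<close>
    have "num A \<omega> + num B \<omega> = card ((X \<omega> \<inter> A) \<union> (X \<omega> \<inter> B))"
      using AB X_fin[OF w] by (intro card_Un_disjoint[symmetric]) auto
    also have "\<dots> \<le> num UNIV \<omega>" using X_fin[OF w] by (intro card_mono) auto
    finally have n: "num A \<omega> + num B \<omega> \<le> num UNIV \<omega>" .
    have "(3::real) ^ num A \<omega> \<le> 3 ^ num UNIV \<omega>" "(3::real) ^ num B \<omega> \<le> 3 ^ num UNIV \<omega>"
      using n by (auto intro!: power_increasing)
    then show "\<bar>\<Phi> l i \<omega>\<bar> \<le> 3 ^ num UNIV \<omega>" "\<bar>\<Psi> l j \<omega>\<bar> \<le> 3 ^ num UNIV \<omega>"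
      using b(1)[OF w, of l i] b(2)[OF w, of l j] by linarith+
    have "\<bar>\<Phi> l i \<omega> * \<Psi> l j \<omega>\<bar> \<le> 3 ^ num A \<omega> * 3 ^ num B \<omega>"
      unfolding abs_mult by (intro mult_mono b w) auto
    also have "\<dots> = 3 ^ (num A \<omega> + num B \<omega>)" by (simp add: power_add)
    also have "\<dots> \<le> 3 ^ num UNIV \<omega>" using n by (intro power_increasing) auto
    finally show "\<bar>\<Phi> l i \<omega> * \<Psi> l j \<omega>\<bar> \<le> 3 ^ num UNIV \<omega>" .
  qed
  have F': "F i \<subseteq> space P" "counts_det P X \<A> (F i)" "F i \<in> sets P" if "i \<in> I0" for i
    using F(3)[OF that] sets.sets_into_space by auto
  have G': "G j \<subseteq> space P" "counts_det P X \<B> (G j)" "G j \<in> sets P" if "j \<in> J0" for j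
    using G(3)[OF that] sets.sets_into_space by auto
  have c\<Phi>: "\<forall>\<^sub>F l in sequentially. \<Phi> l i \<omega> = indicator (F i) \<omega>" if i: "i \<in> I0" and w: "\<omega> \<in> space P" for i \<omega>
    using ev1[OF w]
  proof eventually_elim
    case (elim l)
    show ?case unfolding \<Phi>_def I_def
      by (rule mlin_event_code[OF \<F>(1,3) \<A>(3) w _ F'(1,2)[OF i]]) (use elim I_def in auto)
  qed
  have c\<Psi>: "\<forall>\<^sub>F l in sequentially. \<Psi> l j \<omega> = indicator (G j) \<omega>" if j: "j \<in> J0" and w: "\<omega> \<in> space P" for j \<omega>
    using ev1[OF w]
  proof eventually_elim
    case (elim l)
    show ?case unfolding \<Psi>_def J_def
      by (rule mlin_event_code[OF \<F>(1,4) \<B>(3) w _ G'(1,2)[OF j]]) (use elim J_def in auto)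
  qed
  have lim: "(\<lambda>l. \<integral>\<omega>. h l \<omega> \<partial>P) \<longlonglongrightarrow> measure P E"
    if h: "\<And>l. h l \<in> borel_measurable P" "\<And>l \<omega>. \<omega> \<in> space P \<Longrightarrow> \<bar>h l \<omega>\<bar> \<le> 3 ^ num UNIV \<omega>"
      "\<And>\<omega>. \<omega> \<in> space P \<Longrightarrow> \<forall>\<^sub>F l in sequentially. h l \<omega> = indicator E \<omega>" and E: "E \<in> sets P" for h :: "nat \<Rightarrow> 'w \<Rightarrow> real" and E
  proof -
    have "(\<lambda>l. \<integral>\<omega>. h l \<omega> \<partial>P) \<longlonglongrightarrow> (\<integral>\<omega>. indicator E \<omega> \<partial>P)"
    proof (rule integral_dominated_convergence[OF _ h(1) integrable_three_power])
      show "AE \<omega> in P. (\<lambda>l. h l \<omega>) \<longlonglongrightarrow> indicator E \<omega>" using h(3) by (intro AE_I2 tendsto_eventually)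
      show "AE \<omega> in P. norm (h l \<omega>) \<le> 3 ^ num UNIV \<omega>" for l using h(2) by (intro AE_I2) simp
      show "(indicator E :: 'w \<Rightarrow> real) \<in> borel_measurable P" using E by simp
    qed
    then show ?thesis using E sets.sets_into_space[OF E] by (simp add: Int_absorb2)
  qed
  have L\<Phi>: "(\<lambda>l. \<integral>\<omega>. \<Phi> l i \<omega> \<partial>P) \<longlonglongrightarrow> measure P (F i)" if "i \<in> I0" for i
    by (rule lim[OF m(1) b'(1) c\<Phi>[OF that] F'(3)[OF that]])
  have L\<Psi>: "(\<lambda>l. \<integral>\<omega>. \<Psi> l j \<omega> \<partial>P) \<longlonglongrightarrow> measure P (G j)" if "j \<in> J0" for j
    by (rule lim[OF m(2) b'(2) c\<Psi>[OF that] G'(3)[OF that]])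
  have L2: "(\<lambda>l. \<integral>\<omega>. \<Phi> l i \<omega> * \<Psi> l j \<omega> \<partial>P) \<longlonglongrightarrow> measure P (F i \<inter> G j)" if i: "i \<in> I0" and j: "j \<in> J0" for i j
  proof (rule lim)
    show "F i \<inter> G j \<in> sets P" using F'(3)[OF i] G'(3)[OF j] by auto
    show "(\<lambda>\<omega>. \<Phi> l i \<omega> * \<Psi> l j \<omega>) \<in> borel_measurable P" for l using m by (intro borel_measurable_times)
    show "\<bar>\<Phi> l i \<omega> * \<Psi> l j \<omega>\<bar> \<le> 3 ^ num UNIV \<omega>" if "\<omega> \<in> space P" for l \<omega> using b'(3)[OF that] .
    show "\<forall>\<^sub>F l in sequentially. \<Phi> l i \<omega> * \<Psi> l j \<omega> = indicator (F i \<inter> G j) \<omega>" if w: "\<omega> \<in> space P" for \<omega>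
      using c\<Phi>[OF i w] c\<Psi>[OF j w] by eventually_elim (simp add: indicator_inter_arith)
  qed
  let ?S = "\<lambda>l. \<Sum>i\<in>I0. \<Sum>j\<in>J0. \<bar>(\<integral>\<omega>. \<Phi> l i \<omega> * \<Psi> l j \<omega> \<partial>P) - (\<integral>\<omega>. \<Phi> l i \<omega> \<partial>P) * (\<integral>\<omega>. \<Psi> l j \<omega> \<partial>P)\<bar>"
  have "?S \<longlonglongrightarrow> (\<Sum>i\<in>I0. \<Sum>j\<in>J0. \<bar>measure P (F i \<inter> G j) - measure P (F i) * measure P (G j)\<bar>)"
    by (intro tendsto_sum tendsto_rabs tendsto_diff tendsto_mult L\<Phi> L\<Psi> L2)
  moreover have "\<forall>\<^sub>F l in sequentially. ?S l \<le> RA * RB * om\<^sup>2"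
  proof -
    obtain e where e: "e > 0" "\<And>Q y. Q \<in> sets \<nu> \<Longrightarrow> Q \<subseteq> C \<Longrightarrow> Q \<subseteq> ball y e \<Longrightarrow> gI Q \<le> 1" using ex_mesh_gI_le by blast
    from order_tendstoD(2)[OF LIMSEQ_inverse_real_of_nat e(1)]
    show ?thesis
    proof eventually_elim
      case (elim l)
      \<comment> \<open>From some mesh on, the excess masses are admissible as parameters in
        \<open>sum_abs_shcoef_le\<close>.\<close>
      have g1: "gI Q \<le> 1" if Q: "Q \<in> I l \<union> J l" for Q
      proof -
        obtain y where "Q \<subseteq> ball y (inverse (real (Suc l)))" using small(1)[OF Q] by blast
        also have "\<dots> \<subseteq> ball y e" using elim by (intro subset_ball) auto
        finally have "Q \<subseteq> ball y e" .
        then show ?thesis using Q I(2)[of l] J(2)[of l] by (intro e(2)[of Q y] small(2)[OF Q]) auto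
      qed
      let ?D = "\<lambda>U V. bI (U \<union> V) - bI U * bI V"
      have "?S l = (\<Sum>i\<in>I0. \<Sum>j\<in>J0. \<bar>\<Sum>U\<in>Pow (I l). \<Sum>V\<in>Pow (J l).
          shcoef (event_code \<A> (F i)) (I l) gI U * shcoef (event_code \<B> (G j)) (J l) gI V * ?D U V\<bar>)"
        unfolding \<Phi>_def \<Psi>_def mlin_moments[OF I(1,2) J(1,2) IJ] ..
      also have "\<dots> \<le> (\<Sum>U\<in>Pow (I l). \<Sum>V\<in>Pow (J l). 2 ^ card U * 2 ^ card V * \<bar>?D U V\<bar>)"
        using F' G' by (intro sum_abs_shcoef_pairs_le I(1) J(1) gI_nonneg g1 F(1) G(1) event_code_bounds(1) sum_event_code_le F(2) G(2)) auto
      also have "\<dots> \<le> Hs f (I l) * Hs f (J l) * om\<^sup>2"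
      proof (rule sum_bI_decorrelation[OF I(1,2) J(1,2) IJ(1) _ f])
        fix P Q x y assume "P \<in> I l" "Q \<in> J l" "x \<in> P" "y \<in> Q"
        then have "x \<in> A" "y \<in> B" using I(4)[of l] J(4)[of l] by auto
        then show "\<bar>K x y\<bar> \<le> om" by (rule om)
      qed
      also have "\<dots> \<le> RA * RB * om\<^sup>2"
      proof (intro mult_right_mono mult_mono)
        show "Hs f (I l) \<le> RA" using I[of l] by (intro RA) auto
        show "Hs f (J l) \<le> RB" using J[of l] by (intro RB) auto
        show "0 \<le> Hs f (J l)" using J[of l] f by (intro Hs_le(1)) auto
        have "0 \<le> Hs f (I l)" using I[of l] f by (intro Hs_le(1)) auto
        then show "0 \<le> RA" using \<open>Hs f (I l) \<le> RA\<close> by simp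
      qed simp
      finally show ?case .
    qed
  qed
  ultimately show ?thesis by (rule tendsto_upperbound) simp
qed

lemma sum_measure_le:
  assumes "finite I" "I \<subseteq> sets \<nu>" "disjoint I" "\<Union>I \<subseteq> A" "A \<in> sets \<nu>"
  shows "(\<Sum>Q\<in>I. w Q) \<le> w A"
proof -
  have "(\<Sum>Q\<in>I. w Q) = w (\<Union>Q\<in>I. Q)"
    using assms by (intro finite_measure_finite_Union[symmetric]) (auto simp: disjoint_family_on_def disjoint_def)
  also have "\<dots> \<le> w A" using assms by (intro finite_measure_mono) auto
  finally show ?thesis .
qed

text \<open>The two choices of the weight \<open>f\<close>. In both, the bound on \<open>Hs\<close>
  increases with the total mass of the cells, which is at most \<open>p\<close> or
  \<open>q\<close>.\<close>

lemma count_events_decorrelate_bounded: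
  fixes F :: "'i \<Rightarrow> 'w set" and G :: "'j \<Rightarrow> 'w set"
  assumes A: "A \<in> sets borel" "A \<subseteq> C" "w A \<le> p" and B: "B \<in> sets borel" "B \<subseteq> C" "w B \<le> q" and AB: "A \<inter> B = {}"
    and \<A>: "finite \<A>" "\<A> \<subseteq> sets borel" "\<And>D. D \<in> \<A> \<Longrightarrow> D \<subseteq> A"
    and \<B>: "finite \<B>" "\<B> \<subseteq> sets borel" "\<And>D. D \<in> \<B> \<Longrightarrow> D \<subseteq> B"
    and F: "finite I0" "disjoint_family_on F I0" "\<And>i. i \<in> I0 \<Longrightarrow> F i \<in> sets P \<and> counts_det P X \<A> (F i)"
    and G: "finite J0" "disjoint_family_on G J0" "\<And>j. j \<in> J0 \<Longrightarrow> G j \<in> sets P \<and> counts_det P X \<B> (G j)"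
    and om: "\<And>x y. x \<in> A \<Longrightarrow> y \<in> B \<Longrightarrow> \<bar>K x y\<bar> \<le> om"
  shows "(\<Sum>i\<in>I0. \<Sum>j\<in>J0. \<bar>measure P (F i \<inter> G j) - measure P (F i) * measure P (G j)\<bar>)
      \<le> 2 * p * ((1 + 2 * k * p) * exp (2 * k * p)) * (2 * q * ((1 + 2 * k * q) * exp (2 * k * q))) * om\<^sup>2"
    and "minors_vanish N (sets \<nu>) kk \<Longrightarrow>
      (\<Sum>i\<in>I0. \<Sum>j\<in>J0. \<bar>measure P (F i \<inter> G j) - measure P (F i) * measure P (G j)\<bar>)
      \<le> 2 * p * (real N * 3 ^ N) * (2 * q * (real N * 3 ^ N)) * om\<^sup>2"
proof -
  have g: "Hs (\<lambda>n. 2 ^ n) I \<le> 2 * p * ((1 + 2 * k * p) * exp (2 * k * p))"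
    if I: "finite I" "I \<subseteq> sets \<nu>" "disjoint I" "\<Union>I \<subseteq> A" and A: "A \<in> sets borel" "w A \<le> p" for I A p
  proof -
    let ?s = "\<Sum>Q\<in>I. w Q"
    have s: "0 \<le> ?s" "?s \<le> p" using sum_measure_le[OF I] A by (auto intro: sum_nonneg simp: sets_borel)
    have "Hs (\<lambda>n. 2 ^ n) I \<le> 2 * ?s * ((1 + 2 * k * ?s) * exp (2 * k * ?s))" by (rule Hs_general[OF I(1,2)])
    also have "\<dots> \<le> 2 * p * ((1 + 2 * k * p) * exp (2 * k * p))"
      using s k_nonneg by (intro mult_mono add_mono mult_nonneg_nonneg) (auto intro!: mult_left_mono)
    finally show ?thesis .
  qed
  show "(\<Sum>i\<in>I0. \<Sum>j\<in>J0. \<bar>measure P (F i \<inter> G j) - measure P (F i) * measure P (G j)\<bar>)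
      \<le> 2 * p * ((1 + 2 * k * p) * exp (2 * k * p)) * (2 * q * ((1 + 2 * k * q) * exp (2 * k * q))) * om\<^sup>2"
    by (rule count_events_decorrelate[OF A(1,2) B(1,2) AB \<A> \<B> F G om, where f = "\<lambda>n. 2 ^ n"])
      (auto intro: g[OF _ _ _ _ A(1,3)] g[OF _ _ _ _ B(1,3)])
  assume rk: "minors_vanish N (sets \<nu>) kk"
  let ?f = "\<lambda>n. if n \<le> N then 2 ^ n else 0 :: real"
  have r: "Hs ?f I \<le> 2 * p * (real N * 3 ^ N)"
    if I: "finite I" "I \<subseteq> sets \<nu>" "disjoint I" "\<Union>I \<subseteq> A" and A: "A \<in> sets borel" "w A \<le> p" for I A p
  proof -
    have "Hs ?f I \<le> 2 * (\<Sum>Q\<in>I. w Q) * (real N * 3 ^ N)" by (rule Hs_rank[OF rk I(1,2,3)])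
    also have "\<dots> \<le> 2 * p * (real N * 3 ^ N)"
      using sum_measure_le[OF I] A by (intro mult_right_mono) (auto simp: sets_borel)
    finally show ?thesis .
  qed
  show "(\<Sum>i\<in>I0. \<Sum>j\<in>J0. \<bar>measure P (F i \<inter> G j) - measure P (F i) * measure P (G j)\<bar>)
      \<le> 2 * p * (real N * 3 ^ N) * (2 * q * (real N * 3 ^ N)) * om\<^sup>2"
  proof (rule count_events_decorrelate[OF A(1,2) B(1,2) AB \<A> \<B> F G om, where f = ?f])
    fix S :: "'a set set" assume S: "finite S"
    \<comment> \<open>Beyond the rank, \<open>bI\<close> vanishes on every family with more than
      \<open>N\<close> cells, in particular on all families containing such an
      \<open>S\<close>.\<close>
    show "?f (card S) = 2 ^ card S \<or> (\<forall>T. finite T \<longrightarrow> S \<subseteq> T \<longrightarrow> bI T = 0)"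
    proof (cases "card S \<le> N")
      case False
      have "bI T = 0" if "finite T" "S \<subseteq> T" for T
        using False card_mono[OF that] by (intro bI_eq_0[OF rk that(1)]) simp
      then show ?thesis by blast
    qed simp
  qed (auto intro: r[OF _ _ _ _ A(1,3)] r[OF _ _ _ _ B(1,3)])
qed

end

section \<open>Restriction to a window and approximation of events\<close>

lemma locally_finite_sigma_finite:
  assumes "locally_finite_measure \<mu>"
  shows "sigma_finite_measure \<mu>"
proof
  have s: "sets \<mu> = sets borel" and f: "\<And>B. B \<in> sets borel \<Longrightarrow> bounded B \<Longrightarrow> emeasure \<mu> B < \<infinity>"
    using assms by (auto simp: locally_finite_measure_def)
  have sp: "space \<mu> = UNIV" using sets_eq_imp_space_eq[OF s] by simp
  show "\<exists>A. countable A \<and> A \<subseteq> sets \<mu> \<and> \<Union>A = space \<mu> \<and> (\<forall>a\<in>A. emeasure \<mu> a \<noteq> \<infinity>)"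
  proof (intro exI[of _ "range (\<lambda>n. cball 0 (real n))"] conjI)
    show "\<Union>(range (\<lambda>n. cball 0 (real n))) = space \<mu>" using real_arch_simple by (auto simp: sp)
    show "\<forall>a\<in>range (\<lambda>n. cball 0 (real n)). emeasure \<mu> a \<noteq> \<infinity>" using f by (auto simp: less_top)
  qed (auto simp: s)
qed

locale dpp_window =
  fixes P :: "'w measure" and \<mu> :: "'a::euclidean_space measure" and X :: "'w \<Rightarrow> 'a set" and K :: "'a \<Rightarrow> 'a \<Rightarrow> real"
    and C :: "'a set"
  assumes dpp: "is_DPP P \<mu> X K" and K_bounded: "\<exists>c. \<forall>x y. \<bar>K x y\<bar> \<le> c" and compact_C: "compact C"
begin

text \<open>Cutting by a density, not by restricting the space, keeps the underlying space and the
  Borel sets unchanged, so sets and functions need no translation.\<close>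

definition \<nu> :: "'a measure" where
  "\<nu> = density \<mu> (\<lambda>x. ennreal (indicator C x))"

abbreviation XC :: "'w \<Rightarrow> 'a set" where
  "XC \<omega> \<equiv> X \<omega> \<inter> C"

lemma sets_\<mu>: "sets \<mu> = sets borel" and fin_\<mu>: "B \<in> sets borel \<Longrightarrow> bounded B \<Longrightarrow> emeasure \<mu> B < \<infinity>"
  and vk: "valid_kernel \<mu> K" and prob_P: "prob_space P"
  and X_finite: "\<omega> \<in> space P \<Longrightarrow> bounded B \<Longrightarrow> finite (X \<omega> \<inter> B)"
  and X_measurable: "B \<in> sets borel \<Longrightarrow> bounded B \<Longrightarrow> (\<lambda>\<omega>. card (X \<omega> \<inter> B)) \<in> measurable P (count_space UNIV)"
  and X_moment: "h \<in> borel_measurable (PiM {..<n} (\<lambda>_. \<mu>)) \<Longrightarrow>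
        (\<integral>\<^sup>+ \<omega>. (\<integral>\<^sup>+ x. h x \<partial>count_space (dtuples n (X \<omega>))) \<partial>P)
        = (\<integral>\<^sup>+ x. h x * ennreal (ldet n (\<lambda>i j. K (x i) (x j))) \<partial>PiM {..<n} (\<lambda>_. \<mu>))"
  using dpp unfolding is_DPP_def locally_finite_measure_def by auto

sublocale \<mu>: sigma_finite_measure \<mu>
  using dpp by (intro locally_finite_sigma_finite) (simp add: is_DPP_def)

lemma C_borel [measurable, simp]: "C \<in> sets borel" and C_sets: "C \<in> sets \<mu>" and bounded_C: "bounded C"
  using compact_C by (auto simp: sets_\<mu> borel_closed compact_imp_closed compact_imp_bounded)

lemma space_\<mu>: "space \<mu> = UNIV"
  using sets_eq_imp_space_eq[OF sets_\<mu>] by simp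

lemma sets_\<nu> [measurable_cong]: "sets \<nu> = sets \<mu>"
  by (simp add: \<nu>_def)

lemma emeasure_\<nu>: "B \<in> sets \<mu> \<Longrightarrow> emeasure \<nu> B = emeasure \<mu> (B \<inter> C)"
proof -
  assume B: "B \<in> sets \<mu>"
  have "emeasure \<nu> B = (\<integral>\<^sup>+x. ennreal (indicator C x) * indicator B x \<partial>\<mu>)"
    unfolding \<nu>_def using C_sets by (intro emeasure_density B) auto
  also have "\<dots> = (\<integral>\<^sup>+x. indicator (B \<inter> C) x \<partial>\<mu>)"
    by (intro nn_integral_cong) (auto simp: indicator_def)
  also have "\<dots> = emeasure \<mu> (B \<inter> C)" using B C_sets by (intro nn_integral_indicator) auto
  finally show ?thesis .
qed

lemma finite_\<nu>: "finite_measure \<nu>"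
proof
  have "emeasure \<nu> UNIV = emeasure \<mu> C" using sets.top[of \<mu>] by (simp add: space_\<mu> emeasure_\<nu>)
  then show "emeasure \<nu> (space \<nu>) \<noteq> \<infinity>"
    using fin_\<mu>[OF C_borel bounded_C] by (simp add: \<nu>_def space_\<mu>)
qed

sublocale N: cell_space \<nu>
  using finite_\<nu> by (simp add: cell_space_def cell_space_axioms_def \<nu>_def space_\<mu>)

lemma K_le_sup: "\<bar>K x y\<bar> \<le> kernel_sup K"
proof -
  obtain c where "\<And>x y. \<bar>K x y\<bar> \<le> c" using K_bounded by blast
  then show ?thesis unfolding kernel_sup_def by (intro cSup_upper) (auto simp: bdd_above_def)
qed

lemma K_measurable: "(\<lambda>z. K (fst z) (snd z)) \<in> borel_measurable (\<nu> \<Otimes>\<^sub>M \<nu>)"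
proof -
  have "case_prod K \<in> borel_measurable (\<mu> \<Otimes>\<^sub>M \<mu>)" using vk by (simp add: valid_kernel_def)
  moreover have "sets (\<nu> \<Otimes>\<^sub>M \<nu>) = sets (\<mu> \<Otimes>\<^sub>M \<mu>)" by (rule sets_pair_measure_cong[OF sets_\<nu> sets_\<nu>])
  ultimately show ?thesis by (simp add: case_prod_beta' cong: measurable_cong_sets)
qed

lemma integral_\<nu>:
  fixes f :: "'a \<Rightarrow> real"
  assumes "f \<in> borel_measurable \<mu>"
  shows "(\<integral>x. f x \<partial>\<nu>) = (\<integral>x. indicator C x * f x \<partial>\<mu>)"
  unfolding \<nu>_def using assms C_sets by (subst integral_density) auto

lemma sq_int_cut:
  assumes f: "f \<in> borel_measurable \<mu>" and B: "\<And>x. \<bar>f x\<bar> \<le> B"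
  shows "sq_int \<mu> (\<lambda>x. indicator C x * f x)" "vanishes_outside C (\<lambda>x. indicator C x * f x)"
proof -
  note f[measurable] C_sets[measurable]
  have "integrable \<mu> (\<lambda>x. (indicator C x * f x)\<^sup>2)"
  proof (rule Bochner_Integration.integrable_bound)
    show "integrable \<mu> (\<lambda>x. indicator C x * B\<^sup>2 :: real)"
      using fin_\<mu>[OF C_borel bounded_C] C_sets by simp
    show "AE x in \<mu>. norm ((indicator C x * f x)\<^sup>2) \<le> norm (indicator C x * B\<^sup>2 :: real)"
      using power_mono[OF B, of _ 2] by (auto simp: indicator_def)
  qed measurable
  then show "sq_int \<mu> (\<lambda>x. indicator C x * f x)" by (simp add: sq_int_def)
  show "vanishes_outside C (\<lambda>x. indicator C x * f x)" by (simp add: vanishes_outside_def)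
qed

text \<open>Identifies the form of the cut measure with \<open>qform\<close> of the cut function, to
  which the assumptions in \<open>valid_kernel\<close> apply: a bounded function cut to
  \<open>C\<close> is square integrable with support in a compact set.\<close>

lemma qform_cut:
  assumes f: "f \<in> borel_measurable \<nu>" and B: "\<And>x. \<bar>f x\<bar> \<le> B"
  shows "(\<integral>z. f (fst z) * K (fst z) (snd z) * f (snd z) \<partial>(\<nu> \<Otimes>\<^sub>M \<nu>)) = qform \<mu> K (\<lambda>x. indicator C x * f x)"
proof -
  note f[measurable] K_measurable[measurable] C_sets[measurable]
  let ?h = "\<lambda>z. f (fst z) * K (fst z) (snd z) * f (snd z)"
  have hm[measurable]: "?h \<in> borel_measurable (\<nu> \<Otimes>\<^sub>M \<nu>)" by measurable
  have fm: "f \<in> borel_measurable \<mu>" using f by (simp cong: measurable_cong_sets)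
  have "integrable (\<nu> \<Otimes>\<^sub>M \<nu>) ?h"
  proof (rule N.integrable_bounded2[OF hm, of "B * kernel_sup K * B"])
    fix z
    have "0 \<le> B" using B[of undefined] by linarith
    then show "\<bar>?h z\<bar> \<le> B * kernel_sup K * B"
      unfolding abs_mult using K_le_sup[of undefined undefined] by (intro mult_mono mult_nonneg_nonneg B K_le_sup) auto
  qed
  from N.integral_fst'[OF this]
  have "(\<integral>z. ?h z \<partial>(\<nu> \<Otimes>\<^sub>M \<nu>)) = (\<integral>x. (\<integral>y. f x * K x y * f y \<partial>\<nu>) \<partial>\<nu>)" by simp
  also have "\<dots> = (\<integral>x. indicator C x * (\<integral>y. f x * K x y * f y \<partial>\<nu>) \<partial>\<mu>)"
  proof (rule integral_\<nu>)
    have "(\<lambda>x. \<integral>y. ?h (x, y) \<partial>\<nu>) \<in> borel_measurable \<nu>" by measurable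
    then show "(\<lambda>x. \<integral>y. f x * K x y * f y \<partial>\<nu>) \<in> borel_measurable \<mu>" by (simp cong: measurable_cong_sets)
  qed
  also have "\<dots> = (\<integral>x. (\<integral>y. (indicator C x * f x) * K x y * (indicator C y * f y) \<partial>\<mu>) \<partial>\<mu>)"
  proof (intro Bochner_Integration.integral_cong refl)
    fix x
    have "Pair x \<in> measurable \<nu> (\<nu> \<Otimes>\<^sub>M \<nu>)" by (rule measurable_Pair1') (simp add: \<nu>_def space_\<mu>)
    from measurable_compose[OF this K_measurable] have Kx[measurable]: "(\<lambda>y. K x y) \<in> borel_measurable \<mu>" by (simp cong: measurable_cong_sets)
    note fm[measurable]
    have "(\<integral>y. f x * K x y * f y \<partial>\<nu>) = (\<integral>y. indicator C y * (f x * K x y * f y) \<partial>\<mu>)" by (rule integral_\<nu>) measurable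
    then show "indicator C x * (\<integral>y. f x * K x y * f y \<partial>\<nu>) = (\<integral>y. (indicator C x * f x) * K x y * (indicator C y * f y) \<partial>\<mu>)"
      by (simp add: mult_ac flip: integral_mult_right_zero)
  qed
  finally show ?thesis by (simp add: qform_def)
qed

sublocale N: bounded_kernel \<nu> K "kernel_sup K"
proof
  show "(\<lambda>z. K (fst z) (snd z)) \<in> borel_measurable (\<nu> \<Otimes>\<^sub>M \<nu>)" by (rule K_measurable)
  show "K x y = K y x" for x y using vk by (simp add: valid_kernel_def)
  show "\<bar>K x y\<bar> \<le> kernel_sup K" for x y by (rule K_le_sup)
  fix f :: "'a \<Rightarrow> real" and B assume f: "f \<in> borel_measurable \<nu>" and B: "\<And>x. \<bar>f x\<bar> \<le> B"
  have fm: "f \<in> borel_measurable \<mu>" using f by (simp cong: measurable_cong_sets)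
  have q: "0 \<le> qform \<mu> K (\<lambda>x. indicator C x * f x)"
    "qform \<mu> K (\<lambda>x. indicator C x * f x) \<le> (\<integral>x. (indicator C x * f x)\<^sup>2 \<partial>\<mu>)"
    using vk compact_C sq_int_cut[OF fm B] unfolding valid_kernel_def by blast+
  show "0 \<le> (\<integral>z. f (fst z) * K (fst z) (snd z) * f (snd z) \<partial>(\<nu> \<Otimes>\<^sub>M \<nu>))"
    using q(1) unfolding qform_cut[OF f B] .
  have "(\<integral>x. (indicator C x * f x)\<^sup>2 \<partial>\<mu>) = (\<integral>x. indicator C x * (f x)\<^sup>2 \<partial>\<mu>)"
    by (intro Bochner_Integration.integral_cong) (auto simp: indicator_def)
  also have "\<dots> = (\<integral>x. (f x)\<^sup>2 \<partial>\<nu>)" using fm by (subst integral_\<nu>) auto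
  finally show "(\<integral>z. f (fst z) * K (fst z) (snd z) * f (snd z) \<partial>(\<nu> \<Otimes>\<^sub>M \<nu>)) \<le> (\<integral>x. (f x)\<^sup>2 \<partial>\<nu>)"
    using q(2) unfolding qform_cut[OF f B] by simp
qed

text \<open>The images of more than \<open>N\<close> indicators lie in the span of \<open>N\<close>
  functions, so some nontrivial combination of them is zero almost everywhere. Integrated against
  the same indicators, this combination becomes a kernel vector of the matrix.\<close>

lemma minors_vanish_of_rank:
  assumes rk: "kernel_rank_le \<mu> K N"
  shows "minors_vanish N (sets \<nu>) N.kk"
  unfolding minors_vanish_def
proof (intro allI impI)
  fix n and f :: "nat \<Rightarrow> 'a set" assume n: "N < n" and f: "f ` {..<n} \<subseteq> sets \<nu>"
  obtain \<phi> where \<phi>: "\<And>g. sq_int \<mu> g \<Longrightarrow> vanishes_outside C g \<Longrightarrow>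
      \<exists>c::nat \<Rightarrow> real. AE x in \<mu>. (\<integral>y. K x y * g y \<partial>\<mu>) = (\<Sum>k<N. c k * \<phi> k x)"
    using rk compact_C unfolding kernel_rank_le_def by blast
  have fs: "f b \<in> sets \<mu>" if "b < n" for b using f that by (auto simp: sets_\<nu>)
  have "\<exists>c::nat \<Rightarrow> real. AE x in \<mu>. (\<integral>y. K x y * (indicator C y * indicator (f b) y) \<partial>\<mu>) = (\<Sum>k<N. c k * \<phi> k x)"
    if "b < n" for b
    using fs[OF that] by (intro \<phi> sq_int_cut[of _ 1]) (auto simp: indicator_def)
  then have "\<forall>b\<in>{..<n}. \<exists>c::nat \<Rightarrow> real. AE x in \<mu>. (\<integral>y. K x y * (indicator C y * indicator (f b) y) \<partial>\<mu>) = (\<Sum>k<N. c k * \<phi> k x)"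
    by simp
  from bchoice[OF this] obtain c where
    c: "\<forall>b\<in>{..<n}. AE x in \<mu>. (\<integral>y. K x y * (indicator C y * indicator (f b) y) \<partial>\<mu>) = (\<Sum>k<N. c b k * \<phi> k x)" ..
  have "\<exists>v. (\<exists>j\<in>{..<n}. v j \<noteq> 0) \<and> (\<forall>l<N. (\<Sum>b<n. v b * c b l) = 0)"
    by (rule fdet_dependent_columns) (use n in simp_all)
  then obtain v where vv: "(\<exists>j\<in>{..<n}. v j \<noteq> 0) \<and> (\<forall>l<N. (\<Sum>b<n. v b * c b l) = 0)" ..
  then obtain j where "j < n" "v j \<noteq> 0" by auto
  with vv have v: "\<And>l. l < N \<Longrightarrow> (\<Sum>b<n. v b * c b l) = (0::real)" "j < n" "v j \<noteq> 0" by simp_all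
  let ?T = "\<lambda>b x. \<integral>y. indicator (f b) y * K x y \<partial>\<nu>"
  note K_measurable[measurable]
  have T: "?T b x = (\<integral>y. K x y * (indicator C y * indicator (f b) y) \<partial>\<mu>)" if b: "b < n" for b x
  proof -
    have "Pair x \<in> measurable \<nu> (\<nu> \<Otimes>\<^sub>M \<nu>)" by (rule measurable_Pair1') (simp add: \<nu>_def space_\<mu>)
    from measurable_compose[OF this K_measurable] have [measurable]: "(\<lambda>y. K x y) \<in> borel_measurable \<mu>" by (simp cong: measurable_cong_sets)
    note fs[OF b, measurable]
    have "?T b x = (\<integral>y. indicator C y * (indicator (f b) y * K x y) \<partial>\<mu>)" by (rule integral_\<nu>) measurable
    then show ?thesis by (simp add: mult_ac)
  qed
  have "AE x in \<mu>. \<forall>b\<in>{..<n}. ?T b x = (\<Sum>k<N. c b k * \<phi> k x)"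
  proof (rule AE_finite_allI)
    fix b assume b: "b \<in> {..<n}"
    from b have "b < n" by simp
    show "AE x in \<mu>. ?T b x = (\<Sum>k<N. c b k * \<phi> k x)"
      unfolding T[OF \<open>b < n\<close>] using c[rule_format, OF b] .
  qed simp
  then have "AE x in \<mu>. (\<Sum>b<n. v b * ?T b x) = 0"
  proof eventually_elim
    case (elim x)
    have "(\<Sum>b<n. v b * ?T b x) = (\<Sum>b<n. \<Sum>k<N. (v b * c b k) * \<phi> k x)"
      using elim by (simp add: sum_distrib_left mult_ac)
    also have "\<dots> = (\<Sum>k<N. (\<Sum>b<n. v b * c b k) * \<phi> k x)"
      unfolding sum_distrib_right by (rule sum.swap)
    finally show ?case using v(1) by simp
  qed
  then have AE0: "AE x in \<nu>. (\<Sum>b<n. v b * ?T b x) = 0"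
    unfolding \<nu>_def using C_sets by (subst AE_density) (auto elim: eventually_mono)
  have "(\<Sum>b<n. N.kk (f a) (f b) * v b) = 0" if a: "a < n" for a
  proof -
    have i: "integrable (\<nu> \<Otimes>\<^sub>M \<nu>) (\<lambda>z. indicator (f a) (fst z) * indicator (f b) (snd z) * K (fst z) (snd z))"
      if "b < n" for b using fs[OF a] fs[OF that] by (intro N.integrable_kk) (auto simp: sets_\<nu>)
    have kk: "N.kk (f a) (f b) = (\<integral>x. indicator (f a) x * ?T b x \<partial>\<nu>)" if "b < n" for b
      unfolding N.kk_def N.integral_fst'[OF i[OF that], symmetric] by (simp add: mult.assoc)
    have it: "integrable \<nu> (\<lambda>x. indicator (f a) x * ?T b x)" if "b < n" for b
      using N.integrable_fst'[OF i[OF that]] by (simp add: mult.assoc)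
    have "(\<Sum>b<n. N.kk (f a) (f b) * v b) = (\<Sum>b<n. \<integral>x. indicator (f a) x * ?T b x * v b \<partial>\<nu>)"
      using kk by (intro sum.cong) auto
    also have "\<dots> = (\<integral>x. (\<Sum>b<n. indicator (f a) x * ?T b x * v b) \<partial>\<nu>)"
      using it by (intro Bochner_Integration.integral_sum[symmetric] integrable_mult_left) auto
    also have "\<dots> = 0"
    proof (rule integral_eq_zero_AE)
      show "AE x in \<nu>. (\<Sum>b<n. indicator (f a) x * ?T b x * v b) = 0"
        using AE0
      proof eventually_elim
        case (elim x)
        have "(\<Sum>b<n. indicator (f a) x * ?T b x * v b) = indicator (f a) x * (\<Sum>b<n. v b * ?T b x)"
          by (simp add: sum_distrib_left mult_ac)
        then show ?case using elim by simp
      qed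
    qed
    finally show ?thesis .
  qed
  then show "fdet {..<n} (\<lambda>a b. N.kk (f a) (f b)) = 0"
    by (intro fdet_kernel[where v = v and k = j]) (use v in auto)
qed

lemma PiM_\<nu>:
  fixes I :: "'i set"
  assumes I: "finite I"
  shows "PiM I (\<lambda>_. \<nu>) = density (PiM I (\<lambda>_. \<mu>)) (indicator (PiE I (\<lambda>_. C)))"
proof (rule sym, rule product_sigma_finite.PiM_eqI[OF N.product_sigma_finite_const I])
  interpret M: product_sigma_finite "\<lambda>_::'i. \<mu>" by standard
  show "sets (density (PiM I (\<lambda>_. \<mu>)) (indicator (PiE I (\<lambda>_. C)))) = sets (PiM I (\<lambda>_. \<nu>))"
    using sets_\<nu> by (simp cong: sets_PiM_cong)
  fix A :: "'i \<Rightarrow> 'a set" assume "\<And>i. i \<in> I \<Longrightarrow> A i \<in> sets \<nu>"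
  then have A: "\<And>i. i \<in> I \<Longrightarrow> A i \<in> sets \<mu>" by (simp add: sets_\<nu>)
  have s: "PiE I (\<lambda>_. C) \<in> sets (PiM I (\<lambda>_. \<mu>))" "PiE I A \<in> sets (PiM I (\<lambda>_. \<mu>))"
    using A C_sets I by (auto intro!: sets_PiM_I_finite)
  have "emeasure (density (PiM I (\<lambda>_. \<mu>)) (indicator (PiE I (\<lambda>_. C)))) (PiE I A)
      = (\<integral>\<^sup>+x. indicator (PiE I (\<lambda>_. C)) x * indicator (PiE I A) x \<partial>PiM I (\<lambda>_. \<mu>))"
    using s by (intro emeasure_density) auto
  also have "\<dots> = (\<integral>\<^sup>+x. indicator (PiE I (\<lambda>i. A i \<inter> C)) x \<partial>PiM I (\<lambda>_. \<mu>))"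
    by (intro nn_integral_cong) (auto simp: indicator_def PiE_iff)
  also have "\<dots> = emeasure (PiM I (\<lambda>_. \<mu>)) (PiE I (\<lambda>i. A i \<inter> C))"
    using A C_sets I by (intro nn_integral_indicator sets_PiM_I_finite) auto
  also have "\<dots> = (\<Prod>i\<in>I. emeasure \<mu> (A i \<inter> C))"
    using A C_sets I by (intro M.emeasure_PiM) auto
  also have "\<dots> = (\<Prod>i\<in>I. emeasure \<nu> (A i))" using A by (intro prod.cong) (auto simp: emeasure_\<nu>)
  finally show "emeasure (density (PiM I (\<lambda>_. \<mu>)) (indicator (PiE I (\<lambda>_. C)))) (PiE I A) = (\<Prod>i\<in>I. emeasure \<nu> (A i))" .
qed

text \<open>The defining intensity formula is used with the indicator of a product of sets
  intersected with \<open>C\<close>. The factors coming from \<open>C\<close> restrict the tuples on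
  one side and supply the density of the cut measure on the other.\<close>

lemma XC_moment:
  assumes B: "\<And>a. a < n \<Longrightarrow> B a \<in> sets \<nu>"
    and Km: "(\<lambda>x. fdet {..<n} (\<lambda>i j. K (x i) (x j))) \<in> borel_measurable (PiM {..<n} (\<lambda>_. \<nu>))"
  shows "(\<integral>\<^sup>+\<omega>. of_nat (card {x \<in> dtuples n (XC \<omega>). \<forall>a<n. x a \<in> B a}) \<partial>P)
      = (\<integral>\<^sup>+x. (\<Prod>a<n. indicator (B a) (x a)) * ennreal (fdet {..<n} (\<lambda>i j. K (x i) (x j))) \<partial>PiM {..<n} (\<lambda>_. \<nu>))"
proof -
  let ?S = "PiE {..<n} (\<lambda>_. C)"
  let ?h = "\<lambda>x. (\<Prod>a<n. indicator (B a \<inter> C) (x a)) :: ennreal"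
  have hm: "(\<lambda>x. (\<Prod>a<n. indicator (D a) (x a)) :: ennreal) \<in> borel_measurable (PiM {..<n} (\<lambda>_. \<mu>))"
    if D: "\<And>a. a < n \<Longrightarrow> D a \<in> sets \<mu>" for D
  proof (rule borel_measurable_prod_ennreal)
    fix a assume a: "a \<in> {..<n}"
    then have [measurable]: "D a \<in> sets \<mu>" using D by auto
    show "(\<lambda>x. indicator (D a) (x a) :: ennreal) \<in> borel_measurable (PiM {..<n} (\<lambda>_. \<mu>))" using a by measurable
  qed
  have B\<mu>: "B a \<in> sets \<mu>" if "a < n" for a using B[OF that] by (simp add: sets_\<nu>)
  have "(\<integral>\<^sup>+\<omega>. of_nat (card {x \<in> dtuples n (XC \<omega>). \<forall>a<n. x a \<in> B a}) \<partial>P)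
      = (\<integral>\<^sup>+\<omega>. (\<integral>\<^sup>+x. ?h x \<partial>count_space (dtuples n (X \<omega>))) \<partial>P)"
  proof (rule nn_integral_cong)
    fix \<omega> assume w: "\<omega> \<in> space P"
    let ?T = "{x \<in> dtuples n (XC \<omega>). \<forall>a<n. x a \<in> B a}"
    have fT: "finite ?T" by (rule finite_subset[OF _ finite_dtuples[OF X_finite[OF w bounded_C], of n]]) auto
    have sub: "?T \<subseteq> dtuples n (X \<omega>)" unfolding dtuples_def by auto
    have "(\<integral>\<^sup>+x. ?h x \<partial>count_space (dtuples n (X \<omega>))) = (\<integral>\<^sup>+x. indicator ?T x \<partial>count_space (dtuples n (X \<omega>)))"
    proof (rule nn_integral_cong)
      fix x assume "x \<in> space (count_space (dtuples n (X \<omega>)))"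
      then have x: "x \<in> dtuples n (X \<omega>)" by simp
      show "?h x = indicator ?T x"
      proof (cases "\<forall>a<n. x a \<in> B a \<inter> C")
        case True
        then have "x \<in> ?T" using x unfolding dtuples_def by auto
        then show ?thesis using True by (auto intro!: prod.neutral)
      next
        case False
        then obtain a where a: "a < n" "x a \<notin> B a \<inter> C" by auto
        then have "x \<notin> ?T" unfolding dtuples_def by auto
        moreover have "?h x = 0" using a by (intro prod_zero) (auto intro!: bexI[of _ a])
        ultimately show ?thesis by simp
      qed
    qed
    also have "\<dots> = emeasure (count_space (dtuples n (X \<omega>))) ?T" using sub by (intro nn_integral_indicator) auto
    also have "\<dots> = of_nat (card ?T)" using sub fT by (simp add: emeasure_count_space_finite)
    finally show "of_nat (card ?T) = (\<integral>\<^sup>+x. ?h x \<partial>count_space (dtuples n (X \<omega>)))" by simp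
  qed
  also have "\<dots> = (\<integral>\<^sup>+x. ?h x * ennreal (ldet n (\<lambda>i j. K (x i) (x j))) \<partial>PiM {..<n} (\<lambda>_. \<mu>))"
    by (intro X_moment hm) (use B\<mu> C_sets in auto)
  also have "\<dots> = (\<integral>\<^sup>+x. indicator ?S x * ((\<Prod>a<n. indicator (B a) (x a)) * ennreal (fdet {..<n} (\<lambda>i j. K (x i) (x j)))) \<partial>PiM {..<n} (\<lambda>_. \<mu>))"
  proof (rule nn_integral_cong)
    fix x assume "x \<in> space (PiM {..<n} (\<lambda>_. \<mu>))"
    then have x: "x \<in> extensional {..<n}" by (simp add: space_PiM PiE_iff)
    have "?h x = (\<Prod>a<n. indicator C (x a)) * (\<Prod>a<n. indicator (B a) (x a))"
      unfolding prod.distrib[symmetric] by (intro prod.cong refl) (auto simp: indicator_def)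
    moreover have "(\<Prod>a<n. indicator C (x a)) = (indicator ?S x :: ennreal)"
    proof (cases "x \<in> ?S")
      case True then show ?thesis by (auto intro!: prod.neutral simp: PiE_iff)
    next
      case False
      then obtain a where "a < n" "x a \<notin> C" using x by (auto simp: PiE_iff)
      then have "(\<Prod>a<n. indicator C (x a)) = (0 :: ennreal)" by (intro prod_zero) (auto intro!: bexI[of _ a])
      then show ?thesis using False by simp
    qed
    ultimately show "?h x * ennreal (ldet n (\<lambda>i j. K (x i) (x j)))
        = indicator ?S x * ((\<Prod>a<n. indicator (B a) (x a)) * ennreal (fdet {..<n} (\<lambda>i j. K (x i) (x j))))"
      by (simp add: ldet_eq_fdet mult.assoc)
  qed
  also have "\<dots> = (\<integral>\<^sup>+x. (\<Prod>a<n. indicator (B a) (x a)) * ennreal (fdet {..<n} (\<lambda>i j. K (x i) (x j))) \<partial>PiM {..<n} (\<lambda>_. \<nu>))"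
  proof -
    have "sets (PiM {..<n} (\<lambda>_. \<nu>)) = sets (PiM {..<n} (\<lambda>_. \<mu>))" using sets_\<nu> by (simp cong: sets_PiM_cong)
    then have "(\<lambda>x. fdet {..<n} (\<lambda>i j. K (x i) (x j))) \<in> borel_measurable (PiM {..<n} (\<lambda>_. \<mu>))"
      using Km by (simp cong: measurable_cong_sets)
    then show ?thesis
      unfolding PiM_\<nu>[OF finite_lessThan] using hm[OF B\<mu>] C_sets
      by (subst nn_integral_density) (auto intro!: sets_PiM_I_finite)
  qed
  finally show ?thesis .
qed

lemma window_bound:
  fixes F :: "'i \<Rightarrow> 'w set" and G :: "'j \<Rightarrow> 'w set"
  assumes A: "A \<in> sets borel" "A \<subseteq> C" "emeasure \<mu> A \<le> ennreal p" "0 \<le> p"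
    and B: "B \<in> sets borel" "B \<subseteq> C" "emeasure \<mu> B \<le> ennreal q" "0 \<le> q" and AB: "A \<inter> B = {}"
    and \<A>: "finite \<A>" "\<A> \<subseteq> sets borel" "\<And>D. D \<in> \<A> \<Longrightarrow> D \<subseteq> A"
    and \<B>: "finite \<B>" "\<B> \<subseteq> sets borel" "\<And>D. D \<in> \<B> \<Longrightarrow> D \<subseteq> B"
    and F: "finite I0" "disjoint_family_on F I0" "\<And>i. i \<in> I0 \<Longrightarrow> F i \<in> sets P \<and> counts_det P X \<A> (F i)"
    and G: "finite J0" "disjoint_family_on G J0" "\<And>j. j \<in> J0 \<Longrightarrow> G j \<in> sets P \<and> counts_det P X \<B> (G j)"
    and om: "\<And>x y. x \<in> A \<Longrightarrow> y \<in> B \<Longrightarrow> \<bar>K x y\<bar> \<le> om"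
  defines "k \<equiv> kernel_sup K"
  shows "(\<Sum>i\<in>I0. \<Sum>j\<in>J0. \<bar>measure P (F i \<inter> G j) - measure P (F i) * measure P (G j)\<bar>)
      \<le> 2 * p * ((1 + 2 * k * p) * exp (2 * k * p)) * (2 * q * ((1 + 2 * k * q) * exp (2 * k * q))) * om\<^sup>2"
    and "kernel_rank_le \<mu> K N \<Longrightarrow>
      (\<Sum>i\<in>I0. \<Sum>j\<in>J0. \<bar>measure P (F i \<inter> G j) - measure P (F i) * measure P (G j)\<bar>)
      \<le> 2 * p * (real N * 3 ^ N) * (2 * q * (real N * 3 ^ N)) * om\<^sup>2"
proof -
  obtain d Fs where dF: "kernel_limit \<nu> K (kernel_sup K) d Fs"
    using N.ex_limit unfolding kernel_limit_def kernel_limit_axioms_def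
    using N.bounded_kernel_axioms by blast
  interpret L: kernel_limit \<nu> K "kernel_sup K" d Fs by (rule dF)
  interpret E: euclidean_counts \<nu> K "kernel_sup K" d Fs P XC C
  proof (intro euclidean_counts.intro point_counts.intro dF prob_P euclidean_counts_axioms.intro point_counts_axioms.intro)
    show "finite (XC \<omega>)" if "\<omega> \<in> space P" for \<omega> using X_finite[OF that bounded_C] .
    show "(\<lambda>\<omega>. card (XC \<omega> \<inter> E)) \<in> measurable P (count_space UNIV)" if "E \<in> sets \<nu>" for E
    proof -
      have "C \<inter> E \<in> sets borel" using that by (auto simp: sets_\<nu> sets_\<mu>)
      moreover have "bounded (C \<inter> E)" using bounded_C bounded_subset by auto
      ultimately show ?thesis using X_measurable[of "C \<inter> E"] by (simp add: Int_assoc)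
    qed
    show "(\<integral>\<^sup>+\<omega>. of_nat (card {x \<in> dtuples n (XC \<omega>). \<forall>a<n. x a \<in> B a}) \<partial>P)
      = (\<integral>\<^sup>+x. (\<Prod>a<n. indicator (B a) (x a)) * ennreal (fdet {..<n} (\<lambda>i j. K (x i) (x j))) \<partial>PiM {..<n} (\<lambda>_. \<nu>))"
      if "\<And>a. a < n \<Longrightarrow> B a \<in> sets \<nu>" for n B
      by (intro XC_moment that L.fdet_measurable L.K_measurable_PiM) auto
    have "(\<lambda>x. (x, x)) \<in> measurable \<nu> (\<nu> \<Otimes>\<^sub>M \<nu>)" by measurable
    from measurable_compose[OF this K_measurable] show "(\<lambda>x. K x x) \<in> borel_measurable \<nu>" by simp
    show "sets \<nu> = sets borel" by (simp add: sets_\<nu> sets_\<mu>)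
    show "bounded C" by (rule bounded_C)
  qed
  have m: "measure \<nu> S \<le> r" if "S \<in> sets borel" "S \<subseteq> C" "emeasure \<mu> S \<le> ennreal r" "0 \<le> r" for S r
  proof -
    have "emeasure \<nu> S \<le> ennreal r" using that by (simp add: emeasure_\<nu> sets_\<mu> Int_absorb2)
    then show ?thesis using that(4) by (simp add: N.emeasure_eq_measure)
  qed
  \<comment> \<open>All test sets lie in the window, where the configuration and its restriction
    have the same counts.\<close>
  have det: "counts_det P XC \<D> S" if S: "counts_det P X \<D> S" and \<D>: "\<And>D. D \<in> \<D> \<Longrightarrow> D \<subseteq> C" for \<D> S
    unfolding counts_det_def
  proof (intro ballI impI)
    fix \<omega> \<omega>' assume w: "\<omega> \<in> space P" "\<omega>' \<in> space P" "\<forall>D\<in>\<D>. card (XC \<omega> \<inter> D) = card (XC \<omega>' \<inter> D)" "\<omega> \<in> S"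
    have "card (X \<omega> \<inter> D) = card (X \<omega>' \<inter> D)" if D: "D \<in> \<D>" for D
    proof -
      have "XC \<omega> \<inter> D = X \<omega> \<inter> D" "XC \<omega>' \<inter> D = X \<omega>' \<inter> D" using \<D>[OF D] by auto
      then show ?thesis using w(3)[rule_format, OF D] by simp
    qed
    then show "\<omega>' \<in> S" using S w(1,2,4) unfolding counts_det_def by blast
  qed
  have F': "F i \<in> sets P \<and> counts_det P XC \<A> (F i)" if "i \<in> I0" for i
    using F(3)[OF that] det[OF _ order_trans[OF \<A>(3) A(2)]] by blast
  have G': "G j \<in> sets P \<and> counts_det P XC \<B> (G j)" if "j \<in> J0" for j
    using G(3)[OF that] det[OF _ order_trans[OF \<B>(3) B(2)]] by blast
  note b = E.count_events_decorrelate_bounded[OF A(1,2) m[OF A] B(1,2) m[OF B] AB \<A> \<B> F(1,2) F' G(1,2) G' om]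
  show "(\<Sum>i\<in>I0. \<Sum>j\<in>J0. \<bar>measure P (F i \<inter> G j) - measure P (F i) * measure P (G j)\<bar>)
      \<le> 2 * p * ((1 + 2 * k * p) * exp (2 * k * p)) * (2 * q * ((1 + 2 * k * q) * exp (2 * k * q))) * om\<^sup>2"
    unfolding k_def by (rule b(1))
  assume rk: "kernel_rank_le \<mu> K N"
  show "(\<Sum>i\<in>I0. \<Sum>j\<in>J0. \<bar>measure P (F i \<inter> G j) - measure P (F i) * measure P (G j)\<bar>)
      \<le> 2 * p * (real N * 3 ^ N) * (2 * q * (real N * 3 ^ N)) * om\<^sup>2"
    by (rule b(2)) (assumption | rule minors_vanish_of_rank[OF rk])+
qed

end

text \<open>An algebra that contains the generators of \<open>cfg_events\<close>. Each member
  involves only finitely many bounded sets, so a bounded window suffices for it even if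
  \<open>A\<close> is unbounded.\<close>

definition count_events :: "'w measure \<Rightarrow> ('w \<Rightarrow> 'a::euclidean_space set) \<Rightarrow> 'a set \<Rightarrow> 'w set set" where
  "count_events P X A = {E \<in> sets P. \<exists>\<D>. finite \<D> \<and> (\<forall>D\<in>\<D>. D \<in> sets borel \<and> bounded D \<and> D \<subseteq> A) \<and> counts_det P X \<D> E}"

lemma counts_det_mono: "counts_det P X \<D> E \<Longrightarrow> \<D> \<subseteq> \<D>' \<Longrightarrow> counts_det P X \<D>' E"
  unfolding counts_det_def by blast

lemma count_events_sets: "count_events P X A \<subseteq> sets P"
  by (auto simp: count_events_def)

lemma count_events_empty: "{} \<in> count_events P X A"
  unfolding count_events_def counts_det_def by auto

lemma count_events_Compl:
  assumes "E \<in> count_events P X A"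
  shows "space P - E \<in> count_events P X A"
proof -
  obtain \<D> where D: "finite \<D>" "\<forall>D\<in>\<D>. D \<in> sets borel \<and> bounded D \<and> D \<subseteq> A" "counts_det P X \<D> E"
    and E: "E \<in> sets P" using assms unfolding count_events_def by blast
  have "counts_det P X \<D> (space P - E)"
    unfolding counts_det_def
  proof (intro ballI impI)
    fix \<omega> \<omega>' assume w: "\<omega> \<in> space P" "\<omega>' \<in> space P" "\<forall>D\<in>\<D>. card (X \<omega> \<inter> D) = card (X \<omega>' \<inter> D)" "\<omega> \<in> space P - E"
    have "\<forall>D\<in>\<D>. card (X \<omega>' \<inter> D) = card (X \<omega> \<inter> D)" using w(3) by simp
    then have "\<omega>' \<in> E \<Longrightarrow> \<omega> \<in> E" using D(3) w(1,2) unfolding counts_det_def by blast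
    then show "\<omega>' \<in> space P - E" using w by blast
  qed
  moreover have "space P - E \<in> sets P" using E by auto
  ultimately show ?thesis using D(1,2) unfolding count_events_def by blast
qed

lemma count_events_Un:
  assumes "E \<in> count_events P X A" "E' \<in> count_events P X A"
  shows "E \<union> E' \<in> count_events P X A"
proof -
  obtain \<D> where D: "finite \<D>" "\<forall>D\<in>\<D>. D \<in> sets borel \<and> bounded D \<and> D \<subseteq> A" "counts_det P X \<D> E"
    and E: "E \<in> sets P" using assms(1) unfolding count_events_def by blast
  obtain \<D>' where D': "finite \<D>'" "\<forall>D\<in>\<D>'. D \<in> sets borel \<and> bounded D \<and> D \<subseteq> A" "counts_det P X \<D>' E'"
    and E': "E' \<in> sets P" using assms(2) unfolding count_events_def by blast
  have "counts_det P X (\<D> \<union> \<D>') E" "counts_det P X (\<D> \<union> \<D>') E'"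
    using counts_det_mono[OF D(3)] counts_det_mono[OF D'(3)] by auto
  then have "counts_det P X (\<D> \<union> \<D>') (E \<union> E')" unfolding counts_det_def by blast
  moreover have "E \<union> E' \<in> sets P" using E E' by auto
  moreover have "finite (\<D> \<union> \<D>')" "\<forall>D\<in>\<D> \<union> \<D>'. D \<in> sets borel \<and> bounded D \<and> D \<subseteq> A" using D D' by auto
  ultimately show ?thesis unfolding count_events_def by blast
qed

lemma count_events_Diff:
  assumes "E \<in> count_events P X A" "E' \<in> count_events P X A"
  shows "E - E' \<in> count_events P X A"
proof -
  have "E \<subseteq> space P" using assms(1) count_events_sets sets.sets_into_space by blast
  then have "E - E' = space P - ((space P - E) \<union> E')" by auto
  then show ?thesis using count_events_Compl[OF count_events_Un[OF count_events_Compl[OF assms(1)] assms(2)]] by simp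
qed

lemma count_events_UN:
  "finite I \<Longrightarrow> (\<And>i. i \<in> I \<Longrightarrow> E i \<in> count_events P X A) \<Longrightarrow> (\<Union>i\<in>I. E i) \<in> count_events P X A"
  by (induction rule: finite_induct) (auto simp: count_events_empty intro: count_events_Un)

lemma count_events_Basic:
  assumes A: "A \<in> sets borel" and B: "B \<in> sets borel" "bounded B"
    and meas: "\<And>B. B \<in> sets borel \<Longrightarrow> bounded B \<Longrightarrow> (\<lambda>\<omega>. card (X \<omega> \<inter> B)) \<in> measurable P (count_space UNIV)"
  shows "(\<lambda>\<omega>. card (X \<omega> \<inter> A \<inter> B)) -` {k} \<inter> space P \<in> count_events P X A"
proof -
  have AB: "A \<inter> B \<in> sets borel" "bounded (A \<inter> B)" using A B by (auto intro: bounded_subset)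
  have eq: "X \<omega> \<inter> A \<inter> B = X \<omega> \<inter> (A \<inter> B)" for \<omega> by auto
  have "(\<lambda>\<omega>. card (X \<omega> \<inter> A \<inter> B)) -` {k} \<inter> space P \<in> sets P"
    unfolding eq by (rule measurable_sets[OF meas[OF AB]]) simp
  moreover have "counts_det P X {A \<inter> B} ((\<lambda>\<omega>. card (X \<omega> \<inter> A \<inter> B)) -` {k} \<inter> space P)"
    unfolding counts_det_def eq by auto
  ultimately show ?thesis using AB unfolding count_events_def by (auto intro!: exI[of _ "{A \<inter> B}"])
qed

section \<open>Approximation of partitions by count events\<close>

context prob_space
begin

lemma symm_diff_bound:
  assumes "U \<in> events" "V \<in> events"
  shows "\<bar>prob U - prob V\<bar> \<le> prob ((U - V) \<union> (V - U))"
proof -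
  have "prob U \<le> prob (V \<union> ((U - V) \<union> (V - U)))" "prob V \<le> prob (U \<union> ((U - V) \<union> (V - U)))"
    using assms by (auto intro!: finite_measure_mono)
  moreover have "prob (V \<union> ((U - V) \<union> (V - U))) \<le> prob V + prob ((U - V) \<union> (V - U))"
    "prob (U \<union> ((U - V) \<union> (V - U))) \<le> prob U + prob ((U - V) \<union> (V - U))"
    using assms by (auto intro!: measure_Un_le)
  ultimately show ?thesis by linarith
qed

text \<open>The probability of the intersection and the product of the probabilities each move by at
  most twice \<open>\<delta>\<close>.\<close>

lemma covariance_perturb:
  assumes ev: "S \<in> events" "S' \<in> events" "T \<in> events" "T' \<in> events"
    and a: "prob ((S - S') \<union> (S' - S)) \<le> \<delta>" and b: "prob ((T - T') \<union> (T' - T)) \<le> \<delta>"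
  shows "\<bar>prob (S \<inter> T) - prob S * prob T\<bar> \<le> \<bar>prob (S' \<inter> T') - prob S' * prob T'\<bar> + 4 * \<delta>"
proof -
  let ?a = "(S - S') \<union> (S' - S)" and ?b = "(T - T') \<union> (T' - T)"
  have "\<bar>prob (S \<inter> T) - prob (S' \<inter> T')\<bar> \<le> prob ((S \<inter> T - S' \<inter> T') \<union> (S' \<inter> T' - S \<inter> T))"
    using ev by (intro symm_diff_bound) auto
  also have "\<dots> \<le> prob (?a \<union> ?b)" using ev by (intro finite_measure_mono) auto
  also have "\<dots> \<le> prob ?a + prob ?b" using ev by (intro measure_Un_le) auto
  finally have 1: "\<bar>prob (S \<inter> T) - prob (S' \<inter> T')\<bar> \<le> 2 * \<delta>" using a b by linarith
  have dS: "\<bar>prob S - prob S'\<bar> \<le> \<delta>" and dT: "\<bar>prob T - prob T'\<bar> \<le> \<delta>"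
    using symm_diff_bound[of S S'] symm_diff_bound[of T T'] ev a b by linarith+
  have "prob S * prob T - prob S' * prob T' = (prob S - prob S') * prob T + prob S' * (prob T - prob T')"
    by (simp add: algebra_simps)
  then have "\<bar>prob S * prob T - prob S' * prob T'\<bar> \<le> \<bar>prob S - prob S'\<bar> * prob T + prob S' * \<bar>prob T - prob T'\<bar>"
    using abs_triangle_ineq[of "(prob S - prob S') * prob T" "prob S' * (prob T - prob T')"] by (simp add: abs_mult)
  also have "\<dots> \<le> \<delta> * 1 + 1 * \<delta>"
    by (intro add_mono mult_mono dS dT) (auto intro: order_trans[OF abs_ge_zero dS])
  finally show ?thesis using 1 by linarith
qed

lemma approx_partition:
  assumes A: "A \<in> sets borel"
    and meas: "\<And>B. B \<in> sets borel \<Longrightarrow> bounded B \<Longrightarrow> (\<lambda>\<omega>. card (X \<omega> \<inter> B)) \<in> measurable M (count_space UNIV)"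
    and F: "finite_partition M (cfg_events M X A) I F" and \<delta>: "\<delta> > 0"
  shows "\<exists>F'. disjoint_family_on F' I \<and> (\<forall>i\<in>I. F' i \<in> count_events M X A \<and> prob ((F i - F' i) \<union> (F' i - F i)) \<le> \<delta>)"
proof -
  have I: "finite I" and Fc: "\<And>i. i \<in> I \<Longrightarrow> F i \<in> cfg_events M X A" and Fd: "disjoint_family_on F I"
    using F unfolding finite_partition_def by auto
  define e where "e = \<delta> / (real (card I) + 1)"
  have e: "e > 0" using \<delta> by (simp add: e_def add_nonneg_pos)
  have ap: "F i \<in> events \<and> (\<forall>e>0. \<exists>B\<in>count_events M X A. prob ((F i - B) \<union> (B - F i)) < e)" if "i \<in> I" for i
  proof (rule approx_by_algebra)
    show "F i \<in> sigma_sets (space M) {(\<lambda>\<omega>. card (X \<omega> \<inter> A \<inter> B)) -` {k} \<inter> space M | B k. B \<in> sets borel \<and> bounded B}"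
      using Fc[OF that] unfolding cfg_events_def .
    show "{(\<lambda>\<omega>. card (X \<omega> \<inter> A \<inter> B)) -` {k} \<inter> space M | B k. B \<in> sets borel \<and> bounded B} \<subseteq> count_events M X A"
      using count_events_Basic[OF A _ _ meas] by blast
  qed (intro finite_measure_axioms count_events_sets count_events_empty count_events_Compl count_events_Un; assumption)+
  then have "\<forall>i\<in>I. \<exists>B. B \<in> count_events M X A \<and> prob ((F i - B) \<union> (B - F i)) < e" using e by blast
  from bchoice[OF this] obtain H where
    H0: "\<forall>i\<in>I. H i \<in> count_events M X A \<and> prob ((F i - H i) \<union> (H i - F i)) < e" ..
  then have H: "H i \<in> count_events M X A" "prob ((F i - H i) \<union> (H i - F i)) < e" if "i \<in> I" for i using that by auto
  \<comment> \<open>Approximants of disjoint events may overlap; subtracting the earlier ones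
    restores the disjointness on which \<open>sum_event_code_le\<close> relies.\<close>
  define F' where "F' i = H i - (\<Union>j\<in>{j \<in> I. j < i}. H j)" for i
  show ?thesis
  proof (intro exI[of _ F'] conjI ballI)
    show "disjoint_family_on F' I"
      unfolding disjoint_family_on_def
    proof (intro ballI impI)
      fix i j assume ij: "i \<in> I" "j \<in> I" "i \<noteq> j"
      then consider "i < j" | "j < i" by linarith
      then show "F' i \<inter> F' j = {}" using ij unfolding F'_def by cases auto
    qed
    fix i assume i: "i \<in> I"
    show "F' i \<in> count_events M X A"
      unfolding F'_def using I i by (intro count_events_Diff count_events_UN H) auto
    have ev: "(F j - H j) \<union> (H j - F j) \<in> events" if "j \<in> I" for j
      using ap[OF that] H(1)[OF that] count_events_sets by blast
    \<comment> \<open>A point of \<open>F i\<close> that is lost to an earlier \<open>H j\<close>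
      lies outside \<open>F j\<close>, so it belongs to the error of \<open>j\<close>. The total
      error is at most the sum of all errors, which explains the division by the number of events in
      \<open>e\<close>.\<close>
    have "(F i - F' i) \<union> (F' i - F i) \<subseteq> (\<Union>j\<in>I. (F j - H j) \<union> (H j - F j))"
    proof
      fix x assume x: "x \<in> (F i - F' i) \<union> (F' i - F i)"
      show "x \<in> (\<Union>j\<in>I. (F j - H j) \<union> (H j - F j))"
      proof (cases "x \<in> (F i - H i) \<union> (H i - F i)")
        case True then show ?thesis using i by blast
      next
        case False
        then obtain j where j: "j \<in> I" "j < i" "x \<in> H j" "x \<in> F i" using x unfolding F'_def by auto
        have "F i \<inter> F j = {}" using Fd i j(1,2) unfolding disjoint_family_on_def by auto
        then have "x \<notin> F j" using j(4) by auto
        then show ?thesis using j(1,3) by blast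
      qed
    qed
    then have "prob ((F i - F' i) \<union> (F' i - F i)) \<le> prob (\<Union>j\<in>I. (F j - H j) \<union> (H j - F j))"
      using ev I by (intro finite_measure_mono sets.finite_UN) auto
    also have "\<dots> \<le> (\<Sum>j\<in>I. prob ((F j - H j) \<union> (H j - F j)))"
      using ev I by (intro finite_measure_subadditive_finite) auto
    also have "\<dots> \<le> (\<Sum>j\<in>I. e)" using H(2) by (intro sum_mono) (auto intro: less_imp_le)
    also have "\<dots> \<le> \<delta>" using \<delta> by (simp add: e_def field_simps)
    finally show "prob ((F i - F' i) \<union> (F' i - F i)) \<le> \<delta>" .
  qed
qed

lemma partition_covariance_le:
  assumes A: "A \<in> sets borel" and B: "B \<in> sets borel"
    and meas: "\<And>B. B \<in> sets borel \<Longrightarrow> bounded B \<Longrightarrow> (\<lambda>\<omega>. card (X \<omega> \<inter> B)) \<in> measurable M (count_space UNIV)"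
    and F: "finite_partition M (cfg_events M X A) I F" and G: "finite_partition M (cfg_events M X B) J G"
    and R: "\<And>F G. disjoint_family_on F I \<Longrightarrow> disjoint_family_on G J \<Longrightarrow> (\<And>i. i \<in> I \<Longrightarrow> F i \<in> count_events M X A) \<Longrightarrow>
      (\<And>j. j \<in> J \<Longrightarrow> G j \<in> count_events M X B) \<Longrightarrow>
      (\<Sum>i\<in>I. \<Sum>j\<in>J. \<bar>prob (F i \<inter> G j) - prob (F i) * prob (G j)\<bar>) \<le> R"
  shows "(\<Sum>i\<in>I. \<Sum>j\<in>J. \<bar>prob (F i \<inter> G j) - prob (F i) * prob (G j)\<bar>) \<le> R"
proof (rule field_le_epsilon)
  fix \<epsilon> :: real assume \<epsilon>: "\<epsilon> > 0"
  \<comment> \<open>Each pair of events costs \<open>4 * \<delta>\<close>, and there are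
    \<open>card I * card J\<close> pairs.\<close>
  define \<delta> where "\<delta> = \<epsilon> / (4 * (real (card I * card J) + 1))"
  have \<delta>: "\<delta> > 0" using \<epsilon> by (simp add: \<delta>_def add_nonneg_pos)
  have "\<exists>F'. disjoint_family_on F' I \<and> (\<forall>i\<in>I. F' i \<in> count_events M X A \<and> prob ((F i - F' i) \<union> (F' i - F i)) \<le> \<delta>)"
    by (rule approx_partition[OF A meas F \<delta>])
  then obtain F' where F0: "disjoint_family_on F' I \<and> (\<forall>i\<in>I. F' i \<in> count_events M X A \<and> prob ((F i - F' i) \<union> (F' i - F i)) \<le> \<delta>)" ..
  have F': "disjoint_family_on F' I" "\<And>i. i \<in> I \<Longrightarrow> F' i \<in> count_events M X A"
    "\<And>i. i \<in> I \<Longrightarrow> prob ((F i - F' i) \<union> (F' i - F i)) \<le> \<delta>" using F0 by simp_all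
  have "\<exists>G'. disjoint_family_on G' J \<and> (\<forall>i\<in>J. G' i \<in> count_events M X B \<and> prob ((G i - G' i) \<union> (G' i - G i)) \<le> \<delta>)"
    by (rule approx_partition[OF B meas G \<delta>])
  then obtain G' where G0: "disjoint_family_on G' J \<and> (\<forall>i\<in>J. G' i \<in> count_events M X B \<and> prob ((G i - G' i) \<union> (G' i - G i)) \<le> \<delta>)" ..
  have G': "disjoint_family_on G' J" "\<And>i. i \<in> J \<Longrightarrow> G' i \<in> count_events M X B"
    "\<And>i. i \<in> J \<Longrightarrow> prob ((G i - G' i) \<union> (G' i - G i)) \<le> \<delta>" using G0 by simp_all
  have ev: "S \<in> events" if S: "S \<in> cfg_events M X D" and D: "D \<in> sets borel" for S D
    using S unfolding cfg_events_def
  proof (rule subsetD[OF sets.sigma_sets_subset, rotated])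
    show "{(\<lambda>\<omega>. card (X \<omega> \<inter> D \<inter> B)) -` {k} \<inter> space M | B k. B \<in> sets borel \<and> bounded B} \<subseteq> events"
      using count_events_Basic[OF D _ _ meas] count_events_sets by blast
  qed
  have "(\<Sum>i\<in>I. \<Sum>j\<in>J. \<bar>prob (F i \<inter> G j) - prob (F i) * prob (G j)\<bar>)
      \<le> (\<Sum>i\<in>I. \<Sum>j\<in>J. \<bar>prob (F' i \<inter> G' j) - prob (F' i) * prob (G' j)\<bar> + 4 * \<delta>)"
  proof (intro sum_mono covariance_perturb)
    fix i j assume i: "i \<in> I" and j: "j \<in> J"
    show "F i \<in> events" "G j \<in> events" using F G i j A B unfolding finite_partition_def by (auto intro: ev)
    show "F' i \<in> events" "G' j \<in> events" using F'(2)[OF i] G'(2)[OF j] count_events_sets by blast+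
    show "prob ((F i - F' i) \<union> (F' i - F i)) \<le> \<delta>" by (rule F'(3)[OF i])
    show "prob ((G j - G' j) \<union> (G' j - G j)) \<le> \<delta>" by (rule G'(3)[OF j])
  qed
  also have "\<dots> = (\<Sum>i\<in>I. \<Sum>j\<in>J. \<bar>prob (F' i \<inter> G' j) - prob (F' i) * prob (G' j)\<bar>) + real (card I * card J) * (4 * \<delta>)"
    by (simp add: sum.distrib)
  also have "\<dots> \<le> R + \<epsilon>"
  proof (rule add_mono)
    show "(\<Sum>i\<in>I. \<Sum>j\<in>J. \<bar>prob (F' i \<inter> G' j) - prob (F' i) * prob (G' j)\<bar>) \<le> R"
      by (rule R[OF F'(1) G'(1) F'(2) G'(2)])
    have "0 \<le> real (card I * card J)" by simp
    then show "real (card I * card J) * (4 * \<delta>) \<le> \<epsilon>"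
      unfolding \<delta>_def using \<epsilon> by (simp add: field_simps add_pos_nonneg del: of_nat_mult)
  qed
  finally show "(\<Sum>i\<in>I. \<Sum>j\<in>J. \<bar>prob (F i \<inter> G j) - prob (F i) * prob (G j)\<bar>) \<le> R + \<epsilon>" .
qed

lemma beta_coef_bounds:
  assumes R: "\<And>I J F G. finite_partition M \<A> I F \<Longrightarrow> finite_partition M \<B> J G \<Longrightarrow>
      (\<Sum>i\<in>I. \<Sum>j\<in>J. \<bar>prob (F i \<inter> G j) - prob (F i) * prob (G j)\<bar>) \<le> R"
    and sp: "space M \<in> \<A>" "space M \<in> \<B>"
  shows "0 \<le> beta_coef M \<A> \<B>" "beta_coef M \<A> \<B> \<le> R / 2"
proof -
  let ?S = "{\<Sum>i\<in>I. \<Sum>j\<in>J. \<bar>prob (F i \<inter> G j) - prob (F i) * prob (G j)\<bar>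
      | I J F G. finite_partition M \<A> I F \<and> finite_partition M \<B> J G}"
  have "finite_partition M \<C> {0} (\<lambda>_. space M)" if "space M \<in> \<C>" for \<C>
    using that by (auto simp: finite_partition_def disjoint_family_on_def)
  note triv = this[OF sp(1)] this[OF sp(2)]
  \<comment> \<open>The one-block partitions show that the set of sums is nonempty and contains 0,
    which a real supremum needs for the lower bound.\<close>
  have "0 = (\<Sum>i\<in>{0::nat}. \<Sum>j\<in>{0::nat}. \<bar>prob (space M \<inter> space M) - prob (space M) * prob (space M)\<bar>)"
    by (simp add: prob_space)
  then have mem: "0 \<in> ?S"
    using triv by (intro CollectI exI[of _ "{0::nat}"] exI[of _ "\<lambda>_. space M"] conjI)
  have le: "x \<le> R" if "x \<in> ?S" for x using that by (elim CollectE exE conjE) (simp only: R)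
  have "bdd_above ?S" by (rule bdd_aboveI[of _ R], rule le)
  with mem have "0 \<le> Sup ?S" by (rule cSup_upper)
  moreover have "?S \<noteq> {}" using mem by (rule ex_in_conv[THEN iffD1, OF exI])
  then have "Sup ?S \<le> R" by (rule cSup_least[OF _ le])
  ultimately have "0 \<le> Sup ?S" "Sup ?S \<le> R" by simp_all
  then show "0 \<le> beta_coef M \<A> \<B>" "beta_coef M \<A> \<B> \<le> R / 2" unfolding beta_coef_def by simp_all
qed

end

section \<open>The mixing coefficients of the process\<close>

lemma set_dist_less_norm:
  assumes "set_dist A B > ereal r" "x \<in> A" "y \<in> B"
  shows "r < norm (y - x)"
proof -
  have "set_dist A B \<le> ereal (norm (y - x))"
    unfolding set_dist_def by (intro INF_lower2[OF assms(2)] INF_lower2[OF assms(3)]) simp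
  then have "ereal r < ereal (norm (y - x))" using assms(1) by (rule less_le_trans[rotated])
  then show ?thesis by simp
qed

lemma kernel_omega_upper:
  assumes "\<exists>c. \<forall>x y. \<bar>K x y\<bar> \<le> c" "r \<le> norm (y - x)"
  shows "\<bar>K x y\<bar> \<le> kernel_omega K r"
  unfolding kernel_omega_def using assms by (intro cSup_upper) (auto simp: bdd_above_def)

text \<open>The window depends on the finitely many test sets of the two families of events, but the
  bound depends only on the masses of \<open>A\<close> and \<open>B\<close> and on their distance.
  It therefore holds for all partitions at once.\<close>

lemma dpp_beta_coef:
  fixes P :: "'w measure" and \<mu> :: "'a::euclidean_space measure"
  assumes dpp: "is_DPP P \<mu> X K" and bdd: "\<exists>c. \<forall>x y. \<bar>K x y\<bar> \<le> c"
    and A: "A \<in> sets \<mu>" "emeasure \<mu> A \<le> ennreal p" "0 < p" and B: "B \<in> sets \<mu>" "emeasure \<mu> B \<le> ennreal q" "0 < q"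
    and r: "set_dist A B > ereal r" "0 < r"
  defines "k \<equiv> kernel_sup K"
  shows "0 \<le> beta_coef P (cfg_events P X A) (cfg_events P X B)"
    and "beta_coef P (cfg_events P X A) (cfg_events P X B)
      \<le> 2 * p * ((1 + 2 * k * p) * exp (2 * k * p)) * (2 * q * ((1 + 2 * k * q) * exp (2 * k * q))) * (kernel_omega K r)\<^sup>2 / 2"
      (is "_ \<le> ?R1 / 2")
    and "kernel_rank_le \<mu> K N \<Longrightarrow> beta_coef P (cfg_events P X A) (cfg_events P X B)
      \<le> 2 * p * (real N * 3 ^ N) * (2 * q * (real N * 3 ^ N)) * (kernel_omega K r)\<^sup>2 / 2"
      (is "_ \<Longrightarrow> _ \<le> ?R2 / 2")
proof -
  interpret P: prob_space P using dpp by (simp add: is_DPP_def)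
  have sets_\<mu>: "sets \<mu> = sets borel" using dpp by (simp add: is_DPP_def locally_finite_measure_def)
  have meas: "(\<lambda>\<omega>. card (X \<omega> \<inter> B)) \<in> measurable P (count_space UNIV)" if "B \<in> sets borel" "bounded B" for B
    using dpp that by (simp add: is_DPP_def)
  have Ab: "A \<in> sets borel" and Bb: "B \<in> sets borel" using A B by (auto simp: sets_\<mu>)
  have sp: "space P \<in> cfg_events P X D" for D unfolding cfg_events_def by (rule sigma_sets_top)
  have AB: "A \<inter> B = {}" using set_dist_less_norm[OF r(1)] r(2) by force
  have om: "\<bar>K x y\<bar> \<le> kernel_omega K r" if "x \<in> A" "y \<in> B" for x y
    using set_dist_less_norm[OF r(1) that] by (intro kernel_omega_upper bdd) simp
  have main: "(\<Sum>i\<in>I. \<Sum>j\<in>J. \<bar>P.prob (F i \<inter> G j) - P.prob (F i) * P.prob (G j)\<bar>) \<le> ?R1 \<and>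
      (kernel_rank_le \<mu> K N \<longrightarrow> (\<Sum>i\<in>I. \<Sum>j\<in>J. \<bar>P.prob (F i \<inter> G j) - P.prob (F i) * P.prob (G j)\<bar>) \<le> ?R2)"
    if I: "finite I" and J: "finite J" and Fd: "disjoint_family_on F I" and Gd: "disjoint_family_on G J"
      and F: "\<And>i. i \<in> I \<Longrightarrow> F i \<in> count_events P X A" and G: "\<And>j. j \<in> J \<Longrightarrow> G j \<in> count_events P X B"
    for I J :: "nat set" and F G
  proof -
    have gather: "\<exists>\<D>. finite \<D> \<and> (\<forall>D\<in>\<D>. D \<in> sets borel \<and> bounded D \<and> D \<subseteq> S) \<and> (\<forall>i\<in>I. H i \<in> sets P \<and> counts_det P X \<D> (H i))"
      if I: "finite I" and H: "\<And>i. i \<in> I \<Longrightarrow> H i \<in> count_events P X S" for I :: "nat set" and H S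
    proof -
      have "\<forall>i\<in>I. \<exists>\<D>. finite \<D> \<and> (\<forall>D\<in>\<D>. D \<in> sets borel \<and> bounded D \<and> D \<subseteq> S) \<and> counts_det P X \<D> (H i)"
        using H unfolding count_events_def by blast
      from bchoice[OF this] obtain E where
        E: "\<forall>i\<in>I. finite (E i) \<and> (\<forall>D\<in>E i. D \<in> sets borel \<and> bounded D \<and> D \<subseteq> S) \<and> counts_det P X (E i) (H i)" ..
      have "counts_det P X (\<Union>i\<in>I. E i) (H i)" if "i \<in> I" for i
        by (rule counts_det_mono[of P X "E i"]) (use E that in auto)
      moreover have "H i \<in> sets P" if "i \<in> I" for i using H[OF that] count_events_sets by blast
      ultimately show ?thesis using I E by (intro exI[of _ "\<Union>i\<in>I. E i"]) blast
    qed
    have "\<exists>\<A>. finite \<A> \<and> (\<forall>D\<in>\<A>. D \<in> sets borel \<and> bounded D \<and> D \<subseteq> A) \<and> (\<forall>i\<in>I. F i \<in> sets P \<and> counts_det P X \<A> (F i))"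
      by (rule gather[OF I F])
    then obtain \<A> where \<A>: "finite \<A> \<and> (\<forall>D\<in>\<A>. D \<in> sets borel \<and> bounded D \<and> D \<subseteq> A) \<and> (\<forall>i\<in>I. F i \<in> sets P \<and> counts_det P X \<A> (F i))" ..
    have "\<exists>\<B>. finite \<B> \<and> (\<forall>D\<in>\<B>. D \<in> sets borel \<and> bounded D \<and> D \<subseteq> B) \<and> (\<forall>j\<in>J. G j \<in> sets P \<and> counts_det P X \<B> (G j))"
      by (rule gather[OF J G])
    then obtain \<B> where \<B>: "finite \<B> \<and> (\<forall>D\<in>\<B>. D \<in> sets borel \<and> bounded D \<and> D \<subseteq> B) \<and> (\<forall>j\<in>J. G j \<in> sets P \<and> counts_det P X \<B> (G j))" ..
    have \<A>1: "finite \<A>" "\<And>D. D \<in> \<A> \<Longrightarrow> D \<in> sets borel" "\<And>D. D \<in> \<A> \<Longrightarrow> bounded D" "\<And>D. D \<in> \<A> \<Longrightarrow> D \<subseteq> A"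
      and 2: "\<And>i. i \<in> I \<Longrightarrow> F i \<in> sets P \<and> counts_det P X \<A> (F i)" using \<A> by simp_all
    have \<B>1: "finite \<B>" "\<And>D. D \<in> \<B> \<Longrightarrow> D \<in> sets borel" "\<And>D. D \<in> \<B> \<Longrightarrow> bounded D" "\<And>D. D \<in> \<B> \<Longrightarrow> D \<subseteq> B"
      and 3: "\<And>j. j \<in> J \<Longrightarrow> G j \<in> sets P \<and> counts_det P X \<B> (G j)" using \<B> by simp_all
    \<comment> \<open>\<open>A\<close> and \<open>B\<close> may be unbounded; a ball containing all
      the test sets serves as window, and both sets are intersected with it.\<close>
    have "bounded (\<Union>(\<A> \<union> \<B>))" using \<A>1 \<B>1 by (intro bounded_Union finite_UnI) auto
    then obtain \<rho> where "\<forall>y\<in>\<Union>(\<A> \<union> \<B>). dist 0 y \<le> \<rho>" unfolding bounded_any_center[where a = 0] ..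
    then have \<rho>: "\<Union>(\<A> \<union> \<B>) \<subseteq> cball 0 \<rho>" by (intro subsetI) simp
    interpret W: dpp_window P \<mu> X K "cball 0 \<rho>" by (intro dpp_window.intro dpp bdd compact_cball)
    let ?A = "A \<inter> cball 0 \<rho>" and ?B = "B \<inter> cball 0 \<rho>"
    have eA: "emeasure \<mu> ?A \<le> ennreal p" by (rule order_trans[OF emeasure_mono[OF Int_lower1 A(1)] A(2)])
    have eB: "emeasure \<mu> ?B \<le> ennreal q" by (rule order_trans[OF emeasure_mono[OF Int_lower1 B(1)] B(2)])
    have p0: "0 \<le> p" "0 \<le> q" using A B by simp_all
    have bor: "?A \<in> sets borel" "?B \<in> sets borel" using Ab Bb by auto
    have \<A>': "D \<subseteq> ?A" if "D \<in> \<A>" for D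
      using \<A>1(4)[OF that] \<rho> that by (intro Int_greatest) auto
    have \<B>': "D \<subseteq> ?B" if "D \<in> \<B>" for D
      using \<B>1(4)[OF that] \<rho> that by (intro Int_greatest) auto
    have 1: "\<A> \<subseteq> sets borel" "\<B> \<subseteq> sets borel" by (rule subsetI, rule \<A>1(2) \<B>1(2), assumption)+
    have dis: "?A \<inter> ?B = {}" using AB by auto
    have om': "\<bar>K x y\<bar> \<le> kernel_omega K r" if "x \<in> ?A" "y \<in> ?B" for x y using om that by simp
    note b = W.window_bound[OF bor(1) Int_lower2 eA p0(1) bor(2) Int_lower2 eB p0(2) dis \<A>1(1) 1(1) \<A>' \<B>1(1) 1(2) \<B>' I Fd 2 J Gd 3 om']
    show ?thesis unfolding k_def by (intro conjI impI; rule b; assumption)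
  qed
  have R1: "(\<Sum>i\<in>I. \<Sum>j\<in>J. \<bar>P.prob (F i \<inter> G j) - P.prob (F i) * P.prob (G j)\<bar>) \<le> ?R1"
    and R2: "kernel_rank_le \<mu> K N \<Longrightarrow> (\<Sum>i\<in>I. \<Sum>j\<in>J. \<bar>P.prob (F i \<inter> G j) - P.prob (F i) * P.prob (G j)\<bar>) \<le> ?R2"
    if F: "finite_partition P (cfg_events P X A) I F" and G: "finite_partition P (cfg_events P X B) J G" for I J F G
  proof -
    have fin: "finite I" "finite J" using F G by (auto simp: finite_partition_def)
    show "(\<Sum>i\<in>I. \<Sum>j\<in>J. \<bar>P.prob (F i \<inter> G j) - P.prob (F i) * P.prob (G j)\<bar>) \<le> ?R1"
      by (rule P.partition_covariance_le[OF Ab Bb meas F G], assumption+, rule conjunct1[OF main[OF fin]])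
    assume rk: "kernel_rank_le \<mu> K N"
    show "(\<Sum>i\<in>I. \<Sum>j\<in>J. \<bar>P.prob (F i \<inter> G j) - P.prob (F i) * P.prob (G j)\<bar>) \<le> ?R2"
      by (rule P.partition_covariance_le[OF Ab Bb meas F G], assumption+, rule conjunct2[OF main[OF fin], THEN mp, OF _ _ _ _ rk])
  qed
  show "0 \<le> beta_coef P (cfg_events P X A) (cfg_events P X B)"
    by (rule P.beta_coef_bounds(1)[OF R1 sp sp])
  show "beta_coef P (cfg_events P X A) (cfg_events P X B) \<le> ?R1 / 2"
    by (rule P.beta_coef_bounds(2)[OF R1 sp sp])
  show "beta_coef P (cfg_events P X A) (cfg_events P X B) \<le> ?R2 / 2" if rk: "kernel_rank_le \<mu> K N"
    by (rule P.beta_coef_bounds(2)[OF R2[OF _ _ rk] sp sp])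
qed

lemma dpp_beta_pq:
  fixes P :: "'w measure" and \<mu> :: "'a::euclidean_space measure"
  assumes dpp: "is_DPP P \<mu> X K" and bdd: "\<exists>c. \<forall>x y. \<bar>K x y\<bar> \<le> c" and pqr: "p > 0" "q > 0" "r > 0"
  shows "0 \<le> beta_pq P \<mu> X p q r"
    and "beta_pq P \<mu> X p q r \<le> 4 * p * q * (1 + 2 * p * kernel_sup K) * (1 + 2 * q * kernel_sup K)
             * exp (2 * kernel_sup K * (p + q)) * (kernel_omega K r)\<^sup>2" (is "_ \<le> ?B1")
    and "kernel_rank_le \<mu> K N \<Longrightarrow> beta_pq P \<mu> X p q r \<le> 4 * p * q * (real N)\<^sup>2 * 9 ^ N * (kernel_omega K r)\<^sup>2"
      (is "_ \<Longrightarrow> _ \<le> ?B2")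
proof -
  let ?S = "{beta_coef P (cfg_events P X A) (cfg_events P X B) | A B.
      A \<in> sets \<mu> \<and> B \<in> sets \<mu> \<and> emeasure \<mu> A \<le> ennreal p \<and> emeasure \<mu> B \<le> ennreal q \<and> set_dist A B > ereal r}"
  let ?b = "beta_coef P (cfg_events P X {}) (cfg_events P X {})"
  have sd: "set_dist {} {} > ereal r" by (simp add: set_dist_def top_ereal_def)
  \<comment> \<open>The pair of empty sets, at infinite distance, always qualifies, so the supremum
    is over a nonempty set and is nonnegative.\<close>
  have mem: "?b \<in> ?S" using sd by (intro CollectI exI[of _ "{}"]) auto
  have b0: "0 \<le> ?b" by (rule dpp_beta_coef(1)[OF dpp bdd _ _ pqr(1) _ _ pqr(2) sd pqr(3)]) auto
  obtain c where c: "\<And>x y. \<bar>K x y\<bar> \<le> c" using bdd by blast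
  have "\<bar>K undefined undefined\<bar> \<le> kernel_sup K"
    unfolding kernel_sup_def using c by (intro cSup_upper) (auto simp: bdd_above_def)
  then have k: "0 \<le> kernel_sup K" by linarith
  have u1: "x \<le> ?B1" if "x \<in> ?S" for x
  proof -
    let ?k = "kernel_sup K"
    from that have "x \<le> 2 * p * ((1 + 2 * ?k * p) * exp (2 * ?k * p)) * (2 * q * ((1 + 2 * ?k * q) * exp (2 * ?k * q))) * (kernel_omega K r)\<^sup>2 / 2"
      using dpp_beta_coef(2)[OF dpp bdd _ _ pqr(1) _ _ pqr(2) _ pqr(3)] by auto
    \<comment> \<open>The factor 1/2 in the definition of the coefficient gives half of the stated
      bound.\<close>
    also have "\<dots> = ?B1 / 2" by (simp add: exp_add[symmetric] algebra_simps flip: exp_add)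
    also have "\<dots> \<le> ?B1" using k pqr by simp
    finally show ?thesis .
  qed
  have u2: "x \<le> ?B2" if "x \<in> ?S" and rk: "kernel_rank_le \<mu> K N" for x
  proof -
    from that(1) have "x \<le> 2 * p * (real N * 3 ^ N) * (2 * q * (real N * 3 ^ N)) * (kernel_omega K r)\<^sup>2 / 2"
      using dpp_beta_coef(3)[OF dpp bdd _ _ pqr(1) _ _ pqr(2) _ pqr(3) rk] by auto
    \<comment> \<open>The two sides contribute $3^N$ each, which multiply to $9^N$; the factor 1/2
      again comes from the definition of the coefficient.\<close>
    also have "\<dots> = ?B2 / 2"
    proof -
      have "(9::real) ^ N = 3 ^ N * 3 ^ N" by (simp flip: power_mult_distrib)
      then show ?thesis by (simp add: power2_eq_square)
    qed
    also have "\<dots> \<le> ?B2" using pqr by simp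
    finally show ?thesis .
  qed
  have "bdd_above ?S" by (rule bdd_aboveI[of _ ?B1], rule u1)
  with mem have "?b \<le> Sup ?S" by (rule cSup_upper)
  then show "0 \<le> beta_pq P \<mu> X p q r" using b0 unfolding beta_pq_def by linarith
  have ne: "?S \<noteq> {}" using mem by (rule ex_in_conv[THEN iffD1, OF exI])
  show "beta_pq P \<mu> X p q r \<le> ?B1" unfolding beta_pq_def by (rule cSup_least[OF ne u1])
  show "beta_pq P \<mu> X p q r \<le> ?B2" if "kernel_rank_le \<mu> K N"
    unfolding beta_pq_def by (rule cSup_least[OF ne u2[OF _ that]])
qed

theorem theorem2:
  fixes P :: "'w measure" and \<mu> :: "'a::euclidean_space measure"
    and X :: "'w \<Rightarrow> 'a set" and K :: "'a \<Rightarrow> 'a \<Rightarrow> real"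
  assumes dpp: "is_DPP P \<mu> X K"
    and bdd: "\<exists>C. \<forall>x y. \<bar>K x y\<bar> \<le> C"
    and decay: "(kernel_omega K \<longlongrightarrow> 0) at_top"
  shows "beta_mixing P \<mu> X \<and>
         (\<forall>p q r. p > 0 \<longrightarrow> q > 0 \<longrightarrow> r > 0 \<longrightarrow>
           beta_pq P \<mu> X p q r \<le> 4 * p * q * (1 + 2 * p * kernel_sup K) * (1 + 2 * q * kernel_sup K)
             * exp (2 * kernel_sup K * (p + q)) * (kernel_omega K r)\<^sup>2) \<and>
         (\<forall>N::nat. kernel_rank_le \<mu> K N \<longrightarrow> (\<forall>p q r. p > 0 \<longrightarrow> q > 0 \<longrightarrow> r > 0 \<longrightarrow>
           beta_pq P \<mu> X p q r \<le> 4 * p * q * (real N)\<^sup>2 * 9 ^ N * (kernel_omega K r)\<^sup>2))"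
proof (intro conjI allI impI)
  show "beta_mixing P \<mu> X"
    unfolding beta_mixing_def
  proof (intro allI impI)
    fix p q :: real assume pq: "p > 0" "q > 0"
    let ?c = "4 * p * q * (1 + 2 * p * kernel_sup K) * (1 + 2 * q * kernel_sup K) * exp (2 * kernel_sup K * (p + q))"
    show "((\<lambda>r. beta_pq P \<mu> X p q r) \<longlongrightarrow> 0) at_top"
    proof (rule tendsto_sandwich)
      show "\<forall>\<^sub>F r in at_top. 0 \<le> beta_pq P \<mu> X p q r"
        using eventually_gt_at_top[of 0] by eventually_elim (rule dpp_beta_pq(1)[OF dpp bdd pq])
      show "\<forall>\<^sub>F r in at_top. beta_pq P \<mu> X p q r \<le> ?c * (kernel_omega K r)\<^sup>2"
        using eventually_gt_at_top[of 0] by eventually_elim (rule dpp_beta_pq(2)[OF dpp bdd pq])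
      have "((\<lambda>r. ?c * (kernel_omega K r)\<^sup>2) \<longlongrightarrow> ?c * 0\<^sup>2) at_top"
        by (intro tendsto_intros decay)
      then show "((\<lambda>r. ?c * (kernel_omega K r)\<^sup>2) \<longlongrightarrow> 0) at_top" by simp
    qed simp
  qed
qed (intro dpp_beta_pq(2,3)[OF dpp bdd]; assumption)+

end
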